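(* Let $f\in C^4(\mathbb R)$ with $f''\ge c>0$, $\ell,\varepsilon>0$ and $u_0\in H^1(\mathbb R)$. Then there exists a global smooth solution $u^{\ell,\varepsilon}\in C(\mathbb R^+,H^3(\mathbb R))\cap C^1(\mathbb R^+,H^2(\mathbb R))$ of $$u_t+\Big[f(u)+\tfrac12\ell^2\,\mathfrak G*\{f''(u)\,(u_x^2+\chi_\varepsilon(u_x))\}\Big]_x=0,\qquad u(0,\cdot)=u_0^\varepsilon,$$ which satisfies, with $q=u^{\ell,\varepsilon}_x$ and $u=u^{\ell,\varepsilon}$, $$\Big[\tfrac12u^2+\tfrac12\ell^2q^2\Big]_t+\Big[K(u)+\tfrac12\ell^2f'(u)q^2+\ell^2uP^\varepsilon\Big]_x=\tfrac12\ell^2f''(u)\,q\,\chi_\varepsilon(q)\le0.$$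
   Context: $\mathfrak G(x)=(2\ell)^{-1}e^{-|x|/\ell}$; $j_\varepsilon$ is a Friedrichs mollifier and $u_0^\varepsilon=u_0*j_\varepsilon$; $\chi_\varepsilon(q)=(q+1/\varepsilon)^2$ for $q\le-1/\varepsilon$ and $\chi_\varepsilon(q)=0$ for $q>-1/\varepsilon$; $P^\varepsilon=\tfrac12\mathfrak G*\{f''(u^{\ell,\varepsilon})((u^{\ell,\varepsilon}_x)^2+\chi_\varepsilon(u^{\ell,\varepsilon}_x))\}$; $K'(u)=uf'(u)$. *)

theory Defs
  imports "HOL-Analysis.Analysis"
begin

definition C_k :: "nat \<Rightarrow> (real \<Rightarrow> real) \<Rightarrow> bool" where
  "C_k n f \<longleftrightarrow> (\<forall>j<n. \<forall>x. ((deriv ^^ j) f) differentiable (at x))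
                 \<and> continuous_on UNIV ((deriv ^^ n) f)"

definition test_fun :: "(real \<Rightarrow> real) \<Rightarrow> bool" where
  "test_fun \<phi> \<longleftrightarrow> (\<forall>k. \<forall>x. ((deriv ^^ k) \<phi>) differentiable (at x))
                   \<and> (\<exists>R. \<forall>x. \<bar>x\<bar> > R \<longrightarrow> \<phi> x = 0)"

definition L2 :: "(real \<Rightarrow> real) \<Rightarrow> bool" where
  "L2 g \<longleftrightarrow> g \<in> borel_measurable lborel \<and> integrable lborel (\<lambda>x. (g x)\<^sup>2)"

definition weak_deriv :: "(real \<Rightarrow> real) \<Rightarrow> (real \<Rightarrow> real) \<Rightarrow> bool" where
  "weak_deriv g h \<longleftrightarrow> (\<forall>\<phi>. test_fun \<phi> \<longrightarrow>
      (LINT x|lborel. g x * deriv \<phi> x) = - (LINT x|lborel. h x * \<phi> x))"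

definition sobolev_derivs :: "nat \<Rightarrow> (real \<Rightarrow> real) \<Rightarrow> (nat \<Rightarrow> real \<Rightarrow> real) \<Rightarrow> bool" where
  "sobolev_derivs k g D \<longleftrightarrow> D 0 = g \<and> (\<forall>j\<le>k. L2 (D j))
                           \<and> (\<forall>j<k. weak_deriv (D j) (D (Suc j)))"

definition in_H :: "nat \<Rightarrow> (real \<Rightarrow> real) \<Rightarrow> bool" where
  "in_H k g \<longleftrightarrow> (\<exists>D. sobolev_derivs k g D)"

text \<open>H^k norm (weak derivatives are unique a.e., so this is well defined on H^k).\<close>
definition H_norm :: "nat \<Rightarrow> (real \<Rightarrow> real) \<Rightarrow> real" where
  "H_norm k g = (let D = (SOME D. sobolev_derivs k g D)
                 in sqrt (\<Sum>j\<le>k. LINT x|lborel. (D j x)\<^sup>2))"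

definition cont_H :: "nat \<Rightarrow> (real \<Rightarrow> real \<Rightarrow> real) \<Rightarrow> bool" where
  "cont_H k u \<longleftrightarrow> (\<forall>t\<ge>0. in_H k (u t)) \<and>
     (\<forall>t\<ge>0. ((\<lambda>s. H_norm k (\<lambda>x. u s x - u t x)) \<longlongrightarrow> 0) (at t within {0..}))"

definition C1_H :: "nat \<Rightarrow> (real \<Rightarrow> real \<Rightarrow> real) \<Rightarrow> bool" where
  "C1_H k u \<longleftrightarrow> cont_H k u \<and> (\<exists>v. cont_H k v \<and>
     (\<forall>t\<ge>0. ((\<lambda>s. H_norm k (\<lambda>x. (u s x - u t x) / (s - t) - v t x)) \<longlongrightarrow> 0)
               (at t within {0..})))"

definition conv :: "(real \<Rightarrow> real) \<Rightarrow> (real \<Rightarrow> real) \<Rightarrow> real \<Rightarrow> real" where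
  "conv g h x = (LINT y|lborel. g (x - y) * h y)"

definition Gker :: "real \<Rightarrow> real \<Rightarrow> real" where
  "Gker l x = exp (- \<bar>x\<bar> / l) / (2 * l)"

definition chi :: "real \<Rightarrow> real \<Rightarrow> real" where
  "chi \<epsilon> q = (if q \<le> - 1 / \<epsilon> then (q + 1 / \<epsilon>)\<^sup>2 else 0)"

definition friedrichs_mollifier :: "(real \<Rightarrow> real) \<Rightarrow> bool" where
  "friedrichs_mollifier j \<longleftrightarrow> test_fun j \<and> (\<forall>x. j x \<ge> 0)
      \<and> (\<forall>x. \<bar>x\<bar> \<ge> 1 \<longrightarrow> j x = 0) \<and> (LINT x|lborel. j x) = 1"

definition mollifier_eps :: "(real \<Rightarrow> real) \<Rightarrow> real \<Rightarrow> real \<Rightarrow> real" where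
  "mollifier_eps j \<epsilon> x = j (x / \<epsilon>) / \<epsilon>"

text \<open>P^eps = 1/2 G * { f''(u) (u_x^2 + chi_eps(u_x)) } at a fixed time (w = u(t,.)).\<close>
definition Peps :: "(real \<Rightarrow> real) \<Rightarrow> real \<Rightarrow> real \<Rightarrow> (real \<Rightarrow> real) \<Rightarrow> real \<Rightarrow> real" where
  "Peps f l \<epsilon> w x = 1/2 * conv (Gker l)
      (\<lambda>y. deriv (deriv f) (w y) * ((deriv w y)\<^sup>2 + chi \<epsilon> (deriv w y))) x"

end

theory Submission
  imports Defs
begin

text \<open>
  In Lagrangian coordinates the equation becomes an ordinary differential equation, with a locally
  Lipschitz right-hand side, for the triple of the velocity, the slope and the logarithm of the
  Jacobian of the flow, as an element of a Banach space of bounded continuous functions. The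
  relation "derivative of velocity = slope times Jacobian" is preserved by the flow, because the
  second derivative of the nonlocal term is a local expression. Spatial decay is propagated by
  slowly varying weights, and the energy identity, where the cut-off enters with the good sign,
  gives the a priori bounds that make the solution global. Along a characteristic the slope can
  only cross the threshold of the cut-off once, downwards, so the kink in the derivative of the
  cut-off still leaves a continuous third space derivative. Domination by a square integrable
  weight turns pointwise continuity into continuity with values in the Sobolev spaces.
\<close>

subsection \<open>Locally Lipschitz ordinary differential equations\<close>

text \<open>Along dy/dt = f'(u), differentiating the equation in space and using P - l^2 P_xx =
  f''(u) (q^2 + chi(q)) / 2 gives the slope equation q' = - f''(u) \<psi>(q) / 2 - P with \<psi>(q)
  = q^2 - chi(q). Its right-hand side is nonpositive, so q could only blow up towards minus
  infinity; there \<psi> is affine, and the Riccati mechanism of wave breaking is reduced to linear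
  growth. This bounds the slope, while the energy bounds u and P. Bounded continuous functions serve
  as state space because superposition and products are locally Lipschitz on them without any
  Sobolev calculus. The price is that decay at infinity is not part of the state. In labels the
  kernel decays only at the rate exp(-R)/l, with R a bound for the solution on the time interval at
  hand, and a weight has to vary more slowly than that; hence weights of arbitrarily small rate are
  required of the datum. They come from convolving u0^2 with a two-sided exponential, which controls
  the mollified datum and its derivatives pointwise.\<close>

lemma gronwall:
  fixes x :: "real \<Rightarrow> 'a::real_normed_vector"
  assumes T: "0 \<le> T"
    and der: "\<And>t. t \<in> {0..T} \<Longrightarrow> (x has_vector_derivative x' t) (at t within {0..T})"
    and bd: "\<And>t. t \<in> {0..T} \<Longrightarrow> norm (x' t) \<le> C * norm (x t) + \<delta>"
    and C: "0 \<le> C" and \<delta>: "0 \<le> \<delta>" and t: "t \<in> {0..T}"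
  shows "norm (x t) \<le> 2 * (norm (x 0) + \<delta> * T) * exp (2 * C * t)"
proof -
  have contx: "continuous_on {0..T} x"
    using der by (meson has_vector_derivative_continuous continuous_on_eq_continuous_within)
  \<comment> \<open>Weighting at twice the rate C makes the integrated bound return only half of the
    maximum M of \<open>g\<close>, which can be absorbed on the left. The factor 2 in the conclusion
    is the price.\<close>
  define g where "g s = exp (- (2 * C * s)) * norm (x s)" for s
  have "continuous_on {0..T} g"
    unfolding g_def using contx by (intro continuous_intros)
  then obtain s0 where s0: "s0 \<in> {0..T}" and mx: "\<And>s. s \<in> {0..T} \<Longrightarrow> g s \<le> g s0"
    using continuous_attains_sup[of "{0..T}" g] T by auto
  define M where "M = g s0"
  have M0: "0 \<le> M" by (simp add: M_def g_def)
  have xs: "norm (x s) \<le> M * exp (2 * C * s)" if "s \<in> {0..T}" for s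
  proof -
    have "g s \<le> M" using mx[OF that] by (simp add: M_def)
    then have "g s * exp (2 * C * s) \<le> M * exp (2 * C * s)" by (rule mult_right_mono) simp
    moreover have "norm (x s) = g s * exp (2 * C * s)" by (simp add: g_def exp_minus)
    ultimately show ?thesis by simp
  qed
  \<comment> \<open>A majorant: its derivative \<delta> + C M exp(2 C s) dominates
    \<open>norm (x' s)\<close> because \<open>norm (x s)\<close> is at most M exp(2 C s).\<close>
  define p where "p s = \<delta> * s + M * exp (2 * C * s) / 2" for s
  have "norm (x s0) \<le> norm (x 0) + \<delta> * T + M * exp (2 * C * s0) / 2 - M / 2"
  proof (cases "s0 = 0")
    case True
    then show ?thesis using T \<delta> by simp
  next
    case False
    then have pos: "0 < s0" using s0 by auto
    have "norm (x s0 - x 0) \<le> p s0 - p 0"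
    proof (rule differentiable_bound_general[OF pos])
      show "continuous_on {0..s0} x" using contx s0 by (auto intro: continuous_on_subset)
      show "continuous_on {0..s0} p" unfolding p_def by (intro continuous_intros) auto
      fix s assume s: "0 < s" "s < s0"
      then have "s \<in> {0..T}" using s0 by auto
      have "at s within {0..T} = at s" using s s0 by (intro at_within_interior) auto
      then show "(x has_vector_derivative x' s) (at s)" using der[OF \<open>s \<in> {0..T}\<close>] by simp
      show "(p has_vector_derivative (\<delta> + C * M * exp (2 * C * s))) (at s)"
        unfolding p_def has_real_derivative_iff_has_vector_derivative[symmetric]
        by (auto intro!: derivative_eq_intros)
      show "norm (x' s) \<le> \<delta> + C * M * exp (2 * C * s)"
        using bd[OF \<open>s \<in> {0..T}\<close>] mult_left_mono[OF xs[OF \<open>s \<in> {0..T}\<close>] C] by (simp add: mult.assoc)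
    qed
    moreover have "norm (x s0) \<le> norm (x 0) + norm (x s0 - x 0)"
      by (metis add.commute diff_add_cancel norm_triangle_ineq)
    moreover have "\<delta> * s0 \<le> \<delta> * T" using s0 \<delta> by (simp add: mult_left_mono)
    ultimately show ?thesis by (simp add: p_def)
  qed
  moreover have "norm (x s0) = M * exp (2 * C * s0)"
    by (simp add: M_def g_def exp_minus field_simps)
  ultimately have 1: "M * exp (2 * C * s0) \<le> 2 * (norm (x 0) + \<delta> * T) - M" by (simp add: field_simps)
  have "M \<le> M * exp (2 * C * s0)" using M0 C s0 mult_left_mono[of 1 "exp (2 * C * s0)" M] by simp
  with 1 M0 have "M \<le> 2 * (norm (x 0) + \<delta> * T)" by linarith
  with xs[OF t] show ?thesis by (meson exp_ge_zero mult_right_mono order_trans)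
qed

definition lip_on_balls :: "('a::real_normed_vector \<Rightarrow> 'b::real_normed_vector) \<Rightarrow> bool" where
  "lip_on_balls F \<longleftrightarrow> (\<forall>R. \<exists>C\<ge>0. \<forall>x y. norm x \<le> R \<longrightarrow> norm y \<le> R \<longrightarrow> norm (F x - F y) \<le> C * norm (x - y))"

definition ode_sol :: "('a::real_normed_vector \<Rightarrow> 'a) \<Rightarrow> real set \<Rightarrow> (real \<Rightarrow> 'a) \<Rightarrow> bool" where
  "ode_sol F S x \<longleftrightarrow> (\<forall>t\<in>S. (x has_vector_derivative F (x t)) (at t within S))"

text \<open>Puts bounded continuous functions, and hence triples of them, into the class over which
  the existence theorems below are stated.\<close>

instance bcontfun :: (metric_space, banach) banach ..

text \<open>Picard iteration in an exponentially weighted (Bielecki) norm: the unknown is the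
  bounded curve exp(-2 C t) x(t). Since the integral of C exp(2 C s) up to t is at most exp(2 C t) /
  2, the iteration contracts with factor 1/2 on the whole half-line at once, without patching short
  intervals.\<close>

lemma lipschitz_ode_global:
  fixes F :: "'a::banach \<Rightarrow> 'a"
  assumes C: "C > 0" and lip: "\<And>x y. norm (F x - F y) \<le> C * norm (x - y)"
  shows "\<exists>x. x 0 = x0 \<and> ode_sol F {0..} x"
proof -
  have contF: "continuous_on A F" for A
  proof (rule continuous_on_subset)
    show "continuous_on UNIV F"
      unfolding continuous_on_iff
    proof (intro ballI allI impI)
      fix x e assume e: "(0::real) < e"
      have "dist (F x') (F x) < e" if "dist x' x < e / C" for x'
        using lip[of x' x] that C by (simp add: dist_norm field_simps)
      then show "\<exists>d>0. \<forall>x'\<in>UNIV. dist x' x < d \<longrightarrow> dist (F x') (F x) < e"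
        using e C by (intro exI[of _ "e / C"]) auto
    qed
  qed simp
  have contg: "continuous_on A (\<lambda>s. F (exp (2 * C * s) *\<^sub>R apply_bcontfun g s))" for g A
    by (intro continuous_on_compose2[OF contF[of UNIV]] continuous_intros) auto
  \<comment> \<open>\<open>max 0 t\<close> freezes the iterate for negative times, because the type
    of bounded continuous functions is over the whole line.\<close>
  define I where "I g t = integral {0..max 0 t} (\<lambda>s. F (exp (2 * C * s) *\<^sub>R apply_bcontfun g s))"
    for g :: "real \<Rightarrow>\<^sub>C 'a" and t
  define G where "G g t = exp (- (2 * C * max 0 t)) *\<^sub>R (x0 + I g t)" for g :: "real \<Rightarrow>\<^sub>C 'a" and t
  have expint: "((\<lambda>s. A * exp (2 * C * s)) has_integral (A * exp (2 * C * t) / (2 * C) - A / (2 * C))) {0..t}"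
    if "0 \<le> t" for A t
  proof -
    have "((\<lambda>s. A * exp (2 * C * s)) has_integral (A * exp (2 * C * t) / (2 * C) - A * exp (2 * C * 0)  / (2 * C))) {0..t}"
      using that C by (intro fundamental_theorem_of_calculus)
        (auto simp: has_real_derivative_iff_has_vector_derivative[symmetric] intro!: derivative_eq_intros)
    then show ?thesis by simp
  qed
  have Gder: "((\<lambda>t. I g t) has_vector_derivative F (exp (2 * C * t) *\<^sub>R apply_bcontfun g t)) (at t within {0..})"
    if t: "0 \<le> t" for g t
  proof -
    have "((\<lambda>u. integral {0..u} (\<lambda>s. F (exp (2 * C * s) *\<^sub>R apply_bcontfun g s))) has_vector_derivative
        F (exp (2 * C * t) *\<^sub>R apply_bcontfun g t)) (at t within {0..t+1})"
      using t by (intro integral_has_vector_derivative contg) auto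
    then have "((\<lambda>u. I g u) has_vector_derivative F (exp (2 * C * t) *\<^sub>R apply_bcontfun g t)) (at t within {0..t+1})"
      by (rule has_vector_derivative_transform[rotated 2]) (use t in \<open>auto simp: I_def max_def\<close>)
    moreover have "at t within {0..t+1} = at t within {0..}"
      by (rule at_within_nhd[of _ "{..<t+1}"]) auto
    ultimately show ?thesis by simp
  qed
  have contI: "continuous_on UNIV (I g)" for g
  proof -
    have "continuous_on {0..} (I g)"
      using Gder by (meson atLeast_iff has_vector_derivative_continuous continuous_on_eq_continuous_within)
    then have "continuous_on UNIV (\<lambda>t. I g (max 0 t))"
      by (rule continuous_on_compose2) (auto intro!: continuous_intros)
    then show ?thesis by (simp add: I_def)
  qed
  have diffI: "norm (I g t - I h t) \<le> dist g h * exp (2 * C * max 0 t) / 2" for g h t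
  proof -
    have "norm (integral {0..max 0 t} (\<lambda>s. F (exp (2 * C * s) *\<^sub>R apply_bcontfun g s) - F (exp (2 * C * s) *\<^sub>R apply_bcontfun h s)))
        \<le> integral {0..max 0 t} (\<lambda>s. (C * dist g h) * exp (2 * C * s))"
    proof (rule integral_norm_bound_integral)
      show "(\<lambda>s. F (exp (2 * C * s) *\<^sub>R apply_bcontfun g s) - F (exp (2 * C * s) *\<^sub>R apply_bcontfun h s)) integrable_on {0..max 0 t}"
        by (intro integrable_continuous_interval continuous_intros contg)
      show "(\<lambda>s. (C * dist g h) * exp (2 * C * s)) integrable_on {0..max 0 t}"
        by (intro integrable_continuous_interval continuous_intros)
      fix s
      have "norm (F (exp (2 * C * s) *\<^sub>R apply_bcontfun g s) - F (exp (2 * C * s) *\<^sub>R apply_bcontfun h s))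
         \<le> C * (exp (2 * C * s) * dist (apply_bcontfun g s) (apply_bcontfun h s))"
        using lip[of "exp (2 * C * s) *\<^sub>R apply_bcontfun g s" "exp (2 * C * s) *\<^sub>R apply_bcontfun h s"]
        by (simp add: dist_norm flip: scaleR_diff_right)
      also have "\<dots> \<le> C * (exp (2 * C * s) * dist g h)"
        using C by (intro mult_left_mono dist_bounded) auto
      finally show "norm (F (exp (2 * C * s) *\<^sub>R apply_bcontfun g s) - F (exp (2 * C * s) *\<^sub>R apply_bcontfun h s))
         \<le> (C * dist g h) * exp (2 * C * s)" by (simp add: ac_simps)
    qed
    also have "\<dots> = (C * dist g h) * exp (2 * C * max 0 t) / (2 * C) - (C * dist g h) / (2 * C)"
      by (rule integral_unique[OF expint]) simp
    also have "\<dots> \<le> dist g h * exp (2 * C * max 0 t) / 2" using C by simp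
    finally show ?thesis
      unfolding I_def by (subst (asm) integral_diff) (auto intro!: integrable_continuous_interval contg)
  qed
  have I0: "norm (I 0 t) \<le> norm (F 0) * max 0 t" for t
    unfolding I_def by (simp add: mult.commute)
  have G_in: "G g \<in> bcontfun" for g
  proof (rule bcontfun_normI)
    show "continuous_on UNIV (G g)" unfolding G_def by (intro continuous_intros contI)
    fix t
    have e: "max 0 t * exp (- (2 * C * max 0 t)) \<le> 1 / (2 * C)"
    proof -
      have "2 * C * max 0 t \<le> exp (2 * C * max 0 t)"
        using exp_ge_add_one_self[of "2 * C * max 0 t"] by linarith
      then have "2 * C * max 0 t * exp (- (2 * C * max 0 t)) \<le> 1"
        by (simp add: exp_minus divide_simps)
      then show ?thesis using C by (simp add: field_simps)
    qed
    have "norm (x0 + I g t) \<le> norm x0 + (norm (I 0 t) + norm (I g t - I 0 t))"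
      using norm_triangle_ineq[of x0 "I g t"] norm_triangle_sub[of "I g t" "I 0 t"] by linarith
    also have "\<dots> \<le> norm x0 + (norm (F 0) * max 0 t + dist g 0 * exp (2 * C * max 0 t) / 2)"
      using I0[of t] diffI[of g t 0] by linarith
    finally have "norm (G g t) \<le> exp (- (2 * C * max 0 t)) * (norm x0 + (norm (F 0) * max 0 t + dist g 0 * exp (2 * C * max 0 t) / 2))"
      by (simp add: G_def)
    also have "\<dots> = exp (- (2 * C * max 0 t)) * norm x0 + norm (F 0) * (max 0 t * exp (- (2 * C * max 0 t))) + dist g 0 / 2"
      by (simp add: exp_minus field_simps)
    also have "\<dots> \<le> 1 * norm x0 + norm (F 0) * (1 / (2 * C)) + dist g 0 / 2"
      using C e by (intro add_mono mult_right_mono mult_left_mono) auto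
    finally show "norm (G g t) \<le> 1 * norm x0 + norm (F 0) * (1 / (2 * C)) + dist g 0 / 2" .
  qed
  define H where "H g = Bcontfun (G g)" for g
  have H: "apply_bcontfun (H g) = G g" for g
    unfolding H_def using G_in by (simp add: Bcontfun_inverse)
  have "\<exists>!g. H g = g"
  proof (rule banach_fix_type[where c="1/2"], simp, simp, intro allI)
    fix g h
    show "dist (H g) (H h) \<le> 1 / 2 * dist g h"
    proof (rule dist_bound)
      fix t
      have "dist (G g t) (G h t) = exp (- (2 * C * max 0 t)) * norm (I g t - I h t)"
        by (simp add: G_def dist_norm flip: scaleR_diff_right)
      also have "\<dots> \<le> exp (- (2 * C * max 0 t)) * (dist g h * exp (2 * C * max 0 t) / 2)"
        by (intro mult_left_mono diffI) auto
      also have "\<dots> = 1 / 2 * dist g h" by (simp add: exp_minus)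
      finally show "dist (H g t) (H h t) \<le> 1 / 2 * dist g h" by (simp add: H)
    qed
  qed
  then obtain g where g: "H g = g" by auto
  define x where "x t = x0 + I g t" for t
  have xg: "exp (2 * C * t) *\<^sub>R apply_bcontfun g t = x t" if "0 \<le> t" for t
    using that arg_cong[OF g, of "\<lambda>h. apply_bcontfun h t"]
    by (simp add: H G_def x_def exp_minus scaleR_right_distrib[symmetric])
      (metis divideR_right exp_not_eq_zero scaleR_scaleR)
  show ?thesis
  proof (intro exI[of _ x] conjI)
    show "x 0 = x0" by (simp add: x_def I_def)
    show "ode_sol F {0..} x"
      unfolding ode_sol_def
    proof
      fix t :: real assume "t \<in> {0..}"
      then have t: "0 \<le> t" by simp
      have "((\<lambda>t. x0 + I g t) has_vector_derivative 0 + F (exp (2 * C * t) *\<^sub>R apply_bcontfun g t)) (at t within {0..})"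
        by (intro derivative_intros Gder[OF t])
      then show "(x has_vector_derivative F (x t)) (at t within {0..})"
        by (simp add: xg[OF t] x_def[symmetric])
    qed
  qed
qed

text \<open>Composing a vector field with this retraction onto a ball turns Lipschitz continuity on
  balls into global Lipschitz continuity and leaves the field unchanged inside the ball.\<close>

definition radial :: "real \<Rightarrow> 'a::real_normed_vector \<Rightarrow> 'a" where
  "radial R z = (if norm z \<le> R then z else (R / norm z) *\<^sub>R z)"

lemma norm_radial_le: "0 \<le> R \<Longrightarrow> norm (radial R z) \<le> R"
  by (auto simp: radial_def)

text \<open>The factor 2 adds up a change of direction and a change of length, each of size at most
  \<open>norm (x - y)\<close>; no inner product is available.\<close>

lemma radial_lipschitz:
  assumes R: "0 \<le> R" shows "norm (radial R x - radial R y) \<le> 2 * norm (x - y)"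
proof -
  have io: "norm (x - (R / norm y) *\<^sub>R y) \<le> 2 * norm (x - y)" if "norm x \<le> R" "R < norm y" for x y :: 'a
  proof -
    have ny: "norm y > 0" using that R by linarith
    have "norm (y - (R / norm y) *\<^sub>R y) = norm y - R"
    proof -
      have "y - (R / norm y) *\<^sub>R y = (1 - R / norm y) *\<^sub>R y" by (simp add: scaleR_diff_left)
      then have "norm (y - (R / norm y) *\<^sub>R y) = \<bar>1 - R / norm y\<bar> * norm y" by simp
      also have "\<dots> = norm y - R" using that ny by (simp add: field_simps)
      finally show ?thesis .
    qed
    then have "norm (x - (R / norm y) *\<^sub>R y) \<le> norm (x - y) + (norm y - R)"
      by (metis norm_triangle_ineq diff_add_cancel add_diff_eq)
    also have "norm y - R \<le> norm (x - y)" using that norm_triangle_ineq2[of y x] by (simp add: norm_minus_commute)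
    finally show ?thesis by simp
  qed
  consider "norm x \<le> R" "norm y \<le> R" | "norm x \<le> R" "R < norm y" | "R < norm x" "norm y \<le> R" | "R < norm x" "R < norm y"
    by linarith
  then show ?thesis
  proof cases
    case 1 then show ?thesis by (simp add: radial_def)
  next
    case 2 then show ?thesis using io by (simp add: radial_def)
  next
    case 3 then show ?thesis using io[of y x] by (simp add: radial_def norm_minus_commute)
  next
    case 4
    then have n: "norm x > 0" "norm y > 0" using R by linarith+
    have "(R / norm x) *\<^sub>R x - (R / norm y) *\<^sub>R y = (R / norm x) *\<^sub>R (x - y) + (R / norm x - R / norm y) *\<^sub>R y"
      by (simp add: algebra_simps)
    then have "norm ((R / norm x) *\<^sub>R x - (R / norm y) *\<^sub>R y) \<le> (R / norm x) * norm (x - y) + \<bar>R / norm x - R / norm y\<bar> * norm y"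
      using R n by (metis (no_types, lifting) abs_of_nonneg divide_nonneg_pos norm_scaleR norm_triangle_ineq)
    also have "\<bar>R / norm x - R / norm y\<bar> * norm y = (R / norm x) * \<bar>norm y - norm x\<bar>"
    proof -
      have "R / norm x - R / norm y = (R / norm x) * (norm y - norm x) / norm y"
        using n by (simp add: field_simps)
      then show ?thesis using R n by (simp add: abs_mult)
    qed
    also have "(R / norm x) * norm (x - y) + (R / norm x) * \<bar>norm y - norm x\<bar> = (R / norm x) * (norm (x - y) + \<bar>norm y - norm x\<bar>)"
      by (simp add: algebra_simps)
    also have "\<dots> \<le> 1 * (norm (x - y) + \<bar>norm y - norm x\<bar>)"
      using 4 R n by (intro mult_right_mono) auto
    also have "\<dots> \<le> 2 * norm (x - y)"
      using norm_triangle_ineq3[of y x] by (simp add: norm_minus_commute)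
    finally show ?thesis using 4 by (simp add: radial_def)
  qed
qed

lemma ode_sol_continuous: "ode_sol F S x \<Longrightarrow> continuous_on S x"
  unfolding ode_sol_def by (meson has_vector_derivative_continuous continuous_on_eq_continuous_within)

lemma ode_sol_subset: "ode_sol F S x \<Longrightarrow> T \<subseteq> S \<Longrightarrow> ode_sol F T x"
  unfolding ode_sol_def by (meson has_vector_derivative_within_subset subsetD)

lemma ode_sol_unique:
  assumes F: "lip_on_balls F" and T: "0 \<le> T"
    and x: "ode_sol F {0..T} x" and y: "ode_sol F {0..T} y" and 0: "x 0 = y 0" and t: "t \<in> {0..T}"
  shows "x t = y t"
proof -
  have "compact (x ` {0..T})" "compact (y ` {0..T})"
    using ode_sol_continuous[OF x] ode_sol_continuous[OF y] compact_continuous_image compact_Icc by blast+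
  then have "bounded (x ` {0..T} \<union> y ` {0..T})" by (simp add: compact_imp_bounded)
  then obtain R where "\<forall>z\<in>x ` {0..T} \<union> y ` {0..T}. norm z \<le> R"
    unfolding bounded_iff by blast
  then have R: "norm (x s) \<le> R \<and> norm (y s) \<le> R" if "s \<in> {0..T}" for s
    using that by simp
  obtain C where C: "C \<ge> 0" "\<And>x y. norm x \<le> R \<Longrightarrow> norm y \<le> R \<Longrightarrow> norm (F x - F y) \<le> C * norm (x - y)"
    using F unfolding lip_on_balls_def by meson
  have "norm (x t - y t) \<le> 2 * (norm (x 0 - y 0) + 0 * T) * exp (2 * C * t)"
  proof (rule gronwall[OF T _ _ C(1) _ t, where x'="\<lambda>s. F (x s) - F (y s)"])
    show "((\<lambda>s. x s - y s) has_vector_derivative F (x s) - F (y s)) (at s within {0..T})" if "s \<in> {0..T}" for s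
      using x y that unfolding ode_sol_def by (intro derivative_intros) auto
    show "norm (F (x s) - F (y s)) \<le> C * norm (x s - y s) + 0" if "s \<in> {0..T}" for s
      using C(2) R[OF that] by simp
  qed simp
  then show ?thesis using 0 by simp
qed

text \<open>The field is truncated outside the ball of radius R + 1, where R is the a priori bound
  up to time T. The truncated problem has a global solution, which can never reach the sphere of
  radius R + 1: up to the first hitting time it solves the original equation and is therefore
  bounded by R. Uniqueness glues the solutions for integer T.\<close>

lemma ode_global_from_apriori_bounds:
  fixes F :: "'a::banach \<Rightarrow> 'a"
  assumes F: "lip_on_balls F"
    and apriori: "\<And>T. 0 \<le> T \<Longrightarrow> \<exists>R. \<forall>\<tau> x. 0 \<le> \<tau> \<longrightarrow> \<tau> \<le> T \<longrightarrow> x 0 = x0 \<longrightarrow> ode_sol F {0..\<tau>} x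
        \<longrightarrow> norm (x \<tau>) \<le> R"
  shows "\<exists>x. x 0 = x0 \<and> ode_sol F {0..} x"
proof -
  have loc: "\<exists>x. x 0 = x0 \<and> ode_sol F {0..T} x" if T: "0 \<le> T" for T
  proof -
    obtain R where R: "\<And>\<tau> x. 0 \<le> \<tau> \<Longrightarrow> \<tau> \<le> T \<Longrightarrow> x 0 = x0 \<Longrightarrow> ode_sol F {0..\<tau>} x \<Longrightarrow> norm (x \<tau>) \<le> R"
      using apriori[OF T] by blast
    \<comment> \<open>The one-point interval [0, 0] carries the constant solution, so the a priori
      bound also covers the initial value.\<close>
    have triv: "norm x0 \<le> R"
    proof -
      have "ode_sol F {0..0} (\<lambda>_. x0)"
        by (simp add: ode_sol_def has_vector_derivative_def has_derivative_within_singleton_iff bounded_linear_scaleR_left)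
      then show ?thesis using R[of 0 "\<lambda>_. x0"] T by auto
    qed
    then have R0: "0 \<le> R + 1" using norm_ge_zero[of x0] by linarith
    obtain C where C: "C \<ge> 0" "\<And>x y. norm x \<le> R + 1 \<Longrightarrow> norm y \<le> R + 1 \<Longrightarrow> norm (F x - F y) \<le> C * norm (x - y)"
      using F unfolding lip_on_balls_def by meson
    have "norm (F (radial (R+1) x) - F (radial (R+1) y)) \<le> (2 * C + 1) * norm (x - y)" for x y
    proof -
      have "norm (F (radial (R+1) x) - F (radial (R+1) y)) \<le> C * (2 * norm (x - y))"
        using C(2)[OF norm_radial_le[OF R0] norm_radial_le[OF R0]] mult_left_mono[OF radial_lipschitz[OF R0] C(1)]
        by (rule order_trans)
      also have "\<dots> \<le> (2 * C + 1) * norm (x - y)" by (simp add: algebra_simps)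
      finally show ?thesis .
    qed
    then obtain x where x0: "x 0 = x0" and x: "ode_sol (\<lambda>z. F (radial (R+1) z)) {0..} x"
      using lipschitz_ode_global[of "2 * C + 1" "\<lambda>z. F (radial (R+1) z)"] C(1) by (meson add_nonneg_pos mult_nonneg_nonneg zero_le_numeral zero_less_one)
    have cont: "continuous_on {0..} x" by (rule ode_sol_continuous[OF x])
    have true_sol: "ode_sol F {0..\<tau>} x" if "\<And>s. s \<in> {0..\<tau>} \<Longrightarrow> norm (x s) \<le> R + 1" for \<tau>
      using ode_sol_subset[OF x, of "{0..\<tau>}"] that unfolding ode_sol_def radial_def by auto
    have "norm (x s) \<le> R + 1" if s: "s \<in> {0..T}" for s
    proof (rule ccontr)
      assume "\<not> norm (x s) \<le> R + 1"
      then have big: "R + 1 < norm (x s)" by simp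
      \<comment> \<open>The hitting times of the sphere of radius R + 1; the least of them, \<tau>,
        is the time at which the a priori bound is contradicted.\<close>
      define A where "A = {r \<in> {0..s}. norm (x r) = R + 1}"
      have cs: "continuous_on {0..s} (\<lambda>r. norm (x r))"
        using cont s by (intro continuous_intros) (auto intro: continuous_on_subset)
      have "closed A" unfolding A_def by (intro continuous_closed_preimage_constant cs) auto
      moreover have "A \<subseteq> {0..s}" by (auto simp: A_def)
      ultimately have "compact A" by (meson bounded_closed_interval bounded_subset compact_eq_bounded_closed)
      moreover have "A \<noteq> {}"
        using IVT'[of "\<lambda>r. norm (x r)" 0 "R + 1" s] triv big cs s x0 by (auto simp: A_def)
      ultimately have "\<exists>\<tau>\<in>A. \<forall>r\<in>A. \<tau> \<le> r" by (intro compact_attains_inf)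
      then obtain \<tau> where \<tau>: "\<tau> \<in> A" and least: "\<And>r. r \<in> A \<Longrightarrow> \<tau> \<le> r"
        by auto
      have "norm (x r) \<le> R + 1" if r: "r \<in> {0..\<tau>}" for r
      proof (rule ccontr)
        assume "\<not> norm (x r) \<le> R + 1"
        moreover have "{0..r} \<subseteq> {0..s}" using r \<tau> unfolding A_def by force
        then have "continuous_on {0..r} (\<lambda>r. norm (x r))" by (rule continuous_on_subset[OF cs])
        ultimately have "\<exists>r'\<ge>0. r' \<le> r \<and> norm (x r') = R + 1"
          using triv x0 r IVT'[of "\<lambda>r. norm (x r)" 0 "R + 1" r] by auto
        then obtain r' where "0 \<le> r'" "r' \<le> r" "norm (x r') = R + 1" by blast
        then have "r' \<in> A" "r' \<le> r" using r \<tau> by (auto simp: A_def)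
        then have "r = \<tau>" using least r by force
        then show False using \<tau> \<open>\<not> norm (x r) \<le> R + 1\<close> by (simp add: A_def)
      qed
      then have "norm (x \<tau>) \<le> R" using R[of \<tau> x] true_sol \<tau> s x0 by (auto simp: A_def)
      then show False using \<tau> by (simp add: A_def)
    qed
    then show ?thesis using true_sol x0 by blast
  qed
  define xx where "xx n = (SOME x. x 0 = x0 \<and> ode_sol F {0..real n} x)" for n
  have xx: "xx n 0 = x0" "ode_sol F {0..real n} (xx n)" for n
    using someI_ex[OF loc[of "real n"]] by (auto simp: xx_def)
  have agree: "xx n t = xx m t" if "0 \<le> t" "t \<le> real n" "t \<le> real m" for n m t
    by (rule ode_sol_unique[OF F, of t])
       (use that xx in \<open>auto intro: ode_sol_subset[OF xx(2)]\<close>)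
  define x where "x t = xx (nat \<lceil>t\<rceil> + 1) t" for t :: real
  have xeq: "x t = xx n t" if "0 \<le> t" "t \<le> real n" for n t
    unfolding x_def by (rule agree) (use that in \<open>auto simp: of_nat_ceiling intro: order_trans[OF of_nat_ceiling]\<close>)
  show ?thesis
  proof (intro exI[of _ x] conjI)
    show "x 0 = x0" using xeq[of 0 0] xx(1) by simp
    show "ode_sol F {0..} x"
      unfolding ode_sol_def
    proof
      fix t :: real assume "t \<in> {0..}"
      then have t: "0 \<le> t" by simp
      \<comment> \<open>The additional 1 places t strictly below the right end n, so that the
        filters within [0, n] and within the half-line agree at t.\<close>
      define n where "n = nat \<lceil>t\<rceil> + 1"
      have tn: "t < real n" unfolding n_def using t by linarith
      have "(xx n has_vector_derivative F (xx n t)) (at t within {0..real n})"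
        using xx(2)[of n] t tn unfolding ode_sol_def by auto
      then have "(x has_vector_derivative F (xx n t)) (at t within {0..real n})"
        by (rule has_vector_derivative_transform[rotated 2]) (use t tn xeq in auto)
      moreover have "at t within {0..real n} = at t within {0..}"
        by (rule at_within_nhd[of _ "{..<real n}"]) (use tn in auto)
      ultimately show "(x has_vector_derivative F (x t)) (at t within {0..})"
        using xeq[of t n] t tn by simp
    qed
  qed
qed

section \<open>Calculus of maps that are Lipschitz on bounded sets\<close>

lemma lip_on_ballsI:
  assumes "\<And>R. 0 \<le> R \<Longrightarrow> \<exists>C. \<forall>x y. norm x \<le> R \<longrightarrow> norm y \<le> R \<longrightarrow> norm (F x - F y) \<le> C * norm (x - y)"
  shows "lip_on_balls F"
  unfolding lip_on_balls_def
proof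
  fix R :: real
  obtain C where C: "\<And>x y. norm x \<le> max R 0 \<Longrightarrow> norm y \<le> max R 0 \<Longrightarrow> norm (F x - F y) \<le> C * norm (x - y)"
    using assms[of "max R 0"] by auto
  have "norm (F x - F y) \<le> \<bar>C\<bar> * norm (x - y)" if "norm x \<le> R" "norm y \<le> R" for x y
  proof -
    have "norm (F x - F y) \<le> C * norm (x - y)" using that by (intro C) auto
    also have "\<dots> \<le> \<bar>C\<bar> * norm (x - y)" by (rule mult_right_mono) auto
    finally show ?thesis .
  qed
  then show "\<exists>C\<ge>0. \<forall>x y. norm x \<le> R \<longrightarrow> norm y \<le> R \<longrightarrow> norm (F x - F y) \<le> C * norm (x - y)"
    by (intro exI[of _ "\<bar>C\<bar>"]) auto
qed

lemma lip_on_ballsE: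
  assumes "lip_on_balls F"
  obtains C where "0 \<le> C" "\<And>x y. norm x \<le> R \<Longrightarrow> norm y \<le> R \<Longrightarrow> norm (F x - F y) \<le> C * norm (x - y)"
  using assms unfolding lip_on_balls_def by meson

lemma lip_on_balls_bounded:
  assumes "lip_on_balls F"
  obtains B where "0 \<le> B" "\<And>x. norm x \<le> R \<Longrightarrow> norm (F x) \<le> B"
proof -
  obtain C where C: "0 \<le> C" "\<And>x y. norm x \<le> max R 0 \<Longrightarrow> norm y \<le> max R 0 \<Longrightarrow> norm (F x - F y) \<le> C * norm (x - y)"
    using assms by (rule lip_on_ballsE[where R="max R 0"]) blast
  have "norm (F x) \<le> norm (F 0) + C * max R 0" if "norm x \<le> R" for x
  proof -
    have "norm (F x) \<le> norm (F 0) + norm (F x - F 0)" by (rule norm_triangle_sub)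
    also have "norm (F x - F 0) \<le> C * norm x" using C(2)[of x 0] that by simp
    also have "\<dots> \<le> C * max R 0" using that C(1) by (intro mult_left_mono) auto
    finally show ?thesis by simp
  qed
  then show ?thesis using C(1) by (intro that[of "norm (F 0) + C * max R 0"]) auto
qed

lemma lip_on_balls_compose:
  fixes F :: "'a::real_normed_vector \<Rightarrow> 'b::real_normed_vector" and G :: "'b \<Rightarrow> 'c::real_normed_vector"
  assumes G: "lip_on_balls G" and F: "lip_on_balls F"
  shows "lip_on_balls (\<lambda>x. G (F x))"
proof (rule lip_on_ballsI)
  fix R :: real
  obtain B where B: "\<And>x. norm x \<le> R \<Longrightarrow> norm (F x) \<le> B" using lip_on_balls_bounded[OF F] by metis
  obtain C where C: "0 \<le> C" "\<And>x y. norm x \<le> R \<Longrightarrow> norm y \<le> R \<Longrightarrow> norm (F x - F y) \<le> C * norm (x - y)"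
    using F by (rule lip_on_ballsE[where R="R"]) blast
  obtain D where D: "0 \<le> D" "\<And>x y. norm x \<le> B \<Longrightarrow> norm y \<le> B \<Longrightarrow> norm (G x - G y) \<le> D * norm (x - y)"
    using G by (rule lip_on_ballsE[where R="B"]) blast
  show "\<exists>C. \<forall>x y. norm x \<le> R \<longrightarrow> norm y \<le> R \<longrightarrow> norm (G (F x) - G (F y)) \<le> C * norm (x - y)"
  proof (intro exI[of _ "D * C"] allI impI)
    fix x y :: 'a assume "norm x \<le> R" "norm y \<le> R"
    then show "norm (G (F x) - G (F y)) \<le> D * C * norm (x - y)"
      using D(2)[OF B B] mult_left_mono[OF C(2) D(1)] by (metis mult.assoc order_trans)
  qed
qed

lemma lip_on_balls_bounded_linear:
  assumes "bounded_linear F" shows "lip_on_balls F"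
proof (rule lip_on_ballsI)
  obtain K where "\<And>x. norm (F x) \<le> norm x * K" using bounded_linear.bounded[OF assms] by blast
  then show "\<exists>C. \<forall>x y. norm x \<le> R \<longrightarrow> norm y \<le> R \<longrightarrow> norm (F x - F y) \<le> C * norm (x - y)" for R
    using bounded_linear.linear[OF assms] by (intro exI[of _ K]) (simp add: linear_diff[symmetric] mult.commute)
qed

lemma lip_on_balls_Pair:
  fixes F :: "'a::real_normed_vector \<Rightarrow> 'b::real_normed_vector" and G :: "'a \<Rightarrow> 'c::real_normed_vector"
  assumes F: "lip_on_balls F" and G: "lip_on_balls G"
  shows "lip_on_balls (\<lambda>x. (F x, G x))"
proof (rule lip_on_ballsI)
  fix R :: real
  obtain C where C: "\<And>x y. norm x \<le> R \<Longrightarrow> norm y \<le> R \<Longrightarrow> norm (F x - F y) \<le> C * norm (x - y)"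
    using F by (rule lip_on_ballsE[where R="R"]) blast
  obtain D where D: "\<And>x y. norm x \<le> R \<Longrightarrow> norm y \<le> R \<Longrightarrow> norm (G x - G y) \<le> D * norm (x - y)"
    using G by (rule lip_on_ballsE[where R="R"]) blast
  show "\<exists>C. \<forall>x y. norm x \<le> R \<longrightarrow> norm y \<le> R \<longrightarrow> norm ((F x, G x) - (F y, G y)) \<le> C * norm (x - y)"
  proof (intro exI[of _ "C + D"] allI impI)
    fix x y :: 'a assume "norm x \<le> R" "norm y \<le> R"
    then have "norm (F x - F y) + norm (G x - G y) \<le> (C + D) * norm (x - y)"
      using C D by (simp add: distrib_right add_mono)
    then show "norm ((F x, G x) - (F y, G y)) \<le> (C + D) * norm (x - y)"
      using norm_Pair_le[of "F x - F y" "G x - G y"] by simp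
  qed
qed

lemma lip_on_balls_add:
  assumes "lip_on_balls F" "lip_on_balls G" shows "lip_on_balls (\<lambda>x. F x + G x)"
  using lip_on_balls_compose[OF lip_on_balls_bounded_linear[OF bounded_linear_add[OF bounded_linear_fst bounded_linear_snd]]
      lip_on_balls_Pair[OF assms]] by simp

lemma lip_on_balls_scaleR: "lip_on_balls F \<Longrightarrow> lip_on_balls (\<lambda>x. c *\<^sub>R F x)"
  using lip_on_balls_compose[OF lip_on_balls_bounded_linear[OF bounded_linear_scaleR_right]] by blast

lemma lip_on_balls_diff:
  assumes "lip_on_balls F" "lip_on_balls G" shows "lip_on_balls (\<lambda>x. F x - G x)"
  using lip_on_balls_add[OF assms(1) lip_on_balls_scaleR[OF assms(2), of "-1"]] by simp

lemma lip_on_balls_C1: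
  fixes g :: "real \<Rightarrow> real"
  assumes g: "\<And>x. (g has_real_derivative g' x) (at x)" and c: "continuous_on UNIV g'"
  shows "lip_on_balls g"
proof (rule lip_on_ballsI)
  fix R :: real assume "0 \<le> R"
  have "compact (g' ` {-R..R})" by (intro compact_continuous_image continuous_on_subset[OF c]) auto
  then obtain B where "\<forall>x\<in>{-R..R}. norm (g' x) \<le> B"
    using compact_imp_bounded[of "g' ` {-R..R}"] unfolding bounded_iff by auto
  then have B: "norm (g' x) \<le> B" if "x \<in> {-R..R}" for x using that by blast
  show "\<exists>C. \<forall>x y. norm x \<le> R \<longrightarrow> norm y \<le> R \<longrightarrow> norm (g x - g y) \<le> C * norm (x - y)"
  proof (intro exI[of _ B] allI impI)
    fix x y :: real assume "norm x \<le> R" "norm y \<le> R"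
    then show "norm (g x - g y) \<le> B * norm (x - y)"
      using B by (intro field_differentiable_bound[of "{-R..R}" g g']) (auto intro: g has_field_derivative_at_within)
  qed
qed

section \<open>Nemytskii (superposition) operators, products and reflection on bounded continuous
  functions\<close>

definition nem :: "(real \<Rightarrow> real) \<Rightarrow> (real \<Rightarrow>\<^sub>C real) \<Rightarrow> (real \<Rightarrow>\<^sub>C real)" where
  "nem g u = Bcontfun (\<lambda>x. g (apply_bcontfun u x))"

definition bmul :: "(real \<Rightarrow>\<^sub>C real) \<Rightarrow> (real \<Rightarrow>\<^sub>C real) \<Rightarrow> (real \<Rightarrow>\<^sub>C real)" where
  "bmul u v = Bcontfun (\<lambda>x. apply_bcontfun u x * apply_bcontfun v x)"

definition brefl :: "(real \<Rightarrow>\<^sub>C real) \<Rightarrow> (real \<Rightarrow>\<^sub>C real)" where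
  "brefl u = Bcontfun (\<lambda>x. apply_bcontfun u (- x))"

lemma abs_le_norm_bcontfun: "\<bar>apply_bcontfun u x\<bar> \<le> norm u" for u :: "real \<Rightarrow>\<^sub>C real"
  using norm_bounded[of u x] by simp

lemma nem_apply:
  assumes g: "continuous_on UNIV g" shows "apply_bcontfun (nem g u) x = g (apply_bcontfun u x)"
proof -
  have "compact (g ` {- norm u..norm u})" by (intro compact_continuous_image continuous_on_subset[OF g]) auto
  then obtain B where "\<forall>x\<in>{- norm u..norm u}. norm (g x) \<le> B"
    using compact_imp_bounded[of "g ` {- norm u..norm u}"] unfolding bounded_iff by auto
  then have B: "norm (g x) \<le> B" if "x \<in> {- norm u..norm u}" for x using that by blast
  have "(\<lambda>x. g (apply_bcontfun u x)) \<in> bcontfun"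
  proof (rule bcontfun_normI)
    show "continuous_on UNIV (\<lambda>x. g (apply_bcontfun u x))" by (rule continuous_on_compose2[OF g]) auto
    show "norm (g (apply_bcontfun u x)) \<le> B" for x
      using B[of "apply_bcontfun u x"] abs_le_norm_bcontfun[of u x] by (auto simp: abs_le_iff)
  qed
  then show ?thesis by (simp add: nem_def Bcontfun_inverse)
qed

lemma bmul_apply [simp]: "apply_bcontfun (bmul u v) x = apply_bcontfun u x * apply_bcontfun v x"
proof -
  have "(\<lambda>x. apply_bcontfun u x * apply_bcontfun v x) \<in> bcontfun"
  proof (rule bcontfun_normI)
    show "norm (apply_bcontfun u x * apply_bcontfun v x) \<le> norm u * norm v" for x
      by (simp add: abs_mult mult_mono abs_le_norm_bcontfun)
  qed (intro continuous_intros; simp)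
  then show ?thesis by (simp add: bmul_def Bcontfun_inverse)
qed

lemma brefl_apply [simp]: "apply_bcontfun (brefl u) x = apply_bcontfun u (- x)"
proof -
  have "(\<lambda>x. apply_bcontfun u (- x)) \<in> bcontfun"
  proof (rule bcontfun_normI)
    show "continuous_on UNIV (\<lambda>x. apply_bcontfun u (- x))"
      by (rule continuous_on_compose2[of UNIV "apply_bcontfun u"]) (auto intro!: continuous_intros)
  qed (rule norm_bounded)
  then show ?thesis by (simp add: brefl_def Bcontfun_inverse)
qed

lemma bounded_linear_brefl: "bounded_linear brefl"
proof (rule bounded_linear_intro)
  show "norm (brefl u) \<le> norm u * 1" for u
    by (rule norm_bound) (simp add: abs_le_norm_bcontfun)
qed (auto intro!: bcontfun_eqI)

lemma lip_on_balls_brefl: "lip_on_balls F \<Longrightarrow> lip_on_balls (\<lambda>x. brefl (F x))"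
  using lip_on_balls_compose[OF lip_on_balls_bounded_linear[OF bounded_linear_brefl]] by blast

lemma lip_on_balls_bmul_pair: "lip_on_balls (\<lambda>p. bmul (fst p) (snd p))"
proof (rule lip_on_ballsI)
  fix R :: real assume R: "0 \<le> R"
  have norm_fst: "norm (fst p) \<le> norm p" and norm_snd: "norm (snd p) \<le> norm p"
    for p :: "(real \<Rightarrow>\<^sub>C real) \<times> (real \<Rightarrow>\<^sub>C real)"
    using norm_fst_le[of "fst p" "snd p"] norm_snd_le[of "snd p" "fst p"] by simp_all
  have nm: "norm (bmul a b) \<le> norm a * norm b" for a b
    by (rule norm_bound) (simp add: abs_mult mult_mono abs_le_norm_bcontfun)
  show "\<exists>C. \<forall>x y. norm x \<le> R \<longrightarrow> norm y \<le> R \<longrightarrow>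
      norm (bmul (fst x) (snd x) - bmul (fst y) (snd y)) \<le> C * norm (x - y)"
  proof (intro exI[of _ "R + R"] allI impI)
    fix x y :: "(real \<Rightarrow>\<^sub>C real) \<times> (real \<Rightarrow>\<^sub>C real)" assume x: "norm x \<le> R" and y: "norm y \<le> R"
    have "bmul (fst x) (snd x) - bmul (fst y) (snd y) = bmul (fst (x - y)) (snd x) + bmul (fst y) (snd (x - y))"
      by (auto intro!: bcontfun_eqI simp: algebra_simps)
    then have "norm (bmul (fst x) (snd x) - bmul (fst y) (snd y)) \<le>
        norm (fst (x - y)) * norm (snd x) + norm (fst y) * norm (snd (x - y))"
      using nm[of "fst (x - y)" "snd x"] nm[of "fst y" "snd (x - y)"]
        norm_triangle_ineq[of "bmul (fst (x - y)) (snd x)" "bmul (fst y) (snd (x - y))"] by simp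
    also have "\<dots> \<le> norm (x - y) * R + R * norm (x - y)"
      using x y R by (intro add_mono mult_mono norm_fst norm_snd order_trans[OF norm_fst x] order_trans[OF norm_snd x] order_trans[OF norm_fst y]) auto
    finally show "norm (bmul (fst x) (snd x) - bmul (fst y) (snd y)) \<le> (R + R) * norm (x - y)"
      by (simp add: algebra_simps)
  qed
qed

lemma lip_on_balls_bmul:
  assumes "lip_on_balls F" "lip_on_balls G" shows "lip_on_balls (\<lambda>x. bmul (F x) (G x))"
  using lip_on_balls_compose[OF lip_on_balls_bmul_pair lip_on_balls_Pair[OF assms]] by simp

lemma lip_on_balls_imp_continuous:
  fixes g :: "'a::real_normed_vector \<Rightarrow> 'b::real_normed_vector"
  assumes "lip_on_balls g" shows "continuous_on S g"
proof (rule continuous_on_subset[of UNIV])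
  show "continuous_on UNIV g"
    unfolding continuous_on_iff
  proof (intro ballI allI impI)
    fix x :: 'a and e :: real assume e: "0 < e"
    obtain C where C: "0 \<le> C" "\<And>a b. norm a \<le> norm x + 1 \<Longrightarrow> norm b \<le> norm x + 1 \<Longrightarrow> norm (g a - g b) \<le> C * norm (a - b)"
      using assms by (rule lip_on_ballsE[where R="norm x + 1"]) blast
    have "dist (g x') (g x) < e" if d: "dist x' x < min 1 (e / (C + 1))" for x'
    proof -
      have "norm x' \<le> norm x + 1" using d norm_triangle_sub[of x' x] by (auto simp: dist_norm)
      then have "dist (g x') (g x) \<le> C * dist x' x" using C(2)[of x' x] by (simp add: dist_norm)
      also have "\<dots> \<le> (C + 1) * dist x' x" by (simp add: algebra_simps)
      also have "\<dots> < e" using d C(1) by (simp add: field_simps)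
      finally show ?thesis .
    qed
    then show "\<exists>d>0. \<forall>x'\<in>UNIV. dist x' x < d \<longrightarrow> dist (g x') (g x) < e"
      using e C(1) by (intro exI[of _ "min 1 (e / (C + 1))"]) auto
  qed
qed simp

lemma lip_on_balls_nem:
  assumes g: "lip_on_balls g" and F: "lip_on_balls F"
  shows "lip_on_balls (\<lambda>x. nem g (F x))"
proof (rule lip_on_balls_compose[OF _ F], rule lip_on_ballsI)
  fix R :: real
  obtain C where C: "0 \<le> C" "\<And>x y. norm x \<le> R \<Longrightarrow> norm y \<le> R \<Longrightarrow> norm (g x - g y) \<le> C * norm (x - y)"
    using g by (rule lip_on_ballsE[where R="R"]) blast
  show "\<exists>C. \<forall>u v. norm u \<le> R \<longrightarrow> norm v \<le> R \<longrightarrow> norm (nem g u - nem g v) \<le> C * norm (u - v)"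
  proof (intro exI[of _ C] allI impI)
    fix u v :: "real \<Rightarrow>\<^sub>C real" assume u: "norm u \<le> R" and v: "norm v \<le> R"
    show "norm (nem g u - nem g v) \<le> C * norm (u - v)"
    proof (rule norm_bound)
      fix x
      have "norm (g (apply_bcontfun u x) - g (apply_bcontfun v x)) \<le> C * norm (apply_bcontfun u x - apply_bcontfun v x)"
        using u v abs_le_norm_bcontfun[of u x] abs_le_norm_bcontfun[of v x] by (intro C(2)) auto
      also have "\<dots> \<le> C * norm (u - v)"
        using C(1) abs_le_norm_bcontfun[of "u - v" x] by (intro mult_left_mono) auto
      finally show "norm (apply_bcontfun (nem g u - nem g v) x) \<le> C * norm (u - v)"
        by (simp add: nem_apply[OF lip_on_balls_imp_continuous[OF g]])
    qed
  qed
qed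

subsection \<open>The one-sided exponential kernel in Lagrangian coordinates\<close>

lemma continuous_antiderivative:
  fixes g :: "real \<Rightarrow> real"
  assumes "continuous_on UNIV g"
  shows "\<exists>Y. Y 0 = 0 \<and> (\<forall>x. (Y has_real_derivative g x) (at x))"
proof -
  obtain F where F: "\<And>x. (F has_vector_derivative g x) (at x)"
    using einterval_antiderivative[of "-\<infinity>" "\<infinity>" g] assms
    by (auto simp: continuous_on_eq_continuous_at)
  then show ?thesis
    by (intro exI[of _ "\<lambda>x. F x - F 0"])
      (auto simp: has_real_derivative_iff_has_vector_derivative intro!: derivative_eq_intros)
qed

text \<open>A primitive of the Jacobian exp L, hence the Lagrangian position up to a translation.
  The kernel sees only differences of its values, so the position does not have to be a component of
  the state.\<close>

definition flowmap :: "(real \<Rightarrow>\<^sub>C real) \<Rightarrow> real \<Rightarrow> real" where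
  "flowmap L = (SOME Y. Y 0 = 0 \<and> (\<forall>x. (Y has_real_derivative exp (apply_bcontfun L x)) (at x)))"

lemma flowmap_deriv: "(flowmap L has_real_derivative exp (apply_bcontfun L x)) (at x)"
proof -
  have "\<exists>Y. Y 0 = 0 \<and> (\<forall>x. (Y has_real_derivative exp (apply_bcontfun L x)) (at x))"
    by (intro continuous_antiderivative continuous_intros) auto
  from someI_ex[OF this] show "(flowmap L has_real_derivative exp (apply_bcontfun L x)) (at x)"
    unfolding flowmap_def by auto
qed

lemma flowmap_continuous: "continuous_on S (flowmap L)"
  using flowmap_deriv by (meson DERIV_isCont continuous_at_imp_continuous_on)

text \<open>Distances between labels shrink at most by the factor exp(-R). This turns decay of the
  kernel in space into decay in labels at the rate exp(-R)/l, the rate against which weights are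
  measured.\<close>

lemma flowmap_diff_ge:
  assumes R: "norm L \<le> R" and le: "y \<le> x"
  shows "exp (- R) * (x - y) \<le> flowmap L x - flowmap L y"
proof (cases "y = x")
  case False
  then obtain z where "flowmap L x - flowmap L y = (x - y) * exp (apply_bcontfun L z)"
    using MVT2[of y x "flowmap L" "\<lambda>z. exp (apply_bcontfun L z)"] le flowmap_deriv by auto
  moreover have "exp (- R) \<le> exp (apply_bcontfun L z)"
    using abs_le_norm_bcontfun[of L z] R by auto
  ultimately show ?thesis using le by (simp add: mult.commute mult_left_mono)
qed simp

lemma exp_diff_le:
  fixes a b :: real
  assumes "\<bar>a\<bar> \<le> R" "\<bar>b\<bar> \<le> R" shows "\<bar>exp a - exp b\<bar> \<le> exp R * \<bar>a - b\<bar>"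
proof -
  have "norm (exp a - exp b) \<le> exp R * norm (a - b)"
    by (rule field_differentiable_bound[of "{-R..R}" exp exp])
      (use assms in \<open>auto intro: DERIV_exp has_field_derivative_at_within\<close>)
  then show ?thesis by simp
qed

text \<open>Changing the Jacobian changes distances in proportion to x - y; this linear growth is
  absorbed later by part of the exponential decay of the kernel.\<close>

lemma flowmap_diff_lip:
  assumes 1: "norm L \<le> R" and 2: "norm L' \<le> R" and le: "y \<le> x"
  shows "\<bar>(flowmap L x - flowmap L y) - (flowmap L' x - flowmap L' y)\<bar> \<le> exp R * norm (L - L') * (x - y)"
proof -
  have "norm ((flowmap L x - flowmap L' x) - (flowmap L y - flowmap L' y)) \<le> (exp R * norm (L - L')) * norm (x - y)"
  proof (rule field_differentiable_bound[of UNIV _ "\<lambda>z. exp (apply_bcontfun L z) - exp (apply_bcontfun L' z)"])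
    fix z
    show "((\<lambda>x. flowmap L x - flowmap L' x) has_field_derivative exp (apply_bcontfun L z) - exp (apply_bcontfun L' z)) (at z within UNIV)"
      by (intro derivative_intros flowmap_deriv)
    have "\<bar>exp (apply_bcontfun L z) - exp (apply_bcontfun L' z)\<bar> \<le> exp R * \<bar>apply_bcontfun L z - apply_bcontfun L' z\<bar>"
      using abs_le_norm_bcontfun[of L z] abs_le_norm_bcontfun[of L' z] 1 2 by (intro exp_diff_le) auto
    also have "\<dots> \<le> exp R * norm (L - L')"
      using abs_le_norm_bcontfun[of "L - L'" z] by (intro mult_left_mono) auto
    finally show "norm (exp (apply_bcontfun L z) - exp (apply_bcontfun L' z)) \<le> exp R * norm (L - L')" by simp
  qed auto
  then show ?thesis using le by (simp add: algebra_simps)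
qed

lemma has_bochner_integral_exp_decay:
  assumes k: "0 < k"
  shows "has_bochner_integral lborel (\<lambda>y. indicator {..x} y * exp (- (k * (x - y)))) (1 / k :: real)"
proof -
  have "(\<integral>\<^sup>+t. ennreal (exp (- (k * t))) * indicator {0..} t \<partial>lborel) = 0 - (- exp (- (k * 0)) / k)"
  proof (rule nn_integral_FTC_atLeast[where F="\<lambda>t. - exp (- (k * t)) / k"])
    show "((\<lambda>t. - exp (- (k * t)) / k) \<longlongrightarrow> 0) at_top"
    proof -
      have "filterlim (\<lambda>t::real. - (k * t)) at_bot at_top"
        unfolding filterlim_uminus_at_bot using k by (simp add: filterlim_tendsto_pos_mult_at_top[OF tendsto_const] filterlim_ident)
      then have "((\<lambda>t. exp (- (k * t))) \<longlongrightarrow> 0) at_top"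
        by (rule filterlim_compose[OF exp_at_bot])
      then have "((\<lambda>t. - exp (- (k * t)) / k) \<longlongrightarrow> - 0 / k) at_top"
        using k by (intro tendsto_intros) auto
      then show ?thesis by simp
    qed
  qed (use k in \<open>auto intro!: derivative_eq_intros\<close>)
  then have "(\<integral>\<^sup>+t. ennreal (indicator {0..} t * exp (- (k * t))) \<partial>lborel) = ennreal (1 / k)"
    by (subst nn_integral_cong[where v="\<lambda>t. ennreal (exp (- (k * t))) * indicator {0..} t"])
      (auto simp: indicator_def)
  then have "has_bochner_integral lborel (\<lambda>t. indicator {0..} t * exp (- (k * t))) (1 / k)"
    using k by (intro has_bochner_integral_nn_integral) auto
  then have "has_bochner_integral lborel (\<lambda>t. indicator {0..} (x + (-1) * t) * exp (- (k * (x + (-1) * t)))) (1 / k)"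
    using lborel_has_bochner_integral_real_affine_iff[of "-1" "\<lambda>t. indicator {0..} t * exp (- (k * t)) :: real" "1 / k" x] by simp
  then show ?thesis by (simp add: indicator_def)
qed

text \<open>The part of the exponential convolution coming from labels to the left of x. The part
  from the right is the same operator conjugated with the reflection \<open>brefl\<close>, so all
  analysis is done once.\<close>

definition kint :: "real \<Rightarrow> (real \<Rightarrow>\<^sub>C real) \<Rightarrow> (real \<Rightarrow>\<^sub>C real) \<Rightarrow> real \<Rightarrow> real" where
  "kint l L \<rho> x = (LINT y|lborel. indicator {..x} y * exp (- (flowmap L x - flowmap L y) / l) * apply_bcontfun \<rho> y)"

lemma kernel_measurable [measurable]:
  "(\<lambda>y. indicator {..x} y * exp (- (flowmap L x - flowmap L y) / l) * apply_bcontfun \<rho> y) \<in> borel_measurable borel"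
proof -
  have [measurable]: "flowmap L \<in> borel_measurable borel" "apply_bcontfun \<rho> \<in> borel_measurable borel"
    by (auto intro: borel_measurable_continuous_onI flowmap_continuous)
  show ?thesis by measurable
qed

lemma kernel_le:
  assumes "norm L \<le> R" "0 < l"
  shows "indicator {..x} y * exp (- (flowmap L x - flowmap L y) / l) \<le> indicator {..x} y * exp (- (exp (- R) / l * (x - y)))"
proof (cases "y \<le> x")
  case True
  define D where "D = flowmap L x - flowmap L y"
  have "exp (- R) / l * (x - y) \<le> D / l"
    using divide_right_mono[OF flowmap_diff_ge[OF assms(1) True], of l] assms(2) by (simp add: D_def)
  then show ?thesis using True unfolding D_def[symmetric] by simp
qed simp

text \<open>The kernel decays at the rate exp(-R)/l while the weight grows at most at the rate
  \<beta>; what is left is an exponential of rate exp(-R)/l - \<beta>, whose integral is the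
  denominator. With the weight 1 and \<beta> = 0 this becomes the plain bound.\<close>

lemma kint_weighted:
  assumes L: "norm L \<le> R" and l: "0 < l" and \<beta>: "0 \<le> \<beta>" "\<beta> < exp (- R) / l" and w: "\<And>y. \<omega> y \<le> exp (\<beta> * \<bar>x - y\<bar>) * \<omega> x"
    and B: "0 \<le> B" and \<rho>: "\<And>y. \<bar>apply_bcontfun \<rho> y\<bar> \<le> B * \<omega> y"
  shows "integrable lborel (\<lambda>y. indicator {..x} y * exp (- (flowmap L x - flowmap L y) / l) * apply_bcontfun \<rho> y)"
    and "\<bar>kint l L \<rho> x\<bar> \<le> B * \<omega> x / (exp (- R) / l - \<beta>)"
proof -
  define k where "k = exp (- R) / l - \<beta>"
  have k: "0 < k" using \<beta> by (simp add: k_def)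
  have hb: "has_bochner_integral lborel (\<lambda>y. B * \<omega> x * (indicator {..x} y * exp (- (k * (x - y))))) (B * \<omega> x * (1 / k))"
    by (intro has_bochner_integral_mult_right has_bochner_integral_exp_decay k)
  have bd: "norm (indicator {..x} y * exp (- (flowmap L x - flowmap L y) / l) * apply_bcontfun \<rho> y)
      \<le> B * \<omega> x * (indicator {..x} y * exp (- (k * (x - y))))" for y
  proof (cases "y \<le> x")
    case True
    have "norm (indicator {..x} y * exp (- (flowmap L x - flowmap L y) / l) * apply_bcontfun \<rho> y)
        \<le> exp (- (exp (- R) / l * (x - y))) * (B * (exp (\<beta> * \<bar>x - y\<bar>) * \<omega> x))"
      using kernel_le[OF L l, of x y] True order_trans[OF \<rho>[of y] mult_left_mono[OF w[of y] B]]
      by (simp add: abs_mult mult_mono)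
    also have "\<dots> = B * \<omega> x * (exp (- (exp (- R) / l * (x - y))) * exp (\<beta> * (x - y)))" using True by simp
    also have "exp (- (exp (- R) / l * (x - y))) * exp (\<beta> * (x - y)) = exp (- (k * (x - y)))"
      by (simp add: exp_add[symmetric] k_def algebra_simps)
    finally show ?thesis using True by simp
  qed simp
  show I: "integrable lborel (\<lambda>y. indicator {..x} y * exp (- (flowmap L x - flowmap L y) / l) * apply_bcontfun \<rho> y)"
  proof (rule Bochner_Integration.integrable_bound[OF integrable.intros[OF hb]])
    show "AE y in lborel. norm (indicator {..x} y * exp (- (flowmap L x - flowmap L y) / l) * apply_bcontfun \<rho> y)
        \<le> norm (B * \<omega> x * (indicator {..x} y * exp (- (k * (x - y)))))"
      using order_trans[OF bd abs_ge_self] by (intro AE_I2) (simp only: real_norm_def)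
  qed (use kernel_measurable in simp)
  have "norm (kint l L \<rho> x) \<le> (LINT y|lborel. B * \<omega> x * (indicator {..x} y * exp (- (k * (x - y)))))"
    unfolding kint_def by (intro Bochner_Integration.integral_norm_bound_integral I bd integrable.intros[OF hb])
  also have "\<dots> = B * \<omega> x / k" using has_bochner_integral_integral_eq[OF hb] by simp
  finally show "\<bar>kint l L \<rho> x\<bar> \<le> B * \<omega> x / (exp (- R) / l - \<beta>)" by (simp add: k_def)
qed

lemma
  assumes l: "0 < l"
  shows kernel_integrable: "integrable lborel (\<lambda>y. indicator {..x} y * exp (- (flowmap L x - flowmap L y) / l) * apply_bcontfun \<rho> y)"
    and kint_bound: "\<bar>kint l L \<rho> x\<bar> \<le> norm \<rho> / (exp (- norm L) / l)"
  using kint_weighted[of L "norm L" l 0 "\<lambda>_. 1" x "norm \<rho>" \<rho>] l by (simp_all add: abs_le_norm_bcontfun)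

text \<open>The exponential of a difference factorises, so \<open>kint\<close> is exp(- flowmap / l)
  times an indefinite integral. The product rule and the fundamental theorem then give a linear
  first-order equation, without differentiating under the integral sign.\<close>

lemma kint_deriv:
  assumes l: "0 < l"
  shows "(kint l L \<rho> has_real_derivative apply_bcontfun \<rho> x - exp (apply_bcontfun L x) / l * kint l L \<rho> x) (at x)"
proof -
  define g where "g y = exp (flowmap L y / l) * apply_bcontfun \<rho> y" for y
  define H where "H x = exp (flowmap L x / l) * kint l L \<rho> x" for x
  have contg: "continuous_on S g" for S
    unfolding g_def using l by (intro continuous_intros flowmap_continuous) auto
  have split: "exp (flowmap L x / l) * (indicator {..x} y * exp (- (flowmap L x - flowmap L y) / l) * apply_bcontfun \<rho> y)
      = indicator {..x} y * g y" for x y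
    by (simp add: g_def diff_divide_distrib exp_diff exp_minus field_simps)
  have gint: "integrable lborel (\<lambda>y. indicator {..x} y * g y)" for x
    using integrable_mult_right[OF kernel_integrable[OF l, of x L \<rho>], of "exp (flowmap L x / l)"]
    by (simp only: split)
  have Hint: "H x = (LINT y|lborel. indicator {..x} y * g y)" for x
    unfolding H_def kint_def by (subst integral_mult_right_zero[symmetric]) (simp only: split)
  have HD: "(H has_real_derivative g x) (at x)"
  proof -
    \<comment> \<open>Any base point to the left of x would do; it replaces the integral from minus
      infinity by a constant plus an integral over a compact interval.\<close>
    define a where "a = x - 1"
    have Heq: "H z = H a + integral {a..z} g" if "a \<le> z" for z
    proof -
      have "set_integrable lborel {a..z} g"
        by (rule borel_integrable_atLeastAtMost') (rule contg)
      then have "(LINT y|lborel. indicator {a..z} y * g y) = integral {a..z} g" "integrable lborel (\<lambda>y. indicator {a..z} y * g y)"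
        using set_borel_integral_eq_integral(2)[of "{a..z}" g] by (simp_all add: set_lebesgue_integral_def set_integrable_def)
      moreover have "(LINT y|lborel. indicator {..z} y * g y) = (LINT y|lborel. indicator {..a} y * g y + indicator {a..z} y * g y)"
      proof (rule integral_cong_AE)
        show "AE y in lborel. indicator {..z} y * g y = indicator {..a} y * g y + indicator {a..z} y * g y"
          using AE_lborel_singleton[of a] by eventually_elim (use that in \<open>auto simp: indicator_def\<close>)
        show "(\<lambda>y. indicator {..z} y * g y) \<in> borel_measurable lborel" using gint by auto
        show "(\<lambda>y. indicator {..a} y * g y + indicator {a..z} y * g y) \<in> borel_measurable lborel"
          using gint calculation(2) by (intro borel_measurable_add borel_measurable_integrable) auto
      qed
      ultimately show ?thesis by (simp add: Hint gint)
    qed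
    have "((\<lambda>z. integral {a..z} g) has_real_derivative g x) (at x within {a..x+1})"
      by (rule integral_has_real_derivative[OF contg]) (auto simp: a_def)
    then have "((\<lambda>z. integral {a..z} g) has_real_derivative g x) (at x)"
      using at_within_Icc_at[of a x "x + 1"] by (simp add: a_def)
    then have "((\<lambda>z. H a + integral {a..z} g) has_real_derivative 0 + g x) (at x)"
      by (intro derivative_intros)
    then have 1: "((\<lambda>z. H a + integral {a..z} g) has_real_derivative g x) (at x)" by (simp only: add_0)
    show ?thesis
    proof (rule has_field_derivative_transform_within_open[OF 1, of "{a<..}"])
      show "H a + integral {a..z} g = H z" if "z \<in> {a<..}" for z
        by (rule Heq[symmetric]) (use that in auto)
    qed (auto simp: a_def)
  qed
  have "((\<lambda>x. exp (- flowmap L x / l) * H x) has_real_derivative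
      exp (- flowmap L x / l) * g x + (exp (- flowmap L x / l) * (- exp (apply_bcontfun L x) / l)) * H x) (at x)"
    by (rule DERIV_cong[OF DERIV_mult[OF DERIV_fun_exp HD]])
      (use l in \<open>auto intro!: derivative_eq_intros flowmap_deriv simp: algebra_simps\<close>)
  moreover have "(\<lambda>x. exp (- flowmap L x / l) * H x) = kint l L \<rho>"
    by (rule ext) (simp add: H_def exp_minus)
  moreover have "exp (- flowmap L x / l) * g x + (exp (- flowmap L x / l) * (- exp (apply_bcontfun L x) / l)) * H x
      = apply_bcontfun \<rho> x - exp (apply_bcontfun L x) / l * kint l L \<rho> x"
    by (simp add: g_def H_def exp_minus field_simps)
  ultimately show ?thesis by simp
qed

definition bkint :: "real \<Rightarrow> (real \<Rightarrow>\<^sub>C real) \<Rightarrow> (real \<Rightarrow>\<^sub>C real) \<Rightarrow> (real \<Rightarrow>\<^sub>C real)" where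
  "bkint l L \<rho> = Bcontfun (kint l L \<rho>)"

lemma bkint_apply:
  assumes l: "0 < l" shows "apply_bcontfun (bkint l L \<rho>) = kint l L \<rho>"
proof -
  have "kint l L \<rho> \<in> bcontfun"
  proof (rule bcontfun_normI)
    show "continuous_on UNIV (kint l L \<rho>)"
      using kint_deriv[OF l] by (meson DERIV_isCont continuous_at_imp_continuous_on)
    show "norm (kint l L \<rho> x) \<le> norm \<rho> / (exp (- norm L) / l)" for x
      using kint_bound[OF l] by simp
  qed
  then show ?thesis by (simp add: bkint_def Bcontfun_inverse)
qed

lemma exp_minus_diff_le:
  fixes a b c :: real
  assumes "c \<le> a" "c \<le> b" shows "\<bar>exp (- a) - exp (- b)\<bar> \<le> exp (- c) * \<bar>a - b\<bar>"
proof -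
  have *: "exp (- a) - exp (- b) \<le> exp (- c) * (b - a)" if "c \<le> a" "a \<le> b" for a b :: real
  proof -
    have "exp (- b) = exp (- a) * exp (- (b - a))" by (simp add: exp_add[symmetric])
    also have "\<dots> \<ge> exp (- a) * (1 - (b - a))"
      using exp_ge_add_one_self[of "- (b - a)"] by (intro mult_left_mono) (linarith, simp)
    finally have "exp (- a) - exp (- b) \<le> exp (- a) * (b - a)" by (simp add: algebra_simps)
    also have "\<dots> \<le> exp (- c) * (b - a)" using that by (intro mult_right_mono) auto
    finally show ?thesis .
  qed
  show ?thesis
    using *[of a b] *[of b a] assms by (cases "a \<le> b") auto
qed

text \<open>The exponents for two Jacobians differ by an amount proportional to z = x - y, which is
  unbounded. Half of the decay rate k pays for it: z exp(-k z) is at most (2/k) exp(-k z / 2), and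
  the remaining half keeps the integral finite, namely equal to 2/k.\<close>

lemma lip_on_balls_bkint_pair:
  assumes l: "0 < l" shows "lip_on_balls (\<lambda>p. bkint l (fst p) (snd p))"
proof (rule lip_on_ballsI)
  fix R :: real assume R: "0 \<le> R"
  define k where "k = exp (- R) / l"
  \<comment> \<open>The first summand is the cost of changing the kernel against a density of size
    R, the 1 the cost of changing the density.\<close>
  define C where "C = 2 / k * (exp R / l) * R + 1"
  have k: "0 < k" using l by (simp add: k_def)
  have C: "0 \<le> C" using k l R by (simp add: C_def)
  show "\<exists>C. \<forall>p q. norm p \<le> R \<longrightarrow> norm q \<le> R \<longrightarrow> norm (bkint l (fst p) (snd p) - bkint l (fst q) (snd q)) \<le> C * norm (p - q)"
  proof (intro exI[of _ "C * (2 / k)"] allI impI)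
    fix p q :: "(real \<Rightarrow>\<^sub>C real) \<times> (real \<Rightarrow>\<^sub>C real)" assume p: "norm p \<le> R" and q: "norm q \<le> R"
    obtain L \<rho> L' \<rho>' where pq: "p = (L, \<rho>)" "q = (L', \<rho>')" by (cases p, cases q)
    have L: "norm L \<le> R" "norm L' \<le> R" "norm \<rho> \<le> R" "norm \<rho>' \<le> R"
      using p q norm_fst_le[of L \<rho>] norm_fst_le[of L' \<rho>'] norm_snd_le[of \<rho> L] norm_snd_le[of \<rho>' L'] pq by auto
    define d where "d = norm (p - q)"
    have d: "0 \<le> d" "norm (L - L') \<le> d" "norm (\<rho> - \<rho>') \<le> d"
      using norm_fst_le[of "L - L'" "\<rho> - \<rho>'"] norm_snd_le[of "\<rho> - \<rho>'" "L - L'"] pq by (auto simp: d_def)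
    show "norm (bkint l (fst p) (snd p) - bkint l (fst q) (snd q)) \<le> C * (2 / k) * norm (p - q)"
    proof (rule norm_bound)
      fix x
      let ?K = "\<lambda>L \<rho> y. indicator {..x} y * exp (- (flowmap L x - flowmap L y) / l) * apply_bcontfun \<rho> y"
      have hb: "has_bochner_integral lborel (\<lambda>y. C * d * (indicator {..x} y * exp (- (k / 2 * (x - y))))) (C * d * (1 / (k / 2)))"
        using k by (intro has_bochner_integral_mult_right has_bochner_integral_exp_decay) auto
      have bd: "norm (?K L \<rho> y - ?K L' \<rho>' y) \<le> C * d * (indicator {..x} y * exp (- (k / 2 * (x - y))))" for y
      proof (cases "y \<le> x")
        case True
        define z where "z = x - y"
        have z: "0 \<le> z" using True by (simp add: z_def)
        define D where "D = (flowmap L x - flowmap L y) / l"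
        define D' where "D' = (flowmap L' x - flowmap L' y) / l"
        have DD: "k * z \<le> D" "k * z \<le> D'"
          using divide_right_mono[OF flowmap_diff_ge[OF L(1) True], of l] divide_right_mono[OF flowmap_diff_ge[OF L(2) True], of l] l
          by (auto simp: D_def D'_def k_def z_def)
        have "\<bar>D - D'\<bar> = \<bar>(flowmap L x - flowmap L y) - (flowmap L' x - flowmap L' y)\<bar> / l"
          using l by (simp add: D_def D'_def diff_divide_distrib[symmetric])
        also have "\<dots> \<le> exp R * norm (L - L') * z / l"
          using flowmap_diff_lip[OF L(1,2) True] l by (intro divide_right_mono) (auto simp: z_def)
        also have "\<dots> \<le> exp R * d * z / l"
          using d l z by (intro divide_right_mono mult_right_mono mult_left_mono) auto
        finally have D1: "\<bar>D - D'\<bar> \<le> exp R * d * z / l" .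
        have zz: "z \<le> 2 / k * exp (k / 2 * z)"
          using exp_ge_add_one_self[of "k / 2 * z"] k by (simp add: field_simps)
        have "\<bar>exp (- D) - exp (- D')\<bar> \<le> exp (- (k * z)) * \<bar>D - D'\<bar>" by (rule exp_minus_diff_le[OF DD])
        also have "\<dots> \<le> exp (- (k * z)) * (exp R * d * (2 / k * exp (k / 2 * z)) / l)"
          by (intro mult_left_mono order_trans[OF D1] divide_right_mono zz) (use d(1) l in auto)
        also have "\<dots> = (2 / k * (exp R / l)) * d * (exp (- (k * z)) * exp (k / 2 * z))" by simp
        also have "exp (- (k * z)) * exp (k / 2 * z) = exp (- (k / 2 * z))" by (simp add: exp_add[symmetric])
        finally have E: "\<bar>exp (- D) - exp (- D')\<bar> \<le> (2 / k * (exp R / l)) * d * exp (- (k / 2 * z))" .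
        have "k * z \<ge> k / 2 * z" using k z by (simp add: field_simps)
        then have E': "exp (- D') \<le> exp (- (k / 2 * z))" using DD by simp
        have "norm (?K L \<rho> y - ?K L' \<rho>' y) = \<bar>(exp (- D) - exp (- D')) * apply_bcontfun \<rho> y + exp (- D') * apply_bcontfun (\<rho> - \<rho>') y\<bar>"
          using True by (simp add: D_def D'_def algebra_simps diff_divide_distrib)
        also have "\<dots> \<le> \<bar>exp (- D) - exp (- D')\<bar> * \<bar>apply_bcontfun \<rho> y\<bar> + exp (- D') * \<bar>apply_bcontfun (\<rho> - \<rho>') y\<bar>"
          by (rule order_trans[OF abs_triangle_ineq]) (simp add: abs_mult)
        also have "\<dots> \<le> ((2 / k * (exp R / l)) * d * exp (- (k / 2 * z))) * R + exp (- (k / 2 * z)) * d"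
          using E E' order_trans[OF abs_le_norm_bcontfun L(3)] order_trans[OF abs_le_norm_bcontfun d(3)] k l d(1)
          by (intro add_mono mult_mono) auto
        also have "\<dots> = C * d * exp (- (k / 2 * z))" by (simp add: C_def algebra_simps)
        finally show ?thesis using True by (simp add: z_def)
      qed simp
      have e1: "apply_bcontfun (bkint l (fst p) (snd p) - bkint l (fst q) (snd q)) x = kint l L \<rho> x - kint l L' \<rho>' x"
        unfolding pq fst_conv snd_conv minus_bcontfun.rep_eq bkint_apply[OF l] ..
      have e2: "kint l L \<rho> x - kint l L' \<rho>' x = (LINT y|lborel. ?K L \<rho> y - ?K L' \<rho>' y)"
        unfolding kint_def
        by (rule Bochner_Integration.integral_diff[OF kernel_integrable[OF l] kernel_integrable[OF l], symmetric])
      have e3: "norm (LINT y|lborel. ?K L \<rho> y - ?K L' \<rho>' y) \<le> (LINT y|lborel. C * d * (indicator {..x} y * exp (- (k / 2 * (x - y)))))"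
        by (rule Bochner_Integration.integral_norm_bound_integral[OF _ _ bd])
          (rule Bochner_Integration.integrable_diff kernel_integrable[OF l] integrable.intros[OF hb])+
      have e4: "(LINT y|lborel. C * d * (indicator {..x} y * exp (- (k / 2 * (x - y))))) = C * d * (1 / (k / 2))"
        by (fact has_bochner_integral_integral_eq[OF hb])
      show "norm (apply_bcontfun (bkint l (fst p) (snd p) - bkint l (fst q) (snd q)) x) \<le> C * (2 / k) * norm (p - q)"
        using e3 unfolding e1 e2 e4 unfolding d_def by (simp add: ac_simps)
    qed
  qed
qed

lemma lip_on_balls_bkint:
  assumes "0 < l" "lip_on_balls F" "lip_on_balls G" shows "lip_on_balls (\<lambda>x. bkint l (F x) (G x))"
  using lip_on_balls_compose[OF lip_on_balls_bkint_pair[OF assms(1)] lip_on_balls_Pair[OF assms(2,3)]] by simp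

definition dchi :: "real \<Rightarrow> real \<Rightarrow> real" where
  "dchi \<epsilon> q = (if q \<le> - 1 / \<epsilon> then 2 * (q + 1 / \<epsilon>) else 0)"

lemma chi_alt: "chi \<epsilon> q = (min (q + 1 / \<epsilon>) 0)\<^sup>2"
  by (auto simp: chi_def min_def)

lemma dchi_alt: "dchi \<epsilon> q = 2 * min (q + 1 / \<epsilon>) 0"
  by (auto simp: dchi_def min_def)

lemma continuous_on_dchi: "continuous_on S (dchi \<epsilon>)"
  unfolding dchi_alt by (intro continuous_intros)

text \<open>Only the threshold needs an argument: \<open>chi\<close> vanishes there and is quadratic
  on one side, so the difference quotient is at most \<open>\<bar>h\<bar>\<close>.\<close>

lemma chi_deriv: "(chi \<epsilon> has_real_derivative dchi \<epsilon> q) (at q)"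
proof -
  consider "q < - 1 / \<epsilon>" | "q > - 1 / \<epsilon>" | "q = - 1 / \<epsilon>" by linarith
  then show ?thesis
  proof cases
    case 1
    have "((\<lambda>q. (q + 1 / \<epsilon>)\<^sup>2) has_real_derivative dchi \<epsilon> q) (at q)"
      using 1 by (auto intro!: derivative_eq_intros simp: dchi_def)
    then show ?thesis
      by (rule has_field_derivative_transform_within_open[of _ _ _ "{..< - 1 / \<epsilon>}"]) (use 1 in \<open>auto simp: chi_def\<close>)
  next
    case 2
    have "((\<lambda>q. 0) has_real_derivative dchi \<epsilon> q) (at q)" using 2 by (auto simp: dchi_def)
    then show ?thesis
      by (rule has_field_derivative_transform_within_open[of _ _ _ "{- 1 / \<epsilon> <..}"]) (use 2 in \<open>auto simp: chi_def\<close>)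
  next
    case 3
    have "((\<lambda>h. (chi \<epsilon> (q + h) - chi \<epsilon> q) / h) \<longlongrightarrow> 0) (at 0)"
    proof (rule Lim_null_comparison)
      show "\<forall>\<^sub>F h in at 0. norm ((chi \<epsilon> (q + h) - chi \<epsilon> q) / h) \<le> \<bar>h\<bar>"
        using 3 by (intro always_eventually) (auto simp: chi_def power2_eq_square)
      show "((\<lambda>h::real. \<bar>h\<bar>) \<longlongrightarrow> 0) (at 0)" by (rule tendsto_eq_intros refl | simp)+
    qed
    then show ?thesis using 3 by (simp add: DERIV_def dchi_def)
  qed
qed

lemma chi_nonneg: "0 \<le> chi \<epsilon> q"
  by (simp add: chi_alt)

lemma chi_le_square: "0 < \<epsilon> \<Longrightarrow> chi \<epsilon> q \<le> q\<^sup>2"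
proof -
  assume "0 < \<epsilon>"
  then have "\<bar>min (q + 1 / \<epsilon>) 0\<bar> \<le> \<bar>q\<bar>"
    using divide_pos_pos[of 1 \<epsilon>] by linarith
  then show ?thesis unfolding chi_alt by (rule abs_le_square_iff[THEN iffD1])
qed

text \<open>Says that log \<omega> is Lipschitz with constant \<beta>, written multiplicatively so
  that no logarithm of zero occurs.\<close>

definition slow :: "real \<Rightarrow> (real \<Rightarrow> real) \<Rightarrow> bool" where
  "slow \<beta> \<omega> \<longleftrightarrow> 0 \<le> \<beta> \<and> (\<forall>x. 0 \<le> \<omega> x) \<and> (\<forall>x y. \<omega> y \<le> exp (\<beta> * \<bar>x - y\<bar>) * \<omega> x)"

text \<open>Raises a weight to one that is bounded below by \<delta>, so that quotients by the
  weight have a finite supremum; \<delta> is sent to zero afterwards.\<close>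

lemma slow_add_const:
  assumes "slow \<beta> \<omega>" "0 \<le> \<delta>" shows "slow \<beta> (\<lambda>x. \<omega> x + \<delta>)"
  using assms unfolding slow_def
  by (auto simp: distrib_left intro!: add_mono mult_le_cancel_right1[THEN iffD2])

text \<open>Continuity in time is uniform in space, because it is continuity in the supremum norm;
  together with continuity in space at the limit time this gives joint continuity.\<close>

lemma continuous_on_bcontfun_curve:
  fixes X :: "real \<Rightarrow> (real \<Rightarrow>\<^sub>C real)"
  assumes "continuous_on S X"
  shows "continuous_on (S \<times> UNIV) (\<lambda>p. apply_bcontfun (X (fst p)) (snd p))"
  unfolding continuous_on_def
proof
  fix p assume p: "p \<in> S \<times> (UNIV :: real set)"
  let ?F = "at p within S \<times> UNIV"
  have 1: "((\<lambda>q. apply_bcontfun (X (fst p)) (snd q)) \<longlongrightarrow> apply_bcontfun (X (fst p)) (snd p)) ?F"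
    by (rule isCont_tendsto_compose[OF _ tendsto_snd[OF tendsto_ident_at]])
      (use continuous_on_eq_continuous_at[of UNIV "apply_bcontfun (X (fst p))"] in simp)
  have "continuous_on (S \<times> UNIV) (\<lambda>q. X (fst q))"
    by (rule continuous_on_compose2[OF assms]) (auto intro!: continuous_intros)
  then have "((\<lambda>q. X (fst q)) \<longlongrightarrow> X (fst p)) ?F" using p unfolding continuous_on_def by (rule bspec)
  then have "((\<lambda>q. dist (X (fst q)) (X (fst p))) \<longlongrightarrow> 0) ?F" by (rule tendsto_dist_iff[THEN iffD1])
  then have "((\<lambda>q. apply_bcontfun (X (fst q)) (snd q) - apply_bcontfun (X (fst p)) (snd q)) \<longlongrightarrow> 0) ?F"
  proof (rule Lim_null_comparison[rotated], intro always_eventually allI)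
    show "norm (apply_bcontfun (X (fst q)) (snd q) - apply_bcontfun (X (fst p)) (snd q)) \<le> dist (X (fst q)) (X (fst p))" for q
      using dist_bounded[of "X (fst q)" "snd q" "X (fst p)"] by (simp add: dist_real_def)
  qed
  from tendsto_add[OF this 1] show "((\<lambda>q. apply_bcontfun (X (fst q)) (snd q)) \<longlongrightarrow> apply_bcontfun (X (fst p)) (snd p)) ?F"
    by simp
qed

lemma bounded_linear_apply_bcontfun: "bounded_linear (\<lambda>u :: real \<Rightarrow>\<^sub>C real. apply_bcontfun u x)"
  by (rule bounded_linear_intro[of _ 1]) (auto simp: abs_le_norm_bcontfun)

text \<open>The same halving as in \<open>gronwall\<close>, for a scalar function: integrating K D
  exp(2 K s) gives at most half of D exp(2 K t).\<close>

lemma deriv_exp_bound: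
  fixes y :: "real \<Rightarrow> real"
  assumes d: "\<And>s. s \<in> {0..T} \<Longrightarrow> (y has_real_derivative y' s) (at s within {0..T})"
    and b: "\<And>s. s \<in> {0..T} \<Longrightarrow> \<bar>y' s\<bar> \<le> K * D * exp (2 * K * s)" and D: "0 \<le> D" and t: "t \<in> {0..T}"
  shows "\<bar>y t - y 0\<bar> \<le> D * exp (2 * K * t) / 2"
proof (cases "t = 0")
  case False
  then have pos: "0 < t" using t by auto
  have cont: "continuous_on {0..T} y" using d by (meson DERIV_continuous continuous_on_eq_continuous_within)
  have "norm (y t - y 0) \<le> D * exp (2 * K * t) / 2 - D * exp (2 * K * 0) / 2"
  proof (rule differentiable_bound_general[OF pos])
    show "continuous_on {0..t} y" using cont t by (auto intro: continuous_on_subset)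
    show "continuous_on {0..t} (\<lambda>t. D * exp (2 * K * t) / 2)" by (intro continuous_intros) auto
    fix s assume s: "0 < s" "s < t"
    then have "s \<in> {0..T}" "at s within {0..T} = at s" using t at_within_Icc_at[of 0 s T] by auto
    then show "(y has_vector_derivative y' s) (at s)" using d[of s] by (simp add: has_real_derivative_iff_has_vector_derivative)
    show "((\<lambda>t. D * exp (2 * K * t) / 2) has_vector_derivative K * D * exp (2 * K * s)) (at s)"
      unfolding has_real_derivative_iff_has_vector_derivative[symmetric] by (auto intro!: derivative_eq_intros)
    show "norm (y' s) \<le> K * D * exp (2 * K * s)" using b \<open>s \<in> {0..T}\<close> by simp
  qed
  then show ?thesis using D by simp
qed (use D in simp)

subsection \<open>The equation in Lagrangian coordinates\<close>

text \<open>The derivatives of f are explicit parameters, so that chain rules can be applied without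
  going through iterated \<open>deriv\<close>.\<close>

locale reg_law =
  fixes f f1 f2 f3 f4 :: "real \<Rightarrow> real" and c l \<epsilon> :: real
  assumes f_d: "\<And>x. (f has_real_derivative f1 x) (at x)"
    and f1_d: "\<And>x. (f1 has_real_derivative f2 x) (at x)"
    and f2_d: "\<And>x. (f2 has_real_derivative f3 x) (at x)"
    and f3_d: "\<And>x. (f3 has_real_derivative f4 x) (at x)"
    and f4_cont: "continuous_on UNIV f4"
    and f2_ge: "\<And>x. c \<le> f2 x" and c_pos: "0 < c" and l_pos: "0 < l" and \<epsilon>_pos: "0 < \<epsilon>"
begin

lemma f_cont: "continuous_on S f" "continuous_on S f1" "continuous_on S f2" "continuous_on S f3"
  using f_d f1_d f2_d f3_d by (meson DERIV_isCont continuous_at_imp_continuous_on)+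

lemma f2_pos: "0 < f2 x"
  using f2_ge[of x] c_pos by linarith

text \<open>\<open>\<kappa>\<close> is the source of the nonlocal term and \<open>\<psi>\<close> the
  nonlinearity of the slope equation. They are tied by \<psi>(q) + \<kappa>(q) = 2 q^2. Below the
  threshold \<psi>(q) = - 2 q / \<epsilon> - 1 / \<epsilon>^2 is affine, which is what the cut-off
  is for.\<close>

definition \<psi> where "\<psi> q = q\<^sup>2 - chi \<epsilon> q"
definition \<kappa> where "\<kappa> q = q\<^sup>2 + chi \<epsilon> q"
definition d\<psi> where "d\<psi> q = 2 * q - dchi \<epsilon> q"

lemma \<psi>_deriv: "(\<psi> has_real_derivative d\<psi> q) (at q)"
  unfolding \<psi>_def[abs_def] d\<psi>_def by (auto intro!: derivative_eq_intros chi_deriv)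

lemma \<kappa>_deriv: "(\<kappa> has_real_derivative 2 * q + dchi \<epsilon> q) (at q)"
  unfolding \<kappa>_def[abs_def] by (auto intro!: derivative_eq_intros chi_deriv)

lemma \<psi>_bounds: "0 \<le> \<psi> q" "\<psi> q \<le> q\<^sup>2" and \<kappa>_bounds: "0 \<le> \<kappa> q" "\<kappa> q \<le> 2 * q\<^sup>2"
  using chi_nonneg[of \<epsilon> q] chi_le_square[OF \<epsilon>_pos, of q] by (auto simp: \<psi>_def \<kappa>_def)

lemma continuous_on_d\<psi>: "continuous_on S d\<psi>"
  unfolding d\<psi>_def[abs_def] by (intro continuous_intros continuous_on_dchi)

lemma lip_f2: "lip_on_balls f2" and lip_\<psi>: "lip_on_balls \<psi>" and lip_\<kappa>: "lip_on_balls \<kappa>" and lip_exp: "lip_on_balls (exp :: real \<Rightarrow> real)"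
  by (rule lip_on_balls_C1[OF f2_d] lip_on_balls_C1[OF \<psi>_deriv] lip_on_balls_C1[OF \<kappa>_deriv] lip_on_balls_C1[OF DERIV_exp];
      intro continuous_intros f_cont continuous_on_d\<psi> continuous_on_dchi)+

lemmas nem_f2 = nem_apply[OF lip_on_balls_imp_continuous[OF lip_f2]]
lemmas nem_\<psi> = nem_apply[OF lip_on_balls_imp_continuous[OF lip_\<psi>]]
lemmas nem_\<kappa> = nem_apply[OF lip_on_balls_imp_continuous[OF lip_\<kappa>]]
lemmas nem_exp = nem_apply[OF lip_on_balls_imp_continuous[OF lip_exp]]

text \<open>The state is (U, Q, L): velocity, slope and logarithm of the Jacobian at the label x.
  The Jacobian of the change of variables is part of rho, and Ileft, Iright are the two halves of the
  convolution with the exponential kernel.\<close>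

definition rho :: "(real \<Rightarrow>\<^sub>C real) \<times> (real \<Rightarrow>\<^sub>C real) \<times> (real \<Rightarrow>\<^sub>C real) \<Rightarrow> (real \<Rightarrow>\<^sub>C real)" where
  "rho z = bmul (nem f2 (fst z)) (bmul (nem \<kappa> (fst (snd z))) (nem exp (snd (snd z))))"

definition Ileft where "Ileft z = bkint l (snd (snd z)) (rho z)"
definition Iright where "Iright z = brefl (bkint l (brefl (snd (snd z))) (brefl (rho z)))"
text \<open>The factor is 1/2 from the definition of P times 1/(2 l) from the kernel. In
  \<open>Pxop\<close> the derivative of exp(-|x|/l) adds 1/l and opposite signs for the two
  halves.\<close>

definition Pop where "Pop z = (1 / (4 * l)) *\<^sub>R (Ileft z + Iright z)"
definition Pxop where "Pxop z = (1 / (4 * l\<^sup>2)) *\<^sub>R (Iright z - Ileft z)"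

text \<open>Along dy/dt = f'(u): the velocity changes by -l^2 P_x, the slope by - f''(u) \<psi>(q) /
  2 - P, and the logarithm of the Jacobian by f''(u) q. No spatial derivative of the state occurs,
  hence no derivative is lost.\<close>

definition vf :: "(real \<Rightarrow>\<^sub>C real) \<times> (real \<Rightarrow>\<^sub>C real) \<times> (real \<Rightarrow>\<^sub>C real) \<Rightarrow> (real \<Rightarrow>\<^sub>C real) \<times> (real \<Rightarrow>\<^sub>C real) \<times> (real \<Rightarrow>\<^sub>C real)" where
  "vf z = ((- l\<^sup>2) *\<^sub>R Pxop z,
     (- 1 / 2) *\<^sub>R bmul (nem f2 (fst z)) (nem \<psi> (fst (snd z))) - Pop z,
     bmul (nem f2 (fst z)) (fst (snd z)))"

lemma lip_proj:
  "lip_on_balls (\<lambda>z :: (real \<Rightarrow>\<^sub>C real) \<times> (real \<Rightarrow>\<^sub>C real) \<times> (real \<Rightarrow>\<^sub>C real). fst z)"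
  "lip_on_balls (\<lambda>z :: (real \<Rightarrow>\<^sub>C real) \<times> (real \<Rightarrow>\<^sub>C real) \<times> (real \<Rightarrow>\<^sub>C real). fst (snd z))"
  "lip_on_balls (\<lambda>z :: (real \<Rightarrow>\<^sub>C real) \<times> (real \<Rightarrow>\<^sub>C real) \<times> (real \<Rightarrow>\<^sub>C real). snd (snd z))"
  by (intro lip_on_balls_bounded_linear bounded_linear_intros)+

lemma lip_rho: "lip_on_balls rho"
  unfolding rho_def[abs_def] by (intro lip_on_balls_bmul lip_on_balls_nem lip_f2 lip_\<kappa> lip_exp lip_proj)

lemma lip_Ileft: "lip_on_balls Ileft" and lip_Iright: "lip_on_balls Iright"
  unfolding Ileft_def[abs_def] Iright_def[abs_def]
  by (intro lip_on_balls_bkint lip_on_balls_brefl lip_rho lip_proj l_pos)+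

lemma lip_Pop: "lip_on_balls Pop" and lip_Pxop: "lip_on_balls Pxop"
  unfolding Pop_def[abs_def] Pxop_def[abs_def]
  by (intro lip_on_balls_scaleR lip_on_balls_add lip_on_balls_diff lip_Ileft lip_Iright)+

lemma lip_vf: "lip_on_balls vf"
  unfolding vf_def[abs_def]
  by (intro lip_on_balls_Pair lip_on_balls_scaleR lip_on_balls_diff lip_on_balls_bmul lip_on_balls_nem
      lip_f2 lip_\<psi> lip_Pop lip_Pxop lip_proj)

lemma rho_apply: "apply_bcontfun (rho z) x = f2 (apply_bcontfun (fst z) x) * (\<kappa> (apply_bcontfun (fst (snd z)) x) * exp (apply_bcontfun (snd (snd z)) x))"
  by (simp add: rho_def nem_f2 nem_\<kappa> nem_exp)

lemma Ileft_apply: "apply_bcontfun (Ileft z) x = kint l (snd (snd z)) (rho z) x"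
  and Iright_apply: "apply_bcontfun (Iright z) x = kint l (brefl (snd (snd z))) (brefl (rho z)) (- x)"
  by (simp_all add: Ileft_def Iright_def bkint_apply[OF l_pos])

lemma Pop_apply: "apply_bcontfun (Pop z) x = (apply_bcontfun (Ileft z) x + apply_bcontfun (Iright z) x) / (4 * l)"
  and Pxop_apply: "apply_bcontfun (Pxop z) x = (apply_bcontfun (Iright z) x - apply_bcontfun (Ileft z) x) / (4 * l\<^sup>2)"
  by (simp_all add: Pop_def Pxop_def)

lemma Ileft_deriv: "(apply_bcontfun (Ileft z) has_real_derivative apply_bcontfun (rho z) x - exp (apply_bcontfun (snd (snd z)) x) / l * apply_bcontfun (Ileft z) x) (at x)"
  unfolding Ileft_apply using kint_deriv[OF l_pos] by (simp add: Ileft_def bkint_apply[OF l_pos])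

lemma Iright_deriv: "(apply_bcontfun (Iright z) has_real_derivative exp (apply_bcontfun (snd (snd z)) x) / l * apply_bcontfun (Iright z) x - apply_bcontfun (rho z) x) (at x)"
proof -
  have "((\<lambda>x. kint l (brefl (snd (snd z))) (brefl (rho z)) (- x)) has_real_derivative
     (apply_bcontfun (brefl (rho z)) (- x) - exp (apply_bcontfun (brefl (snd (snd z))) (- x)) / l * kint l (brefl (snd (snd z))) (brefl (rho z)) (- x)) * (- 1)) (at x)"
    by (rule DERIV_chain2[OF kint_deriv[OF l_pos]]) (auto intro!: derivative_eq_intros)
  moreover have "apply_bcontfun (Iright z) = (\<lambda>x. kint l (brefl (snd (snd z))) (brefl (rho z)) (- x))"
    by (auto simp: Iright_apply)
  ultimately show ?thesis by simp
qed

lemma Pop_deriv: "(apply_bcontfun (Pop z) has_real_derivative apply_bcontfun (Pxop z) x * exp (apply_bcontfun (snd (snd z)) x)) (at x)"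
proof -
  have "((\<lambda>x. (apply_bcontfun (Ileft z) x + apply_bcontfun (Iright z) x) / (4 * l)) has_real_derivative
     ((apply_bcontfun (rho z) x - exp (apply_bcontfun (snd (snd z)) x) / l * apply_bcontfun (Ileft z) x) +
      (exp (apply_bcontfun (snd (snd z)) x) / l * apply_bcontfun (Iright z) x - apply_bcontfun (rho z) x)) / (4 * l)) (at x)"
    by (intro DERIV_cdivide DERIV_add Ileft_deriv Iright_deriv)
  moreover have "apply_bcontfun (Pop z) = (\<lambda>x. (apply_bcontfun (Ileft z) x + apply_bcontfun (Iright z) x) / (4 * l))"
    by (auto simp: Pop_apply)
  moreover have "((apply_bcontfun (rho z) x - exp (apply_bcontfun (snd (snd z)) x) / l * apply_bcontfun (Ileft z) x) +
      (exp (apply_bcontfun (snd (snd z)) x) / l * apply_bcontfun (Iright z) x - apply_bcontfun (rho z) x)) / (4 * l)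
     = apply_bcontfun (Pxop z) x * exp (apply_bcontfun (snd (snd z)) x)"
    using l_pos by (simp add: Pxop_apply power2_eq_square field_simps)
  ultimately show ?thesis by simp
qed

text \<open>The densities, which cancel in the derivative of the sum \<open>Pop\<close>, add up in
  that of the difference. This is P - l^2 P_xx = f''(u) \<kappa>(q) / 2 in labels, with the Jacobian
  of \<open>rho\<close> factored out.\<close>

lemma Pxop_deriv: "(apply_bcontfun (Pxop z) has_real_derivative
   (apply_bcontfun (Pop z) x - f2 (apply_bcontfun (fst z) x) * \<kappa> (apply_bcontfun (fst (snd z)) x) / 2) / l\<^sup>2 * exp (apply_bcontfun (snd (snd z)) x)) (at x)"
proof -
  have "((\<lambda>x. (apply_bcontfun (Iright z) x - apply_bcontfun (Ileft z) x) / (4 * l\<^sup>2)) has_real_derivative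
      ((exp (apply_bcontfun (snd (snd z)) x) / l * apply_bcontfun (Iright z) x - apply_bcontfun (rho z) x) -
      (apply_bcontfun (rho z) x - exp (apply_bcontfun (snd (snd z)) x) / l * apply_bcontfun (Ileft z) x)) / (4 * l\<^sup>2)) (at x)"
    by (intro DERIV_cdivide DERIV_diff Ileft_deriv Iright_deriv)
  moreover have "apply_bcontfun (Pxop z) = (\<lambda>x. (apply_bcontfun (Iright z) x - apply_bcontfun (Ileft z) x) / (4 * l\<^sup>2))"
    by (auto simp: Pxop_apply)
  moreover have "((exp (apply_bcontfun (snd (snd z)) x) / l * apply_bcontfun (Iright z) x - apply_bcontfun (rho z) x) -
      (apply_bcontfun (rho z) x - exp (apply_bcontfun (snd (snd z)) x) / l * apply_bcontfun (Ileft z) x)) / (4 * l\<^sup>2)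
    = (apply_bcontfun (Pop z) x - f2 (apply_bcontfun (fst z) x) * \<kappa> (apply_bcontfun (fst (snd z)) x) / 2) / l\<^sup>2 * exp (apply_bcontfun (snd (snd z)) x)"
    using l_pos by (simp add: Pop_apply rho_apply power2_eq_square field_simps)
  ultimately show ?thesis by simp
qed

lemma rho_nonneg: "0 \<le> apply_bcontfun (rho z) x"
  using f2_pos[of "apply_bcontfun (fst z) x"] \<kappa>_bounds by (simp add: rho_apply)

lemma kint_nonneg: "(\<And>y. 0 \<le> apply_bcontfun \<rho> y) \<Longrightarrow> 0 \<le> kint l L \<rho> x"
  unfolding kint_def by (intro Bochner_Integration.integral_nonneg mult_nonneg_nonneg) auto

lemma Ileft_nonneg: "0 \<le> apply_bcontfun (Ileft z) x" and Iright_nonneg: "0 \<le> apply_bcontfun (Iright z) x"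
  by (auto simp: Ileft_apply Iright_apply intro!: kint_nonneg rho_nonneg)

lemma Pop_nonneg: "0 \<le> apply_bcontfun (Pop z) x"
  using l_pos by (simp add: Pop_apply Ileft_nonneg Iright_nonneg)

text \<open>Both halves are nonnegative, so their difference is bounded by their sum; the constants
  differ by the factor 1/l.\<close>

lemma Pxop_le_Pop: "\<bar>apply_bcontfun (Pxop z) x\<bar> \<le> apply_bcontfun (Pop z) x / l"
  using Ileft_nonneg[of z x] Iright_nonneg[of z x] l_pos
  by (simp add: Pop_apply Pxop_apply power2_eq_square field_simps)

lemma norm_brefl_le: "norm (brefl u) \<le> norm u"
  by (rule norm_bound) (simp add: abs_le_norm_bcontfun)

text \<open>Each half contributes at most B \<omega> / (exp(-R)/l - \<beta>); for the right half the
  weight is reflected together with the density, which preserves slow variation.\<close>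

lemma Pop_weighted:
  assumes L: "norm (snd (snd z)) \<le> R" and s: "slow \<beta> \<omega>" and \<beta>: "\<beta> < exp (- R) / l"
    and B: "0 \<le> B" and r: "\<And>y. apply_bcontfun (rho z) y \<le> B * \<omega> y"
  shows "apply_bcontfun (Pop z) x \<le> B * \<omega> x / (2 * l * (exp (- R) / l - \<beta>))"
proof -
  define k where "k = exp (- R) / l - \<beta>"
  have k: "0 < k" using \<beta> by (simp add: k_def)
  have r': "\<bar>apply_bcontfun (rho z) y\<bar> \<le> B * \<omega> y" for y using r[of y] rho_nonneg[of z y] by simp
  have 1: "apply_bcontfun (Ileft z) x \<le> B * \<omega> x / k"
    using kint_weighted(2)[OF L l_pos _ \<beta> _ B r', of x] s unfolding slow_def k_def Ileft_apply by auto
  have w': "\<omega> (- y) \<le> exp (\<beta> * \<bar>- x - y\<bar>) * \<omega> (- (- x))" for y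
  proof -
    have "\<bar>x - - y\<bar> = \<bar>- x - y\<bar>" by linarith
    moreover have "\<omega> (- y) \<le> exp (\<beta> * \<bar>x - - y\<bar>) * \<omega> x" using s unfolding slow_def by blast
    ultimately show ?thesis by simp
  qed
  have 2: "apply_bcontfun (Iright z) x \<le> B * \<omega> x / k"
    using kint_weighted(2)[OF order_trans[OF norm_brefl_le L] l_pos _ \<beta> _ B, of "\<lambda>y. \<omega> (- y)" "- x" "brefl (rho z)"] w' r' s
    unfolding slow_def k_def Iright_apply by auto
  have "apply_bcontfun (Pop z) x \<le> (B * \<omega> x / k + B * \<omega> x / k) / (4 * l)"
    unfolding Pop_apply using 1 2 l_pos by (intro divide_right_mono) auto
  also have "\<dots> = B * \<omega> x / (2 * l * k)" using l_pos k by (simp add: field_simps)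
  finally show ?thesis by (simp add: k_def)
qed

end

text \<open>A solution on a bounded time interval whose initial slope is the derivative of its
  initial velocity. The interval is a parameter because the a priori bounds must be proved before
  any global solution is known.\<close>

locale lagrangian = reg_law +
  fixes T :: real and X :: "real \<Rightarrow> (real \<Rightarrow>\<^sub>C real) \<times> (real \<Rightarrow>\<^sub>C real) \<times> (real \<Rightarrow>\<^sub>C real)"
    and U0 Q0 :: "real \<Rightarrow>\<^sub>C real"
  assumes T: "0 \<le> T" and X0: "X 0 = (U0, Q0, 0)" and sol: "ode_sol vf {0..T} X"
    and U0_deriv: "\<And>x. (apply_bcontfun U0 has_real_derivative apply_bcontfun Q0 x) (at x)"
begin

definition U where "U t x = apply_bcontfun (fst (X t)) x"
definition Q where "Q t x = apply_bcontfun (fst (snd (X t))) x"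
definition J where "J t x = exp (apply_bcontfun (snd (snd (X t))) x)"
definition P where "P t x = apply_bcontfun (Pop (X t)) x"
definition Px where "Px t x = apply_bcontfun (Pxop (X t)) x"

lemma init: "U 0 x = apply_bcontfun U0 x" "Q 0 x = apply_bcontfun Q0 x" "J 0 x = 1"
  by (simp_all add: U_def Q_def J_def X0)

lemma J_pos: "0 < J t x"
  by (simp add: J_def)

lemma X_cont: "continuous_on {0..T} X"
  by (rule ode_sol_continuous[OF sol])

lemma U_cont: "continuous_on ({0..T} \<times> UNIV) (\<lambda>p. U (fst p) (snd p))"
  unfolding U_def by (intro continuous_on_bcontfun_curve continuous_intros X_cont)

lemma Q_cont: "continuous_on ({0..T} \<times> UNIV) (\<lambda>p. Q (fst p) (snd p))"
  unfolding Q_def by (intro continuous_on_bcontfun_curve continuous_intros X_cont)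

lemma J_cont: "continuous_on ({0..T} \<times> UNIV) (\<lambda>p. J (fst p) (snd p))"
  unfolding J_def by (intro continuous_on_exp continuous_on_bcontfun_curve continuous_intros X_cont)

lemma P_cont: "continuous_on ({0..T} \<times> UNIV) (\<lambda>p. P (fst p) (snd p))"
  unfolding P_def
  by (intro continuous_on_bcontfun_curve continuous_on_compose2[OF lip_on_balls_imp_continuous[OF lip_Pop, of UNIV] X_cont]) auto

lemma Px_cont: "continuous_on ({0..T} \<times> UNIV) (\<lambda>p. Px (fst p) (snd p))"
  unfolding Px_def
  by (intro continuous_on_bcontfun_curve continuous_on_compose2[OF lip_on_balls_imp_continuous[OF lip_Pxop, of UNIV] X_cont]) auto

lemma comp_deriv:
  assumes t: "t \<in> {0..T}"
  shows "((\<lambda>s. apply_bcontfun (fst (X s)) x) has_real_derivative apply_bcontfun (fst (vf (X t))) x) (at t within {0..T})"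
    "((\<lambda>s. apply_bcontfun (fst (snd (X s))) x) has_real_derivative apply_bcontfun (fst (snd (vf (X t)))) x) (at t within {0..T})"
    "((\<lambda>s. apply_bcontfun (snd (snd (X s))) x) has_real_derivative apply_bcontfun (snd (snd (vf (X t)))) x) (at t within {0..T})"
proof -
  have d: "(X has_vector_derivative vf (X t)) (at t within {0..T})" using sol t by (simp add: ode_sol_def)
  show "((\<lambda>s. apply_bcontfun (fst (X s)) x) has_real_derivative apply_bcontfun (fst (vf (X t))) x) (at t within {0..T})"
    unfolding has_real_derivative_iff_has_vector_derivative
    by (rule bounded_linear.has_vector_derivative[OF bounded_linear_compose[OF bounded_linear_apply_bcontfun bounded_linear_fst] d])
  show "((\<lambda>s. apply_bcontfun (fst (snd (X s))) x) has_real_derivative apply_bcontfun (fst (snd (vf (X t)))) x) (at t within {0..T})"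
    unfolding has_real_derivative_iff_has_vector_derivative
    by (rule bounded_linear.has_vector_derivative[OF bounded_linear_compose[OF bounded_linear_apply_bcontfun bounded_linear_compose[OF bounded_linear_fst bounded_linear_snd]] d])
  show "((\<lambda>s. apply_bcontfun (snd (snd (X s))) x) has_real_derivative apply_bcontfun (snd (snd (vf (X t)))) x) (at t within {0..T})"
    unfolding has_real_derivative_iff_has_vector_derivative
    by (rule bounded_linear.has_vector_derivative[OF bounded_linear_compose[OF bounded_linear_apply_bcontfun bounded_linear_compose[OF bounded_linear_snd bounded_linear_snd]] d])
qed

lemma U_t: "t \<in> {0..T} \<Longrightarrow> ((\<lambda>s. U s x) has_real_derivative - l\<^sup>2 * Px t x) (at t within {0..T})"
  using comp_deriv(1)[of t x] by (simp add: U_def Px_def vf_def)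

lemma Q_t: "t \<in> {0..T} \<Longrightarrow> ((\<lambda>s. Q s x) has_real_derivative - 1 / 2 * f2 (U t x) * \<psi> (Q t x) - P t x) (at t within {0..T})"
  using comp_deriv(2)[of t x] by (simp add: U_def Q_def P_def vf_def nem_f2 nem_\<psi>)

lemma J_t: "t \<in> {0..T} \<Longrightarrow> ((\<lambda>s. J s x) has_real_derivative f2 (U t x) * Q t x * J t x) (at t within {0..T})"
proof -
  assume t: "t \<in> {0..T}"
  have "((\<lambda>s. exp (apply_bcontfun (snd (snd (X s))) x)) has_real_derivative
      exp (apply_bcontfun (snd (snd (X t))) x) * apply_bcontfun (snd (snd (vf (X t)))) x) (at t within {0..T})"
    by (rule DERIV_chain2[OF DERIV_exp comp_deriv(3)[OF t]])
  then show ?thesis by (simp add: J_def U_def Q_def vf_def nem_f2 mult.commute)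
qed

lemma P_x: "(P t has_real_derivative Px t x * J t x) (at x)"
  using Pop_deriv[of "X t" x] by (simp add: P_def[abs_def] Px_def J_def)

lemma Px_x: "(Px t has_real_derivative (P t x - f2 (U t x) * \<kappa> (Q t x) / 2) / l\<^sup>2 * J t x) (at x)"
  using Pxop_deriv[of "X t" x] by (simp add: P_def Px_def[abs_def] J_def U_def Q_def)

lemma P_nonneg: "0 \<le> P t x" and Px_le: "\<bar>Px t x\<bar> \<le> P t x / l"
  by (simp_all add: P_def Px_def Pop_nonneg Pxop_le_Pop)

lemma cont_f2U: "continuous_on ({0..T} \<times> UNIV) (\<lambda>p. f2 (U (fst p) (snd p)))"
  by (rule continuous_on_compose2[OF f_cont(3) U_cont]) auto

lemma cont_\<kappa>Q: "continuous_on ({0..T} \<times> UNIV) (\<lambda>p. \<kappa> (Q (fst p) (snd p)))"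
  by (rule continuous_on_compose2[OF lip_on_balls_imp_continuous[OF lip_\<kappa>, of UNIV] Q_cont]) auto

lemma cont_\<psi>Q: "continuous_on ({0..T} \<times> UNIV) (\<lambda>p. \<psi> (Q (fst p) (snd p)))"
  by (rule continuous_on_compose2[OF lip_on_balls_imp_continuous[OF lip_\<psi>, of UNIV] Q_cont]) auto

lemma cont_slice_t:
  assumes "continuous_on ({0..T} \<times> UNIV) (\<lambda>p. F (fst p) (snd p))" "S \<subseteq> {0..T}"
  shows "continuous_on S (\<lambda>s. F s x)"
  by (rule continuous_on_compose2[OF assms(1), of S "\<lambda>s. (s, x)", simplified]) (use assms(2) in \<open>auto intro!: continuous_intros\<close>)

lemma cont_slice_x:
  assumes "continuous_on ({0..T} \<times> UNIV) (\<lambda>p. F (fst p) (snd p))" "t \<in> {0..T}"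
  shows "continuous_on S (F t)"
  by (rule continuous_on_compose2[OF assms(1), of S "\<lambda>s. (t, s)", simplified]) (use assms(2) in \<open>auto intro!: continuous_intros\<close>)

lemma swap_cont:
  assumes "continuous_on ({0..T} \<times> UNIV) (\<lambda>p. F (fst p) (snd p))" "S \<subseteq> {0..T}"
  shows "continuous_on (A \<times> S) (\<lambda>(x, s). F s x)"
proof -
  have "continuous_on (A \<times> S) (\<lambda>p. (snd p, fst p))" by (intro continuous_intros)
  moreover have "(\<lambda>p. (snd p, fst p)) ` (A \<times> S) \<subseteq> {0..T} \<times> UNIV" using assms(2) by auto
  ultimately show ?thesis using continuous_on_compose2[OF assms(1), of "A \<times> S" "\<lambda>p. (snd p, fst p)"]
    by (simp add: split_beta)
qed

lemma FTC_t:
  assumes t: "t \<in> {0..T}" and d: "\<And>s. s \<in> {0..T} \<Longrightarrow> (g has_real_derivative g' s) (at s within {0..T})"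
  shows "(g' has_integral (g t - g 0)) {0..t}"
  using t d unfolding has_real_derivative_iff_has_vector_derivative
  by (intro fundamental_theorem_of_calculus) (auto intro: has_vector_derivative_within_subset[of _ _ _ "{0..T}"])

text \<open>The spatial derivative of U and the product Q J have the same time derivative, because
  the second derivative of the nonlocal term is local.\<close>

lemma U_x:
  assumes t: "t \<in> {0..T}"
  shows "(U t has_real_derivative Q t x * J t x) (at x)"
proof -
  \<comment> \<open>The common time derivative of Q J and of the label derivative of U. That Q J has
    it rests on \<psi>(q) + \<kappa>(q) = 2 q^2: - f'' \<psi> / 2 + f'' q^2 equals f'' \<kappa> /
    2.\<close>
  define G where "G s x = - (P s x - f2 (U s x) * \<kappa> (Q s x) / 2) * J s x" for s x
  have G_cont: "continuous_on ({0..T} \<times> UNIV) (\<lambda>p. G (fst p) (snd p))"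
    unfolding G_def by (intro continuous_intros P_cont cont_f2U cont_\<kappa>Q J_cont) auto
  have "((\<lambda>s. Q s x * J s x) has_real_derivative G s x) (at s within {0..T})" if s: "s \<in> {0..T}" for s
  proof (rule DERIV_cong[OF DERIV_mult[OF Q_t[OF s] J_t[OF s]]])
    show "(- 1 / 2 * f2 (U s x) * \<psi> (Q s x) - P s x) * J s x + (f2 (U s x) * Q s x * J s x) * Q s x = G s x"
      by (simp add: G_def \<psi>_def \<kappa>_def power2_eq_square algebra_simps)
  qed
  then have "((\<lambda>s. G s x) has_integral (Q t x * J t x - Q 0 x * J 0 x)) {0..t}"
    by (rule FTC_t[OF t])
  then have Gint: "integral (cbox 0 t) (\<lambda>s. G s x) = Q t x * J t x - Q 0 x"
    by (simp add: integral_unique init)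
  have Ueq: "U t y = U 0 y + integral (cbox 0 t) (\<lambda>s. - l\<^sup>2 * Px s y)" for y
  proof -
    have "((\<lambda>s. - l\<^sup>2 * Px s y) has_integral (U t y - U 0 y)) {0..t}" by (rule FTC_t[OF t U_t])
    from integral_unique[OF this] show ?thesis unfolding cbox_interval by linarith
  qed
  have sub: "{0..t} \<subseteq> {0..T}" using t by auto
  have "((\<lambda>y. integral (cbox 0 t) (\<lambda>s. - l\<^sup>2 * Px s y)) has_real_derivative integral (cbox 0 t) (\<lambda>s. G s x)) (at x within UNIV)"
  proof (rule leibniz_rule_field_derivative)
    show "((\<lambda>y. - l\<^sup>2 * Px s y) has_real_derivative G s y) (at y within UNIV)" for y s
      by (rule DERIV_cong[OF DERIV_cmult[OF Px_x]]) (use l_pos in \<open>simp add: G_def field_simps\<close>)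
    show "(\<lambda>s. - l\<^sup>2 * Px s y) integrable_on cbox 0 t" for y
      unfolding cbox_interval by (intro integrable_continuous_interval continuous_intros cont_slice_t[OF Px_cont] sub)
    show "continuous_on (UNIV \<times> cbox 0 t) (\<lambda>(y, s). G s y)"
      using swap_cont[OF G_cont sub] by simp
  qed auto
  then have "((\<lambda>y. U 0 y + integral (cbox 0 t) (\<lambda>s. - l\<^sup>2 * Px s y)) has_real_derivative Q 0 x + (Q t x * J t x - Q 0 x)) (at x)"
    unfolding Gint using U0_deriv[of x] by (intro DERIV_add) (simp_all add: init)
  then show ?thesis unfolding Ueq[abs_def, symmetric] by (simp add: Ueq[symmetric])
qed

lemma X_bounded:
  obtains R where "0 \<le> R" "\<And>t. t \<in> {0..T} \<Longrightarrow> norm (fst (X t)) \<le> R \<and> norm (fst (snd (X t))) \<le> R \<and> norm (snd (snd (X t))) \<le> R"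
proof -
  have "bounded (X ` {0..T})" by (intro compact_imp_bounded compact_continuous_image X_cont) auto
  then obtain R where R: "\<forall>z\<in>X ` {0..T}. norm z \<le> R" unfolding bounded_iff by auto
  have "norm (fst (X t)) \<le> R \<and> norm (fst (snd (X t))) \<le> R \<and> norm (snd (snd (X t))) \<le> R" if "t \<in> {0..T}" for t
  proof -
    have "norm (X t) \<le> R" using R that by simp
    moreover have "norm (fst (X t)) \<le> norm (X t)" "norm (snd (X t)) \<le> norm (X t)"
      using norm_fst_le[of "fst (X t)" "snd (X t)"] norm_snd_le[of "snd (X t)" "fst (X t)"] by simp_all
    moreover have "norm (fst (snd (X t))) \<le> norm (snd (X t))" "norm (snd (snd (X t))) \<le> norm (snd (X t))"
      using norm_fst_le[of "fst (snd (X t))" "snd (snd (X t))"] norm_snd_le[of "snd (snd (X t))" "fst (snd (X t))"] by simp_all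
    ultimately show ?thesis by linarith
  qed
  moreover have "0 \<le> R" using R T order_trans[OF norm_ge_zero[of "X 0"]] by simp
  ultimately show ?thesis using that by blast
qed

text \<open>A Gronwall argument for the supremum of U and Q divided by the weight. One factor of Q^2
  is spent on the bound R, so the nonlocal term is bounded linearly, with the constant k, by that
  supremum. K adds the rates of the velocity equation (l k) and of the slope equation (F2 R / 2 +
  k). With the exponential of rate 2 K the supremum M satisfies M \<le> A + M / 2. The lower bound
  \<delta> ensures that M is finite and does not enter the result.\<close>

lemma decay_pos:
  assumes R: "0 \<le> R" "\<And>t. t \<in> {0..T} \<Longrightarrow> norm (fst (X t)) \<le> R \<and> norm (fst (snd (X t))) \<le> R \<and> norm (snd (snd (X t))) \<le> R"
    and s: "slow \<beta> \<omega>" and \<beta>: "\<beta> < exp (- R) / l" and \<delta>: "0 < \<delta>" "\<And>x. \<delta> \<le> \<omega> x"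
    and F2: "\<And>v. \<bar>v\<bar> \<le> R \<Longrightarrow> f2 v \<le> F2"
    and k: "k = F2 * (2 * R * exp R) / (2 * l * (exp (- R) / l - \<beta>))"
    and K: "K = l * k + (F2 * R / 2 + k)"
    and i: "0 \<le> A" "\<And>x. \<bar>apply_bcontfun U0 x\<bar> \<le> A * \<omega> x" "\<And>x. \<bar>apply_bcontfun Q0 x\<bar> \<le> A * \<omega> x"
    and t: "t \<in> {0..T}"
  shows "\<bar>U t x\<bar> \<le> 2 * A * exp (2 * K * t) * \<omega> x" and "\<bar>Q t x\<bar> \<le> 2 * A * exp (2 * K * t) * \<omega> x"
proof -
  have UR: "\<bar>U s y\<bar> \<le> R" and QR: "\<bar>Q s y\<bar> \<le> R" and JR: "J s y \<le> exp R" if "s \<in> {0..T}" for s y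
    using R(2)[OF that] abs_le_norm_bcontfun[of "fst (X s)" y] abs_le_norm_bcontfun[of "fst (snd (X s))" y]
      abs_le_norm_bcontfun[of "snd (snd (X s))" y] unfolding U_def Q_def J_def by auto
  have \<omega>: "0 < \<omega> y" for y using \<delta>(2)[of y] \<delta>(1) by linarith
  have F20: "0 < F2" using F2[of 0] f2_pos[of 0] R by auto
  have k0: "0 \<le> k" using F20 R \<beta> l_pos unfolding k by (intro divide_nonneg_nonneg mult_nonneg_nonneg) auto
  have K0: "0 \<le> K" using k0 F20 R l_pos by (simp add: K)
  \<comment> \<open>Here the supremum runs over a noncompact set, so its finiteness needs both the
    bound R and the lower bound \<delta> of the weight.\<close>
  define g where "g p = exp (- (2 * K * fst p)) * max \<bar>U (fst p) (snd p)\<bar> \<bar>Q (fst p) (snd p)\<bar> / \<omega> (snd p)" for p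
  have g0: "0 \<le> g p" for p using \<omega>[of "snd p"] by (simp add: g_def)
  have "g p \<le> 1 * R / \<delta>" if "p \<in> {0..T} \<times> UNIV" for p
  proof -
    have "exp (- (2 * K * fst p)) \<le> 1" using K0 that by auto
    then show ?thesis unfolding g_def using UR QR that \<delta> R
      by (intro frac_le mult_mono) auto
  qed
  then have bdd: "bdd_above (g ` ({0..T} \<times> UNIV))" by (intro bdd_aboveI[of _ "1 * R / \<delta>"]) auto
  define M where "M = (SUP p\<in>{0..T} \<times> UNIV. g p)"
  have M: "g p \<le> M" if "p \<in> {0..T} \<times> UNIV" for p unfolding M_def by (rule cSUP_upper[OF that bdd])
  have M0: "0 \<le> M" using M[of "(0, 0)"] g0[of "(0, 0)"] T by auto
  have UM: "\<bar>U s y\<bar> \<le> M * exp (2 * K * s) * \<omega> y" and QM: "\<bar>Q s y\<bar> \<le> M * exp (2 * K * s) * \<omega> y"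
    if s: "s \<in> {0..T}" for s y
  proof -
    have "g (s, y) * (exp (2 * K * s) * \<omega> y) \<le> M * (exp (2 * K * s) * \<omega> y)"
      using M[of "(s, y)"] s \<omega>[of y] by (intro mult_right_mono) auto
    moreover have "g (s, y) * (exp (2 * K * s) * \<omega> y) = max \<bar>U s y\<bar> \<bar>Q s y\<bar>"
      using \<omega>[of y] by (simp add: g_def exp_minus field_simps)
    ultimately show "\<bar>U s y\<bar> \<le> M * exp (2 * K * s) * \<omega> y" "\<bar>Q s y\<bar> \<le> M * exp (2 * K * s) * \<omega> y"
      unfolding mult.assoc by linarith+
  qed
  have Pb: "P s y \<le> k * (M * exp (2 * K * s)) * \<omega> y" if s: "s \<in> {0..T}" for s y
  proof -
    have "P s y \<le> (F2 * (2 * R * exp R)) * (M * exp (2 * K * s)) * \<omega> y / (2 * l * (exp (- R) / l - \<beta>))"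
      unfolding P_def
    proof (rule Pop_weighted[OF _ assms(3) \<beta>])
      show "norm (snd (snd (X s))) \<le> R" using R(2)[OF s] by simp
      show "0 \<le> F2 * (2 * R * exp R) * (M * exp (2 * K * s))" using F20 R M0 by simp
      fix z
      have "(Q s z)\<^sup>2 \<le> R * \<bar>Q s z\<bar>" using QR[OF s, of z] by (metis abs_ge_zero mult_right_mono power2_abs power2_eq_square)
      also have "\<dots> \<le> R * (M * exp (2 * K * s) * \<omega> z)" using QM[OF s] R by (intro mult_left_mono) auto
      finally have "\<kappa> (Q s z) \<le> 2 * (R * (M * exp (2 * K * s) * \<omega> z))" using \<kappa>_bounds(2)[of "Q s z"] by linarith
      then have "f2 (U s z) * (\<kappa> (Q s z) * J s z) \<le> F2 * (2 * (R * (M * exp (2 * K * s) * \<omega> z)) * exp R)"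
        using F2[OF UR[OF s]] JR[OF s, of z] F20 R M0 \<omega>[of z] J_pos[of s z] f2_pos[of "U s z"] \<kappa>_bounds(1)[of "Q s z"]
        by (intro mult_mono) auto
      then show "apply_bcontfun (rho (X s)) z \<le> F2 * (2 * R * exp R) * (M * exp (2 * K * s)) * \<omega> z"
        by (simp add: rho_apply U_def Q_def J_def ac_simps)
    qed
    then show ?thesis by (simp add: k ac_simps)
  qed
  have Ut: "\<bar>U s y\<bar> \<le> (A + M / 2) * exp (2 * K * s) * \<omega> y \<and> \<bar>Q s y\<bar> \<le> (A + M / 2) * exp (2 * K * s) * \<omega> y"
    if s: "s \<in> {0..T}" for s y
  proof
    have e1: "1 \<le> exp (2 * K * s)" using K0 s by simp
    have expand: "(A + M / 2) * exp (2 * K * s) * \<omega> y = A * exp (2 * K * s) * \<omega> y + M * \<omega> y * exp (2 * K * s) / 2"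
      by (simp add: algebra_simps)
    have Ae: "A * \<omega> y \<le> A * exp (2 * K * s) * \<omega> y"
      using e1 i(1) \<omega>[of y] mult_left_mono[OF e1, of A] by (intro mult_right_mono) auto
    have "\<bar>- l\<^sup>2 * Px r y\<bar> \<le> K * (M * \<omega> y) * exp (2 * K * r)" if r: "r \<in> {0..T}" for r
    proof -
      have "\<bar>- l\<^sup>2 * Px r y\<bar> = l\<^sup>2 * \<bar>Px r y\<bar>" by (simp add: abs_mult)
      also have "\<dots> \<le> l\<^sup>2 * (P r y / l)" by (intro mult_left_mono Px_le) auto
      also have "\<dots> = l * P r y" using l_pos by (simp add: power2_eq_square)
      also have "\<dots> \<le> l * (k * (M * exp (2 * K * r)) * \<omega> y)" using Pb[OF r] l_pos by (intro mult_left_mono) auto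
      also have "\<dots> = (l * k) * (M * exp (2 * K * r) * \<omega> y)" by simp
      also have "\<dots> \<le> K * (M * exp (2 * K * r) * \<omega> y)"
        using k0 F20 R M0 \<omega>[of y] unfolding K by (intro mult_right_mono) auto
      finally show ?thesis by (simp add: ac_simps)
    qed
    then have "\<bar>U s y - U 0 y\<bar> \<le> M * \<omega> y * exp (2 * K * s) / 2"
      using M0 \<omega>[of y] by (intro deriv_exp_bound[OF U_t _ _ s]) auto
    then show "\<bar>U s y\<bar> \<le> (A + M / 2) * exp (2 * K * s) * \<omega> y"
      using i(2)[of y] Ae expand unfolding init by linarith
    have "\<bar>- 1 / 2 * f2 (U r y) * \<psi> (Q r y) - P r y\<bar> \<le> K * (M * \<omega> y) * exp (2 * K * r)" if r: "r \<in> {0..T}" for r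
    proof -
      have "\<psi> (Q r y) \<le> R * \<bar>Q r y\<bar>" using QR[OF r, of y] \<psi>_bounds(2)[of "Q r y"]
        by (metis abs_ge_zero mult_right_mono power2_abs power2_eq_square order_trans)
      also have "\<dots> \<le> R * (M * exp (2 * K * r) * \<omega> y)" using QM[OF r] R by (intro mult_left_mono) auto
      finally have "f2 (U r y) * \<psi> (Q r y) \<le> F2 * (R * (M * exp (2 * K * r) * \<omega> y))"
        using F2[OF UR[OF r]] F20 f2_pos[of "U r y"] \<psi>_bounds(1)[of "Q r y"] by (intro mult_mono) auto
      moreover have "0 \<le> f2 (U r y) * \<psi> (Q r y)" using f2_pos[of "U r y"] \<psi>_bounds(1)[of "Q r y"] by simp
      ultimately have "\<bar>- 1 / 2 * f2 (U r y) * \<psi> (Q r y) - P r y\<bar> \<le> F2 * (R * (M * exp (2 * K * r) * \<omega> y)) / 2 + k * (M * exp (2 * K * r)) * \<omega> y"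
        using Pb[OF r, of y] P_nonneg[of r y] by linarith
      also have "\<dots> = (F2 * R / 2 + k) * (M * exp (2 * K * r) * \<omega> y)" by (simp add: algebra_simps)
      also have "\<dots> \<le> K * (M * exp (2 * K * r) * \<omega> y)"
        using k0 l_pos M0 \<omega>[of y] unfolding K by (intro mult_right_mono) auto
      finally show ?thesis by (simp add: ac_simps)
    qed
    then have "\<bar>Q s y - Q 0 y\<bar> \<le> M * \<omega> y * exp (2 * K * s) / 2"
      using M0 \<omega>[of y] by (intro deriv_exp_bound[OF Q_t _ _ s]) auto
    then show "\<bar>Q s y\<bar> \<le> (A + M / 2) * exp (2 * K * s) * \<omega> y"
      using i(3)[of y] Ae expand unfolding init by linarith
  qed
  have "g p \<le> A + M / 2" if p: "p \<in> {0..T} \<times> UNIV" for p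
  proof -
    have "max \<bar>U (fst p) (snd p)\<bar> \<bar>Q (fst p) (snd p)\<bar> \<le> (A + M / 2) * (exp (2 * K * fst p) * \<omega> (snd p))"
      using Ut[of "fst p" "snd p"] p by (auto simp: mult.assoc)
    then have "g p \<le> exp (- (2 * K * fst p)) * ((A + M / 2) * (exp (2 * K * fst p) * \<omega> (snd p))) / \<omega> (snd p)"
      unfolding g_def using \<omega>[of "snd p"] by (intro divide_right_mono mult_left_mono) auto
    also have "\<dots> = A + M / 2" using \<omega>[of "snd p"] by (simp add: exp_minus field_simps)
    finally show ?thesis .
  qed
  then have "M \<le> A + M / 2" unfolding M_def using T by (intro cSUP_least) auto
  then have "M \<le> 2 * A" by simp
  then have "M * (exp (2 * K * t) * \<omega> x) \<le> 2 * A * (exp (2 * K * t) * \<omega> x)"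
    using \<omega>[of x] by (intro mult_right_mono) auto
  then show "\<bar>U t x\<bar> \<le> 2 * A * exp (2 * K * t) * \<omega> x" "\<bar>Q t x\<bar> \<le> 2 * A * exp (2 * K * t) * \<omega> x"
    using UM[OF t, of x] QM[OF t, of x] unfolding mult.assoc by linarith+
qed

text \<open>The constants of \<open>decay_pos\<close> are independent of the lower bound of the
  weight, so it can be applied to \<omega> + \<delta> and \<delta> sent to zero. The bound for P
  then follows from that for the density.\<close>

lemma decay:
  assumes R: "0 \<le> R" "\<And>t. t \<in> {0..T} \<Longrightarrow> norm (fst (X t)) \<le> R \<and> norm (fst (snd (X t))) \<le> R \<and> norm (snd (snd (X t))) \<le> R"
    and s: "slow \<beta> \<omega>" and \<beta>: "\<beta> < exp (- R) / l"
    and i: "0 \<le> A" "\<And>x. \<bar>apply_bcontfun U0 x\<bar> \<le> A * \<omega> x" "\<And>x. \<bar>apply_bcontfun Q0 x\<bar> \<le> A * \<omega> x"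
  shows "\<exists>C\<ge>0. \<forall>t\<in>{0..T}. \<forall>x. \<bar>U t x\<bar> \<le> C * \<omega> x \<and> \<bar>Q t x\<bar> \<le> C * \<omega> x \<and> P t x \<le> C * \<omega> x"
proof -
  obtain F2 where "0 \<le> F2" and F2': "\<And>v. norm v \<le> R \<Longrightarrow> norm (f2 v) \<le> F2"
    using lip_on_balls_bounded[OF lip_f2] by blast
  have F2: "f2 v \<le> F2" if "\<bar>v\<bar> \<le> R" for v by (rule order_trans[OF abs_ge_self]) (use F2'[of v] that in simp)
  define k where "k = F2 * (2 * R * exp R) / (2 * l * (exp (- R) / l - \<beta>))"
  define K where "K = l * k + (F2 * R / 2 + k)"
  have k0: "0 \<le> k" using \<open>0 \<le> F2\<close> R \<beta> l_pos unfolding k_def by (intro divide_nonneg_nonneg mult_nonneg_nonneg) auto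
  have K0: "0 \<le> K" using k0 \<open>0 \<le> F2\<close> R l_pos by (simp add: K_def)
  define C where "C = 2 * A * exp (2 * K * T)"
  have C0: "0 \<le> C" using i by (simp add: C_def)
  have \<omega>0: "0 \<le> \<omega> x" for x using s by (simp add: slow_def)
  have UQ: "\<bar>U t x\<bar> \<le> C * \<omega> x \<and> \<bar>Q t x\<bar> \<le> C * \<omega> x" if t: "t \<in> {0..T}" for t x
  proof -
    have "\<bar>U t x\<bar> \<le> C * \<omega> x + e \<and> \<bar>Q t x\<bar> \<le> C * \<omega> x + e" if e: "0 < e" for e
    proof -
      \<comment> \<open>Chosen so that C \<delta> is at most e; the 1 guards against C = 0.\<close>
      define \<delta> where "\<delta> = e / (C + 1)"
      have \<delta>: "0 < \<delta>" using e C0 by (simp add: \<delta>_def)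
      have le: "y \<le> A * \<omega> z \<Longrightarrow> y \<le> A * (\<omega> z + \<delta>)" for y z
        using i(1) \<delta> mult_left_mono[of "\<omega> z" "\<omega> z + \<delta>" A] by linarith
      have ex: "2 * A * exp (2 * K * t) \<le> C"
        unfolding C_def using i(1) K0 t by (intro mult_left_mono) (auto intro: mult_left_mono)
      have "2 * A * exp (2 * K * t) * (\<omega> x + \<delta>) \<le> C * (\<omega> x + \<delta>)"
        using \<omega>0[of x] \<delta> by (intro mult_right_mono ex) auto
      also have "\<dots> \<le> C * \<omega> x + e"
        using e C0 by (simp add: \<delta>_def field_simps)
      finally show ?thesis
        using decay_pos[OF R slow_add_const[OF s less_imp_le[OF \<delta>]] \<beta> \<delta> _ F2 k_def K_def i(1) le[OF i(2)] le[OF i(3)] t, of x] \<omega>0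
        by fastforce
    qed
    then show ?thesis by (meson field_le_epsilon)
  qed
  have rho: "apply_bcontfun (rho (X t)) z \<le> (F2 * (2 * R * exp R)) * C * \<omega> z" if t: "t \<in> {0..T}" for t z
  proof -
    have Qz: "\<bar>Q t z\<bar> \<le> R" "\<bar>U t z\<bar> \<le> R" "J t z \<le> exp R"
      using R(2)[OF t] abs_le_norm_bcontfun[of "fst (X t)" z] abs_le_norm_bcontfun[of "fst (snd (X t))" z]
      abs_le_norm_bcontfun[of "snd (snd (X t))" z] unfolding U_def Q_def J_def by auto
    have "(Q t z)\<^sup>2 \<le> R * \<bar>Q t z\<bar>" using Qz(1) by (metis abs_ge_zero mult_right_mono power2_abs power2_eq_square)
    also have "\<dots> \<le> R * (C * \<omega> z)" using UQ[OF t, of z] R by (intro mult_left_mono) auto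
    finally have "\<kappa> (Q t z) \<le> 2 * (R * (C * \<omega> z))" using \<kappa>_bounds(2)[of "Q t z"] by linarith
    then have "f2 (U t z) * (\<kappa> (Q t z) * J t z) \<le> F2 * (2 * (R * (C * \<omega> z)) * exp R)"
      using F2[OF Qz(2)] Qz(3) \<open>0 \<le> F2\<close> R C0 \<omega>0[of z] J_pos[of t z] f2_pos[of "U t z"] \<kappa>_bounds(1)[of "Q t z"]
      by (intro mult_mono) auto
    then show ?thesis by (simp add: rho_apply U_def Q_def J_def ac_simps)
  qed
  have Pk: "P t x \<le> k * C * \<omega> x" if t: "t \<in> {0..T}" for t x
  proof -
    have "P t x \<le> (F2 * (2 * R * exp R)) * C * \<omega> x / (2 * l * (exp (- R) / l - \<beta>))"
      unfolding P_def by (rule Pop_weighted[OF _ s \<beta> _ rho[OF t]]) (use R t C0 \<open>0 \<le> F2\<close> in auto)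
    then show ?thesis by (simp add: k_def ac_simps)
  qed
  show ?thesis
  proof (intro exI[of _ "C + k * C"] conjI ballI allI)
    show "0 \<le> C + k * C" using C0 k0 by simp
    have le: "C * \<omega> x \<le> (C + k * C) * \<omega> x" "k * C * \<omega> x \<le> (C + k * C) * \<omega> x" for x
      using C0 k0 \<omega>0[of x] by (auto intro!: mult_right_mono)
    fix t x assume t: "t \<in> {0..T}"
    show "\<bar>U t x\<bar> \<le> (C + k * C) * \<omega> x" "\<bar>Q t x\<bar> \<le> (C + k * C) * \<omega> x" "P t x \<le> (C + k * C) * \<omega> x"
      using UQ[OF t, of x] Pk[OF t, of x] le[of x] by linarith+
  qed
qed

end

subsection \<open>A priori bounds\<close>

text \<open>Slow variation lets domination survive the nonlocal term and bounded displacements,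
  square integrability makes dominated fields square integrable, and boundedness makes them
  bounded.\<close>

definition weight :: "real \<Rightarrow> (real \<Rightarrow> real) \<Rightarrow> bool" where
  "weight \<beta> \<omega> \<longleftrightarrow> slow \<beta> \<omega> \<and> integrable lborel (\<lambda>x. (\<omega> x)\<^sup>2) \<and> (\<exists>B. \<forall>x. \<omega> x \<le> B)"

text \<open>Slow variation upgrades an integral to a pointwise bound: \<omega>^2 at the centre of an
  interval of length 2 is at most exp(2 \<beta>) times the integral of \<omega>^2 over it, and these
  integrals tend to zero. The sign s selects one of the two ends of the line.\<close>

lemma weight_tendsto_0:
  assumes w: "weight \<beta> \<omega>" and s: "\<bar>s\<bar> = 1"
  shows "(\<lambda>n. \<omega> (s * real n)) \<longlonglongrightarrow> 0"
proof -
  have \<omega>: "0 \<le> \<omega> x" "\<omega> y \<le> exp (\<beta> * \<bar>x - y\<bar>) * \<omega> x" "0 \<le> \<beta>" for x y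
    using w by (auto simp: weight_def slow_def)
  have int: "integrable lborel (\<lambda>x. (\<omega> x)\<^sup>2)" using w by (simp add: weight_def)
  define A where "A n = {s * real n - 1..s * real n + 1}" for n
  define a where "a n = (LINT y|lborel. indicator (A n) y * (\<omega> y)\<^sup>2)" for n
  have "(\<lambda>n. LINT y|lborel. indicator (A n) y * (\<omega> y)\<^sup>2) \<longlonglongrightarrow> (integral\<^sup>L lborel (\<lambda>y :: real. 0 :: real))"
  proof (rule integral_dominated_convergence[where s="\<lambda>n y. indicator (A n) y * (\<omega> y)\<^sup>2" and f="\<lambda>y. 0" and w="\<lambda>y. (\<omega> y)\<^sup>2"])
    show "AE y in lborel. (\<lambda>n. indicator (A n) y * (\<omega> y)\<^sup>2) \<longlonglongrightarrow> 0"
    proof (rule AE_I2, rule tendsto_eventually)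
      fix y
      have "indicator (A n) y * (\<omega> y)\<^sup>2 = 0" if "nat \<lceil>\<bar>y\<bar> + 2\<rceil> \<le> n" for n
      proof -
        have "\<bar>y\<bar> + 2 \<le> real n" using that by linarith
        moreover have "\<bar>s * real n\<bar> = real n" using s by (simp add: abs_mult)
        ultimately have "y \<notin> A n" unfolding A_def by auto
        then show ?thesis by simp
      qed
      then show "\<forall>\<^sub>F n in sequentially. indicator (A n) y * (\<omega> y)\<^sup>2 = 0"
        unfolding eventually_sequentially by blast
    qed
    show "(\<lambda>y. indicator (A n) y * (\<omega> y)\<^sup>2) \<in> borel_measurable lborel" for n
      using int unfolding A_def by (intro borel_measurable_times) auto
  qed (use int in \<open>auto simp: indicator_def\<close>)
  then have "a \<longlonglongrightarrow> 0" unfolding a_def[abs_def] by simp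
  then have lim: "(\<lambda>n. sqrt (exp (2 * \<beta>) * a n)) \<longlonglongrightarrow> 0"
    by (auto intro!: tendsto_eq_intros)
  have "norm (\<omega> (s * real n)) \<le> sqrt (exp (2 * \<beta>) * a n)" for n
  proof -
    let ?x = "s * real n"
    have "(\<omega> ?x)\<^sup>2 \<le> 2 * (\<omega> ?x)\<^sup>2" by simp
    also have "\<dots> = (LINT y|lborel. indicator (A n) y * (\<omega> ?x)\<^sup>2)" by (simp add: A_def)
    also have "\<dots> \<le> (LINT y|lborel. exp (2 * \<beta>) * (indicator (A n) y * (\<omega> y)\<^sup>2))"
    proof (rule integral_mono)
      show "integrable lborel (\<lambda>y. indicator (A n) y * (\<omega> ?x)\<^sup>2)"
        unfolding A_def by (intro integrable_mult_left integrable_real_indicator) (auto simp: ennreal_less_top)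
      show "integrable lborel (\<lambda>y. exp (2 * \<beta>) * (indicator (A n) y * (\<omega> y)\<^sup>2))"
        unfolding A_def using integrable_mult_indicator[OF _ int, of "{s * real n - 1..s * real n + 1}"]
        by (intro integrable_mult_right) simp
      fix y
      show "indicator (A n) y * (\<omega> ?x)\<^sup>2 \<le> exp (2 * \<beta>) * (indicator (A n) y * (\<omega> y)\<^sup>2)"
      proof (cases "y \<in> A n")
        case True
        then have "\<bar>y - ?x\<bar> \<le> 1" by (auto simp: A_def)
        then have "\<beta> * \<bar>y - ?x\<bar> \<le> \<beta>" using \<omega>(3) mult_left_mono[of "\<bar>y - ?x\<bar>" 1 \<beta>] by simp
        then have "exp (\<beta> * \<bar>y - ?x\<bar>) * \<omega> y \<le> exp \<beta> * \<omega> y" using \<omega>(1)[of y] by (intro mult_right_mono) auto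
        then have "\<omega> ?x \<le> exp \<beta> * \<omega> y" using \<omega>(2)[of ?x y] by linarith
        then have "(\<omega> ?x)\<^sup>2 \<le> (exp \<beta> * \<omega> y)\<^sup>2" using \<omega>(1) by (intro power_mono) auto
        then show ?thesis using True by (simp add: power_mult_distrib exp_double)
      qed simp
    qed
    also have "\<dots> = exp (2 * \<beta>) * a n" by (simp add: a_def)
    finally have "sqrt ((\<omega> ?x)\<^sup>2) \<le> sqrt (exp (2 * \<beta>) * a n)" by (rule real_sqrt_le_mono)
    then show ?thesis using \<omega>(1)[of ?x] by simp
  qed
  then have "\<forall>n. norm (\<omega> (s * real n)) \<le> sqrt (exp (2 * \<beta>) * a n)" by blast
  then show ?thesis by (rule Lim_null_comparison[OF always_eventually lim])
qed

text \<open>Lets an integral over the line be bounded from energy estimates on the intervals [-n, n]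
  alone, with no integrability of the energy density on the line.\<close>

lemma integral_le_of_expanding:
  fixes g h :: "real \<Rightarrow> real"
  assumes g: "integrable lborel g" and gh: "\<And>x. g x \<le> h x" and h: "continuous_on UNIV h"
    and B: "\<And>n::nat. integral {- real n..real n} h \<le> B"
  shows "(LINT x|lborel. g x) \<le> B"
proof (rule LIMSEQ_le_const2)
  show "(\<lambda>n. LINT x|lborel. indicator {- real n..real n} x * g x) \<longlonglongrightarrow> (LINT x|lborel. g x)"
  proof (rule integral_dominated_convergence[where w="\<lambda>x. norm (g x)"])
    show "AE x in lborel. (\<lambda>n. indicator {- real n..real n} x * g x) \<longlonglongrightarrow> g x"
    proof (rule AE_I2, rule tendsto_eventually)
      fix x
      have "indicator {- real n..real n} x * g x = g x" if "nat \<lceil>\<bar>x\<bar>\<rceil> \<le> n" for n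
      proof -
        have "\<bar>x\<bar> \<le> real n" using that by linarith
        then have "x \<in> {- real n..real n}" by auto
        then show ?thesis by simp
      qed
      then show "\<forall>\<^sub>F n in sequentially. indicator {- real n..real n} x * g x = g x"
        unfolding eventually_sequentially by blast
    qed
  qed (use g in \<open>auto simp: indicator_def\<close>)
  have hc: "set_integrable lborel {- real n..real n} h" for n
    by (rule borel_integrable_atLeastAtMost') (rule continuous_on_subset[OF h subset_UNIV])
  have "(LINT x|lborel. indicator {- real n..real n} x * g x) \<le> B" for n
  proof -
    have "(LINT x|lborel. indicator {- real n..real n} x * g x) \<le> (LINT x|lborel. indicator {- real n..real n} x * h x)"
    proof (rule integral_mono)
      show "integrable lborel (\<lambda>x. indicator {- real n..real n} x * g x)"
        using integrable_mult_indicator[OF _ g, of "{- real n..real n}"] by simp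
      show "integrable lborel (\<lambda>x. indicator {- real n..real n} x * h x)"
        using hc[of n] by (simp add: set_integrable_def)
    qed (auto simp: gh indicator_def)
    also have "\<dots> = integral {- real n..real n} h"
      using set_borel_integral_eq_integral(2)[OF hc[of n]] by (simp add: set_lebesgue_integral_def)
    finally show ?thesis using B[of n] by linarith
  qed
  then show "\<exists>N. \<forall>n\<ge>N. (LINT x|lborel. indicator {- real n..real n} x * g x) \<le> B" by blast
qed

lemma integral_Icc_le_LINT:
  fixes g h :: "real \<Rightarrow> real"
  assumes g: "integrable lborel g" and hg: "\<And>x. h x \<le> g x" and g0: "\<And>x. 0 \<le> g x" and h: "continuous_on {a..b} h"
  shows "integral {a..b} h \<le> (LINT x|lborel. g x)"
proof -
  have hc: "set_integrable lborel {a..b} h" by (rule borel_integrable_atLeastAtMost'[OF h])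
  have "integral {a..b} h = (LINT x|lborel. indicator {a..b} x * h x)"
    using set_borel_integral_eq_integral(2)[OF hc] by (simp add: set_lebesgue_integral_def)
  also have "\<dots> \<le> (LINT x|lborel. g x)"
    using hc g by (intro integral_mono) (auto simp: set_integrable_def indicator_def hg g0)
  finally show ?thesis .
qed

context lagrangian
begin

text \<open>Energy per unit of label, whence the Jacobian.\<close>

definition en where "en t x = (1 / 2 * (U t x)\<^sup>2 + 1 / 2 * l\<^sup>2 * (Q t x)\<^sup>2) * J t x"

lemma en_nonneg: "0 \<le> en t x"
  using J_pos[of t x] by (simp add: en_def)

lemma en_cont: "continuous_on ({0..T} \<times> UNIV) (\<lambda>p. en (fst p) (snd p))"
  unfolding en_def by (intro continuous_intros U_cont Q_cont J_cont) auto

text \<open>The energy balance on a fixed label interval: its boundary terms are dominated by the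
  weight at the two ends, and the only term that is not a flux has a sign.\<close>

lemma energy_local:
  assumes C: "\<And>t x. t \<in> {0..T} \<Longrightarrow> \<bar>U t x\<bar> \<le> C * \<omega> x" "\<And>t x. t \<in> {0..T} \<Longrightarrow> P t x \<le> C * \<omega> x" and C0: "0 \<le> C"
    and \<omega>: "\<And>x. 0 \<le> \<omega> x"
  shows "\<exists>D\<ge>0. \<forall>t\<in>{0..T}. \<forall>a b. a \<le> b \<longrightarrow> integral {a..b} (en t) \<le> integral {a..b} (en 0) + D * (\<omega> a + \<omega> b)"
proof -
  obtain R where R: "0 \<le> R" "\<And>t. t \<in> {0..T} \<Longrightarrow> norm (fst (X t)) \<le> R \<and> norm (fst (snd (X t))) \<le> R \<and> norm (snd (snd (X t))) \<le> R"
    using X_bounded by blast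
  have UR: "\<bar>U s y\<bar> \<le> R" if "s \<in> {0..T}" for s y
    using R(2)[OF that] abs_le_norm_bcontfun[of "fst (X s)" y] unfolding U_def by linarith
  \<comment> \<open>In labels the transport of the energy by f'(u) is subtracted from the Eulerian
    flux. What remains of K(u) - u^2 f'(u) / 2 is minus a primitive H of v^2 f''(v) / 2, which
    enters \<open>F\<close> with a plus sign.\<close>
  have hcont: "continuous_on UNIV (\<lambda>v. 1 / 2 * v\<^sup>2 * f2 v)" by (intro continuous_intros f_cont)
  obtain H where H0: "H 0 = 0" and H: "\<And>v. (H has_real_derivative 1 / 2 * v\<^sup>2 * f2 v) (at v)"
    using continuous_antiderivative[OF hcont] by blast
  have "lip_on_balls H" by (rule lip_on_balls_C1[OF H hcont])
  then obtain B where B: "0 \<le> B" "\<And>x y. norm x \<le> R \<Longrightarrow> norm y \<le> R \<Longrightarrow> norm (H x - H y) \<le> B * norm (x - y)"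
    by (rule lip_on_ballsE[where R=R]) blast
  define F where "F t x = - l\<^sup>2 * (U t x * P t x) + H (U t x)" for t x
  define D where "D = l\<^sup>2 * R * C + B * C"
  have D0: "0 \<le> D" using R B C0 by (simp add: D_def)
  have Fb: "\<bar>F t x\<bar> \<le> D * \<omega> x" if t: "t \<in> {0..T}" for t x
  proof -
    have "\<bar>F t x\<bar> \<le> \<bar>- l\<^sup>2 * (U t x * P t x)\<bar> + \<bar>H (U t x)\<bar>" unfolding F_def by (rule abs_triangle_ineq)
    also have "\<bar>- l\<^sup>2 * (U t x * P t x)\<bar> = l\<^sup>2 * (\<bar>U t x\<bar> * P t x)" using P_nonneg[of t x] by (simp add: abs_mult)
    also have "\<dots> \<le> l\<^sup>2 * (R * (C * \<omega> x))" using UR[OF t] C(2)[OF t] P_nonneg R by (intro mult_left_mono mult_mono) auto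
    also have "\<bar>H (U t x)\<bar> \<le> B * \<bar>U t x\<bar>" using B(2)[of "U t x" 0] UR[OF t, of x] R H0 by simp
    also have "\<dots> \<le> B * (C * \<omega> x)" using B(1) C(1)[OF t, of x] by (intro mult_left_mono)
    finally show ?thesis by (simp add: D_def algebra_simps)
  qed
  define et where "et t x = - l\<^sup>2 * (U t x * Px t x * J t x) + l\<^sup>2 * (Q t x * (- 1 / 2 * f2 (U t x) * \<psi> (Q t x) - P t x) * J t x)
      + (1 / 2 * (U t x)\<^sup>2 + 1 / 2 * l\<^sup>2 * (Q t x)\<^sup>2) * (f2 (U t x) * Q t x * J t x)" for t x
  have et_cont: "continuous_on ({0..T} \<times> UNIV) (\<lambda>p. et (fst p) (snd p))"
    unfolding et_def by (intro continuous_intros U_cont Q_cont J_cont P_cont Px_cont cont_f2U cont_\<psi>Q) auto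
  have et: "((\<lambda>s. en s x) has_real_derivative et t x) (at t within {0..T})" if t: "t \<in> {0..T}" for t x
    unfolding en_def et_def
    by (rule derivative_eq_intros U_t[OF t] Q_t[OF t] J_t[OF t] refl)+ (simp add: algebra_simps power2_eq_square)
  have bound: "integral {a..b} (en t) \<le> integral {a..b} (en 0) + T * D * (\<omega> a + \<omega> b)" if t: "t \<in> {0..T}" and ab: "a \<le> b" for t a b
  proof -
    define E where "E s = integral (cbox a b) (\<lambda>x. en s x)" for s
    define E' where "E' s = integral (cbox a b) (\<lambda>x. et s x)" for s
    have ED: "(E has_real_derivative E' s) (at s within {0..T})" if s: "s \<in> {0..T}" for s
      unfolding E_def[abs_def] E'_def
    proof (rule leibniz_rule_field_derivative[OF et _ _ s])
      show "(\<lambda>x. en s x) integrable_on cbox a b" if "s \<in> {0..T}" for s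
        unfolding cbox_interval by (intro integrable_continuous_interval cont_slice_x[OF en_cont that])
      show "continuous_on ({0..T} \<times> cbox a b) (\<lambda>(s, x). et s x)"
        using continuous_on_subset[OF et_cont, of "{0..T} \<times> cbox a b"] by (auto simp: split_beta)
    qed auto
    have Eb: "E' s \<le> D * (\<omega> a + \<omega> b)" if s: "s \<in> {0..T}" for s
    proof -
      define Fx where "Fx x = - l\<^sup>2 * (Q s x * J s x * P s x + U s x * (Px s x * J s x)) + (1 / 2 * (U s x)\<^sup>2 * f2 (U s x)) * (Q s x * J s x)" for x
      have FD: "(F s has_real_derivative Fx x) (at x)" for x
        unfolding F_def[abs_def] Fx_def
        by (rule derivative_eq_intros U_x[OF s] P_x DERIV_chain2[OF H U_x[OF s]] refl)+ (simp add: algebra_simps)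
      have Fint: "(Fx has_integral (F s b - F s a)) {a..b}"
        by (rule fundamental_theorem_of_calculus[OF ab])
          (use FD in \<open>auto simp: has_real_derivative_iff_has_vector_derivative[symmetric] intro: has_field_derivative_at_within\<close>)
      have "E' s \<le> F s b - F s a"
        unfolding E'_def cbox_interval
      proof (rule has_integral_le[OF integrable_integral Fint])
        show "(\<lambda>x. et s x) integrable_on {a..b}" by (intro integrable_continuous_interval cont_slice_x[OF et_cont s])
        fix x
        \<comment> \<open>The cut-off acts only where the slope is negative, so its contribution
          dissipates energy.\<close>
        have "Q s x * chi \<epsilon> (Q s x) \<le> 0"
        proof (cases "Q s x \<le> - 1 / \<epsilon>")
          case True
          then have "Q s x \<le> 0" using divide_pos_pos[OF zero_less_one \<epsilon>_pos] by linarith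
          then show ?thesis using chi_nonneg[of \<epsilon> "Q s x"] by (rule mult_nonpos_nonneg)
        qed (simp add: chi_def)
        then have "1 / 2 * l\<^sup>2 * (f2 (U s x) * J s x) * (Q s x * chi \<epsilon> (Q s x)) \<le> 0"
            using f2_pos[of "U s x"] J_pos[of s x] by (intro mult_nonneg_nonpos[of _ "Q s x * chi \<epsilon> (Q s x)"]) auto
        moreover have "et s x = Fx x + 1 / 2 * l\<^sup>2 * (f2 (U s x) * J s x) * (Q s x * chi \<epsilon> (Q s x))"
          by (simp add: et_def Fx_def \<psi>_def algebra_simps power2_eq_square)
        ultimately show "et s x \<le> Fx x" by linarith
      qed
      also have "\<dots> \<le> D * \<omega> b + D * \<omega> a" using Fb[OF s, of a] Fb[OF s, of b] by linarith
      finally show ?thesis by (simp add: algebra_simps)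
    qed
    have "E t - E 0 \<le> integral {0..t} (\<lambda>s. D * (\<omega> a + \<omega> b))"
      by (rule has_integral_le[OF FTC_t[OF t ED] integrable_integral]) (use Eb t in auto)
    also have "\<dots> = t * (D * (\<omega> a + \<omega> b))" using t by simp
    also have "\<dots> \<le> T * (D * (\<omega> a + \<omega> b))" using t D0 \<omega> by (intro mult_right_mono) auto
    finally show ?thesis by (simp add: E_def mult.assoc)
  qed
  show ?thesis using bound T D0 by (intro exI[of _ "T * D"]) auto
qed

text \<open>The decay of the fields, whose constants depend on the solution, is used only to remove
  boundary terms at infinity; the bounds themselves depend on the initial energy. The velocity
  follows from integrating the derivative of U^2, at most 2/l times the energy density, from minus
  infinity. For P each half is at most 4 F2 E0 / l^2, since the kernel is at most 1 and \<kappa>(q)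
  \<le> 2 q^2.\<close>

lemma apriori:
  assumes w: "\<And>\<beta>. 0 < \<beta> \<Longrightarrow> \<exists>\<omega>. weight \<beta> \<omega> \<and> (\<forall>x. \<bar>apply_bcontfun U0 x\<bar> \<le> \<omega> x \<and> \<bar>apply_bcontfun Q0 x\<bar> \<le> \<omega> x)"
    and E0: "\<And>n::nat. integral {- real n..real n} (\<lambda>x. 1 / 2 * (apply_bcontfun U0 x)\<^sup>2 + 1 / 2 * l\<^sup>2 * (apply_bcontfun Q0 x)\<^sup>2) \<le> E0"
    and F2: "\<And>v. \<bar>v\<bar> \<le> sqrt (2 * E0 / l) \<Longrightarrow> f2 v \<le> F2"
    and t: "t \<in> {0..T}"
  shows "\<bar>U t x\<bar> \<le> sqrt (2 * E0 / l)" and "P t x \<le> 2 * F2 * E0 / l ^ 3"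
proof -
  obtain R where R: "0 \<le> R" "\<And>t. t \<in> {0..T} \<Longrightarrow> norm (fst (X t)) \<le> R \<and> norm (fst (snd (X t))) \<le> R \<and> norm (snd (snd (X t))) \<le> R"
    using X_bounded by blast
  \<comment> \<open>Half of the largest admissible growth rate for this particular solution.\<close>
  define \<beta> where "\<beta> = exp (- R) / l / 2"
  have half: "0 < z \<Longrightarrow> 0 < z / 2 \<and> z / 2 < z" for z :: real by simp
  have \<beta>: "0 < \<beta>" "\<beta> < exp (- R) / l" using divide_pos_pos[OF exp_gt_zero[of "- R"] l_pos] half[of "exp (- R) / l"] unfolding \<beta>_def by blast+
  obtain \<omega> where \<omega>: "weight \<beta> \<omega>" "\<And>x. \<bar>apply_bcontfun U0 x\<bar> \<le> \<omega> x \<and> \<bar>apply_bcontfun Q0 x\<bar> \<le> \<omega> x"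
    using w[OF \<beta>(1)] by blast
  have sl: "slow \<beta> \<omega>" using \<omega>(1) by (simp add: weight_def)
  then have \<omega>0: "0 \<le> \<omega> x" for x by (simp add: slow_def)
  have "\<exists>C\<ge>0. \<forall>t\<in>{0..T}. \<forall>x. \<bar>U t x\<bar> \<le> C * \<omega> x \<and> \<bar>Q t x\<bar> \<le> C * \<omega> x \<and> P t x \<le> C * \<omega> x"
    by (rule decay[OF R sl \<beta>(2), of 1]) (use \<omega>(2) in simp_all)
  then obtain C where C0: "0 \<le> C" and C: "\<forall>t\<in>{0..T}. \<forall>x. \<bar>U t x\<bar> \<le> C * \<omega> x \<and> \<bar>Q t x\<bar> \<le> C * \<omega> x \<and> P t x \<le> C * \<omega> x"
    by blast
  have "\<exists>D\<ge>0. \<forall>t\<in>{0..T}. \<forall>a b. a \<le> b \<longrightarrow> integral {a..b} (en t) \<le> integral {a..b} (en 0) + D * (\<omega> a + \<omega> b)"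
    by (rule energy_local[where C=C]) (use C C0 \<omega>0 in auto)
  then obtain D where D: "\<And>t a b. t \<in> {0..T} \<Longrightarrow> a \<le> b \<Longrightarrow> integral {a..b} (en t) \<le> integral {a..b} (en 0) + D * (\<omega> a + \<omega> b)"
    by blast
  have w1: "(\<lambda>n. \<omega> (real n)) \<longlonglongrightarrow> 0" and w2: "(\<lambda>n. \<omega> (- real n)) \<longlonglongrightarrow> 0"
    using weight_tendsto_0[OF \<omega>(1), of 1] weight_tendsto_0[OF \<omega>(1), of "-1"] by auto
  have en_cont_x: "continuous_on S (en t)" for S by (rule cont_slice_x[OF en_cont t])
  have en_int: "en t integrable_on {a..b}" for a b by (intro integrable_continuous_interval en_cont_x)
  \<comment> \<open>The boundary terms at the ends of [-n, n] disappear in the limit, so the energy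
    on every interval is at most E0.\<close>
  have lim: "(\<lambda>n. E0 + D * (\<omega> (- real n) + \<omega> (real n))) \<longlonglongrightarrow> E0"
    by (rule tendsto_eq_intros w1 w2 refl | simp)+
  have Ebd: "integral {a..b} (en t) \<le> E0" for a b
  proof (rule LIMSEQ_le_const[OF lim], intro exI allI impI)
    fix n assume n: "nat \<lceil>max \<bar>a\<bar> \<bar>b\<bar>\<rceil> \<le> n"
    then have "{a..b} \<subseteq> {- real n..real n}" by auto
    then have "integral {a..b} (en t) \<le> integral {- real n..real n} (en t)"
      by (intro integral_subset_le en_int) (auto simp: en_nonneg)
    also have "\<dots> \<le> integral {- real n..real n} (en 0) + D * (\<omega> (- real n) + \<omega> (real n))"
      by (rule D[OF t]) auto
    also have "integral {- real n..real n} (en 0) \<le> E0" using E0[of n] by (simp add: en_def[abs_def] init)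
    finally show "integral {a..b} (en t) \<le> E0 + D * (\<omega> (- real n) + \<omega> (real n))" by simp
  qed
  have E00: "0 \<le> E0" using Ebd[of 0 "-1"] by simp
  have Ubd: "\<bar>U t x\<bar> \<le> sqrt (2 * E0 / l)" for x
  proof -
    have "(U t x)\<^sup>2 \<le> 2 * E0 / l"
    proof (rule LIMSEQ_le_const)
      have "(\<lambda>n. U t (- real n)) \<longlonglongrightarrow> 0"
      proof (rule Lim_null_comparison[OF always_eventually])
        show "\<forall>n. norm (U t (- real n)) \<le> C * \<omega> (- real n)" using C t by simp
        show "(\<lambda>n. C * \<omega> (- real n)) \<longlonglongrightarrow> 0" using w2 by (rule tendsto_mult_right_zero)
      qed
      then show "(\<lambda>n. (U t (- real n))\<^sup>2 + 2 * E0 / l) \<longlonglongrightarrow> 2 * E0 / l"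
        by (auto intro!: tendsto_eq_intros)
      show "\<exists>N. \<forall>n\<ge>N. (U t x)\<^sup>2 \<le> (U t (- real n))\<^sup>2 + 2 * E0 / l"
      proof (intro exI allI impI)
        fix n assume "nat \<lceil>\<bar>x\<bar>\<rceil> \<le> n"
        then have le: "- real n \<le> x" by linarith
        have "((\<lambda>y. 2 * U t y * (Q t y * J t y)) has_integral ((U t x)\<^sup>2 - (U t (- real n))\<^sup>2)) {- real n..x}"
        proof (rule fundamental_theorem_of_calculus[OF le])
          fix y
          have "((\<lambda>y. (U t y)\<^sup>2) has_real_derivative 2 * U t y * (Q t y * J t y)) (at y)"
            by (rule derivative_eq_intros U_x[OF t] refl)+ simp
          then show "((\<lambda>y. (U t y)\<^sup>2) has_vector_derivative 2 * U t y * (Q t y * J t y)) (at y within {- real n..x})"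
            by (simp add: has_real_derivative_iff_has_vector_derivative has_vector_derivative_at_within)
        qed
        moreover have "((\<lambda>y. 2 / l * en t y) has_integral (2 / l * integral {- real n..x} (en t))) {- real n..x}"
          by (intro has_integral_mult_right integrable_integral en_int)
        ultimately have "(U t x)\<^sup>2 - (U t (- real n))\<^sup>2 \<le> 2 / l * integral {- real n..x} (en t)"
        proof (rule has_integral_le)
          fix y
          \<comment> \<open>From (U - l Q)^2 \<ge> 0; this scaling makes the right-hand side exactly
            twice the energy density after multiplication by the Jacobian.\<close>
          have "2 * U t y * Q t y * l \<le> (U t y)\<^sup>2 + l\<^sup>2 * (Q t y)\<^sup>2"
            using zero_le_power2[of "U t y - l * Q t y"] by (simp add: power2_eq_square algebra_simps)
          then have "2 * U t y * Q t y * l * J t y \<le> ((U t y)\<^sup>2 + l\<^sup>2 * (Q t y)\<^sup>2) * J t y"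
            using J_pos[of t y] by (intro mult_right_mono) auto
          then show "2 * U t y * (Q t y * J t y) \<le> 2 / l * en t y"
            using l_pos by (simp add: en_def field_simps)
        qed
        also have "\<dots> \<le> 2 / l * E0" using l_pos by (intro mult_left_mono Ebd) auto
        finally show "(U t x)\<^sup>2 \<le> (U t (- real n))\<^sup>2 + 2 * E0 / l" by simp
      qed
    qed
    then show ?thesis using real_sqrt_le_mono[of "(U t x)\<^sup>2"] by simp
  qed
  then show "\<bar>U t x\<bar> \<le> sqrt (2 * E0 / l)" .
  have F20: "0 < F2" using F2[of 0] f2_pos[of 0] E00 l_pos by auto
  have rho_le: "apply_bcontfun (rho (X t)) y \<le> 4 * F2 / l\<^sup>2 * en t y" for y
  proof -
    have "f2 (U t y) * (\<kappa> (Q t y) * J t y) \<le> F2 * (2 * (Q t y)\<^sup>2 * J t y)"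
      using F2[OF Ubd] F20 \<kappa>_bounds[of "Q t y"] J_pos[of t y] by (intro mult_mono) auto
    also have "\<dots> = 4 * F2 / l\<^sup>2 * ((1 / 2 * l\<^sup>2 * (Q t y)\<^sup>2) * J t y)" using l_pos by (simp add: field_simps)
    also have "\<dots> \<le> 4 * F2 / l\<^sup>2 * en t y"
      unfolding en_def using F20 J_pos[of t y] by (intro mult_left_mono mult_right_mono) auto
    finally show ?thesis by (simp add: rho_apply U_def Q_def J_def)
  qed
  have hB: "integral {a..b} (\<lambda>y. 4 * F2 / l\<^sup>2 * en t y) \<le> 4 * F2 / l\<^sup>2 * E0" for a b
    using mult_left_mono[OF Ebd[of a b], of "4 * F2 / l\<^sup>2"] F20 by simp
  have kle: "indicator {..x} y * exp (- (flowmap L x - flowmap L y) / l) \<le> 1" for L x y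
  proof (cases "y \<le> x")
    case True
    then have "0 \<le> exp (- norm L) * (x - y)" by simp
    then have "0 \<le> flowmap L x - flowmap L y" using flowmap_diff_ge[OF order_refl True, of L] by linarith
    then have "- (flowmap L x - flowmap L y) / l \<le> 0" using l_pos by (intro divide_nonpos_pos) auto
    then show ?thesis using True by simp
  qed simp
  have kr: "indicator {..x} y * exp (- (flowmap L x - flowmap L y) / l) * r \<le> r" if "0 \<le> r" for L x y r
    using mult_right_mono[OF kle that, of x y L] by simp
  have Il: "apply_bcontfun (Ileft (X t)) x \<le> 4 * F2 / l\<^sup>2 * E0"
    unfolding Ileft_apply kint_def
  proof (rule integral_le_of_expanding[OF kernel_integrable[OF l_pos] _ _ hB])
    show "indicator {..x} y * exp (- (flowmap (snd (snd (X t))) x - flowmap (snd (snd (X t))) y) / l) * apply_bcontfun (rho (X t)) y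
        \<le> 4 * F2 / l\<^sup>2 * en t y" for y
      by (rule order_trans[OF kr[OF rho_nonneg] rho_le])
  qed (intro continuous_intros en_cont_x)
  have Ir: "apply_bcontfun (Iright (X t)) x \<le> 4 * F2 / l\<^sup>2 * E0"
    unfolding Iright_apply kint_def
  proof (rule integral_le_of_expanding[OF kernel_integrable[OF l_pos]])
    show "indicator {..- x} y * exp (- (flowmap (brefl (snd (snd (X t)))) (- x) - flowmap (brefl (snd (snd (X t)))) y) / l) * apply_bcontfun (brefl (rho (X t))) y
        \<le> 4 * F2 / l\<^sup>2 * en t (- y)" for y
      unfolding brefl_apply by (rule order_trans[OF kr[OF rho_nonneg] rho_le])
    show "continuous_on UNIV (\<lambda>y. 4 * F2 / l\<^sup>2 * en t (- y))"
      by (intro continuous_intros continuous_on_compose2[OF en_cont_x[of UNIV]]) auto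
    have rr: "integral {- real n..real n} (\<lambda>y. 4 * F2 / l\<^sup>2 * en t (- y)) = integral {- real n..real n} (\<lambda>y. 4 * F2 / l\<^sup>2 * en t y)" for n
      using Henstock_Kurzweil_Integration.integral_reflect_real[of "real n" "- real n" "\<lambda>y. 4 * F2 / l\<^sup>2 * en t y"] by simp
    show "integral {- real n..real n} (\<lambda>y. 4 * F2 / l\<^sup>2 * en t (- y)) \<le> 4 * F2 / l\<^sup>2 * E0" for n
      unfolding rr by (rule hB)
  qed
  have "P t x \<le> (4 * F2 / l\<^sup>2 * E0 + 4 * F2 / l\<^sup>2 * E0) / (4 * l)"
    unfolding P_def Pop_apply using Il Ir l_pos by (intro divide_right_mono add_mono) auto
  then show "P t x \<le> 2 * F2 * E0 / l ^ 3" using l_pos by (simp add: power2_eq_square power3_eq_cube field_simps)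
qed

text \<open>Linear growth, case by case: below the threshold \<psi>(q) = 2 |q| / \<epsilon> - 1 /
  \<epsilon>^2; between the threshold and 0 one factor of q^2 is at most 1/\<epsilon>; for positive
  q it is at most B. Without the cut-off the first case would be quadratic.\<close>

lemma \<psi>_le: "q \<le> B \<Longrightarrow> 0 \<le> B \<Longrightarrow> \<psi> q \<le> (2 / \<epsilon> + B) * \<bar>q\<bar>"
proof -
  assume q: "q \<le> B" and B: "0 \<le> B"
  have e: "0 < 1 / \<epsilon>" using \<epsilon>_pos by simp
  consider "q \<le> - 1 / \<epsilon>" | "- 1 / \<epsilon> < q" "q \<le> 0" | "0 < q" by linarith
  then show ?thesis
  proof cases
    case 1
    then have "\<bar>q\<bar> = - q" using e by linarith
    then have "\<psi> q = 2 / \<epsilon> * \<bar>q\<bar> - (1 / \<epsilon>)\<^sup>2"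
      using 1 by (simp add: \<psi>_def chi_def power2_eq_square algebra_simps)
    moreover have "0 \<le> B * \<bar>q\<bar>" "0 \<le> (1 / \<epsilon>)\<^sup>2" using B by auto
    ultimately show ?thesis unfolding distrib_right by linarith
  next
    case 2
    then have "\<psi> q = \<bar>q\<bar> * \<bar>q\<bar>" by (simp add: \<psi>_def chi_def power2_eq_square)
    also have "\<dots> \<le> (2 / \<epsilon> + B) * \<bar>q\<bar>" using 2 e B by (intro mult_right_mono) auto
    finally show ?thesis .
  next
    case 3
    then have "\<not> q \<le> - 1 / \<epsilon>" using e by linarith
    with 3 have "\<psi> q = \<bar>q\<bar> * \<bar>q\<bar>" by (simp add: \<psi>_def chi_def power2_eq_square)
    also have "\<bar>q\<bar> \<le> 2 / \<epsilon> + B" using 3 e q by linarith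
    then have "\<bar>q\<bar> * \<bar>q\<bar> \<le> (2 / \<epsilon> + B) * \<bar>q\<bar>" by (intro mult_right_mono) auto
    finally show ?thesis .
  qed
qed

text \<open>The slope never exceeds its initial supremum because its time derivative is nonpositive.
  With this upper bound \<psi> grows linearly, so Gronwall bounds the slope from both sides;
  integrating f''(u) q then bounds the logarithm of the Jacobian. The constants involve T1 instead
  of T so as to be uniform over all shorter intervals.\<close>

lemma apriori_norm:
  assumes Ub: "\<And>t x. t \<in> {0..T} \<Longrightarrow> \<bar>U t x\<bar> \<le> B" and Pb: "\<And>t x. t \<in> {0..T} \<Longrightarrow> P t x \<le> p"
    and F2: "\<And>v. \<bar>v\<bar> \<le> B \<Longrightarrow> f2 v \<le> F2" and p0: "0 \<le> p" and T1: "T \<le> T1"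
    and k: "k = F2 * (2 / \<epsilon> + norm Q0) / 2" and qm: "qm = 2 * (norm Q0 + p * T1) * exp (2 * k * T1)"
  shows "norm (X T) \<le> B + (qm + 2 * (F2 * qm * T1))"
proof -
  have B0: "0 \<le> B" using Ub[of 0 0] T by auto
  have F20: "0 < F2" using F2[of 0] f2_pos[of 0] B0 by auto
  have k0: "0 \<le> k" using F20 \<epsilon>_pos unfolding k by (intro divide_nonneg_nonneg mult_nonneg_nonneg) auto
  have e: "0 < 1 / \<epsilon>" using \<epsilon>_pos by simp
  have Qup: "Q t x \<le> norm Q0" if t: "t \<in> {0..T}" for t x
  proof -
    have "Q t x - Q 0 x \<le> integral {0..t} (\<lambda>_. 0)"
    proof (rule has_integral_le[OF FTC_t[OF t Q_t] integrable_integral])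
      fix s
      have "0 \<le> f2 (U s x) * \<psi> (Q s x)" using f2_pos[of "U s x"] \<psi>_bounds by simp
      then show "- 1 / 2 * f2 (U s x) * \<psi> (Q s x) - P s x \<le> 0" using P_nonneg[of s x] by simp
    qed auto
    then show ?thesis using abs_le_norm_bcontfun[of Q0 x] by (simp add: init)
  qed
  have Qb: "\<bar>Q t x\<bar> \<le> qm" if t: "t \<in> {0..T}" for t x
  proof -
    have "norm (Q t x) \<le> 2 * (norm (Q 0 x) + p * T) * exp (2 * k * t)"
    proof (rule gronwall[OF T, where x'="\<lambda>t. - 1 / 2 * f2 (U t x) * \<psi> (Q t x) - P t x"])
      show "((\<lambda>t. Q t x) has_vector_derivative - 1 / 2 * f2 (U s x) * \<psi> (Q s x) - P s x) (at s within {0..T})" if "s \<in> {0..T}" for s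
        using Q_t[OF that] by (simp add: has_real_derivative_iff_has_vector_derivative)
      fix s assume s: "s \<in> {0..T}"
      have "f2 (U s x) * \<psi> (Q s x) \<le> F2 * ((2 / \<epsilon> + norm Q0) * \<bar>Q s x\<bar>)"
        using F2[OF Ub[OF s]] F20 \<psi>_bounds(1) \<psi>_le[OF Qup[OF s]] by (intro mult_mono) auto
      moreover have "0 \<le> f2 (U s x) * \<psi> (Q s x)" using f2_pos[of "U s x"] \<psi>_bounds by simp
      moreover have "- 1 / 2 * f2 (U s x) * \<psi> (Q s x) = - (f2 (U s x) * \<psi> (Q s x) / 2)" by simp
      moreover have "\<bar>- 1 / 2 * a * b' - b\<bar> \<le> m / 2 + p" if "a * b' \<le> m" "0 \<le> a * b'" "0 \<le> b" "b \<le> p" for a b b' m :: real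
        using that by (simp add: abs_le_iff)
      ultimately have "\<bar>- 1 / 2 * f2 (U s x) * \<psi> (Q s x) - P s x\<bar> \<le> F2 * ((2 / \<epsilon> + norm Q0) * \<bar>Q s x\<bar>) / 2 + p"
        using P_nonneg[of s x] Pb[OF s, of x] by blast
      then show "norm (- 1 / 2 * f2 (U s x) * \<psi> (Q s x) - P s x) \<le> k * norm (Q s x) + p"
        by (simp add: k)
    qed (use k0 p0 t in auto)
    also have "\<dots> \<le> 2 * (norm Q0 + p * T1) * exp (2 * k * T1)"
    proof -
      have "norm (Q 0 x) + p * T \<le> norm Q0 + p * T1"
        using abs_le_norm_bcontfun[of Q0 x] p0 T1 by (auto simp: init intro!: add_mono mult_left_mono)
      moreover have "exp (2 * k * t) \<le> exp (2 * k * T1)" using k0 t T1 by (auto intro!: mult_left_mono)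
      moreover have "0 \<le> p * T" using p0 T by simp
      ultimately show ?thesis by (intro mult_mono) (auto simp: add_nonneg_nonneg)
    qed
    finally show ?thesis by (simp add: qm)
  qed
  have qm0: "0 \<le> qm" using Qb[of 0 0] T by auto
  have Lb: "\<bar>apply_bcontfun (snd (snd (X t))) x\<bar> \<le> 2 * (F2 * qm * T1)" if t: "t \<in> {0..T}" for t x
  proof -
    have "norm (apply_bcontfun (snd (snd (X t))) x) \<le> 2 * (norm (apply_bcontfun (snd (snd (X 0))) x) + (F2 * qm) * T) * exp (2 * 0 * t)"
    proof (rule gronwall[OF T, where x'="\<lambda>t. f2 (U t x) * Q t x"])
      show "((\<lambda>t. apply_bcontfun (snd (snd (X t))) x) has_vector_derivative f2 (U s x) * Q s x) (at s within {0..T})" if "s \<in> {0..T}" for s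
        using comp_deriv(3)[OF that] by (simp add: has_real_derivative_iff_has_vector_derivative vf_def nem_f2 U_def Q_def)
      show "norm (f2 (U s x) * Q s x) \<le> 0 * norm (apply_bcontfun (snd (snd (X s))) x) + F2 * qm" if s: "s \<in> {0..T}" for s
        using F2[OF Ub[OF s]] F20 Qb[OF s] f2_pos[of "U s x"] by (auto simp: abs_mult intro!: mult_mono)
    qed (use F20 qm0 t in auto)
    also have "\<dots> \<le> 2 * (F2 * qm * T1)" using T1 F20 qm0 by (auto simp: X0 intro!: mult_left_mono)
    finally show ?thesis by simp
  qed
  have "norm (X T) \<le> norm (fst (X T)) + (norm (fst (snd (X T))) + norm (snd (snd (X T))))"
    using norm_Pair_le[of "fst (X T)" "snd (X T)"] norm_Pair_le[of "fst (snd (X T))" "snd (snd (X T))"] by simp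
  also have "\<dots> \<le> B + (qm + 2 * (F2 * qm * T1))"
    using Ub[of T] Qb[of T] Lb[of T] T unfolding U_def Q_def by (intro add_mono norm_bound) auto
  finally show ?thesis .
qed

end

theorem (in reg_law) lagrangian_global:
  assumes d: "\<And>x. (apply_bcontfun U0 has_real_derivative apply_bcontfun Q0 x) (at x)"
    and w: "\<And>\<beta>. 0 < \<beta> \<Longrightarrow> \<exists>\<omega>. weight \<beta> \<omega> \<and> (\<forall>x. \<bar>apply_bcontfun U0 x\<bar> \<le> \<omega> x \<and> \<bar>apply_bcontfun Q0 x\<bar> \<le> \<omega> x)"
  shows "\<exists>X. X 0 = (U0, Q0, 0) \<and> ode_sol vf {0..} X"
proof (rule ode_global_from_apriori_bounds[OF lip_vf])
  obtain \<omega> where \<omega>: "weight 1 \<omega>" "\<And>x. \<bar>apply_bcontfun U0 x\<bar> \<le> \<omega> x \<and> \<bar>apply_bcontfun Q0 x\<bar> \<le> \<omega> x"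
    using w[of 1] by auto
  \<comment> \<open>An upper bound for the initial energy, read off from one fixed weight.\<close>
  define E0 where "E0 = (LINT x|lborel. (1 / 2 + 1 / 2 * l\<^sup>2) * (\<omega> x)\<^sup>2)"
  have int: "integrable lborel (\<lambda>x. (\<omega> x)\<^sup>2)" using \<omega>(1) by (simp add: weight_def)
  have E0: "integral {- real n..real n} (\<lambda>x. 1 / 2 * (apply_bcontfun U0 x)\<^sup>2 + 1 / 2 * l\<^sup>2 * (apply_bcontfun Q0 x)\<^sup>2) \<le> E0" for n
    unfolding E0_def
  proof (rule integral_Icc_le_LINT)
    fix x
    have "(apply_bcontfun U0 x)\<^sup>2 \<le> (\<omega> x)\<^sup>2" "(apply_bcontfun Q0 x)\<^sup>2 \<le> (\<omega> x)\<^sup>2"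
      using \<omega>(2)[of x] abs_ge_zero[of "apply_bcontfun U0 x"] by (auto intro!: abs_le_square_iff[THEN iffD1])
    then have "1 / 2 * (apply_bcontfun U0 x)\<^sup>2 + 1 / 2 * l\<^sup>2 * (apply_bcontfun Q0 x)\<^sup>2 \<le> 1 / 2 * (\<omega> x)\<^sup>2 + 1 / 2 * l\<^sup>2 * (\<omega> x)\<^sup>2"
      by (intro add_mono mult_left_mono) auto
    then show "1 / 2 * (apply_bcontfun U0 x)\<^sup>2 + 1 / 2 * l\<^sup>2 * (apply_bcontfun Q0 x)\<^sup>2 \<le> (1 / 2 + 1 / 2 * l\<^sup>2) * (\<omega> x)\<^sup>2"
      by (simp add: algebra_simps)
  qed (use int in \<open>auto intro!: continuous_intros\<close>)
  define B where "B = sqrt (2 * E0 / l)"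
  obtain F2 where F20: "0 \<le> F2" and F2': "\<And>v. norm v \<le> B \<Longrightarrow> norm (f2 v) \<le> F2"
    using lip_on_balls_bounded[OF lip_f2] by blast
  have F2: "f2 v \<le> F2" if "\<bar>v\<bar> \<le> B" for v
    by (rule order_trans[OF abs_ge_self]) (use F2'[of v] that in simp)
  define p where "p = 2 * F2 * E0 / l ^ 3"
  have E00: "0 \<le> E0" unfolding E0_def by (intro Bochner_Integration.integral_nonneg) auto
  then have p0: "0 \<le> p" using F20 l_pos by (simp add: p_def)
  fix T1 :: real assume T1: "0 \<le> T1"
  define k where "k = F2 * (2 / \<epsilon> + norm Q0) / 2"
  define qm where "qm = 2 * (norm Q0 + p * T1) * exp (2 * k * T1)"
  show "\<exists>R. \<forall>\<tau> x. 0 \<le> \<tau> \<longrightarrow> \<tau> \<le> T1 \<longrightarrow> x 0 = (U0, Q0, 0) \<longrightarrow> ode_sol vf {0..\<tau>} x \<longrightarrow> norm (x \<tau>) \<le> R"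
  proof (intro exI[of _ "B + (qm + 2 * (F2 * qm * T1))"] allI impI)
    fix \<tau> X assume "0 \<le> \<tau>" "\<tau> \<le> T1" "X 0 = (U0, Q0, 0)" "ode_sol vf {0..\<tau>} X"
    then interpret lagrangian f f1 f2 f3 f4 c l \<epsilon> \<tau> X U0 Q0 by unfold_locales (use d in auto)
    have Ub: "\<bar>U t x\<bar> \<le> B" and Pb: "P t x \<le> p" if "t \<in> {0..\<tau>}" for t x
      using apriori[OF w E0 F2[unfolded B_def] that, of x] by (auto simp: B_def p_def)
    show "norm (X \<tau>) \<le> B + (qm + 2 * (F2 * qm * T1))"
      by (rule apriori_norm[OF Ub Pb F2 p0 \<open>\<tau> \<le> T1\<close> k_def qm_def])
  qed
qed

section \<open>Jointly continuous fields and their time integrals\<close>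

abbreviation jcont :: "(real \<Rightarrow> real \<Rightarrow> real) \<Rightarrow> bool" where
  "jcont g \<equiv> continuous_on UNIV (\<lambda>p. g (fst p) (snd p))"

lemma jcont_comp:
  assumes "jcont g" "continuous_on A a" "continuous_on A b" shows "continuous_on A (\<lambda>z. g (a z) (b z))"
  using continuous_on_compose2[OF assms(1) continuous_on_Pair[OF assms(2,3)]] by simp

lemma jcont_outer:
  assumes "continuous_on UNIV h" "jcont g" shows "jcont (\<lambda>t x. h (g t x))"
  by (rule continuous_on_compose2[OF assms]) auto

lemma jcont_bounded:
  assumes g: "jcont g"
  shows "\<exists>B\<ge>0. \<forall>t\<in>{a..b}. \<forall>x\<in>{c..d}. \<bar>g t x\<bar> \<le> B"
proof -
  have "bounded ((\<lambda>p. g (fst p) (snd p)) ` ({a..b} \<times> {c..d}))"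
    by (intro compact_imp_bounded compact_continuous_image continuous_on_subset[OF g] compact_Times) auto
  then obtain B where B: "\<forall>z\<in>(\<lambda>p. g (fst p) (snd p)) ` ({a..b} \<times> {c..d}). norm z \<le> B" unfolding bounded_iff by blast
  have "\<bar>g t x\<bar> \<le> max B 0" if "t \<in> {a..b}" "x \<in> {c..d}" for t x
  proof -
    have "norm (g (fst (t, x)) (snd (t, x))) \<le> B" using B that by blast
    then show ?thesis by simp
  qed
  then show ?thesis by (intro exI[of _ "max B 0"]) auto
qed

lemma jcont_unif:
  assumes g: "jcont g" and \<delta>: "0 < \<delta>"
  shows "\<exists>d>0. \<forall>s\<in>{0..T}. \<forall>h. \<bar>h\<bar> < d \<longrightarrow> \<bar>g s (x + h) - g s x\<bar> < \<delta>"
proof -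
  have "uniformly_continuous_on ({0..T} \<times> {x - 1..x + 1}) (\<lambda>p. g (fst p) (snd p))"
    by (intro compact_uniformly_continuous continuous_on_subset[OF g] compact_Times) auto
  then obtain d where d: "0 < d" "\<And>p q. p \<in> {0..T} \<times> {x - 1..x + 1} \<Longrightarrow> q \<in> {0..T} \<times> {x - 1..x + 1} \<Longrightarrow> dist q p < d
      \<Longrightarrow> dist (g (fst q) (snd q)) (g (fst p) (snd p)) < \<delta>"
    using \<delta> unfolding uniformly_continuous_on_def by metis
  have "\<bar>g s (x + h) - g s x\<bar> < \<delta>" if "s \<in> {0..T}" "\<bar>h\<bar> < min d 1" for s h
  proof -
    have "dist (s, x + h) (s, x) < d" using that by (simp add: dist_Pair_Pair dist_real_def)
    then have "dist (g (fst (s, x + h)) (snd (s, x + h))) (g (fst (s, x)) (snd (s, x))) < \<delta>"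
      using that by (intro d(2)) auto
    then show ?thesis by (simp add: dist_real_def)
  qed
  then show ?thesis using d(1) by (intro exI[of _ "min d 1"]) auto
qed

text \<open>The first-order Taylor remainder is small uniformly in time on compact intervals, the
  form in which it can be inserted into Gronwall's inequality.\<close>

lemma jcont_unif_deriv:
  assumes d: "\<And>s x. (g s has_real_derivative gx s x) (at x)" and gx: "jcont gx" and \<delta>: "0 < \<delta>"
  shows "\<exists>d>0. \<forall>s\<in>{0..T}. \<forall>h. \<bar>h\<bar> < d \<longrightarrow> \<bar>g s (x + h) - g s x - h * gx s x\<bar> \<le> \<delta> * \<bar>h\<bar>"
proof -
  obtain e where e: "0 < e" "\<And>s h. s \<in> {0..T} \<Longrightarrow> \<bar>h\<bar> < e \<Longrightarrow> \<bar>gx s (x + h) - gx s x\<bar> < \<delta>"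
    using jcont_unif[OF gx \<delta>] by blast
  have "\<bar>g s (x + h) - g s x - h * gx s x\<bar> \<le> \<delta> * \<bar>h\<bar>" if s: "s \<in> {0..T}" and h: "\<bar>h\<bar> < e" for s h
  proof -
    have "norm ((g s (x + h) - (x + h) * gx s x) - (g s x - x * gx s x)) \<le> \<delta> * norm ((x + h) - x)"
    proof (rule field_differentiable_bound[of "cball x \<bar>h\<bar>" _ "\<lambda>z. gx s z - gx s x"])
      fix z assume z: "z \<in> cball x \<bar>h\<bar>"
      show "((\<lambda>z. g s z - z * gx s x) has_field_derivative gx s z - gx s x) (at z within cball x \<bar>h\<bar>)"
        by (rule has_field_derivative_at_within) (auto intro!: derivative_eq_intros d)
      have "\<bar>z - x\<bar> < e" using z h by (auto simp: dist_real_def)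
      then show "norm (gx s z - gx s x) \<le> \<delta>" using e(2)[OF s, of "z - x"] by simp
    qed (auto simp: dist_real_def)
    then show ?thesis by (simp add: algebra_simps)
  qed
  then show ?thesis using e(1) by blast
qed

text \<open>\<open>max 0 t\<close> makes the integral vanish for negative times, so that it is
  jointly continuous on the whole plane and no side condition on t has to be carried along.\<close>

definition tint :: "(real \<Rightarrow> real \<Rightarrow> real) \<Rightarrow> real \<Rightarrow> real \<Rightarrow> real" where
  "tint g t x = integral {0..max 0 t} (\<lambda>s. g s x)"

lemma jcont_slice: "jcont g \<Longrightarrow> continuous_on A (\<lambda>s. g s x)" "jcont g \<Longrightarrow> continuous_on A (g s)"
proof -
  assume g: "jcont g"
  show "continuous_on A (\<lambda>s. g s x)" by (intro jcont_comp[OF g] continuous_intros)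
  show "continuous_on A (g s)" using jcont_comp[OF g, of A "\<lambda>_. s" "\<lambda>x. x"] by (simp add: continuous_intros)
qed

lemma tint_0 [simp]: "tint g 0 x = 0"
  by (simp add: tint_def)

lemma tint_jcont:
  assumes g: "jcont g" shows "jcont (tint g)"
proof -
  \<comment> \<open>Rescaling to the unit interval moves t from the limit of integration into the
    integrand, where continuity in parameters applies.\<close>
  have eq: "tint g t x = max 0 t * integral {0..1} (\<lambda>\<sigma>. g (max 0 t * \<sigma>) x)" for t x
  proof (cases "0 < t")
    case True
    have "((\<lambda>\<sigma>. g (t * \<sigma>) x) has_integral (1 / t) *\<^sub>R integral {0..t} (\<lambda>s. g s x)) {0..1}"
      using has_integral_affinity[of "\<lambda>s. g s x" "integral {0..t} (\<lambda>s. g s x)" 0 t t 0] True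
        integrable_continuous_interval[OF jcont_slice(1)[OF g, of "{0..t}" x]]
      by (simp add: integrable_integral)
    then show ?thesis using True by (simp add: tint_def integral_unique)
  qed (simp add: tint_def)
  have "continuous_on UNIV (\<lambda>p. integral (cbox 0 1) (\<lambda>\<sigma>. g (max 0 (fst p) * \<sigma>) (snd p)))"
  proof (rule integral_continuous_on_param)
    show "continuous_on (UNIV \<times> cbox 0 1) (\<lambda>(p, \<sigma>). g (max 0 (fst p) * \<sigma>) (snd p))"
      unfolding split_beta by (intro jcont_comp[OF g] continuous_intros)
  qed
  then show ?thesis unfolding eq cbox_interval by (intro continuous_intros) auto
qed

lemma tint_t:
  assumes g: "jcont g" and t: "0 \<le> t"
  shows "((\<lambda>s. tint g s x) has_real_derivative g t x) (at t within {0..})"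
proof -
  have "((\<lambda>u. integral {0..u} (\<lambda>s. g s x)) has_real_derivative g t x) (at t within {0..t+1})"
    using t by (intro integral_has_real_derivative jcont_slice[OF g]) auto
  then have "((\<lambda>u. tint g u x) has_real_derivative g t x) (at t within {0..t+1})"
    unfolding has_real_derivative_iff_has_vector_derivative
    by (rule has_vector_derivative_transform[rotated 2]) (use t in \<open>auto simp: tint_def max_def\<close>)
  moreover have "at t within {0..t+1} = at t within {0..}"
    by (rule at_within_nhd[of _ "{..<t+1}"]) auto
  ultimately show ?thesis by simp
qed

lemma tint_x:
  assumes d: "\<And>s x. (g s has_real_derivative gx s x) (at x)" and g: "jcont g" and gx: "jcont gx"
  shows "(tint g t has_real_derivative tint gx t x) (at x)"
proof -
  have "((\<lambda>y. integral (cbox 0 (max 0 t)) (\<lambda>s. g s y)) has_real_derivative integral (cbox 0 (max 0 t)) (\<lambda>s. gx s x)) (at x within UNIV)"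
  proof (rule leibniz_rule_field_derivative)
    show "(\<lambda>s. g s y) integrable_on cbox 0 (max 0 t)" for y
      unfolding cbox_interval by (intro integrable_continuous_interval jcont_slice g)
    show "continuous_on (UNIV \<times> cbox 0 (max 0 t)) (\<lambda>(y, s). gx s y)"
      unfolding split_beta by (intro jcont_comp[OF gx] continuous_intros)
  qed (auto intro: d)
  then show ?thesis by (simp add: tint_def[abs_def])
qed

lemma tint_bound:
  assumes g: "jcont g" and b: "\<And>s. s \<in> {0..T} \<Longrightarrow> \<bar>g s x\<bar> \<le> B" and B: "0 \<le> B" and t: "t \<in> {0..T}"
  shows "\<bar>tint g t x\<bar> \<le> B * T"
proof -
  have "norm (integral {0..t} (\<lambda>s. g s x)) \<le> B * (t - 0)"
    using b t by (intro integral_bound jcont_slice g) auto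
  also have "\<dots> \<le> B * T" using t B by (intro mult_left_mono) auto
  finally show ?thesis using t by (simp add: tint_def max_def)
qed

lemma tint_antideriv:
  assumes d: "\<And>s. 0 \<le> s \<Longrightarrow> ((\<lambda>s. G s x) has_real_derivative g s x) (at s within {0..})" and t: "0 \<le> t"
  shows "tint g t x = G t x - G 0 x"
proof -
  have "((\<lambda>s. g s x) has_integral (G t x - G 0 x)) {0..t}"
    using t d unfolding has_real_derivative_iff_has_vector_derivative
    by (intro fundamental_theorem_of_calculus) (auto intro: has_vector_derivative_within_subset[of _ _ _ "{0..}"])
  then show ?thesis using t by (simp add: tint_def integral_unique)
qed

text \<open>\<open>S0\<close> and \<open>\<Theta>0\<close> are the second and third derivatives of
  the datum. The curve is frozen for negative times to make all fields continuous on the plane.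
  Weights of every rate are required because the admissible rate depends on the solution and on the
  time horizon.\<close>

locale global_lagrangian = reg_law +
  fixes X :: "real \<Rightarrow> (real \<Rightarrow>\<^sub>C real) \<times> (real \<Rightarrow>\<^sub>C real) \<times> (real \<Rightarrow>\<^sub>C real)"
    and U0 Q0 :: "real \<Rightarrow>\<^sub>C real" and S0 \<Theta>0 :: "real \<Rightarrow> real"
  assumes X0': "X 0 = (U0, Q0, 0)" and sol': "ode_sol vf {0..} X" and X_neg: "\<And>t. t \<le> 0 \<Longrightarrow> X t = X 0"
    and U0_d: "\<And>x. (apply_bcontfun U0 has_real_derivative apply_bcontfun Q0 x) (at x)"
    and Q0_d: "\<And>x. (apply_bcontfun Q0 has_real_derivative S0 x) (at x)"
    and S0_d: "\<And>x. (S0 has_real_derivative \<Theta>0 x) (at x)"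
    and \<Theta>0_cont: "continuous_on UNIV \<Theta>0"
    and weights: "\<And>\<beta>. 0 < \<beta> \<Longrightarrow> \<exists>\<omega>. weight \<beta> \<omega> \<and>
      (\<forall>x. \<bar>apply_bcontfun U0 x\<bar> \<le> \<omega> x \<and> \<bar>apply_bcontfun Q0 x\<bar> \<le> \<omega> x \<and> \<bar>S0 x\<bar> \<le> \<omega> x \<and> \<bar>\<Theta>0 x\<bar> \<le> \<omega> x)"
begin

lemma lag: "0 \<le> T \<Longrightarrow> lagrangian f f1 f2 f3 f4 c l \<epsilon> T X U0 Q0"
  by unfold_locales (use X0' U0_d in \<open>auto intro: ode_sol_subset[OF sol']\<close>)

text \<open>The fields do not involve the length of the interval, so the instance of length 0
  suffices to name them; facts at time t are then taken from \<open>lag\<close> on a longer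
  interval.\<close>

sublocale L0: lagrangian f f1 f2 f3 f4 c l \<epsilon> 0 X U0 Q0
  by (rule lag) simp

abbreviation "U \<equiv> L0.U"
abbreviation "Q \<equiv> L0.Q"
abbreviation "J \<equiv> L0.J"
abbreviation "P \<equiv> L0.P"
abbreviation "Px \<equiv> L0.Px"

lemma X_cont': "continuous_on UNIV X"
proof -
  have "continuous_on UNIV (\<lambda>t. X (max 0 t))"
    by (rule continuous_on_compose2[OF ode_sol_continuous[OF sol']]) (auto intro!: continuous_intros)
  moreover have "X (max 0 t) = X t" for t using X_neg[of t] by (simp add: max_def)
  ultimately show ?thesis by simp
qed

lemma jc_U: "jcont U" and jc_Q: "jcont Q" and jc_J: "jcont J" and jc_P: "jcont P" and jc_Px: "jcont Px"
proof -
  show "jcont U" "jcont Q" "jcont J"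
    unfolding L0.U_def L0.Q_def L0.J_def UNIV_Times_UNIV[symmetric]
    by (intro continuous_on_exp continuous_on_bcontfun_curve continuous_intros X_cont')+
  show "jcont P" "jcont Px"
    unfolding L0.P_def L0.Px_def UNIV_Times_UNIV[symmetric]
    by (intro continuous_on_bcontfun_curve continuous_on_compose2[OF lip_on_balls_imp_continuous[OF lip_Pop, of UNIV] X_cont']
        continuous_on_compose2[OF lip_on_balls_imp_continuous[OF lip_Pxop, of UNIV] X_cont']; simp)+
qed

lemma at_within_expand: "0 \<le> t \<Longrightarrow> at t within {0..t+1} = at t within {0..}" for t :: real
  by (rule at_within_nhd[of _ "{..<t+1}"]) auto

lemma U_t': "0 \<le> t \<Longrightarrow> ((\<lambda>s. U s x) has_real_derivative - l\<^sup>2 * Px t x) (at t within {0..})"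
  and Q_t': "0 \<le> t \<Longrightarrow> ((\<lambda>s. Q s x) has_real_derivative - 1 / 2 * f2 (U t x) * \<psi> (Q t x) - P t x) (at t within {0..})"
  and J_t': "0 \<le> t \<Longrightarrow> ((\<lambda>s. J s x) has_real_derivative f2 (U t x) * Q t x * J t x) (at t within {0..})"
  using lagrangian.U_t[OF lag, of "t + 1" t x] lagrangian.Q_t[OF lag, of "t + 1" t x] lagrangian.J_t[OF lag, of "t + 1" t x]
  by (simp_all add: at_within_expand)

lemma neg_eq: "t \<le> 0 \<Longrightarrow> U t = U 0" "t \<le> 0 \<Longrightarrow> Q t = Q 0" "t \<le> 0 \<Longrightarrow> J t = J 0"
  using X_neg[of t] by (auto simp: L0.U_def[abs_def] L0.Q_def[abs_def] L0.J_def[abs_def])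

lemma U_x': "(U t has_real_derivative Q t x * J t x) (at x)"
proof (cases "0 \<le> t")
  case True
  then show ?thesis using lagrangian.U_x[OF lag, of t t x] by simp
next
  case False
  then show ?thesis using neg_eq[of t] L0.U_x[of 0 x] by simp
qed

text \<open>The characteristic equation for the second space derivative reads S' = - a1 S - b1.\<close>

definition a1 where "a1 t x = f2 (U t x) * (2 * Q t x) - f2 (U t x) * min (Q t x + 1 / \<epsilon>) 0"
definition b1 where "b1 t x = 1 / 2 * f3 (U t x) * (Q t x * \<psi> (Q t x)) + Px t x"
text \<open>Solution of the linear equation by variation of constants: \<open>A1\<close> is the
  exponent of the integrating factor and \<open>I1\<close> the Duhamel term. \<open>S\<close> is
  defined in this way before it is known to be a derivative of Q.\<close>

definition A1 where "A1 = tint a1"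
definition I1 where "I1 = tint (\<lambda>s x. exp (A1 s x) * b1 s x)"
definition S where "S t x = exp (- A1 t x) * (S0 x - I1 t x)"

lemma \<psi>_cont: "continuous_on UNIV \<psi>" and \<kappa>_cont: "continuous_on UNIV \<kappa>"
  by (rule lip_on_balls_imp_continuous[OF lip_\<psi>] lip_on_balls_imp_continuous[OF lip_\<kappa>])+

lemmas jc_f = jcont_outer[OF f_cont(2) jc_U] jcont_outer[OF f_cont(3) jc_U] jcont_outer[OF f_cont(4) jc_U] jcont_outer[OF f4_cont jc_U]
lemmas jc_\<psi> = jcont_outer[OF \<psi>_cont jc_Q] jcont_outer[OF \<kappa>_cont jc_Q] jcont_outer[OF continuous_on_d\<psi> jc_Q]

lemma jc_a1: "jcont a1" and jc_b1: "jcont b1"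
  unfolding a1_def b1_def by (intro continuous_intros jc_f jc_\<psi> jc_Q jc_Px; simp)+

lemma jc_A1: "jcont A1"
  unfolding A1_def by (rule tint_jcont[OF jc_a1])

lemma jc_I1_integrand: "jcont (\<lambda>s x. exp (A1 s x) * b1 s x)"
  by (intro continuous_intros jc_A1 jc_b1)

lemma jc_I1: "jcont I1"
  unfolding I1_def by (rule tint_jcont[OF jc_I1_integrand])

lemma S0_cont: "continuous_on UNIV S0"
  using S0_d by (meson DERIV_isCont continuous_at_imp_continuous_on)

lemma jc_S: "jcont S"
  unfolding S_def by (intro continuous_intros jc_A1 jc_I1 continuous_on_compose2[OF S0_cont]) auto

lemma S_t: "0 \<le> t \<Longrightarrow> ((\<lambda>s. S s x) has_real_derivative - a1 t x * S t x - b1 t x) (at t within {0..})"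
proof -
  assume t: "0 \<le> t"
  have 1: "((\<lambda>s. A1 s x) has_real_derivative a1 t x) (at t within {0..})" unfolding A1_def by (rule tint_t[OF jc_a1 t])
  have 2: "((\<lambda>s. I1 s x) has_real_derivative exp (A1 t x) * b1 t x) (at t within {0..})"
    unfolding I1_def by (rule tint_t[OF jc_I1_integrand t])
  show ?thesis
    unfolding S_def
    by (rule DERIV_cong[OF DERIV_mult[OF DERIV_chain2[OF DERIV_exp DERIV_minus[OF 1]] DERIV_diff[OF DERIV_const 2]]])
      (simp add: exp_minus field_simps)
qed

lemma a1_alt: "a1 t x = f2 (U t x) * Q t x + 1 / 2 * f2 (U t x) * d\<psi> (Q t x)"
  by (simp add: a1_def d\<psi>_def dchi_alt algebra_simps)

lemma d\<psi>_lip: "\<bar>d\<psi> p - d\<psi> q\<bar> \<le> 4 * \<bar>p - q\<bar>"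
proof -
  define m where "m = 1 / \<epsilon>"
  have "\<bar>2 * min (p + m) 0 - 2 * min (q + m) 0\<bar> \<le> 2 * \<bar>p - q\<bar>" by (auto simp: min_def abs_if)
  moreover have "\<bar>2 * p - a - (2 * q - b)\<bar> \<le> 4 * \<bar>p - q\<bar>" if "\<bar>a - b\<bar> \<le> 2 * \<bar>p - q\<bar>" for a b
  proof -
    have eq: "2 * p - a - (2 * q - b) = 2 * (p - q) - (a - b)" by simp
    have "\<bar>2 * (p - q)\<bar> = 2 * \<bar>p - q\<bar>" unfolding abs_mult by simp
    then show ?thesis unfolding eq using that abs_triangle_ineq4[of "2 * (p - q)" "a - b"] by linarith
  qed
  ultimately show ?thesis unfolding d\<psi>_def dchi_alt m_def[symmetric] by blast
qed

lemma init': "U 0 x = apply_bcontfun U0 x" "Q 0 x = apply_bcontfun Q0 x" "J 0 x = 1" "S 0 x = S0 x"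
  using L0.init by (simp_all add: S_def A1_def I1_def)

lemma f2U_x: "((\<lambda>x. f2 (U t x)) has_real_derivative f3 (U t x) * (Q t x * J t x)) (at x)"
  by (rule DERIV_chain2[OF f2_d U_x'])

lemma \<psi>_mvt: obtains z where "\<psi> p - \<psi> q = d\<psi> z * (p - q)" "\<bar>z - q\<bar> \<le> \<bar>p - q\<bar>"
proof -
  consider "p < q" | "p = q" | "q < p" by linarith
  then show ?thesis
  proof cases
    case 1
    obtain z where "p < z" "z < q" "\<psi> q - \<psi> p = (q - p) * d\<psi> z" using MVT2[OF 1, of \<psi> d\<psi>] \<psi>_deriv by auto
    then show ?thesis by (intro that[of z]) (auto simp: algebra_simps)
  next
    case 2 then show ?thesis by (intro that[of q]) auto
  next
    case 3
    obtain z where "q < z" "z < p" "\<psi> p - \<psi> q = (p - q) * d\<psi> z" using MVT2[OF 3, of \<psi> d\<psi>] \<psi>_deriv by auto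
    then show ?thesis by (intro that[of z]) (auto simp: algebra_simps)
  qed
qed

text \<open>Q appears nonlinearly on the right of its own equation, so differentiating an integral
  formula would be circular. Instead Gronwall is applied to the remainder r = Q(x + h) - Q(x) - h W
  with W = S J, which solves the linearised equation. It suffices that \<psi> has a Lipschitz
  derivative, so the kink in that derivative does no harm here.\<close>

lemma Q_x_nonneg:
  assumes T: "0 \<le> T"
  shows "(Q T has_real_derivative S T x * J T x) (at x)"
proof -
  define W where "W t x = S t x * J t x" for t x
  obtain BQ where BQ: "0 \<le> BQ" "\<And>t y. t \<in> {0..T} \<Longrightarrow> y \<in> {x-1..x+1} \<Longrightarrow> \<bar>Q t y\<bar> \<le> BQ" using jcont_bounded[OF jc_Q] by blast
  obtain B\<psi> where B\<psi>: "0 \<le> B\<psi>" "\<And>t y. t \<in> {0..T} \<Longrightarrow> y \<in> {x-1..x+1} \<Longrightarrow> \<bar>\<psi> (Q t y)\<bar> \<le> B\<psi>" using jcont_bounded[OF jc_\<psi>(1)] by blast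
  obtain Bf where Bf: "0 \<le> Bf" "\<And>t y. t \<in> {0..T} \<Longrightarrow> y \<in> {x-1..x+1} \<Longrightarrow> \<bar>f2 (U t y)\<bar> \<le> Bf" using jcont_bounded[OF jc_f(2)] by blast
  have "jcont (\<lambda>t x. f3 (U t x) * (Q t x * J t x))" by (intro continuous_intros jc_f jc_Q jc_J)
  then obtain Bg where Bg: "0 \<le> Bg" "\<And>t y. t \<in> {0..T} \<Longrightarrow> y \<in> {x-1..x+1} \<Longrightarrow> \<bar>f3 (U t y) * (Q t y * J t y)\<bar> \<le> Bg"
    using jcont_bounded[of "\<lambda>t x. f3 (U t x) * (Q t x * J t x)" 0 T "x - 1" "x + 1"] by blast
  have "jcont W" unfolding W_def by (intro continuous_intros jc_S jc_J)
  then obtain BW where BW: "0 \<le> BW" "\<And>t y. t \<in> {0..T} \<Longrightarrow> y \<in> {x-1..x+1} \<Longrightarrow> \<bar>W t y\<bar> \<le> BW"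
    using jcont_bounded[of W 0 T "x - 1" "x + 1"] by blast
  define Bd where "Bd = 4 * (BQ + 2) + \<bar>d\<psi> 0\<bar>"
  have Bd: "\<bar>d\<psi> z\<bar> \<le> Bd" if "\<bar>z\<bar> \<le> BQ + 2" for z
  proof -
    have "\<bar>d\<psi> z\<bar> \<le> \<bar>d\<psi> 0\<bar> + \<bar>d\<psi> z - d\<psi> 0\<bar>" by linarith
    also have "\<dots> \<le> \<bar>d\<psi> 0\<bar> + 4 * \<bar>z\<bar>" using d\<psi>_lip[of z 0] by simp
    also have "\<dots> \<le> Bd" using that by (simp add: Bd_def)
    finally show ?thesis .
  qed
  have Bd0: "0 \<le> Bd" using BQ by (simp add: Bd_def)
  \<comment> \<open>One summand for each error that is small relative to h: the expansion of f''(u),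
    its product with the increment of \<psi>, the variation of d\<psi>, and the expansion of
    P.\<close>
  define K where "K = B\<psi> + Bg * Bd + 4 * Bf * BW + 1"
  have K: "0 < K" using B\<psi> Bg Bf BW Bd0 by (simp add: K_def add_nonneg_pos)
  define C where "C = Bf * Bd"
  have C0: "0 \<le> C" using Bf Bd0 by (simp add: C_def)
  have W_t: "((\<lambda>s. W s x) has_real_derivative (- 1 / 2 * f2 (U s x) * d\<psi> (Q s x) * W s x - 1 / 2 * (f3 (U s x) * (Q s x * J s x)) * \<psi> (Q s x) - Px s x * J s x)) (at s within {0..})"
    if s: "0 \<le> s" for s
    unfolding W_def
  proof (rule DERIV_cong[OF DERIV_mult[OF S_t[OF s] J_t'[OF s]]])
    show "(- a1 s x * S s x - b1 s x) * J s x + f2 (U s x) * Q s x * J s x * S s x =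
        - 1 / 2 * f2 (U s x) * d\<psi> (Q s x) * (S s x * J s x) - 1 / 2 * (f3 (U s x) * (Q s x * J s x)) * \<psi> (Q s x) - Px s x * J s x"
      unfolding a1_alt b1_def by (simp add: algebra_simps)
  qed
  have main: "\<exists>d>0. \<forall>h. \<bar>h\<bar> < d \<longrightarrow> \<bar>Q T (x + h) - Q T x - h * W T x\<bar> \<le> e * \<bar>h\<bar>" if e: "0 < e" for e
  proof -
    \<comment> \<open>The reciprocal of the final Gronwall constant, so that the remainder comes out
      below e |h|.\<close>
    define \<delta> where "\<delta> = e / (2 * exp (2 * C * T) * (1 + K * T))"
    have den: "0 < 2 * exp (2 * C * T) * (1 + K * T)" using K T by (simp add: add_pos_nonneg)
    have \<delta>: "0 < \<delta>" using e den by (simp add: \<delta>_def)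
    obtain d1 where d1: "0 < d1" "\<And>s h. s \<in> {0..T} \<Longrightarrow> \<bar>h\<bar> < d1 \<Longrightarrow> \<bar>Q s (x + h) - Q s x\<bar> < min \<delta> 1"
      using jcont_unif[OF jc_Q, of "min \<delta> 1"] \<delta> by (metis min_less_iff_conj zero_less_one)
    have "jcont (\<lambda>t x. f3 (U t x) * (Q t x * J t x))" by (intro continuous_intros jc_f jc_Q jc_J)
    then obtain d2 where d2: "0 < d2" "\<And>s h. s \<in> {0..T} \<Longrightarrow> \<bar>h\<bar> < d2 \<Longrightarrow>
        \<bar>f2 (U s (x + h)) - f2 (U s x) - h * (f3 (U s x) * (Q s x * J s x))\<bar> \<le> \<delta> * \<bar>h\<bar>"
      using jcont_unif_deriv[where g="\<lambda>t x. f2 (U t x)" and gx="\<lambda>t x. f3 (U t x) * (Q t x * J t x)", OF f2U_x _ \<delta>] by blast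
    have "jcont (\<lambda>t x. Px t x * J t x)" by (intro continuous_intros jc_Px jc_J)
    then obtain d3 where d3: "0 < d3" "\<And>s h. s \<in> {0..T} \<Longrightarrow> \<bar>h\<bar> < d3 \<Longrightarrow>
        \<bar>P s (x + h) - P s x - h * (Px s x * J s x)\<bar> \<le> \<delta> * \<bar>h\<bar>"
      using jcont_unif_deriv[where g=P and gx="\<lambda>t x. Px t x * J t x", OF L0.P_x _ \<delta>] by blast
    have "jcont (\<lambda>t x. S0 x)" by (rule continuous_on_compose2[OF S0_cont]) (auto intro!: continuous_intros)
    then obtain d4 where d4: "0 < d4" "\<And>s h. s \<in> {0..T} \<Longrightarrow> \<bar>h\<bar> < d4 \<Longrightarrow>
        \<bar>apply_bcontfun Q0 (x + h) - apply_bcontfun Q0 x - h * S0 x\<bar> \<le> \<delta> * \<bar>h\<bar>"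
      using jcont_unif_deriv[where g="\<lambda>t. apply_bcontfun Q0" and gx="\<lambda>t. S0", OF Q0_d _ \<delta>] by blast
    define d where "d = Min {d1, d2, d3, d4, 1}"
    have d0: "0 < d" using d1 d2 d3 d4 by (simp add: d_def)
    have "\<bar>Q T (x + h) - Q T x - h * W T x\<bar> \<le> e * \<bar>h\<bar>" if h: "\<bar>h\<bar> < d" for h
    proof -
      have hs: "\<bar>h\<bar> < d1" "\<bar>h\<bar> < d2" "\<bar>h\<bar> < d3" "\<bar>h\<bar> < d4" "\<bar>h\<bar> < 1" using h by (auto simp: d_def)
      have xin: "x \<in> {x-1..x+1}" "x + h \<in> {x-1..x+1}" using hs by auto
      define r where "r s = Q s (x + h) - Q s x - h * W s x" for s
      define r' where "r' s = (- 1 / 2 * f2 (U s (x + h)) * \<psi> (Q s (x + h)) - P s (x + h)) - (- 1 / 2 * f2 (U s x) * \<psi> (Q s x) - P s x)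
         - h * (- 1 / 2 * f2 (U s x) * d\<psi> (Q s x) * W s x - 1 / 2 * (f3 (U s x) * (Q s x * J s x)) * \<psi> (Q s x) - Px s x * J s x)" for s
      have rd: "(r has_vector_derivative r' s) (at s within {0..T})" if s: "s \<in> {0..T}" for s
      proof -
        have "(r has_real_derivative r' s) (at s within {0..})"
          unfolding r_def[abs_def] r'_def using s by (intro DERIV_diff DERIV_cmult Q_t' W_t) auto
        then show ?thesis unfolding has_real_derivative_iff_has_vector_derivative
          by (rule has_vector_derivative_within_subset) auto
      qed
      have rb: "norm (r' s) \<le> C * norm (r s) + K * (\<delta> * \<bar>h\<bar>)" if s: "s \<in> {0..T}" for s
      proof -
        obtain z where z: "\<psi> (Q s (x + h)) - \<psi> (Q s x) = d\<psi> z * (Q s (x + h) - Q s x)" "\<bar>z - Q s x\<bar> \<le> \<bar>Q s (x + h) - Q s x\<bar>"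
          using \<psi>_mvt by blast
        have Qd: "\<bar>Q s (x + h) - Q s x\<bar> < \<delta>" "\<bar>Q s (x + h) - Q s x\<bar> < 1" using d1(2)[OF s hs(1)] by auto
        have zb: "\<bar>d\<psi> z\<bar> \<le> Bd" using BQ(2)[OF s xin(1)] z(2) Qd by (intro Bd) linarith
        define F where "F = f2 (U s (x + h)) - f2 (U s x)"
        define g where "g = f3 (U s x) * (Q s x * J s x)"
        define pp where "pp = P s (x + h) - P s x - h * (Px s x * J s x)"
        define k where "k = f2 (U s x)"
        define V where "V = \<psi> (Q s (x + h)) - \<psi> (Q s x)"
        \<comment> \<open>The increment of the right-hand side minus h times its linearisation. Only
          the term with \<open>d\<psi> z * r s\<close> contains the remainder itself and becomes the
          Gronwall term; all others are of order \<delta> |h|.\<close>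
        have "r' s = - 1 / 2 * ((F - h * g) * \<psi> (Q s (x + h))) - 1 / 2 * (h * g * V)
            - 1 / 2 * (k * (d\<psi> z * r s)) - 1 / 2 * (k * ((d\<psi> z - d\<psi> (Q s x)) * (h * W s x))) - pp"
        proof -
          have V': "V = d\<psi> z * (r s + h * W s x)" using z(1) by (simp add: V_def r_def)
          have "r' s = - 1 / 2 * ((F - h * g) * \<psi> (Q s (x + h))) - 1 / 2 * (h * g * V)
            - 1 / 2 * (k * V) + 1 / 2 * (k * (d\<psi> (Q s x) * (h * W s x))) - pp"
            unfolding r'_def F_def g_def pp_def k_def V_def by (simp add: algebra_simps)
          then show ?thesis unfolding V' by (simp add: algebra_simps)
        qed
        then have "\<bar>r' s\<bar> \<le> \<bar>(F - h * g) * \<psi> (Q s (x + h))\<bar> + \<bar>h * g * V\<bar> + \<bar>k * (d\<psi> z * r s)\<bar> + \<bar>k * ((d\<psi> z - d\<psi> (Q s x)) * (h * W s x))\<bar> + \<bar>pp\<bar>"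
          by linarith
        moreover have "\<bar>(F - h * g) * \<psi> (Q s (x + h))\<bar> \<le> (\<delta> * \<bar>h\<bar>) * B\<psi>"
          unfolding abs_mult F_def g_def using d2(2)[OF s hs(2)] B\<psi>(2)[OF s xin(2)] \<delta> by (intro mult_mono) auto
        moreover have "\<bar>h * g * V\<bar> \<le> (\<bar>h\<bar> * Bg) * (Bd * \<delta>)"
        proof -
          have "\<bar>V\<bar> \<le> Bd * \<delta>" unfolding V_def z(1) abs_mult using zb Qd(1) Bd0 by (intro mult_mono) auto
          then show ?thesis unfolding abs_mult g_def using Bg(2)[OF s xin(1)] Bg(1) by (intro mult_mono) (auto simp: abs_mult)
        qed
        moreover have "\<bar>k * (d\<psi> z * r s)\<bar> \<le> C * \<bar>r s\<bar>"
        proof -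
          have "\<bar>k * (d\<psi> z * r s)\<bar> = \<bar>k\<bar> * \<bar>d\<psi> z\<bar> * \<bar>r s\<bar>" by (simp add: abs_mult)
          also have "\<dots> \<le> Bf * Bd * \<bar>r s\<bar>" unfolding k_def using Bf zb by (intro mult_mono mult_right_mono Bf(2)[OF s xin(1)]) auto
          finally show ?thesis by (simp add: C_def)
        qed
        moreover have "\<bar>k * ((d\<psi> z - d\<psi> (Q s x)) * (h * W s x))\<bar> \<le> Bf * ((4 * \<delta>) * (\<bar>h\<bar> * BW))"
        proof -
          have "\<bar>d\<psi> z - d\<psi> (Q s x)\<bar> \<le> 4 * \<delta>" 
            by (rule order_trans[OF d\<psi>_lip]) (use order_trans[OF z(2) less_imp_le[OF Qd(1)]] in simp)
          then show ?thesis unfolding abs_mult k_def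
            using Bf(1) Bf(2)[OF s xin(1)] BW(2)[OF s xin(1)] BW(1) \<delta> by (intro mult_mono) (auto intro!: mult_nonneg_nonneg)
        qed
        moreover have "\<bar>pp\<bar> \<le> \<delta> * \<bar>h\<bar>" unfolding pp_def by (rule d3(2)[OF s hs(3)])
        ultimately have "\<bar>r' s\<bar> \<le> (\<delta> * \<bar>h\<bar>) * B\<psi> + (\<bar>h\<bar> * Bg) * (Bd * \<delta>) + C * \<bar>r s\<bar> + Bf * ((4 * \<delta>) * (\<bar>h\<bar> * BW)) + \<delta> * \<bar>h\<bar>"
          by linarith
        also have "\<dots> = C * \<bar>r s\<bar> + K * (\<delta> * \<bar>h\<bar>)" by (simp add: K_def algebra_simps)
        finally show ?thesis by simp
      qed
      have r0: "norm (r 0) \<le> \<delta> * \<bar>h\<bar>"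
        using d4(2)[of 0 h] hs T by (simp add: r_def W_def init')
      have "norm (r T) \<le> 2 * (norm (r 0) + K * (\<delta> * \<bar>h\<bar>) * T) * exp (2 * C * T)"
        by (rule gronwall[OF T rd rb C0]) (use K \<delta> T in auto)
      also have "\<dots> \<le> 2 * (\<delta> * \<bar>h\<bar> + K * (\<delta> * \<bar>h\<bar>) * T) * exp (2 * C * T)"
        using r0 by (intro mult_right_mono mult_left_mono add_right_mono) auto
      also have "\<dots> = \<delta> * (2 * exp (2 * C * T) * (1 + K * T)) * \<bar>h\<bar>" by (simp add: algebra_simps)
      also have "\<delta> * (2 * exp (2 * C * T) * (1 + K * T)) = e"
        using den unfolding \<delta>_def by (metis less_irrefl nonzero_eq_divide_eq)
      finally show ?thesis by (simp add: r_def)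
    qed
    then show ?thesis using d0 by blast
  qed
  have "((\<lambda>h. (Q T (x + h) - Q T x) / h) \<longlongrightarrow> W T x) (at 0)"
  proof (rule LIM_I)
    fix e :: real assume e: "0 < e"
    obtain d where d: "0 < d" "\<And>h. \<bar>h\<bar> < d \<Longrightarrow> \<bar>Q T (x + h) - Q T x - h * W T x\<bar> \<le> e / 2 * \<bar>h\<bar>"
      using main[of "e / 2"] e by auto
    have "norm ((Q T (x + h) - Q T x) / h - W T x) < e" if h: "h \<noteq> 0" "\<bar>h\<bar> < d" for h
    proof -
      have "(Q T (x + h) - Q T x) / h - W T x = (Q T (x + h) - Q T x - h * W T x) / h" using h(1) by (simp add: field_simps)
      then have "\<bar>(Q T (x + h) - Q T x) / h - W T x\<bar> \<le> e / 2" using d(2)[OF h(2)] h(1) by (simp add: field_simps)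
      then show ?thesis using e by simp
    qed
    then show "\<exists>d>0. \<forall>h. h \<noteq> 0 \<and> norm (h - 0) < d \<longrightarrow> norm ((Q T (x + h) - Q T x) / h - W T x) < e"
      using d(1) by auto
  qed
  then show ?thesis by (simp add: DERIV_def W_def)
qed

lemma S_neg: "t \<le> 0 \<Longrightarrow> S t x = S 0 x"
  by (simp add: S_def A1_def I1_def tint_def max_def)

lemma Q_x': "(Q t has_real_derivative S t x * J t x) (at x)"
proof (cases "0 \<le> t")
  case True then show ?thesis by (rule Q_x_nonneg)
next
  case False
  then show ?thesis using neg_eq[of t] S_neg[of t x] Q_x_nonneg[of 0 x] by simp
qed

end

section \<open>Time integrals of integrands with one exceptional instant\<close>

lemma LINT_Icc_eq_tint:
  assumes g: "jcont g"
  shows "tint g t x = (LINT s|lborel. indicator {0..max 0 t} s * g s x)"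
    and "integrable lborel (\<lambda>s. indicator {0..max 0 t} s * g s x)"
proof -
  have hc: "set_integrable lborel {0..max 0 t} (\<lambda>s. g s x)"
    by (rule borel_integrable_atLeastAtMost') (rule jcont_slice[OF g])
  show "tint g t x = (LINT s|lborel. indicator {0..max 0 t} s * g s x)"
    using set_borel_integral_eq_integral(2)[OF hc] by (simp add: set_lebesgue_integral_def tint_def)
  show "integrable lborel (\<lambda>s. indicator {0..max 0 t} s * g s x)"
    using hc by (simp add: set_integrable_def)
qed

lemma integrable_indicator_Icc: "integrable lborel (\<lambda>s. B * indicator {a..b::real} s :: real)"
  by (intro integrable_mult_right integrable_real_indicator) (auto simp: emeasure_lborel_Icc_eq)

text \<open>A uniform Lipschitz bound in space dominates the difference quotients, so pointwise
  differentiability may fail at one instant z. Plain differentiation under the integral is not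
  applicable to \<open>A1\<close>, whose integrand has a kink at the threshold.\<close>

lemma tint_x_ae:
  assumes F: "jcont F"
    and lip: "\<And>s h. s \<in> {0..max 0 t} \<Longrightarrow> \<bar>h\<bar> \<le> 1 \<Longrightarrow> \<bar>F s (x + h) - F s x\<bar> \<le> B * \<bar>h\<bar>"
    and d: "\<And>s. s \<in> {0..max 0 t} \<Longrightarrow> s \<noteq> z \<Longrightarrow> (F s has_real_derivative F' s) (at x)"
    and m: "F' \<in> borel_measurable borel"
  shows "(tint F t has_real_derivative (LINT s|lborel. indicator {0..max 0 t} s * F' s)) (at x)"
proof -
  let ?ind = "indicator {0..max 0 t} :: real \<Rightarrow> real"
  have "((\<lambda>h. (tint F t (x + h) - tint F t x) / h) \<longlongrightarrow> (LINT s|lborel. ?ind s * F' s)) (at 0 within {-1..1})"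
    unfolding tendsto_at_iff_sequentially
  proof (intro allI impI)
    fix h :: "nat \<Rightarrow> real" assume h: "\<forall>i. h i \<in> {-1..1} - {0}" and h0: "h \<longlonglongrightarrow> 0"
    have "(\<lambda>n. LINT s|lborel. ?ind s * ((F s (x + h n) - F s x) / h n)) \<longlonglongrightarrow> (LINT s|lborel. ?ind s * F' s)"
    proof (rule integral_dominated_convergence[where w="\<lambda>s. B * ?ind s"])
      show "(\<lambda>s. ?ind s * F' s) \<in> borel_measurable lborel" using m by simp
      show "(\<lambda>s. ?ind s * ((F s (x + h n) - F s x) / h n)) \<in> borel_measurable lborel" for n
        using borel_measurable_continuous_onI[OF jcont_slice(1)[OF F]] by measurable
      show "integrable lborel (\<lambda>s. B * ?ind s)" by (rule integrable_indicator_Icc)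
      show "AE s in lborel. (\<lambda>n. ?ind s * ((F s (x + h n) - F s x) / h n)) \<longlonglongrightarrow> ?ind s * F' s"
        using AE_lborel_singleton[of z]
      proof eventually_elim
        case (elim s)
        show ?case
        proof (cases "s \<in> {0..max 0 t}")
          case True
          have "((\<lambda>h. (F s (x + h) - F s x) / h) \<longlongrightarrow> F' s) (at 0)"
            using d[OF True elim] by (simp add: DERIV_def)
          then have "((\<lambda>h. (F s (x + h) - F s x) / h) \<circ> h) \<longlonglongrightarrow> F' s"
            using h h0 unfolding tendsto_at_iff_sequentially by auto
          then show ?thesis using True by (simp add: o_def)
        qed simp
      qed
      show "AE s in lborel. norm (?ind s * ((F s (x + h n) - F s x) / h n)) \<le> B * ?ind s" for n
      proof (rule AE_I2)
        fix s
        show "norm (?ind s * ((F s (x + h n) - F s x) / h n)) \<le> B * ?ind s"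
        proof (cases "s \<in> {0..max 0 t}")
          case True
          have "h n \<noteq> 0" "\<bar>h n\<bar> \<le> 1" using h[rule_format, of n] by auto
          then show ?thesis using lip[OF True, of "h n"] True by (simp add: abs_mult field_simps)
        qed simp
      qed
    qed
    moreover have "(LINT s|lborel. ?ind s * ((F s (x + h n) - F s x) / h n)) = (tint F t (x + h n) - tint F t x) / h n" for n
    proof -
      have "(LINT s|lborel. ?ind s * ((F s (x + h n) - F s x) / h n)) =
          (LINT s|lborel. (?ind s * F s (x + h n) - ?ind s * F s x) / h n)"
        by (rule Bochner_Integration.integral_cong) (auto simp: algebra_simps)
      then show ?thesis unfolding LINT_Icc_eq_tint(1)[OF F]
        by (simp add: LINT_Icc_eq_tint(2)[OF F])
    qed
    ultimately show "((\<lambda>h. (tint F t (x + h) - tint F t x) / h) \<circ> h) \<longlonglongrightarrow> (LINT s|lborel. ?ind s * F' s)"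
      unfolding o_def by (simp only:)
  qed
  then show ?thesis using at_within_Icc_at[of "-1" 0 "1::real"] by (simp add: DERIV_def)
qed

text \<open>Dominated convergence along sequences: the exceptional instant may depend on the limit
  point x, but for each x it is a single null set.\<close>

lemma LINT_param_jcont:
  assumes m: "\<And>x. (\<lambda>s. K s x) \<in> borel_measurable borel"
    and b: "\<And>T r. \<exists>B. \<forall>s\<in>{0..T}. \<forall>x\<in>{-r..r}. \<bar>K s x\<bar> \<le> B"
    and c: "\<And>x. \<exists>z. \<forall>s\<ge>0. s \<noteq> z \<longrightarrow> isCont (K s) x"
  shows "jcont (\<lambda>t x. LINT s|lborel. indicator {0..max 0 t} s * K s x)"
  unfolding continuous_on_sequentially
proof (intro allI ballI impI, elim conjE)
  fix p :: "nat \<Rightarrow> real \<times> real" and q assume p: "p \<longlonglongrightarrow> q"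
  have "bounded (range p)" by (rule convergent_imp_bounded[OF p])
  then obtain r where r: "\<And>n. norm (p n) \<le> r" unfolding bounded_iff by auto
  have pr: "\<bar>fst (p n)\<bar> \<le> r" "\<bar>snd (p n)\<bar> \<le> r" for n
    using r[of n] norm_fst_le[of "fst (p n)" "snd (p n)"] norm_snd_le[of "snd (p n)" "fst (p n)"] by simp_all
  have r0: "0 \<le> r" using r[of 0] norm_ge_zero[of "p 0"] by linarith
  obtain B where B: "\<And>s x. s \<in> {0..r} \<Longrightarrow> x \<in> {-r..r} \<Longrightarrow> \<bar>K s x\<bar> \<le> B" using b[of r r] by blast
  obtain z where z: "\<And>s. 0 \<le> s \<Longrightarrow> s \<noteq> z \<Longrightarrow> isCont (K s) (snd q)" using c[of "snd q"] by blast
  have p1: "(\<lambda>n. fst (p n)) \<longlonglongrightarrow> fst q" "(\<lambda>n. snd (p n)) \<longlonglongrightarrow> snd q" using p by (auto intro: tendsto_intros)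
  have "(\<lambda>n. LINT s|lborel. indicator {0..max 0 (fst (p n))} s * K s (snd (p n))) \<longlonglongrightarrow> (LINT s|lborel. indicator {0..max 0 (fst q)} s * K s (snd q))"
  proof (rule integral_dominated_convergence[where w="\<lambda>s. B * indicator {0..r} s"])
    show "(\<lambda>s. indicator {0..max 0 (fst q)} s * K s (snd q)) \<in> borel_measurable lborel" using m by simp
    show "(\<lambda>s. indicator {0..max 0 (fst (p n))} s * K s (snd (p n))) \<in> borel_measurable lborel" for n using m by simp
    show "integrable lborel (\<lambda>s. B * indicator {0..r} s)" by (rule integrable_indicator_Icc)
    show "AE s in lborel. norm (indicator {0..max 0 (fst (p n))} s * K s (snd (p n))) \<le> B * indicator {0..r} s" for n
    proof (rule AE_I2)
      fix s
      have "snd (p n) \<in> {-r..r}" using pr(2)[of n] by auto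
      moreover have "{0..max 0 (fst (p n))} \<subseteq> {0..r}" using pr(1)[of n] r0 by auto
      moreover have "0 \<le> B" using B[of 0 0] r0 by force
      ultimately show "norm (indicator {0..max 0 (fst (p n))} s * K s (snd (p n))) \<le> B * indicator {0..r} s"
        using B[of s "snd (p n)"] by (auto simp: indicator_def)
    qed
    show "AE s in lborel. (\<lambda>n. indicator {0..max 0 (fst (p n))} s * K s (snd (p n))) \<longlonglongrightarrow> indicator {0..max 0 (fst q)} s * K s (snd q)"
      \<comment> \<open>Two instants are discarded: the exceptional one and the limiting right end,
        at which the indicators need not converge.\<close>
      using AE_lborel_singleton[of z] AE_lborel_singleton[of "max 0 (fst q)"]
    proof eventually_elim
      case (elim s)
      have mx: "(\<lambda>n. max 0 (fst (p n))) \<longlonglongrightarrow> max 0 (fst q)" by (intro tendsto_intros p1)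
      consider "s < 0" | "0 \<le> s" "s < max 0 (fst q)" | "max 0 (fst q) < s" using elim(2) by linarith
      then show ?case
      proof cases
        case 1 then show ?thesis by simp
      next
        case 2
        have "\<forall>\<^sub>F n in sequentially. s < max 0 (fst (p n))" by (rule order_tendstoD(1)[OF mx 2(2)])
        then have "\<forall>\<^sub>F n in sequentially. K s (snd (p n)) = indicator {0..max 0 (fst (p n))} s * K s (snd (p n))"
          by eventually_elim (use 2 in auto)
        moreover have "(\<lambda>n. K s (snd (p n))) \<longlonglongrightarrow> K s (snd q)"
          by (rule isCont_tendsto_compose[OF z[OF 2(1) elim(1)] p1(2)])
        ultimately have "(\<lambda>n. indicator {0..max 0 (fst (p n))} s * K s (snd (p n))) \<longlonglongrightarrow> K s (snd q)"
          by (rule Lim_transform_eventually[rotated])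
        then show ?thesis using 2 by simp
      next
        case 3
        have "\<forall>\<^sub>F n in sequentially. max 0 (fst (p n)) < s" by (rule order_tendstoD(2)[OF mx 3])
        then have "\<forall>\<^sub>F n in sequentially. indicator {0..max 0 (fst (p n))} s * K s (snd (p n)) = 0"
          by eventually_elim auto
        moreover have "s \<notin> {0..max 0 (fst q)}" using 3 by (simp only: atLeastAtMost_iff not_le de_Morgan_conj simp_thms)
        then have "indicator {0..max 0 (fst q)} s * K s (snd q) = 0" by (simp del: atLeastAtMost_iff)
        ultimately show ?thesis by (simp only: tendsto_eventually)
      qed
    qed
  qed
  then show "((\<lambda>p. LINT s|lborel. indicator {0..max 0 (fst p)} s * K s (snd p)) \<circ> p) \<longlonglongrightarrow> (LINT s|lborel. indicator {0..max 0 (fst q)} s * K s (snd q))"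
    by (simp add: o_def)
qed

subsection \<open>Domination by a weight\<close>

text \<open>With the weight 1 this is uniform boundedness on [0, T]. Products are dominated as soon
  as the first factor is bounded, so estimates reduce to exhibiting one decaying factor in each
  term.\<close>

definition dominated :: "real \<Rightarrow> (real \<Rightarrow> real) \<Rightarrow> (real \<Rightarrow> real \<Rightarrow> real) \<Rightarrow> bool" where
  "dominated T w g \<longleftrightarrow> (\<exists>C\<ge>0. \<forall>t\<in>{0..T}. \<forall>x. \<bar>g t x\<bar> \<le> C * w x)"

lemma dominatedI: "0 \<le> C \<Longrightarrow> (\<And>t x. t \<in> {0..T} \<Longrightarrow> \<bar>g t x\<bar> \<le> C * w x) \<Longrightarrow> dominated T w g"
  unfolding dominated_def by blast

lemma dominatedE:
  assumes "dominated T w g"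
  obtains C where "0 \<le> C" "\<forall>t\<in>{0..T}. \<forall>x. \<bar>g t x\<bar> \<le> C * w x"
  using assms unfolding dominated_def by blast

lemma dominated_add:
  assumes "dominated T w g" "dominated T w h" shows "dominated T w (\<lambda>t x. g t x + h t x)"
proof -
  obtain C where C: "0 \<le> C" "\<forall>t\<in>{0..T}. \<forall>x. \<bar>g t x\<bar> \<le> C * w x" using assms(1) by (rule dominatedE)
  obtain D where D: "0 \<le> D" "\<forall>t\<in>{0..T}. \<forall>x. \<bar>h t x\<bar> \<le> D * w x" using assms(2) by (rule dominatedE)
  show ?thesis
  proof (rule dominatedI[of "C + D"])
    fix t x assume "t \<in> {0..T}"
    then have "\<bar>g t x\<bar> \<le> C * w x" "\<bar>h t x\<bar> \<le> D * w x" using C D by blast+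
    then show "\<bar>g t x + h t x\<bar> \<le> (C + D) * w x" unfolding distrib_right by linarith
  qed (use C D in simp)
qed

lemma dominated_mono:
  assumes "dominated T w g" "\<And>t x. t \<in> {0..T} \<Longrightarrow> \<bar>h t x\<bar> \<le> \<bar>g t x\<bar>" shows "dominated T w h"
  using assms unfolding dominated_def by (meson order_trans)

lemma dominated_abs: "dominated T w g \<Longrightarrow> dominated T w (\<lambda>t x. \<bar>g t x\<bar>)"
  by (erule dominated_mono) simp

lemma dominated_minus: "dominated T w g \<Longrightarrow> dominated T w (\<lambda>t x. - g t x)"
  by (erule dominated_mono) simp

lemma dominated_diff: "dominated T w g \<Longrightarrow> dominated T w h \<Longrightarrow> dominated T w (\<lambda>t x. g t x - h t x)"
  using dominated_add[of T w g "\<lambda>t x. - h t x"] dominated_minus[of T w h] by simp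

lemma dominated_mult:
  assumes "dominated T (\<lambda>_. 1) g" "dominated T w h" shows "dominated T w (\<lambda>t x. g t x * h t x)"
proof -
  obtain C where C: "0 \<le> C" "\<forall>t\<in>{0..T}. \<forall>x. \<bar>g t x\<bar> \<le> C * 1" using assms(1) by (rule dominatedE)
  obtain D where D: "0 \<le> D" "\<forall>t\<in>{0..T}. \<forall>x. \<bar>h t x\<bar> \<le> D * w x" using assms(2) by (rule dominatedE)
  show ?thesis
  proof (rule dominatedI[of "C * D"])
    fix t x assume t: "t \<in> {0..T}"
    have "\<bar>g t x\<bar> * \<bar>h t x\<bar> \<le> C * (D * w x)" using C D t by (intro mult_mono) auto
    then show "\<bar>g t x * h t x\<bar> \<le> C * D * w x" by (simp add: abs_mult)
  qed (use C D in simp)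
qed

lemma dominated_const: "dominated T (\<lambda>_. 1) (\<lambda>_ _. a)"
  by (rule dominatedI[of "\<bar>a\<bar>"]) auto

lemma dominated_outer:
  assumes g: "dominated T (\<lambda>_. 1) g" and h: "continuous_on UNIV h" shows "dominated T (\<lambda>_. 1) (\<lambda>t x. h (g t x))"
proof -
  obtain C where C: "0 \<le> C" "\<forall>t\<in>{0..T}. \<forall>x. \<bar>g t x\<bar> \<le> C * 1" using g by (rule dominatedE)
  have "compact (h ` {-C..C})" by (intro compact_continuous_image continuous_on_subset[OF h]) auto
  then obtain B where B: "\<forall>z\<in>h ` {-C..C}. norm z \<le> B" using compact_imp_bounded bounded_iff by blast
  show ?thesis
  proof (rule dominatedI[of "max B 0"])
    fix t x assume "t \<in> {0..T}"
    then have "\<bar>g t x\<bar> \<le> C" using C by simp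
    then have "g t x \<in> {-C..C}" by auto
    then have "norm (h (g t x)) \<le> B" using B by blast
    then show "\<bar>h (g t x)\<bar> \<le> max B 0 * 1" by simp
  qed simp
qed

lemma dominated_tint:
  assumes g: "dominated T w g" and c: "jcont g" and w: "\<And>x. 0 \<le> w x" and T: "0 \<le> T"
  shows "dominated T w (tint g)"
proof -
  obtain C where C: "0 \<le> C" "\<forall>t\<in>{0..T}. \<forall>x. \<bar>g t x\<bar> \<le> C * w x" using g by (rule dominatedE)
  show ?thesis
  proof (rule dominatedI[of "C * T"])
    fix t x assume t: "t \<in> {0..T}"
    have "\<bar>tint g t x\<bar> \<le> (C * w x) * T" by (rule tint_bound[OF c _ _ t]) (use C w in auto)
    then show "\<bar>tint g t x\<bar> \<le> C * T * w x" by (simp add: ac_simps)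
  qed (use C T in simp)
qed

lemma dominated_bounded:
  assumes g: "dominated T w g" and w: "\<And>x. w x \<le> W" "\<And>x. 0 \<le> w x" shows "dominated T (\<lambda>_. 1) g"
proof -
  obtain C where C: "0 \<le> C" "\<forall>t\<in>{0..T}. \<forall>x. \<bar>g t x\<bar> \<le> C * w x" using g by (rule dominatedE)
  have W: "0 \<le> W" using w(1)[of 0] w(2)[of 0] by linarith
  show ?thesis
  proof (rule dominatedI[of "C * W"])
    fix t x assume "t \<in> {0..T}"
    then have "\<bar>g t x\<bar> \<le> C * w x" using C by blast
    also have "\<dots> \<le> C * W" using C w by (intro mult_left_mono) auto
    finally show "\<bar>g t x\<bar> \<le> C * W * 1" by simp
  qed (use C W in simp)
qed

context global_lagrangian
begin

lemma Q_antimono: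
  assumes s: "0 \<le> s" and st: "s \<le> t" shows "Q t x \<le> Q s x"
proof -
  have "((\<lambda>r. - 1 / 2 * f2 (U r x) * \<psi> (Q r x) - P r x) has_integral (Q t x - Q s x)) {s..t}"
    using st s Q_t' unfolding has_real_derivative_iff_has_vector_derivative
    by (intro fundamental_theorem_of_calculus) (auto intro: has_vector_derivative_within_subset[of _ _ _ "{0..}"])
  moreover have "((\<lambda>r. 0) has_integral 0) {s..t}" by simp
  ultimately have "Q t x - Q s x \<le> 0"
  proof (rule has_integral_le)
    fix r
    have "0 \<le> f2 (U r x) * \<psi> (Q r x)" using f2_pos[of "U r x"] \<psi>_bounds by simp
    then show "- 1 / 2 * f2 (U r x) * \<psi> (Q r x) - P r x \<le> 0" using L0.P_nonneg[of r x] by simp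
  qed
  then show ?thesis by simp
qed

text \<open>Q is nonincreasing in time, so two visits to the threshold would make it constant in
  between. But its time derivative there is strictly negative, because \<psi> has the value
  1/\<epsilon>^2 at the threshold, f'' is positive and P is nonnegative.\<close>

lemma crossing_unique: "\<exists>z. \<forall>s\<ge>0. s \<noteq> z \<longrightarrow> Q s x \<noteq> - 1 / \<epsilon>"
proof -
  have no: False if s: "0 \<le> s" "s < t" "Q s x = - 1 / \<epsilon>" "Q t x = - 1 / \<epsilon>" for s t
  proof -
    define r where "r = (s + t) / 2"
    have r: "s < r" "r < t" using s by (auto simp: r_def)
    have const: "Q r' x = - 1 / \<epsilon>" if "r' \<in> {s<..<t}" for r'
      using Q_antimono[of s r' x] Q_antimono[of r' t x] that s by force
    have "((\<lambda>r. Q r x) has_real_derivative - 1 / 2 * f2 (U r x) * \<psi> (Q r x) - P r x) (at r within {0..})"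
      using r s by (intro Q_t') auto
    moreover have "at r within {0..} = at r" using r s by (intro at_within_interior) auto
    ultimately have d: "((\<lambda>r. Q r x) has_real_derivative - 1 / 2 * f2 (U r x) * \<psi> (Q r x) - P r x) (at r)" by simp
    have "((\<lambda>r. Q r x) has_real_derivative 0) (at r)"
      by (rule has_field_derivative_transform_within_open[of "\<lambda>_. - 1 / \<epsilon>" _ _ "{s<..<t}"]) (use r const in auto)
    with d have "- 1 / 2 * f2 (U r x) * \<psi> (Q r x) - P r x = 0" by (rule DERIV_unique)
    moreover have "\<psi> (Q r x) = (1 / \<epsilon>)\<^sup>2"
      using const[of r] r by (simp add: \<psi>_def chi_def)
    moreover have "0 < f2 (U r x) * (1 / \<epsilon>)\<^sup>2" using f2_pos[of "U r x"] \<epsilon>_pos by simp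
    ultimately show False using L0.P_nonneg[of r x] by simp
  qed
  show ?thesis
  proof (cases "\<exists>z\<ge>0. Q z x = - 1 / \<epsilon>")
    case True
    then obtain z where z: "0 \<le> z" "Q z x = - 1 / \<epsilon>" by blast
    show ?thesis using no[of z] no[of _ z] z by (metis linorder_neqE_linordered_idom)
  qed blast
qed

text \<open>The label derivative of \<open>a1\<close> off the threshold; the indicator is the
  derivative of the minimum, with the value 0 at the threshold by convention.\<close>

definition a1x where "a1x t x = f3 (U t x) * (Q t x * J t x) * (2 * Q t x - min (Q t x + 1 / \<epsilon>) 0)
   + f2 (U t x) * ((2 - indicator {..< - 1 / \<epsilon>} (Q t x)) * (S t x * J t x))"

definition \<alpha> where "\<alpha> t x = (LINT s|lborel. indicator {0..max 0 t} s * a1x s x)"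

lemma a1x_measurable: "(\<lambda>s. a1x s x) \<in> borel_measurable borel"
proof -
  have [measurable]: "(\<lambda>s. f3 (U s x)) \<in> borel_measurable borel" "(\<lambda>s. f2 (U s x)) \<in> borel_measurable borel"
     "(\<lambda>s. Q s x) \<in> borel_measurable borel" "(\<lambda>s. J s x) \<in> borel_measurable borel" "(\<lambda>s. S s x) \<in> borel_measurable borel"
    by (rule borel_measurable_continuous_onI jcont_slice(1) jc_f jc_Q jc_J jc_S)+
  show ?thesis unfolding a1x_def by measurable
qed

lemma a1x_isCont: "Q s x \<noteq> - 1 / \<epsilon> \<Longrightarrow> isCont (a1x s) x"
proof -
  assume ne: "Q s x \<noteq> - 1 / \<epsilon>"
  have c: "isCont (\<lambda>x. f3 (U s x)) x" "isCont (\<lambda>x. f2 (U s x)) x" "isCont (Q s) x" "isCont (J s) x" "isCont (S s) x"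
    using jcont_slice(2)[OF jc_f(3), of UNIV s] jcont_slice(2)[OF jc_f(2), of UNIV s] jcont_slice(2)[OF jc_Q, of UNIV s]
      jcont_slice(2)[OF jc_J, of UNIV s] jcont_slice(2)[OF jc_S, of UNIV s]
    by (simp_all add: continuous_on_eq_continuous_at)
  have i: "isCont (\<lambda>x. indicator {..< - 1 / \<epsilon>} (Q s x) :: real) x"
  proof (rule isCont_o2[OF c(3)])
    show "isCont (indicator {..< - 1 / \<epsilon>} :: real \<Rightarrow> real) (Q s x)"
      using ne isCont_indicator[of "Q s x" "{..< - 1 / \<epsilon>}"] by simp
  qed
  show ?thesis unfolding a1x_def[abs_def] by (intro continuous_intros c i)
qed

lemma a1x_bounded: "\<exists>B. \<forall>s\<in>{0..T}. \<forall>x\<in>{-r..r}. \<bar>a1x s x\<bar> \<le> B"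
proof -
  have "jcont (\<lambda>t x. f3 (U t x) * (Q t x * J t x) * (2 * Q t x - min (Q t x + 1 / \<epsilon>) 0))"
    by (intro continuous_intros jc_f jc_Q jc_J)
  then obtain B where B: "\<forall>s\<in>{0..T}. \<forall>x\<in>{-r..r}. \<bar>f3 (U s x) * (Q s x * J s x) * (2 * Q s x - min (Q s x + 1 / \<epsilon>) 0)\<bar> \<le> B"
    using jcont_bounded[of "\<lambda>t x. f3 (U t x) * (Q t x * J t x) * (2 * Q t x - min (Q t x + 1 / \<epsilon>) 0)" 0 T "-r" r] by blast
  have "jcont (\<lambda>t x. f2 (U t x) * (S t x * J t x))" by (intro continuous_intros jc_f jc_S jc_J)
  then obtain D where D: "\<forall>s\<in>{0..T}. \<forall>x\<in>{-r..r}. \<bar>f2 (U s x) * (S s x * J s x)\<bar> \<le> D"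
    using jcont_bounded[of "\<lambda>t x. f2 (U t x) * (S t x * J t x)" 0 T "-r" r] by blast
  have "\<bar>a1x s x\<bar> \<le> B + 2 * D" if "s \<in> {0..T}" "x \<in> {-r..r}" for s x
  proof -
    let ?i = "2 - indicator {..< - 1 / \<epsilon>} (Q s x) :: real"
    have i2: "\<bar>?i * (f2 (U s x) * (S s x * J s x))\<bar> \<le> 2 * D"
      unfolding abs_mult[of ?i] using D that by (intro mult_mono) (auto simp: indicator_def)
    have i1: "\<bar>f3 (U s x) * (Q s x * J s x) * (2 * Q s x - min (Q s x + 1 / \<epsilon>) 0)\<bar> \<le> B" using B that by blast
    have "a1x s x = f3 (U s x) * (Q s x * J s x) * (2 * Q s x - min (Q s x + 1 / \<epsilon>) 0) + ?i * (f2 (U s x) * (S s x * J s x))"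
      by (simp add: a1x_def)
    then show ?thesis by (simp only: order_trans[OF abs_triangle_ineq add_mono[OF i1 i2]])
  qed
  then show ?thesis by blast
qed

text \<open>At a given label the jump of \<open>a1x\<close> is met at no more than one time, hence
  is invisible after integration in time.\<close>

lemma jc_\<alpha>: "jcont \<alpha>"
  unfolding \<alpha>_def
proof (rule LINT_param_jcont[OF a1x_measurable a1x_bounded])
  show "\<exists>z. \<forall>s\<ge>0. s \<noteq> z \<longrightarrow> isCont (a1x s) x" for x using crossing_unique[of x] a1x_isCont by meson
qed

text \<open>The coefficient \<open>a1\<close> is Lipschitz in the label, uniformly in time, and
  differentiable at every time except the crossing, so the almost-everywhere version of
  differentiation under the integral applies.\<close>

lemma A1_x: "(A1 t has_real_derivative \<alpha> t x) (at x)"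
proof -
  obtain z where z: "\<And>s. 0 \<le> s \<Longrightarrow> s \<noteq> z \<Longrightarrow> Q s x \<noteq> - 1 / \<epsilon>" using crossing_unique[of x] by blast
  define T where "T = max 0 t"
  define G where "G s x = f2 (U s x)" for s x
  define m where "m s x = 2 * Q s x - min (Q s x + 1 / \<epsilon>) 0" for s x
  have aG: "a1 s x = G s x * m s x" for s x by (simp add: a1_def G_def m_def algebra_simps)
  obtain BG where BG: "0 \<le> BG" "\<And>s y. s \<in> {0..T} \<Longrightarrow> y \<in> {x-1..x+1} \<Longrightarrow> \<bar>G s y\<bar> \<le> BG"
    using jcont_bounded[OF jc_f(2), of 0 T "x-1" "x+1"] unfolding G_def by blast
  have "jcont m" unfolding m_def by (intro continuous_intros jc_Q)
  then obtain Bm where Bm: "0 \<le> Bm" "\<And>s y. s \<in> {0..T} \<Longrightarrow> y \<in> {x-1..x+1} \<Longrightarrow> \<bar>m s y\<bar> \<le> Bm"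
    using jcont_bounded[of m 0 T "x-1" "x+1"] by blast
  have "jcont (\<lambda>t x. f3 (U t x) * (Q t x * J t x))" by (intro continuous_intros jc_f jc_Q jc_J)
  then obtain Bg where Bg: "0 \<le> Bg" "\<And>s y. s \<in> {0..T} \<Longrightarrow> y \<in> {x-1..x+1} \<Longrightarrow> \<bar>f3 (U s y) * (Q s y * J s y)\<bar> \<le> Bg"
    using jcont_bounded[of "\<lambda>t x. f3 (U t x) * (Q t x * J t x)" 0 T "x-1" "x+1"] by blast
  have "jcont (\<lambda>t x. S t x * J t x)" by (intro continuous_intros jc_S jc_J)
  then obtain BW where BW: "0 \<le> BW" "\<And>s y. s \<in> {0..T} \<Longrightarrow> y \<in> {x-1..x+1} \<Longrightarrow> \<bar>S s y * J s y\<bar> \<le> BW"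
    using jcont_bounded[of "\<lambda>t x. S t x * J t x" 0 T "x-1" "x+1"] by blast
  have lipx: "\<bar>g (x + h) - g x\<bar> \<le> B * \<bar>h\<bar>"
    if "\<And>y. (g has_real_derivative g' y) (at y)" "\<And>y. y \<in> {x-1..x+1} \<Longrightarrow> \<bar>g' y\<bar> \<le> B" "\<bar>h\<bar> \<le> 1" for g g' B h
  proof -
    have "norm (g (x + h) - g x) \<le> B * norm ((x + h) - x)"
      by (rule field_differentiable_bound[of "{x-1..x+1}" g g'])
        (use that in \<open>auto intro: has_field_derivative_at_within\<close>)
    then show ?thesis by simp
  qed
  show ?thesis
    unfolding A1_def \<alpha>_def
  \<comment> \<open>The Lipschitz constant of a product f''(u) m with m = 2 Q - min(Q +
    1/\<epsilon>, 0), where m is Lipschitz with constant 3 as a function of Q.\<close>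
  proof (rule tint_x_ae[OF jc_a1 _ _ a1x_measurable, where B="Bg * Bm + BG * (3 * BW)" and z=z])
    fix s h :: real assume s: "s \<in> {0..max 0 t}" and h: "\<bar>h\<bar> \<le> 1"
    have sT: "s \<in> {0..T}" using s by (simp add: T_def)
    have xin: "x \<in> {x-1..x+1}" "x + h \<in> {x-1..x+1}" using h by auto
    have g: "\<bar>G s (x + h) - G s x\<bar> \<le> Bg * \<bar>h\<bar>"
      by (rule lipx[OF _ _ h, of _ "\<lambda>y. f3 (U s y) * (Q s y * J s y)"]) (use Bg(2)[OF sT] f2U_x in \<open>auto simp: G_def[abs_def]\<close>)
    have q: "\<bar>Q s (x + h) - Q s x\<bar> \<le> BW * \<bar>h\<bar>"
      by (rule lipx[OF _ _ h, of _ "\<lambda>y. S s y * J s y"]) (use BW(2)[OF sT] Q_x' in auto)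
    have "\<bar>min a 0 - min b 0\<bar> \<le> \<bar>a - b\<bar>" for a b :: real by (auto simp: min_def)
    from this[of "Q s (x + h) + 1 / \<epsilon>" "Q s x + 1 / \<epsilon>"]
    have mm: "\<bar>min (Q s (x + h) + 1 / \<epsilon>) 0 - min (Q s x + 1 / \<epsilon>) 0\<bar> \<le> \<bar>Q s (x + h) - Q s x\<bar>" by simp
    have tri: "\<bar>2 * p - a - (2 * q - b)\<bar> \<le> 3 * \<bar>p - q\<bar>" if "\<bar>a - b\<bar> \<le> \<bar>p - q\<bar>" for a b p q :: real
    proof -
      have eq: "2 * p - a - (2 * q - b) = 2 * (p - q) - (a - b)" by simp
      have "\<bar>2 * (p - q)\<bar> = 2 * \<bar>p - q\<bar>" unfolding abs_mult by simp
      then have "\<bar>2 * (p - q)\<bar> + \<bar>a - b\<bar> \<le> 3 * \<bar>p - q\<bar>" using that by simp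
      then show ?thesis unfolding eq by (rule order_trans[OF abs_triangle_ineq4])
    qed
    have "\<bar>m s (x + h) - m s x\<bar> \<le> 3 * \<bar>Q s (x + h) - Q s x\<bar>" unfolding m_def by (rule tri[OF mm])
    then have mb: "\<bar>m s (x + h) - m s x\<bar> \<le> 3 * BW * \<bar>h\<bar>" using mult_left_mono[OF q, of 3] by simp
    have "\<bar>a1 s (x + h) - a1 s x\<bar> = \<bar>(G s (x + h) - G s x) * m s (x + h) + G s x * (m s (x + h) - m s x)\<bar>"
      unfolding aG by (simp add: algebra_simps)
    also have "\<dots> \<le> \<bar>G s (x + h) - G s x\<bar> * \<bar>m s (x + h)\<bar> + \<bar>G s x\<bar> * \<bar>m s (x + h) - m s x\<bar>"
      by (rule order_trans[OF abs_triangle_ineq]) (simp add: abs_mult)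
    also have "\<dots> \<le> (Bg * \<bar>h\<bar>) * Bm + BG * (3 * BW * \<bar>h\<bar>)"
      using g mb Bm(2)[OF sT xin(2)] BG(2)[OF sT xin(1)] Bg(1) BG(1) by (intro add_mono mult_mono) auto
    finally show "\<bar>a1 s (x + h) - a1 s x\<bar> \<le> (Bg * Bm + BG * (3 * BW)) * \<bar>h\<bar>" by (simp add: algebra_simps)
  next
    fix s assume "s \<in> {0..max 0 t}" "s \<noteq> z"
    then have ne: "Q s x \<noteq> - 1 / \<epsilon>" using z by auto
    have mx: "((\<lambda>x. min (Q s x + 1 / \<epsilon>) 0) has_real_derivative indicator {..< - 1 / \<epsilon>} (Q s x) * (S s x * J s x)) (at x)"
    proof -
      have cQ: "continuous_on UNIV (Q s)" by (rule jcont_slice[OF jc_Q])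
      show ?thesis
      proof (cases "Q s x < - 1 / \<epsilon>")
        case True
        have "((\<lambda>x. Q s x + 1 / \<epsilon>) has_real_derivative S s x * J s x) (at x)"
          by (auto intro!: derivative_eq_intros Q_x')
        then have "((\<lambda>x. min (Q s x + 1 / \<epsilon>) 0) has_real_derivative S s x * J s x) (at x)"
          by (rule has_field_derivative_transform_within_open[of _ _ _ "{y. Q s y < - 1 / \<epsilon>}"])
            (use True in \<open>auto intro!: open_Collect_less cQ\<close>)
        then show ?thesis using True by simp
      next
        case False
        then have gt: "- 1 / \<epsilon> < Q s x" using ne by auto
        have "((\<lambda>x. 0) has_real_derivative 0) (at x)" by simp
        then have "((\<lambda>x. min (Q s x + 1 / \<epsilon>) 0) has_real_derivative 0) (at x)"
          by (rule has_field_derivative_transform_within_open[of _ _ _ "{y. - 1 / \<epsilon> < Q s y}"])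
            (use gt in \<open>auto intro!: open_Collect_less cQ\<close>)
        then show ?thesis using False by simp
      qed
    qed
    have "((\<lambda>x. f2 (U s x) * (2 * Q s x - min (Q s x + 1 / \<epsilon>) 0)) has_real_derivative a1x s x) (at x)"
      by (rule DERIV_cong[OF DERIV_mult[OF f2U_x DERIV_diff[OF DERIV_cmult[OF Q_x'] mx]]])
        (simp add: a1x_def algebra_simps)
    then show "(a1 s has_real_derivative a1x s x) (at x)"
      by (simp add: a1_def[abs_def] algebra_simps)
  qed
qed

text \<open>The source \<open>b1\<close> contains \<psi>(Q) undifferentiated, so one derivative
  meets no kink. The fourth derivative of f enters here.\<close>

definition b1x where "b1x t x = 1 / 2 * (f4 (U t x) * (Q t x * J t x) * (Q t x * \<psi> (Q t x))
    + f3 (U t x) * (S t x * J t x * \<psi> (Q t x) + Q t x * (d\<psi> (Q t x) * (S t x * J t x))))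
   + (P t x - f2 (U t x) * \<kappa> (Q t x) / 2) / l\<^sup>2 * J t x"

lemma b1_x: "(b1 t has_real_derivative b1x t x) (at x)"
proof -
  have 1: "((\<lambda>x. f3 (U t x)) has_real_derivative f4 (U t x) * (Q t x * J t x)) (at x)" by (rule DERIV_chain2[OF f3_d U_x'])
  have 2: "((\<lambda>x. \<psi> (Q t x)) has_real_derivative d\<psi> (Q t x) * (S t x * J t x)) (at x)" by (rule DERIV_chain2[OF \<psi>_deriv Q_x'])
  have "((\<lambda>x. 1 / 2 * (f3 (U t x) * (Q t x * \<psi> (Q t x))) + Px t x) has_real_derivative b1x t x) (at x)"
    by (rule DERIV_cong[OF DERIV_add[OF DERIV_cmult[OF DERIV_mult[OF 1 DERIV_mult[OF Q_x' 2]]] L0.Px_x]])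
      (simp add: b1x_def algebra_simps)
  then show ?thesis by (simp add: b1_def[abs_def] mult.assoc)
qed

lemma jc_b1x: "jcont b1x"
  unfolding b1x_def using l_pos by (intro continuous_intros jc_f jc_\<psi> jc_Q jc_J jc_S jc_P) auto

definition I1x where "I1x = tint (\<lambda>s x. exp (A1 s x) * (\<alpha> s x * b1 s x + b1x s x))"

lemma jc_I1x_integrand: "jcont (\<lambda>s x. exp (A1 s x) * (\<alpha> s x * b1 s x + b1x s x))"
  by (intro continuous_intros jc_A1 jc_\<alpha> jc_b1 jc_b1x)

lemma I1_x: "(I1 t has_real_derivative I1x t x) (at x)"
  unfolding I1_def I1x_def
proof (rule tint_x[OF _ jc_I1_integrand jc_I1x_integrand])
  show "((\<lambda>x. exp (A1 s x) * b1 s x) has_real_derivative exp (A1 s x) * (\<alpha> s x * b1 s x + b1x s x)) (at x)" for s x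
    by (rule DERIV_cong[OF DERIV_mult[OF DERIV_chain2[OF DERIV_exp A1_x] b1_x]]) (simp add: algebra_simps)
qed

text \<open>The label derivative of the formula for \<open>S\<close>, divided by the Jacobian so as
  to become the third space derivative.\<close>

definition \<Theta> where "\<Theta> t x = (- \<alpha> t x * S t x + exp (- A1 t x) * (\<Theta>0 x - I1x t x)) / J t x"

lemma S_x: "(S t has_real_derivative \<Theta> t x * J t x) (at x)"
proof -
  have "((\<lambda>x. exp (- A1 t x) * (S0 x - I1 t x)) has_real_derivative \<Theta> t x * J t x) (at x)"
    by (rule DERIV_cong[OF DERIV_mult[OF DERIV_chain2[OF DERIV_exp DERIV_minus[OF A1_x]] DERIV_diff[OF S0_d I1_x]]])
      (use L0.J_pos[of t x] in \<open>simp add: \<Theta>_def S_def field_simps\<close>)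
  then show ?thesis by (simp add: S_def[abs_def])
qed

lemma jc_\<Theta>: "jcont \<Theta>"
proof -
  have "jcont I1x" unfolding I1x_def by (rule tint_jcont[OF jc_I1x_integrand])
  moreover have "J t x \<noteq> 0" for t x using L0.J_pos[of t x] by simp
  ultimately show ?thesis unfolding \<Theta>_def
    by (intro continuous_intros jc_\<alpha> jc_S jc_A1 jc_J continuous_on_compose2[OF \<Theta>0_cont]) auto
qed

text \<open>The linear structure of the equation for S does the work: its coefficient
  \<open>a1\<close> and the exponentials of \<open>A1\<close> need only be bounded, and decay is
  inherited from the source and the datum. The same holds one order higher for \<Theta>. The weight
  is chosen last, after the bound R has fixed the admissible rate.\<close>

lemma dominated_fields:
  assumes T: "0 \<le> T"
  shows "\<exists>\<beta> \<omega>. weight \<beta> \<omega> \<and> dominated T (\<lambda>_. 1) U \<and> dominated T (\<lambda>_. 1) Q \<and> dominated T (\<lambda>_. 1) S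
    \<and> dominated T \<omega> U \<and> dominated T \<omega> Q \<and> dominated T \<omega> S \<and> dominated T \<omega> \<Theta> \<and> dominated T \<omega> P \<and> dominated T \<omega> Px"
proof -
  interpret LT: lagrangian f f1 f2 f3 f4 c l \<epsilon> T X U0 Q0 by (rule lag[OF T])
  obtain R where R: "0 \<le> R" "\<And>t. t \<in> {0..T} \<Longrightarrow> norm (fst (X t)) \<le> R \<and> norm (fst (snd (X t))) \<le> R \<and> norm (snd (snd (X t))) \<le> R"
    using LT.X_bounded by blast
  define \<beta> where "\<beta> = exp (- R) / l / 2"
  have half: "0 < z \<Longrightarrow> 0 < z / 2 \<and> z / 2 < z" for z :: real by simp
  have \<beta>: "0 < \<beta>" "\<beta> < exp (- R) / l" using divide_pos_pos[OF exp_gt_zero[of "- R"] l_pos] half[of "exp (- R) / l"] unfolding \<beta>_def by blast+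
  obtain \<omega> where \<omega>: "weight \<beta> \<omega>" "\<And>x. \<bar>apply_bcontfun U0 x\<bar> \<le> \<omega> x \<and> \<bar>apply_bcontfun Q0 x\<bar> \<le> \<omega> x \<and> \<bar>S0 x\<bar> \<le> \<omega> x \<and> \<bar>\<Theta>0 x\<bar> \<le> \<omega> x"
    using weights[OF \<beta>(1)] by blast
  have sl: "slow \<beta> \<omega>" using \<omega>(1) by (simp add: weight_def)
  then have \<omega>0: "0 \<le> \<omega> x" for x by (simp add: slow_def)
  obtain W where W: "\<And>x. \<omega> x \<le> W" using \<omega>(1) by (auto simp: weight_def)
  have "\<exists>C\<ge>0. \<forall>t\<in>{0..T}. \<forall>x. \<bar>U t x\<bar> \<le> C * \<omega> x \<and> \<bar>Q t x\<bar> \<le> C * \<omega> x \<and> P t x \<le> C * \<omega> x"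
    by (rule LT.decay[OF R sl \<beta>(2), of 1]) (use \<omega>(2) in simp_all)
  then obtain C where C0: "0 \<le> C" and C: "\<forall>t\<in>{0..T}. \<forall>x. \<bar>U t x\<bar> \<le> C * \<omega> x \<and> \<bar>Q t x\<bar> \<le> C * \<omega> x \<and> P t x \<le> C * \<omega> x"
    by blast
  have dU: "dominated T \<omega> U" and dQ: "dominated T \<omega> Q" by (rule dominatedI[OF C0]; use C in blast)+
  have dP: "dominated T \<omega> P" by (rule dominatedI[OF C0]) (use C L0.P_nonneg in simp)
  have dPx: "dominated T \<omega> Px"
  proof (rule dominatedI[of "C / l"])
    fix t x assume "t \<in> {0..T}"
    then have "P t x / l \<le> C * \<omega> x / l" using C l_pos by (intro divide_right_mono) auto
    then show "\<bar>Px t x\<bar> \<le> C / l * \<omega> x" using L0.Px_le[of t x] by simp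
  qed (use C0 l_pos in simp)
  note bdd = dominated_bounded[OF _ W \<omega>0]
  have bU: "dominated T (\<lambda>_. 1) U" and bQ: "dominated T (\<lambda>_. 1) Q" by (rule bdd[OF dU] bdd[OF dQ])+
  have bL: "dominated T (\<lambda>_. 1) (\<lambda>t x. apply_bcontfun (snd (snd (X t))) x)"
  proof (rule dominatedI[OF R(1)])
    fix t x assume "t \<in> {0..T}"
    then have "norm (snd (snd (X t))) \<le> R" using R(2) by blast
    then show "\<bar>apply_bcontfun (snd (snd (X t))) x\<bar> \<le> R * 1"
      using abs_le_norm_bcontfun[of "snd (snd (X t))" x] by linarith
  qed
  have bJ: "dominated T (\<lambda>_. 1) J"
    unfolding L0.J_def[abs_def] by (intro dominated_outer[OF bL] continuous_intros)
  have "dominated T (\<lambda>_. 1) (\<lambda>t x. exp (- apply_bcontfun (snd (snd (X t))) x))"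
    by (rule dominated_outer[OF bL, of "\<lambda>v. exp (- v)"]) (intro continuous_intros)
  then have bJ': "dominated T (\<lambda>_. 1) (\<lambda>t x. 1 / J t x)"
    by (simp add: L0.J_def exp_minus inverse_eq_divide)
  note bf = dominated_outer[OF bU f_cont(3)] dominated_outer[OF bU f_cont(4)] dominated_outer[OF bU f4_cont]
  note bq = dominated_outer[OF bQ \<psi>_cont] dominated_outer[OF bQ continuous_on_d\<psi>]
  have bm: "dominated T (\<lambda>_. 1) (\<lambda>t x. min (Q t x + 1 / \<epsilon>) 0)"
    by (rule dominated_outer[OF bQ, of "\<lambda>q. min (q + 1 / \<epsilon>) 0"]) (intro continuous_intros)
  have d\<psi>: "dominated T \<omega> (\<lambda>t x. \<psi> (Q t x))" and d\<kappa>: "dominated T \<omega> (\<lambda>t x. \<kappa> (Q t x))"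
  proof -
    have qq: "dominated T \<omega> (\<lambda>t x. 2 * (Q t x * Q t x))" by (intro dominated_mult dominated_const bQ dQ)
    show "dominated T \<omega> (\<lambda>t x. \<psi> (Q t x))"
    proof (rule dominated_mono[OF qq])
      show "\<bar>\<psi> (Q t x)\<bar> \<le> \<bar>2 * (Q t x * Q t x)\<bar>" for t x
        using \<psi>_bounds[of "Q t x"] zero_le_square[of "Q t x"] by (simp add: power2_eq_square)
    qed
    show "dominated T \<omega> (\<lambda>t x. \<kappa> (Q t x))"
      by (rule dominated_mono[OF qq]) (use \<kappa>_bounds in \<open>auto simp: power2_eq_square\<close>)
  qed
  have ba1: "dominated T (\<lambda>_. 1) a1" unfolding a1_def by (intro dominated_diff dominated_mult dominated_const bf bQ bm)
  have bA1: "dominated T (\<lambda>_. 1) A1" unfolding A1_def by (intro dominated_tint ba1 jc_a1 T) simp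
  have bE: "dominated T (\<lambda>_. 1) (\<lambda>t x. exp (A1 t x))" "dominated T (\<lambda>_. 1) (\<lambda>t x. exp (- A1 t x))"
    by (intro dominated_outer[OF bA1] dominated_outer[OF dominated_minus[OF bA1]] continuous_intros)+
  have db1: "dominated T \<omega> b1" unfolding b1_def by (intro dominated_add dominated_mult dominated_const bf bQ d\<psi> dPx)
  have dI1: "dominated T \<omega> I1" unfolding I1_def by (intro dominated_tint dominated_mult bE db1 jc_I1_integrand \<omega>0 T)
  have dS0: "dominated T \<omega> (\<lambda>t. S0)" and d\<Theta>0: "dominated T \<omega> (\<lambda>t. \<Theta>0)"
    by (rule dominatedI[of 1]; use \<omega>(2) in simp)+
  have dS: "dominated T \<omega> S" unfolding S_def by (intro dominated_mult dominated_diff bE dS0 dI1)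
  have bS: "dominated T (\<lambda>_. 1) S" by (rule bdd[OF dS])
  have bi: "dominated T (\<lambda>_. 1) (\<lambda>t x. 2 - indicator {..< - 1 / \<epsilon>} (Q t x))"
    by (rule dominatedI[of 2]) (auto simp: indicator_def)
  have "dominated T (\<lambda>_. 1) a1x"
    unfolding a1x_def by (intro dominated_add dominated_diff dominated_mult dominated_const bf bQ bm bJ bS bi)
  then obtain B where B: "0 \<le> B" "\<forall>t\<in>{0..T}. \<forall>x. \<bar>a1x t x\<bar> \<le> B * 1" by (rule dominatedE)
  have b\<alpha>: "dominated T (\<lambda>_. 1) \<alpha>"
  proof (rule dominatedI[of "B * T"])
    fix t x assume t: "t \<in> {0..T}"
    have "norm (LINT s|lborel. indicator {0..max 0 t} s * a1x s x) \<le> (LINT s|lborel. B * indicator {0..T} s)"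
    proof (rule Bochner_Integration.integral_norm_bound_integral)
      have le: "norm (indicator {0..max 0 t} s * a1x s x) \<le> B * indicator {0..T} s" for s
        using B t by (auto simp: indicator_def)
      then show "norm (indicator {0..max 0 t} s * a1x s x) \<le> B * indicator {0..T} s" for s .
      show "integrable lborel (\<lambda>s. B * indicator {0..T} s)" by (rule integrable_indicator_Icc)
      show "integrable lborel (\<lambda>s. indicator {0..max 0 t} s * a1x s x)"
      proof (rule Bochner_Integration.integrable_bound[OF integrable_indicator_Icc])
        show "AE s in lborel. norm (indicator {0..max 0 t} s * a1x s x) \<le> norm (B * indicator {0..T} s)"
          using le abs_ge_self order_trans by (intro AE_I2) fastforce
      qed (use a1x_measurable in simp)
    qed
    also have "\<dots> = B * T" using T by simp
    finally show "\<bar>\<alpha> t x\<bar> \<le> B * T * 1" by (simp add: \<alpha>_def)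
  qed (use B T in simp)
  have db1x: "dominated T \<omega> b1x"
  proof -
    have e: "dominated T (\<lambda>_. 1) (\<lambda>_ _. 1 / l\<^sup>2)" "dominated T (\<lambda>_. 1) (\<lambda>_ _. 1 / 2)" by (rule dominated_const)+
    \<comment> \<open>\<open>b1x\<close> rearranged so that bounded factors come first and a
      decaying one last in every product, as \<open>dominated_mult\<close> expects.\<close>
    have "dominated T \<omega> (\<lambda>t x. 1 / 2 * ((f4 (U t x) * (Q t x * J t x)) * (Q t x * \<psi> (Q t x))
      + f3 (U t x) * (S t x * (J t x * \<psi> (Q t x)) + Q t x * (d\<psi> (Q t x) * (J t x * S t x))))
      + 1 / l\<^sup>2 * (J t x * (P t x - 1 / 2 * (f2 (U t x) * \<kappa> (Q t x)))))"
      by (intro dominated_add dominated_diff dominated_mult e bf bQ bJ bS bq d\<psi> d\<kappa> dP dS)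
    then show ?thesis by (simp add: b1x_def[abs_def] mult.assoc mult.commute mult.left_commute)
  qed
  have dI1x: "dominated T \<omega> I1x"
    unfolding I1x_def by (intro dominated_tint dominated_mult dominated_add bE b\<alpha> db1 db1x jc_I1x_integrand \<omega>0 T)
  have "dominated T \<omega> (\<lambda>t x. 1 / J t x * (- \<alpha> t x * S t x + exp (- A1 t x) * (\<Theta>0 x - I1x t x)))"
    by (intro dominated_mult dominated_add dominated_minus dominated_diff bJ' b\<alpha> dS bE d\<Theta>0 dI1x)
  then have d\<Theta>: "dominated T \<omega> \<Theta>" by (simp add: \<Theta>_def[abs_def])
  show ?thesis using \<omega>(1) bU bQ bS dU dQ dS d\<Theta> dP dPx by blast
qed

end

text \<open>Integrability is assumed of the pulled-back function only; the change of variables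
  theorem, stated for Lebesgue measure, provides it for f, and Borel measurability leads back to
  \<open>lborel\<close>.\<close>

lemma LINT_substitution:
  fixes g :: "real \<Rightarrow> real"
  assumes d: "\<And>x. (g has_real_derivative g' x) (at x)" and pos: "\<And>x. 0 < g' x" and surj: "range g = UNIV"
    and f: "f \<in> borel_measurable borel" and int: "integrable lborel (\<lambda>x. g' x * f (g x))"
  shows "(LINT x|lborel. f x) = (LINT x|lborel. g' x * f (g x))"
proof -
  have mono: "x < y \<Longrightarrow> g x < g y" for x y
    by (rule DERIV_pos_imp_increasing) (use d pos in blast)+
  have inj: "inj_on g UNIV" by (rule inj_onI) (metis less_irrefl linorder_neqE_linordered_idom mono)
  have "(\<lambda>x. \<bar>g' x\<bar> * f (g x)) = (\<lambda>x. g' x * f (g x))" using pos by (auto simp: less_imp_le)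
  then have "(\<lambda>x. \<bar>g' x\<bar> * f (g x)) absolutely_integrable_on UNIV"
    using int by (simp add: set_integrable_def integrable_completion borel_measurable_integrable)
  then have fa: "f absolutely_integrable_on range g \<and> integral (range g) f = integral UNIV (\<lambda>x. \<bar>g' x\<bar> * f (g x))"
    using has_absolute_integral_change_of_variables_1'[of UNIV g g' f "integral UNIV (\<lambda>x. \<bar>g' x\<bar> * f (g x))"] d inj
    by auto
  then have "integrable lebesgue f" by (simp add: surj set_integrable_def)
  then have "integrable lborel f" using f by (simp add: integrable_completion)
  then have "(LINT x|lborel. f x) = integral UNIV f" by (simp add: integral_lborel)
  also have "\<dots> = integral UNIV (\<lambda>x. g' x * f (g x))"
    using fa \<open>(\<lambda>x. \<bar>g' x\<bar> * f (g x)) = (\<lambda>x. g' x * f (g x))\<close> by (simp add: surj)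
  also have "\<dots> = (LINT x|lborel. g' x * f (g x))" using int by (simp add: integral_lborel)
  finally show ?thesis .
qed

text \<open>Allows the abstract primitive in the kernel to be replaced by the actual position of the
  particles.\<close>

lemma flowmap_unique:
  assumes "\<And>x. (g has_real_derivative exp (apply_bcontfun L x)) (at x)"
  shows "flowmap L x - flowmap L y = g x - g y"
proof -
  have "\<forall>z. ((\<lambda>z. flowmap L z - g z) has_real_derivative 0) (at z)"
    by (intro allI DERIV_cong[OF DERIV_diff[OF flowmap_deriv assms]]) simp
  then have "flowmap L x - g x = flowmap L y - g y" by (rule DERIV_isconst_all)
  then show ?thesis by simp
qed

lemma LINT_reflect: "(LINT x|lborel. f (- x)) = (LINT x|lborel. f x)" for f :: "real \<Rightarrow> real"
  using lborel_integral_real_affine[of "-1" f 0] by simp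

lemma integrable_reflect: "integrable lborel (\<lambda>x. f (- x)) \<longleftrightarrow> integrable lborel f" for f :: "real \<Rightarrow> real"
  using lborel_integrable_real_affine_iff[of "-1" f 0] by simp

context global_lagrangian
begin

text \<open>Monotonicity of g turns the one-sided exponents into -|g x - g z| / l on either side of
  x. The right half is reflected back, and the two halves overlap only in the null set {x}.\<close>

lemma two_sided_kernel:
  assumes g: "\<And>x. (g has_real_derivative J t x) (at x)"
  shows "integrable lborel (\<lambda>z. exp (- \<bar>g x - g z\<bar> / l) * apply_bcontfun (rho (X t)) z)"
    and "P t x = 1 / 2 * (LINT z|lborel. exp (- \<bar>g x - g z\<bar> / l) / (2 * l) * apply_bcontfun (rho (X t)) z)"
proof -
  define L where "L = snd (snd (X t))"
  let ?r = "apply_bcontfun (rho (X t))"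
  have gL: "(g has_real_derivative exp (apply_bcontfun L x)) (at x)" for x
    using g by (simp add: L0.J_def L_def)
  have mono: "z \<le> x \<Longrightarrow> g z \<le> g x" for z x
    using g less_imp_le[OF L0.J_pos] by (intro DERIV_nonneg_imp_nondecreasing[of z x g]) blast+
  have "((\<lambda>x. - g (- x)) has_real_derivative exp (apply_bcontfun (brefl L) x)) (at x)" for x
  proof -
    have "((\<lambda>x. g (- x)) has_real_derivative exp (apply_bcontfun L (- x)) * (- 1)) (at x)"
      by (rule DERIV_chain2[OF gL]) (auto intro!: derivative_eq_intros)
    from DERIV_minus[OF this] show ?thesis by simp
  qed
  then have fl2: "flowmap (brefl L) x - flowmap (brefl L) y = - g (- x) - - g (- y)" for x y
    by (rule flowmap_unique)
  have fl1: "flowmap L x - flowmap L y = g x - g y" for x y by (rule flowmap_unique[OF gL])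
  define k1 where "k1 z = indicator {..x} z * exp (- \<bar>g x - g z\<bar> / l) * ?r z" for z
  define k2 where "k2 z = indicator {x..} z * exp (- \<bar>g x - g z\<bar> / l) * ?r z" for z
  have K1: "(\<lambda>z. indicator {..x} z * exp (- (flowmap L x - flowmap L z) / l) * ?r z) = k1"
    unfolding fl1 k1_def
  proof
    show "indicator {..x} z * exp (- (g x - g z) / l) * ?r z = indicator {..x} z * exp (- \<bar>g x - g z\<bar> / l) * ?r z" for z
      using abs_of_nonneg[of "g x - g z"] mono[of z x] by (cases "z \<le> x") simp_all
  qed
  have i1: "integrable lborel k1"
    using kernel_integrable[OF l_pos, of x L "rho (X t)"] unfolding K1 .
  have I1: "apply_bcontfun (Ileft (X t)) x = (LINT z|lborel. k1 z)"
    unfolding Ileft_apply kint_def L_def[symmetric] K1 ..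
  have K2: "(\<lambda>z. indicator {..- x} z * exp (- (flowmap (brefl L) (- x) - flowmap (brefl L) z) / l) * apply_bcontfun (brefl (rho (X t))) z)
      = (\<lambda>z. k2 (- z))"
    unfolding fl2 k2_def
  proof
    fix z
    show "indicator {..- x} z * exp (- (- g (- (- x)) - - g (- z)) / l) * apply_bcontfun (brefl (rho (X t))) z
        = indicator {x..} (- z) * exp (- \<bar>g x - g (- z)\<bar> / l) * ?r (- z)"
    proof (cases "z \<le> - x")
      case True
      then have "\<bar>g x - g (- z)\<bar> = g (- z) - g x" using mono[of x "- z"] by simp
      then show ?thesis using True by (simp add: indicator_def)
    qed (simp add: indicator_def)
  qed
  have i2: "integrable lborel k2"
    using kernel_integrable[OF l_pos, of "- x" "brefl L" "brefl (rho (X t))"] unfolding K2 by (simp only: integrable_reflect)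
  have I2: "apply_bcontfun (Iright (X t)) x = (LINT z|lborel. k2 z)"
    unfolding Iright_apply kint_def L_def[symmetric] K2 by (rule LINT_reflect)
  have ae: "AE z in lborel. k1 z + k2 z = exp (- \<bar>g x - g z\<bar> / l) * ?r z"
    using AE_lborel_singleton[of x] by eventually_elim (auto simp: k1_def k2_def indicator_def)
  have [measurable]: "g \<in> borel_measurable borel" "?r \<in> borel_measurable borel"
    using g by (auto intro!: borel_measurable_continuous_onI simp: continuous_on_eq_continuous_at DERIV_isCont)
      (meson DERIV_isCont)
  have meas: "(\<lambda>z. exp (- \<bar>g x - g z\<bar> / l) * ?r z) \<in> borel_measurable lborel" by measurable
  show int: "integrable lborel (\<lambda>z. exp (- \<bar>g x - g z\<bar> / l) * ?r z)"
    by (rule integrable_cong_AE_imp[OF Bochner_Integration.integrable_add[OF i1 i2] meas]) (use ae in auto)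
  have "(LINT z|lborel. k1 z) + (LINT z|lborel. k2 z) = (LINT z|lborel. k1 z + k2 z)"
    by (rule Bochner_Integration.integral_add[OF i1 i2, symmetric])
  also have "\<dots> = (LINT z|lborel. exp (- \<bar>g x - g z\<bar> / l) * ?r z)"
    by (rule integral_cong_AE[OF _ meas ae]) (use i1 i2 in auto)
  finally have "P t x = (LINT z|lborel. exp (- \<bar>g x - g z\<bar> / l) * ?r z) / (4 * l)"
    unfolding L0.P_def Pop_apply I1 I2 by simp
  also have "\<dots> = 1 / 2 * (LINT z|lborel. exp (- \<bar>g x - g z\<bar> / l) / (2 * l) * ?r z)"
    by (simp add: field_simps)
  finally show "P t x = 1 / 2 * (LINT z|lborel. exp (- \<bar>g x - g z\<bar> / l) / (2 * l) * ?r z)" .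
qed

subsection \<open>Eulerian coordinates\<close>

text \<open>Position at time t of the particle with label x, moving with the velocity f'(U).\<close>

definition y where "y t x = x + tint (\<lambda>s x. f1 (U s x)) t x"

lemma jc_y: "jcont y"
  unfolding y_def by (intro continuous_intros tint_jcont jc_f)

lemma y_t: "0 \<le> t \<Longrightarrow> ((\<lambda>s. y s x) has_real_derivative f1 (U t x)) (at t within {0..})"
  using DERIV_add[OF DERIV_const[of x] tint_t[OF jc_f(1), of t x]] by (simp add: y_def)

text \<open>Differentiating the position in the label gives 1 plus the time integral of f''(U) Q J,
  and that integrand is the time derivative of J by construction of the logarithm of the
  Jacobian.\<close>

lemma y_x: "(y t has_real_derivative J t x) (at x)"
proof -
  have "((\<lambda>x. x + tint (\<lambda>s x. f1 (U s x)) t x) has_real_derivative 1 + tint (\<lambda>s x. f2 (U s x) * (Q s x * J s x)) t x) (at x)"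
  proof (intro DERIV_add DERIV_ident tint_x jc_f)
    show "((\<lambda>x. f1 (U s x)) has_real_derivative f2 (U s x) * (Q s x * J s x)) (at x)" for s x
      by (rule DERIV_chain2[OF f1_d U_x'])
    show "jcont (\<lambda>s x. f2 (U s x) * (Q s x * J s x))" by (intro continuous_intros jc_f jc_Q jc_J)
  qed
  moreover have "1 + tint (\<lambda>s x. f2 (U s x) * (Q s x * J s x)) t x = J t x"
  proof (cases "0 \<le> t")
    case True
    have "tint (\<lambda>s x. f2 (U s x) * (Q s x * J s x)) t x = J t x - J 0 x"
      by (rule tint_antideriv[OF _ True]) (use J_t' in \<open>simp add: mult.assoc\<close>)
    then show ?thesis by (simp add: init')
  next
    case False
    then show ?thesis using neg_eq(3)[of t] by (simp add: tint_def init' max_def)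
  qed
  ultimately show ?thesis by (simp add: y_def[abs_def])
qed

lemma y_less: "a < b \<Longrightarrow> y t a < y t b"
  by (rule DERIV_pos_imp_increasing) (use y_x L0.J_pos in blast)+

text \<open>Finite speed on bounded time intervals. It gives surjectivity of the flow and limits
  what a slowly varying weight can lose in passing from labels to positions.\<close>

lemma y_displacement: "\<exists>B. \<forall>t\<le>T. \<forall>x. \<bar>y t x - x\<bar> \<le> B"
proof -
  define T' where "T' = max 0 T"
  have T': "0 \<le> T'" by (simp add: T'_def)
  have bU: "dominated T' (\<lambda>_. 1) U" using dominated_fields[OF T'] by blast
  have "dominated T' (\<lambda>_. 1) (tint (\<lambda>s x. f1 (U s x)))"
    by (rule dominated_tint[OF dominated_outer[OF bU f_cont(2)] jc_f(1) _ T']) simp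
  then obtain C where C: "\<forall>t\<in>{0..T'}. \<forall>x. \<bar>tint (\<lambda>s x. f1 (U s x)) t x\<bar> \<le> C * 1" by (rule dominatedE)
  have "\<bar>y t x - x\<bar> \<le> C" if "t \<le> T" for t x
  proof -
    have "y t x - x = tint (\<lambda>s x. f1 (U s x)) (max 0 t) x" by (simp add: y_def tint_def)
    moreover have "max 0 t \<in> {0..T'}" using that by (auto simp: T'_def)
    ultimately show ?thesis using C by simp
  qed
  then show ?thesis by blast
qed

lemma y_surj: "\<exists>a. y t a = x"
proof -
  obtain B where B: "\<And>x. \<bar>y t x - x\<bar> \<le> B" using y_displacement[of t] by blast
  have B0: "0 \<le> B" using B[of 0] by linarith
  have "y t (x - B) \<le> x" "x \<le> y t (x + B)" using B[of "x - B"] B[of "x + B"] by (auto simp: abs_le_iff)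
  moreover have "continuous_on {x - B..x + B} (y t)" by (rule jcont_slice[OF jc_y])
  ultimately have "\<exists>a\<ge>x - B. a \<le> x + B \<and> y t a = x" using B0 by (intro IVT') auto
  then show ?thesis by blast
qed

definition Y where "Y t x = (THE a. y t a = x)"

lemma y_Y [simp]: "y t (Y t x) = x" and Y_y [simp]: "Y t (y t a) = a"
proof -
  have uniq: "a = b" if "y t a = y t b" for a b
    using y_less[of a b t] y_less[of b a t] that by (cases a b rule: linorder_cases) auto
  show 1: "Y t (y t a) = a" for a unfolding Y_def by (rule the_equality) (auto dest: uniq)
  show "y t (Y t x) = x" using y_surj[of t x] 1 by auto
qed

lemma Y_less_iff: "Y t x < a \<longleftrightarrow> x < y t a" "a < Y t x \<longleftrightarrow> y t a < x"
  using y_less[of "Y t x" a t] y_less[of a "Y t x" t] by (cases a "Y t x" rule: linorder_cases; auto)+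

text \<open>By monotonicity a < Y(t, x) means y(t, a) < x, an open condition in (t, x) for fixed a;
  this replaces an implicit function theorem.\<close>

lemma jc_Y: "jcont Y"
  unfolding continuous_on_def
proof (rule ballI, rule order_tendstoI)
  fix p :: "real \<times> real" and a :: real
  have c: "((\<lambda>q. y (fst q) a - snd q) \<longlongrightarrow> y (fst p) a - snd p) (at p within UNIV)"
  proof -
    have "continuous_on UNIV (\<lambda>q. y (fst q) a - snd q)" by (intro continuous_intros jcont_comp[OF jc_y])
    then show ?thesis unfolding continuous_on_def by (rule bspec) simp
  qed
  show "\<forall>\<^sub>F q in at p within UNIV. a < Y (fst q) (snd q)" if "a < Y (fst p) (snd p)"
    using order_tendstoD(2)[OF c, of 0] that by (simp add: Y_less_iff)
  show "\<forall>\<^sub>F q in at p within UNIV. Y (fst q) (snd q) < a" if "Y (fst p) (snd p) < a"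
    using order_tendstoD(1)[OF c, of 0] that by (simp add: Y_less_iff)
qed

lemma Y_x: "(Y t has_real_derivative inverse (J t (Y t x))) (at x)"
proof (rule DERIV_inverse_function[of "y t" _ _ _ "x - 1" "x + 1"])
  show "(y t has_real_derivative J t (Y t x)) (at (Y t x))" by (rule y_x)
  show "isCont (Y t) x" using jcont_slice(2)[OF jc_Y, of UNIV t] by (simp add: continuous_on_eq_continuous_at)
qed (use L0.J_pos[of t "Y t x"] in auto)

lemma euler_x:
  assumes "\<And>a. (\<Gamma> t has_real_derivative \<gamma> t a * J t a) (at a)"
  shows "((\<lambda>x. \<Gamma> t (Y t x)) has_real_derivative \<gamma> t (Y t x)) (at x)"
  by (rule DERIV_cong[OF DERIV_chain2[OF assms Y_x]]) (use L0.J_pos[of t "Y t x"] in simp)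

lemma jc_euler: "jcont \<Gamma> \<Longrightarrow> jcont (\<lambda>t x. \<Gamma> t (Y t x))"
  by (erule jcont_comp) (intro continuous_intros jc_Y)+

text \<open>Along the characteristic the field is the Lagrangian one; the rest of the increment is a spatial
  increment, to which the mean value theorem applies.\<close>

lemma euler_t:
  assumes \<Gamma>: "\<And>a. ((\<lambda>s. \<Gamma> s a) has_real_derivative \<Gamma>t a) (at t within {0..})" and t: "0 \<le> t"
    and gx: "\<And>s x. ((\<lambda>x. \<Gamma> s (Y s x)) has_real_derivative gx s x) (at x)" and jc: "jcont gx"
  shows "((\<lambda>s. \<Gamma> s (Y s x)) has_real_derivative \<Gamma>t (Y t x) - f1 (U t (Y t x)) * gx t x) (at t within {0..})"
proof -
  define a where "a = Y t x"
  \<comment> \<open>Displacement of the particle that is at x at time t. Its derivative f'(u)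
    produces the transport term.\<close>
  define \<delta> where "\<delta> s = y s a - x" for s
  have \<delta>t: "\<delta> t = 0" by (simp add: \<delta>_def a_def)
  have \<delta>d: "(\<delta> has_real_derivative f1 (U t a)) (at t within {0..})"
    unfolding \<delta>_def[abs_def] using DERIV_diff[OF y_t[OF t, of a] DERIV_const[of x]] by simp
  have "\<exists>z. \<Gamma> s (Y s (x + \<delta> s)) - \<Gamma> s (Y s x) = \<delta> s * gx s z \<and> \<bar>z - x\<bar> \<le> \<bar>\<delta> s\<bar>" for s
  proof -
    consider "\<delta> s = 0" | "0 < \<delta> s" | "\<delta> s < 0" by linarith
    then show ?thesis
    proof cases
      case 1 then show ?thesis by auto
    next
      case 2
      then obtain z where "x < z" "z < x + \<delta> s" "\<Gamma> s (Y s (x + \<delta> s)) - \<Gamma> s (Y s x) = (x + \<delta> s - x) * gx s z"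
        using MVT2[of x "x + \<delta> s" "\<lambda>x. \<Gamma> s (Y s x)" "gx s"] gx by auto
      then show ?thesis by (intro exI[of _ z]) auto
    next
      case 3
      then obtain z where "x + \<delta> s < z" "z < x" "\<Gamma> s (Y s x) - \<Gamma> s (Y s (x + \<delta> s)) = (x - (x + \<delta> s)) * gx s z"
        using MVT2[of "x + \<delta> s" x "\<lambda>x. \<Gamma> s (Y s x)" "gx s"] gx by auto
      then show ?thesis by (intro exI[of _ z]) (auto simp: algebra_simps)
    qed
  qed
  then obtain z where z: "\<And>s. \<Gamma> s (Y s (x + \<delta> s)) - \<Gamma> s (Y s x) = \<delta> s * gx s (z s)" "\<And>s. \<bar>z s - x\<bar> \<le> \<bar>\<delta> s\<bar>"
    by metis
  have eq: "\<Gamma> s (Y s x) = \<Gamma> s a - \<delta> s * gx s (z s)" for s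
    using z(1)[of s] by (simp add: \<delta>_def)
  have "(\<delta> \<longlongrightarrow> 0) (at t within {0..})"
    using DERIV_continuous[OF \<delta>d] by (simp add: continuous_within \<delta>t)
  then have "((\<lambda>s. z s - x) \<longlongrightarrow> 0) (at t within {0..})"
    by (rule Lim_null_comparison[OF always_eventually, rotated, OF tendsto_rabs_zero]) (use z(2) in simp)
  then have zl: "(z \<longlongrightarrow> x) (at t within {0..})" by (simp add: LIM_zero_iff)
  have gl: "((\<lambda>s. gx s (z s)) \<longlongrightarrow> gx t x) (at t within {0..})"
  proof -
    have "isCont (\<lambda>p. gx (fst p) (snd p)) (t, x)" using jc by (simp add: continuous_on_eq_continuous_at)
    moreover have "((\<lambda>s. (s, z s)) \<longlongrightarrow> (t, x)) (at t within {0..})" by (intro tendsto_Pair tendsto_ident_at zl)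
    ultimately show ?thesis using isCont_tendsto_compose by fastforce
  qed
  have "((\<lambda>s. \<delta> s * gx s (z s)) has_real_derivative f1 (U t a) * gx t x) (at t within {0..})"
    unfolding has_field_derivative_iff
  proof -
    have "((\<lambda>s. (\<delta> s - \<delta> t) / (s - t) * gx s (z s)) \<longlongrightarrow> f1 (U t a) * gx t x) (at t within {0..})"
      using \<delta>d unfolding has_field_derivative_iff by (rule tendsto_mult[OF _ gl])
    then show "((\<lambda>s. (\<delta> s * gx s (z s) - \<delta> t * gx t (z t)) / (s - t)) \<longlongrightarrow> f1 (U t a) * gx t x) (at t within {0..})"
      by (simp add: \<delta>t)
  qed
  then show ?thesis unfolding eq a_def[symmetric] using \<Gamma>[of a] by (intro DERIV_diff) auto
qed

definition u where "u t x = U t (Y t x)"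
definition q where "q t x = Q t (Y t x)"
definition s where "s t x = S t (Y t x)"
definition \<theta> where "\<theta> t x = \<Theta> t (Y t x)"
definition p where "p t x = P t (Y t x)"
definition px where "px t x = Px t (Y t x)"

lemma jc_fields: "jcont u" "jcont q" "jcont s" "jcont \<theta>" "jcont p" "jcont px"
  unfolding u_def q_def s_def \<theta>_def p_def px_def
  by (intro jc_euler jc_U jc_Q jc_S jc_\<Theta> jc_P jc_Px)+

lemma u_x: "(u t has_real_derivative q t x) (at x)" and q_x: "(q t has_real_derivative s t x) (at x)"
  and s_x: "(s t has_real_derivative \<theta> t x) (at x)" and p_x: "(p t has_real_derivative px t x) (at x)"
  unfolding u_def[abs_def] q_def[abs_def] s_def[abs_def] \<theta>_def p_def[abs_def] px_def
  by (rule euler_x U_x' Q_x' S_x L0.P_x)+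

lemma px_x: "(px t has_real_derivative (p t x - f2 (u t x) * \<kappa> (q t x) / 2) / l\<^sup>2) (at x)"
  unfolding u_def q_def p_def px_def[abs_def] using euler_x[of Px t "\<lambda>t a. (P t a - f2 (U t a) * \<kappa> (Q t a) / 2) / l\<^sup>2" x] L0.Px_x by blast

text \<open>Eulerian time derivatives of u, q and s: the change along the characteristic minus the
  transport f'(u) times the space derivative. They are also successive space derivatives of
  \<open>v\<close>, as a C^1 curve in H^2 requires.\<close>

definition v where "v t x = - l\<^sup>2 * px t x - f1 (u t x) * q t x"
definition v1 where "v1 t x = - 1 / 2 * f2 (u t x) * \<psi> (q t x) - p t x - f1 (u t x) * s t x"
definition v2 where "v2 t x = - (f2 (u t x) * q t x + 1 / 2 * f2 (u t x) * d\<psi> (q t x)) * s t x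
   - (1 / 2 * f3 (u t x) * (q t x * \<psi> (q t x)) + px t x) - f1 (u t x) * \<theta> t x"

lemma u_t: "0 \<le> t \<Longrightarrow> ((\<lambda>s. u s x) has_real_derivative v t x) (at t within {0..})"
proof -
  assume t: "0 \<le> t"
  show ?thesis
    using euler_t[of U "\<lambda>a. - l\<^sup>2 * Px t a" t q x, OF U_t'[OF t] t u_x[unfolded u_def[abs_def]] jc_fields(2)]
    by (simp add: u_def v_def px_def)
qed

lemma q_t: "0 \<le> t \<Longrightarrow> ((\<lambda>s. q s x) has_real_derivative v1 t x) (at t within {0..})"
proof -
  assume t: "0 \<le> t"
  show ?thesis
    using euler_t[of Q "\<lambda>a. - 1 / 2 * f2 (U t a) * \<psi> (Q t a) - P t a" t s x, OF Q_t'[OF t] t q_x[unfolded q_def[abs_def]] jc_fields(3)]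
    by (simp add: q_def u_def v1_def p_def)
qed

lemma s_t: "0 \<le> t \<Longrightarrow> ((\<lambda>r. s r x) has_real_derivative v2 t x) (at t within {0..})"
proof -
  assume t: "0 \<le> t"
  show ?thesis
    using euler_t[of S "\<lambda>a. - a1 t a * S t a - b1 t a" t \<theta> x, OF S_t[OF t] t s_x[unfolded s_def[abs_def]] jc_fields(4)]
    by (simp add: q_def u_def s_def v2_def px_def a1_alt b1_def algebra_simps)
qed

lemma v_x: "(v t has_real_derivative v1 t x) (at x)"
  unfolding v_def[abs_def]
  by (rule DERIV_cong[OF DERIV_diff[OF DERIV_cmult[OF px_x] DERIV_mult[OF DERIV_chain2[OF f1_d u_x] q_x]]])
    (use l_pos in \<open>simp add: v1_def \<psi>_def \<kappa>_def power2_eq_square field_simps\<close>)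

lemma v1_x: "(v1 t has_real_derivative v2 t x) (at x)"
proof -
  have "((\<lambda>x. - 1 / 2 * (f2 (u t x) * \<psi> (q t x)) - p t x - f1 (u t x) * s t x) has_real_derivative v2 t x) (at x)"
    by (rule DERIV_cong[OF DERIV_diff[OF DERIV_diff[OF DERIV_cmult[OF DERIV_mult[OF DERIV_chain2[OF f2_d u_x] DERIV_chain2[OF \<psi>_deriv q_x]]] p_x]
        DERIV_mult[OF DERIV_chain2[OF f1_d u_x] s_x]]])
      (simp add: v2_def algebra_simps)
  then show ?thesis by (simp add: v1_def[abs_def] mult.assoc)
qed

lemmas jc_fu = jcont_outer[OF f_cont(2) jc_fields(1)] jcont_outer[OF f_cont(3) jc_fields(1)] jcont_outer[OF f_cont(4) jc_fields(1)]
lemmas jc_\<psi>q = jcont_outer[OF \<psi>_cont jc_fields(2)] jcont_outer[OF continuous_on_d\<psi> jc_fields(2)]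

lemma jc_v: "jcont v" "jcont v1" "jcont v2"
  unfolding v_def v1_def v2_def by (intro continuous_intros jc_fields jc_fu jc_\<psi>q; simp)+

text \<open>Labels and positions differ by at most B, so a slowly varying weight changes by a factor
  of at most exp(\<beta> B).\<close>

lemma dominated_euler:
  assumes w: "weight \<beta> \<omega>" and d: "dominated T \<omega> \<Gamma>" shows "dominated T \<omega> (\<lambda>t x. \<Gamma> t (Y t x))"
proof -
  obtain C where C: "0 \<le> C" "\<forall>t\<in>{0..T}. \<forall>x. \<bar>\<Gamma> t x\<bar> \<le> C * \<omega> x" using d by (rule dominatedE)
  obtain B where B: "\<And>t x. t \<le> T \<Longrightarrow> \<bar>y t x - x\<bar> \<le> B" using y_displacement[of T] by blast
  have \<omega>: "0 \<le> \<omega> x" "\<omega> y \<le> exp (\<beta> * \<bar>x - y\<bar>) * \<omega> x" "0 \<le> \<beta>" for x y using w by (auto simp: weight_def slow_def)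
  show ?thesis
  proof (rule dominatedI[of "C * exp (\<beta> * B)"])
    fix t x assume t: "t \<in> {0..T}"
    have "\<bar>x - Y t x\<bar> \<le> B" using B[of t "Y t x"] t by simp
    then have "exp (\<beta> * \<bar>x - Y t x\<bar>) * \<omega> x \<le> exp (\<beta> * B) * \<omega> x"
      using \<omega> by (intro mult_right_mono) (auto intro: mult_left_mono)
    then have "\<omega> (Y t x) \<le> exp (\<beta> * B) * \<omega> x" using \<omega>(2)[of "Y t x" x] by linarith
    then have "C * \<omega> (Y t x) \<le> C * (exp (\<beta> * B) * \<omega> x)" using C by (intro mult_left_mono) auto
    moreover have "\<bar>\<Gamma> t (Y t x)\<bar> \<le> C * \<omega> (Y t x)" using C t by blast
    ultimately show "\<bar>\<Gamma> t (Y t x)\<bar> \<le> C * exp (\<beta> * B) * \<omega> x" by (simp add: mult.assoc)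
  qed (use C in simp)
qed

lemma dominated_1_euler: "dominated T (\<lambda>_. 1) \<Gamma> \<Longrightarrow> dominated T (\<lambda>_. 1) (\<lambda>t x. \<Gamma> t (Y t x))"
  unfolding dominated_def by blast

lemma dominated_euler_fields:
  assumes T: "0 \<le> T"
  shows "\<exists>\<beta> \<omega>. weight \<beta> \<omega> \<and> dominated T \<omega> u \<and> dominated T \<omega> q \<and> dominated T \<omega> s \<and> dominated T \<omega> \<theta>
    \<and> dominated T \<omega> v \<and> dominated T \<omega> v1 \<and> dominated T \<omega> v2"
proof -
  obtain \<beta> \<omega> where w: "weight \<beta> \<omega>" and b: "dominated T (\<lambda>_. 1) U" "dominated T (\<lambda>_. 1) Q" "dominated T (\<lambda>_. 1) S"
    and d: "dominated T \<omega> U" "dominated T \<omega> Q" "dominated T \<omega> S" "dominated T \<omega> \<Theta>" "dominated T \<omega> P" "dominated T \<omega> Px"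
    using dominated_fields[OF T] by blast
  have bu: "dominated T (\<lambda>_. 1) u" "dominated T (\<lambda>_. 1) q" "dominated T (\<lambda>_. 1) s"
    unfolding u_def q_def s_def by (rule dominated_1_euler b)+
  have du: "dominated T \<omega> u" "dominated T \<omega> q" "dominated T \<omega> s" "dominated T \<omega> \<theta>" "dominated T \<omega> p" "dominated T \<omega> px"
    unfolding u_def q_def s_def \<theta>_def p_def px_def by (rule dominated_euler[OF w] d)+
  note bf = dominated_outer[OF bu(1) f_cont(2)] dominated_outer[OF bu(1) f_cont(3)] dominated_outer[OF bu(1) f_cont(4)]
  note bq = dominated_outer[OF bu(2) \<psi>_cont] dominated_outer[OF bu(2) continuous_on_d\<psi>]
  have qq: "dominated T \<omega> (\<lambda>t x. q t x * q t x)" by (intro dominated_mult bu du)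
  have d\<psi>: "dominated T \<omega> (\<lambda>t x. \<psi> (q t x))"
  proof (rule dominated_mono[OF qq])
    show "\<bar>\<psi> (q t x)\<bar> \<le> \<bar>q t x * q t x\<bar>" for t x
      using \<psi>_bounds[of "q t x"] by (simp add: power2_eq_square)
  qed
  have "dominated T \<omega> v" "dominated T \<omega> v1" "dominated T \<omega> v2"
    unfolding v_def v1_def v2_def
    by (intro dominated_diff dominated_add dominated_mult dominated_minus dominated_const bf bq bu du d\<psi>)+
  then show ?thesis using w du by blast
qed

lemma deriv_f: "deriv f = f1" "deriv f1 = f2"
  using f_d f1_d by (auto intro: DERIV_imp_deriv)

lemma deriv_u: "deriv (u t) = q t"
  using u_x by (auto intro: DERIV_imp_deriv)

text \<open>Links the P of the ordinary differential equation with the convolution in the statement: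
  substituting z = y(t, label) produces exactly the Jacobian contained in
  \<open>rho\<close>.\<close>

lemma Peps_u: "Peps f l \<epsilon> (u t) x = p t x"
proof -
  define F where "F z = Gker l (x - z) * (f2 (u t z) * \<kappa> (q t z))" for z
  define a where "a = Y t x"
  have x: "x = y t a" by (simp add: a_def)
  have "continuous_on UNIV F"
    unfolding F_def Gker_def using l_pos
    by (intro continuous_intros jcont_slice(2)[OF jcont_outer[OF f_cont(3) jc_fields(1)]] jcont_slice(2)[OF jcont_outer[OF \<kappa>_cont jc_fields(2)]]) auto
  then have meas: "F \<in> borel_measurable borel" by (rule borel_measurable_continuous_onI)
  have JF: "J t z * F (y t z) = exp (- \<bar>y t a - y t z\<bar> / l) / (2 * l) * apply_bcontfun (rho (X t)) z" for z
    by (simp add: F_def Gker_def x u_def q_def rho_apply L0.U_def L0.Q_def L0.J_def ac_simps)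
  have "integrable lborel (\<lambda>z. exp (- \<bar>y t a - y t z\<bar> / l) / (2 * l) * apply_bcontfun (rho (X t)) z)"
    using integrable_mult_right[OF two_sided_kernel(1)[where g="y t" and t=t and x=a, OF y_x], of "1 / (2 * l)"] by simp
  then have int: "integrable lborel (\<lambda>z. J t z * F (y t z))" by (simp only: JF)
  have "range (y t) = UNIV" using y_surj by (metis surj_def)
  then have "(LINT z|lborel. F z) = (LINT z|lborel. J t z * F (y t z))"
    by (rule LINT_substitution[OF y_x L0.J_pos _ meas int])
  also have "1 / 2 * \<dots> = P t a"
    unfolding JF by (rule two_sided_kernel(2)[OF y_x, symmetric])
  finally have "1 / 2 * (LINT z|lborel. F z) = p t x" by (simp add: p_def a_def)
  moreover have "Peps f l \<epsilon> (u t) x = 1 / 2 * (LINT z|lborel. F z)"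
    by (simp add: Peps_def conv_def F_def deriv_f deriv_u \<kappa>_def)
  ultimately show ?thesis by simp
qed

lemma Y_0: "Y 0 x = x"
  using Y_y[of 0 x] by (simp add: y_def)

lemma u_0: "u 0 x = apply_bcontfun U0 x"
  by (simp add: u_def Y_0 init')

end

subsection \<open>Uniqueness of weak derivatives\<close>

lemma test_fun_deriv: "test_fun \<phi> \<Longrightarrow> ((deriv ^^ k) \<phi> has_real_derivative (deriv ^^ Suc k) \<phi> x) (at x)"
  by (simp add: test_fun_def DERIV_deriv_iff_real_differentiable)

text \<open>Smoothness is checked by exhibiting the whole sequence of derivatives, which at the same
  time identifies the iterated \<open>deriv\<close>.\<close>

lemma test_funI:
  assumes D: "\<And>k x. (D k has_real_derivative D (Suc k) x) (at x)" and R: "\<And>x. R < \<bar>x\<bar> \<Longrightarrow> D 0 x = 0"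
  shows "test_fun (D 0)" and "(deriv ^^ k) (D 0) = D k"
proof -
  have eq: "(deriv ^^ k) (D 0) = D k" for k
  proof (induction k)
    case (Suc k)
    have "deriv (D k) = D (Suc k)" using D by (auto intro: DERIV_imp_deriv)
    then show ?case using Suc by simp
  qed simp
  show "(deriv ^^ k) (D 0) = D k" by (rule eq)
  show "test_fun (D 0)" unfolding test_fun_def eq using D R real_differentiable_def by blast
qed

lemma test_fun_support:
  assumes "test_fun \<phi>"
  shows "\<exists>R>0. \<forall>x. R < \<bar>x\<bar> \<longrightarrow> (deriv ^^ k) \<phi> x = 0"
proof -
  obtain R where R: "\<And>x. R < \<bar>x\<bar> \<Longrightarrow> \<phi> x = 0" using assms unfolding test_fun_def by auto
  have "\<forall>x. max R 1 < \<bar>x\<bar> \<longrightarrow> (deriv ^^ k) \<phi> x = 0"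
  proof (induction k)
    case 0 then show ?case using R by simp
  next
    case (Suc k)
    show ?case
    proof (intro allI impI)
      fix x assume x: "max R 1 < \<bar>x\<bar>"
      have "open {x :: real. max R 1 < \<bar>x\<bar>}" by (intro open_Collect_less continuous_intros)
      then have "((deriv ^^ k) \<phi> has_real_derivative 0) (at x)"
        by (rule has_field_derivative_transform_within_open[OF DERIV_const[of 0]]) (use x Suc in auto)
      then show "(deriv ^^ Suc k) \<phi> x = 0" using test_fun_deriv[OF assms, of k x] DERIV_unique by blast
    qed
  qed
  then show ?thesis by (intro exI[of _ "max R 1"]) auto
qed

lemma test_fun_cont: "test_fun \<phi> \<Longrightarrow> continuous_on S ((deriv ^^ k) \<phi>)"
  using test_fun_deriv by (meson DERIV_isCont continuous_at_imp_continuous_on)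

lemma test_fun_bounded:
  assumes "test_fun \<phi>" shows "\<exists>B>0. \<forall>x. \<bar>(deriv ^^ k) \<phi> x\<bar> \<le> B"
proof -
  obtain R where R: "R > 0" "\<And>x. R < \<bar>x\<bar> \<Longrightarrow> (deriv ^^ k) \<phi> x = 0" using test_fun_support[OF assms] by blast
  have "compact ((deriv ^^ k) \<phi> ` {-R..R})" by (intro compact_continuous_image test_fun_cont assms) auto
  then obtain B where B: "\<forall>z\<in>(deriv ^^ k) \<phi> ` {-R..R}. norm z \<le> B" using compact_imp_bounded bounded_iff by blast
  have "\<bar>(deriv ^^ k) \<phi> x\<bar> \<le> max B 1" for x
  proof (cases "\<bar>x\<bar> \<le> R")
    case True
    then have "x \<in> {-R..R}" by auto
    then have "norm ((deriv ^^ k) \<phi> x) \<le> B" using B by blast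
    then show ?thesis by simp
  next
    case False
    then have "(deriv ^^ k) \<phi> x = 0" by (intro R(2)) simp
    then show ?thesis by (simp add: max_def)
  qed
  then show ?thesis by (intro exI[of _ "max B 1"]) auto
qed

lemma L2_integrable_on_bounded:
  assumes w: "L2 w"
  shows "integrable lborel (\<lambda>x. indicator {a..b} x * \<bar>w x\<bar>)"
proof (rule Bochner_Integration.integrable_bound)
  have w2: "integrable lborel (\<lambda>x. (w x)\<^sup>2)" and [measurable]: "w \<in> borel_measurable lborel" using w by (auto simp: L2_def)
  show "integrable lborel (\<lambda>x. indicator {a..b} x + (w x)\<^sup>2 :: real)"
    by (intro Bochner_Integration.integrable_add w2 integrable_real_indicator) (auto simp: emeasure_lborel_Icc_eq)
  show "(\<lambda>x. indicator {a..b} x * \<bar>w x\<bar>) \<in> borel_measurable lborel" by measurable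
  have "\<bar>w x\<bar> \<le> 1 + (w x)\<^sup>2" for x
  proof -
    have "0 \<le> (\<bar>w x\<bar> - 1 / 2)\<^sup>2" by simp
    then show ?thesis by (simp add: power2_eq_square algebra_simps)
  qed
  then show "AE x in lborel. norm (indicator {a..b} x * \<bar>w x\<bar>) \<le> norm (indicator {a..b} x + (w x)\<^sup>2)"
    by (intro AE_I2) (auto simp: indicator_def)
qed

lemma L2_mult_integrable:
  assumes w: "L2 w" and m: "m \<in> borel_measurable borel" and B: "\<And>x. \<bar>m x\<bar> \<le> B" and R: "\<And>x. R < \<bar>x\<bar> \<Longrightarrow> m x = 0"
  shows "integrable lborel (\<lambda>x. w x * m x)"
proof (rule Bochner_Integration.integrable_bound)
  show "integrable lborel (\<lambda>x. B * (indicator {-R..R} x * \<bar>w x\<bar>))"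
    by (intro integrable_mult_right L2_integrable_on_bounded w)
  have [measurable]: "w \<in> borel_measurable lborel" using w by (simp add: L2_def)
  have [measurable]: "m \<in> borel_measurable lborel" using m by simp
  show "(\<lambda>x. w x * m x) \<in> borel_measurable lborel" by measurable
  have B0: "0 \<le> B" using B[of 0] by linarith
  have "norm (w x * m x) \<le> norm (B * (indicator {-R..R} x * \<bar>w x\<bar>))" for x
  proof (cases "\<bar>x\<bar> \<le> R")
    case True
    then have "x \<in> {-R..R}" by auto
    then show ?thesis using mult_right_mono[OF B[of x], of "\<bar>w x\<bar>"] B0 by (simp add: abs_mult mult.commute)
  next
    case False
    then have "m x = 0" by (intro R) simp
    then show ?thesis by simp
  qed
  then show "AE x in lborel. norm (w x * m x) \<le> norm (B * (indicator {-R..R} x * \<bar>w x\<bar>))" by simp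
qed

lemma L2_test_integrable:
  assumes "L2 w" "test_fun \<phi>" shows "integrable lborel (\<lambda>x. w x * (deriv ^^ k) \<phi> x)"
proof -
  obtain B where B: "\<And>x. \<bar>(deriv ^^ k) \<phi> x\<bar> \<le> B" using test_fun_bounded[OF assms(2)] by blast
  obtain R where "\<And>x. R < \<bar>x\<bar> \<Longrightarrow> (deriv ^^ k) \<phi> x = 0" using test_fun_support[OF assms(2)] by blast
  then show ?thesis
    by (intro L2_mult_integrable[OF assms(1) _ B] borel_measurable_continuous_onI test_fun_cont assms) auto
qed

text \<open>The positive and negative parts of w, taken as densities, define measures that agree on
  all rays and therefore coincide. Hence the two parts are equal almost everywhere, which forces
  both to vanish.\<close>

lemma AE_zero_of_intervals:
  fixes w :: "real \<Rightarrow> real"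
  assumes w: "integrable lborel w" and z: "\<And>a. (LINT x|lborel. indicator {a<..} x * w x) = 0"
  shows "AE x in lborel. w x = 0"
proof -
  have [measurable]: "w \<in> borel_measurable borel" using w by auto
  have ip: "integrable lborel (\<lambda>x. max 0 (w x))" "integrable lborel (\<lambda>x. max 0 (- w x))"
    using w by (auto intro!: integrable_max)
  have ii: "integrable lborel (\<lambda>x. indicator {a<..} x * max 0 (w x))" "integrable lborel (\<lambda>x. indicator {a<..} x * max 0 (- w x))" for a
    using integrable_mult_indicator[OF _ ip(1), of "{a<..}"] integrable_mult_indicator[OF _ ip(2), of "{a<..}"] by simp_all
  have em: "emeasure (density lborel (\<lambda>x. ennreal (g x))) {a<..} = ennreal (LINT x|lborel. indicator {a<..} x * g x)"
    if "integrable lborel (\<lambda>x. indicator {a<..} x * g x)" "\<And>x. 0 \<le> g x" "g \<in> borel_measurable borel" for g :: "real \<Rightarrow> real" and a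
  proof -
    have "emeasure (density lborel (\<lambda>x. ennreal (g x))) {a<..} = (\<integral>\<^sup>+x. ennreal (g x) * indicator {a<..} x \<partial>lborel)"
      using that(3) by (intro emeasure_density) auto
    also have "\<dots> = (\<integral>\<^sup>+x. ennreal (indicator {a<..} x * g x) \<partial>lborel)"
      by (intro nn_integral_cong) (auto simp: indicator_def)
    also have "\<dots> = ennreal (LINT x|lborel. indicator {a<..} x * g x)"
      by (rule nn_integral_eq_integral[OF that(1)]) (use that(2) in auto)
    finally show ?thesis .
  qed
  have "(LINT x|lborel. indicator {a<..} x * max 0 (w x)) - (LINT x|lborel. indicator {a<..} x * max 0 (- w x)) = 0" for a
  proof -
    have "(LINT x|lborel. indicator {a<..} x * max 0 (w x)) - (LINT x|lborel. indicator {a<..} x * max 0 (- w x))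
        = (LINT x|lborel. indicator {a<..} x * max 0 (w x) - indicator {a<..} x * max 0 (- w x))"
      by (rule Bochner_Integration.integral_diff[OF ii, symmetric])
    also have "\<dots> = (LINT x|lborel. indicator {a<..} x * w x)"
      by (rule Bochner_Integration.integral_cong) (auto simp: indicator_def max_def)
    finally show ?thesis using z by simp
  qed
  then have eq: "(LINT x|lborel. indicator {a<..} x * max 0 (w x)) = (LINT x|lborel. indicator {a<..} x * max 0 (- w x))" for a
    by (rule eq_iff_diff_eq_0[THEN iffD2])
  have e1: "emeasure (density lborel (\<lambda>x. ennreal (max 0 (w x)))) {a<..} = ennreal (LINT x|lborel. indicator {a<..} x * max 0 (w x))" for a
    by (rule em[OF ii(1)]) auto
  have e2: "emeasure (density lborel (\<lambda>x. ennreal (max 0 (- w x)))) {a<..} = ennreal (LINT x|lborel. indicator {a<..} x * max 0 (- w x))" for a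
    by (rule em[OF ii(2)]) auto
  have "density lborel (\<lambda>x. ennreal (max 0 (w x))) = density lborel (\<lambda>x. ennreal (max 0 (- w x)))"
    by (rule measure_eqI_lessThan) (simp_all add: e1 e2 eq)
  then have "AE x in lborel. ennreal (max 0 (w x)) = ennreal (max 0 (- w x))"
    by (intro sigma_finite_measure.density_unique[OF sigma_finite_lborel]) auto
  then show ?thesis by eventually_elim (auto simp: max_def split: if_splits)
qed

context
  fixes j :: "real \<Rightarrow> real"
  assumes j: "friedrichs_mollifier j"
begin

lemma j_test: "test_fun j" and j_nonneg: "0 \<le> j x" and j_supp: "1 \<le> \<bar>x\<bar> \<Longrightarrow> j x = 0" and j_int: "(LINT x|lborel. j x) = 1"
  using j by (auto simp: friedrichs_mollifier_def)

text \<open>The mollifier of the hypothesis doubles as a supply of test functions: its primitive is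
  a smooth transition from 0 to 1, so no explicit bump function has to be constructed.\<close>

lemma smooth_step:
  obtains H where "\<And>x. (H has_real_derivative j x) (at x)" "\<And>x. x \<le> -1 \<Longrightarrow> H x = 0" "\<And>x. 1 \<le> x \<Longrightarrow> H x = 1" "\<And>x. 0 \<le> H x" "\<And>x. H x \<le> 1"
proof -
  have jc: "continuous_on S j" for S using test_fun_cont[OF j_test, of S 0] by simp
  obtain H0 where H0: "\<And>x. (H0 has_real_derivative j x) (at x)" using continuous_antiderivative[OF jc] by blast
  define H where "H x = H0 x - H0 (-1)" for x
  have H: "(H has_real_derivative j x) (at x)" for x
    unfolding H_def[abs_def] using DERIV_diff[OF H0 DERIV_const] by simp
  have mono: "a \<le> b \<Longrightarrow> H a \<le> H b" for a b
    by (rule DERIV_nonneg_imp_nondecreasing[of a b H]) (use H j_nonneg in blast)+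
  have FT: "integral {a..b} j = H b - H a" if "a \<le> b" for a b
    using that H by (intro integral_unique fundamental_theorem_of_calculus)
      (auto simp: has_real_derivative_iff_has_vector_derivative[symmetric] intro: has_field_derivative_at_within)
  have zero: "integral {a..b} j = 0" if "\<And>x. x \<in> {a..b} \<Longrightarrow> j x = 0" for a b
    using integral_cong[of "{a..b}" j "\<lambda>_. 0"] that by simp
  have l: "H x = 0" if "x \<le> -1" for x
  proof -
    have "integral {x..-1} j = 0" by (rule zero) (auto intro!: j_supp)
    then show ?thesis using FT[OF that] by (simp add: H_def)
  qed
  have "H 1 = 1"
  proof -
    have hc: "set_integrable lborel {-1..1} j" by (rule borel_integrable_atLeastAtMost'[OF jc])
    have "(LINT x|lborel. j x) = (LINT x|lborel. indicator {-1..1} x * j x)"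
    proof (rule Bochner_Integration.integral_cong)
      show "j x = indicator {-1..1} x * j x" for x
        using j_supp[of x] by (cases "\<bar>x\<bar> \<le> 1") (auto simp: indicator_def)
    qed simp
    then have "1 = integral {-1..1} j"
      using set_borel_integral_eq_integral(2)[OF hc] j_int by (simp add: set_lebesgue_integral_def)
    then show ?thesis using FT[of "-1" 1] by (simp add: H_def)
  qed
  then have r: "H x = 1" if "1 \<le> x" for x
  proof -
    have "integral {1..x} j = 0" by (rule zero) (auto intro!: j_supp)
    then show ?thesis using FT[OF that] \<open>H 1 = 1\<close> by simp
  qed
  have b: "0 \<le> H x \<and> H x \<le> 1" for x
    using mono[of "-1" x] mono[of x 1] l[of x] r[of x] l[of "-1"] r[of 1] by (cases "x \<le> -1"; cases "1 \<le> x") auto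
  show ?thesis using that[of H] H l r b by blast
qed

text \<open>The difference of two steps, steepened by the factor n + 1 and placed at a and b, is a
  test function with values in [-1, 1] that converges to the indicator of the interval off the
  endpoints.\<close>

lemma weak_zero_interval:
  assumes w: "L2 w" and z: "\<And>\<phi>. test_fun \<phi> \<Longrightarrow> (LINT x|lborel. w x * \<phi> x) = 0" and ab: "a < b"
  shows "(LINT x|lborel. w x * indicator {a<..b} x) = 0"
proof -
  obtain H where H: "\<And>x. (H has_real_derivative j x) (at x)" "\<And>x. x \<le> -1 \<Longrightarrow> H x = 0" "\<And>x. 1 \<le> x \<Longrightarrow> H x = 1" "\<And>x. 0 \<le> H x" "\<And>x. H x \<le> 1"
    using smooth_step by blast
  \<comment> \<open>All derivatives at once: order 0 is the difference of steps, order k + 1 is the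
    k-th derivative of the mollifier with the chain rule factor. \<open>Suc n\<close> keeps the
    scaling at least 1, so the supports stay in one bounded interval.\<close>
  define D where "D n k x = (case k of 0 \<Rightarrow> H (real (Suc n) * (x - a)) - H (real (Suc n) * (x - b))
      | Suc k \<Rightarrow> real (Suc n) ^ Suc k * ((deriv ^^ k) j (real (Suc n) * (x - a)) - (deriv ^^ k) j (real (Suc n) * (x - b))))" for n k x
  have D0: "D n 0 = (\<lambda>x. H (real (Suc n) * (x - a)) - H (real (Suc n) * (x - b)))" for n
    by (rule ext) (simp only: D_def nat.case)
  have lin: "((\<lambda>x. real (Suc n) * (x - e)) has_real_derivative real (Suc n)) (at x)" for n e x
    by (auto intro!: derivative_eq_intros)
  have Dd: "(D n k has_real_derivative D n (Suc k) x) (at x)" for n k x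
  proof (cases k)
    case 0
    show ?thesis unfolding 0 D0
      by (rule DERIV_cong[OF DERIV_diff[OF DERIV_chain2[OF H(1) lin] DERIV_chain2[OF H(1) lin]]]) (simp add: D_def algebra_simps)
  next
    case (Suc i)
    have "D n k = (\<lambda>x. real (Suc n) ^ Suc i * ((deriv ^^ i) j (real (Suc n) * (x - a)) - (deriv ^^ i) j (real (Suc n) * (x - b))))"
      by (rule ext) (simp only: D_def Suc nat.case)
    then show ?thesis unfolding Suc
      by (simp only:) (rule DERIV_cong[OF DERIV_cmult[OF DERIV_diff[OF DERIV_chain2[OF test_fun_deriv[OF j_test] lin] DERIV_chain2[OF test_fun_deriv[OF j_test] lin]]]],
         simp add: D_def algebra_simps)
  qed
  define R where "R = \<bar>a\<bar> + \<bar>b\<bar> + 1"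
  have out: "D n 0 x = 0" if "R < \<bar>x\<bar>" for n x
  proof -
    have m: "z \<le> real (Suc n) * z" if "0 \<le> z" for z using mult_right_mono[of 1 "real (Suc n)" z] that by simp
    consider "x \<le> a - 1" "x \<le> b - 1" | "a + 1 \<le> x" "b + 1 \<le> x" using \<open>R < \<bar>x\<bar>\<close> unfolding R_def by linarith
    then show ?thesis
    proof cases
      case 1
      have "real (Suc n) * (x - a) \<le> -1" "real (Suc n) * (x - b) \<le> -1" using m[of "a - x"] m[of "b - x"] 1 by (simp_all add: algebra_simps)
      then show ?thesis by (simp only: D0 H(2))
    next
      case 2
      have "1 \<le> real (Suc n) * (x - a)" "1 \<le> real (Suc n) * (x - b)" using m[of "x - a"] m[of "x - b"] 2 by linarith+
      then show ?thesis by (simp only: D0 H(3))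
    qed
  qed
  have tf: "test_fun (D n 0)" for n by (rule test_funI(1)[OF Dd out])
  have bd: "\<bar>D n 0 x\<bar> \<le> 1" for n x unfolding D0 using H(4,5) by (smt (verit))
  have [measurable]: "w \<in> borel_measurable lborel" using w by (simp add: L2_def)
  have Dm: "D n 0 \<in> borel_measurable borel" for n
    using test_fun_cont[OF tf[of n], of UNIV 0] by (intro borel_measurable_continuous_onI) simp
  have "(\<lambda>n. LINT x|lborel. w x * D n 0 x) \<longlonglongrightarrow> (LINT x|lborel. w x * indicator {a<..b} x)"
  proof (rule integral_dominated_convergence[where w="\<lambda>x. indicator {-R..R} x * \<bar>w x\<bar>"])
    show "(\<lambda>x. w x * D n 0 x) \<in> borel_measurable lborel" for n using Dm[of n] by measurable
    show "integrable lborel (\<lambda>x. indicator {-R..R} x * \<bar>w x\<bar>)" by (rule L2_integrable_on_bounded[OF w])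
    show "AE x in lborel. norm (w x * D n 0 x) \<le> indicator {-R..R} x * \<bar>w x\<bar>" for n
    proof (rule AE_I2)
      fix x
      show "norm (w x * D n 0 x) \<le> indicator {-R..R} x * \<bar>w x\<bar>"
      proof (cases "R < \<bar>x\<bar>")
        case True then show ?thesis using out[OF True] by simp
      next
        case False
        then have "x \<in> {-R..R}" by auto
        then show ?thesis using mult_left_mono[OF bd[of n x], of "\<bar>w x\<bar>"] by (simp add: abs_mult)
      qed
    qed
    show "AE x in lborel. (\<lambda>n. w x * D n 0 x) \<longlonglongrightarrow> w x * indicator {a<..b} x"
      using AE_lborel_singleton[of a] AE_lborel_singleton[of b]
    proof eventually_elim
      case (elim x)
      have step: "\<forall>\<^sub>F n in sequentially. H (real (Suc n) * (x - e)) = (if e < x then 1 else 0)" if "x \<noteq> e" for e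
      proof -
        define N where "N = nat \<lceil>1 / \<bar>x - e\<bar>\<rceil>"
        have "H (real (Suc n) * (x - e)) = (if e < x then 1 else 0)" if n: "N \<le> n" for n
        proof -
          have "1 / \<bar>x - e\<bar> \<le> real (Suc n)" using n unfolding N_def by linarith
          then have "1 \<le> real (Suc n) * \<bar>x - e\<bar>" using \<open>x \<noteq> e\<close> by (simp add: divide_le_eq del: of_nat_Suc)
          then show ?thesis
            using H(2)[of "real (Suc n) * (x - e)"] H(3)[of "real (Suc n) * (x - e)"] \<open>x \<noteq> e\<close>
            by (cases "e < x") (simp_all add: abs_if algebra_simps del: of_nat_Suc)
        qed
        then show ?thesis unfolding eventually_sequentially by blast
      qed
      have "\<forall>\<^sub>F n in sequentially. w x * D n 0 x = w x * indicator {a<..b} x"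
        using step[OF elim(1)] step[OF elim(2)]
        by eventually_elim (use elim ab in \<open>auto simp: D0 indicator_def simp del: of_nat_Suc\<close>)
      then show ?case by (rule tendsto_eventually)
    qed
  qed measurable
  then show ?thesis using z[OF tf] by (simp add: LIMSEQ_const_iff)
qed

text \<open>Square integrability gives integrability only on bounded sets, hence the restriction to
  (-n, n] and a countable union.\<close>

lemma weak_zero_AE:
  assumes w: "L2 w" and z: "\<And>\<phi>. test_fun \<phi> \<Longrightarrow> (LINT x|lborel. w x * \<phi> x) = 0"
  shows "AE x in lborel. w x = 0"
proof -
  have [measurable]: "w \<in> borel_measurable lborel" using w by (simp add: L2_def)
  have "AE x in lborel. indicator {- real n<..real n} x * w x = 0" for n
  proof (rule AE_zero_of_intervals)
    show "integrable lborel (\<lambda>x. indicator {- real n<..real n} x * w x)"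
      by (rule Bochner_Integration.integrable_bound[OF L2_integrable_on_bounded[OF w, of "- real n" "real n"]])
        (auto simp: indicator_def)
    fix a
    show "(LINT x|lborel. indicator {a<..} x * (indicator {- real n<..real n} x * w x)) = 0"
    proof (cases "max a (- real n) < real n")
      case True
      have "(LINT x|lborel. indicator {a<..} x * (indicator {- real n<..real n} x * w x)) = (LINT x|lborel. w x * indicator {max a (- real n)<..real n} x)"
        by (rule Bochner_Integration.integral_cong) (auto simp: indicator_def)
      then show ?thesis using weak_zero_interval[OF w z True] by simp
    next
      case False
      then have "(\<lambda>x. indicator {a<..} x * (indicator {- real n<..real n} x * w x)) = (\<lambda>x. 0)"
        by (auto simp: indicator_def)
      then show ?thesis by simp
    qed
  qed
  then have "AE x in lborel. \<forall>n. indicator {- real n<..real n} x * w x = 0" by (intro AE_all_countable[THEN iffD2] allI)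
  then show ?thesis
  proof eventually_elim
    case (elim x)
    have "\<bar>x\<bar> < real (nat \<lceil>\<bar>x\<bar>\<rceil> + 1)" by linarith
    then have "x \<in> {- real (nat \<lceil>\<bar>x\<bar>\<rceil> + 1)<..real (nat \<lceil>\<bar>x\<bar>\<rceil> + 1)}" by auto
    then show ?case using elim[rule_format, of "nat \<lceil>\<bar>x\<bar>\<rceil> + 1"] by simp
  qed
qed

lemma L2_diff: "L2 a \<Longrightarrow> L2 b \<Longrightarrow> L2 (\<lambda>x. a x - b x)"
proof -
  assume a: "L2 a" and b: "L2 b"
  have [measurable]: "a \<in> borel_measurable lborel" "b \<in> borel_measurable lborel" using a b by (auto simp: L2_def)
  have "integrable lborel (\<lambda>x. (a x - b x)\<^sup>2)"
  proof (rule Bochner_Integration.integrable_bound)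
    show "integrable lborel (\<lambda>x. 2 * (a x)\<^sup>2 + 2 * (b x)\<^sup>2)" using a b by (auto simp: L2_def)
    have "(a x - b x)\<^sup>2 \<le> 2 * (a x)\<^sup>2 + 2 * (b x)\<^sup>2" for x
      using zero_le_power2[of "a x + b x"] by (simp add: power2_eq_square algebra_simps)
    then show "AE x in lborel. norm ((a x - b x)\<^sup>2) \<le> norm (2 * (a x)\<^sup>2 + 2 * (b x)\<^sup>2)" by simp
  qed measurable
  then show ?thesis by (simp add: L2_def)
qed

lemma weak_deriv_unique:
  assumes g: "AE x in lborel. g x = g' x" "L2 g" "L2 g'" and h: "L2 h" "L2 h'"
    and w: "weak_deriv g h" "weak_deriv g' h'"
  shows "AE x in lborel. h x = h' x"
proof -
  have "AE x in lborel. h x - h' x = 0"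
  proof (rule weak_zero_AE[OF L2_diff[OF h]])
    fix \<phi> assume \<phi>: "test_fun \<phi>"
    have ih: "integrable lborel (\<lambda>x. h x * \<phi> x)" "integrable lborel (\<lambda>x. h' x * \<phi> x)"
      using L2_test_integrable[OF h(1) \<phi>, of 0] L2_test_integrable[OF h(2) \<phi>, of 0] by simp_all
    have [measurable]: "g \<in> borel_measurable lborel" "g' \<in> borel_measurable lborel" "deriv \<phi> \<in> borel_measurable lborel"
      using g test_fun_cont[OF \<phi>, of UNIV 1] by (auto simp: L2_def intro: borel_measurable_continuous_onI)
    have "(LINT x|lborel. g x * deriv \<phi> x) = (LINT x|lborel. g' x * deriv \<phi> x)"
      by (rule integral_cong_AE) (use g(1) in auto)
    then have "(LINT x|lborel. h x * \<phi> x) = (LINT x|lborel. h' x * \<phi> x)" using w \<phi> unfolding weak_deriv_def by simp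
    then have "(LINT x|lborel. h x * \<phi> x - h' x * \<phi> x) = 0" using ih by simp
    then show "(LINT x|lborel. (h x - h' x) * \<phi> x) = 0" by (simp add: left_diff_distrib)
  qed
  then show ?thesis by eventually_elim simp
qed

text \<open>The norm is defined through an arbitrary choice of weak derivatives. Induction on the
  order with almost-everywhere uniqueness shows that any known family computes it.\<close>

lemma H_norm_eq:
  assumes D: "sobolev_derivs k g D"
  shows "H_norm k g = sqrt (\<Sum>i\<le>k. LINT x|lborel. (D i x)\<^sup>2)"
proof -
  define E where "E = (SOME D. sobolev_derivs k g D)"
  have E: "sobolev_derivs k g E" unfolding E_def by (rule someI[of "sobolev_derivs k g", OF D])
  have AE: "AE x in lborel. E i x = D i x" if "i \<le> k" for i
    using that
  proof (induction i)
    case 0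
    then show ?case using E D by (simp add: sobolev_derivs_def)
  next
    case (Suc i)
    then have "i \<le> k" "i < k" by auto
    show ?case
      by (rule weak_deriv_unique[OF Suc.IH[OF \<open>i \<le> k\<close>]]) (use E D Suc.prems \<open>i < k\<close> in \<open>auto simp: sobolev_derivs_def\<close>)
  qed
  have "(LINT x|lborel. (E i x)\<^sup>2) = (LINT x|lborel. (D i x)\<^sup>2)" if "i \<le> k" for i
  proof (rule integral_cong_AE)
    show "(\<lambda>x. (E i x)\<^sup>2) \<in> borel_measurable lborel" "(\<lambda>x. (D i x)\<^sup>2) \<in> borel_measurable lborel"
      using E D that by (auto simp: sobolev_derivs_def L2_def)
    show "AE x in lborel. (E i x)\<^sup>2 = (D i x)\<^sup>2" using AE[OF that] by eventually_elim simp
  qed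
  then show ?thesis by (simp add: H_norm_def E_def[symmetric])
qed

end

section \<open>From classical derivatives with a square integrable majorant to Sobolev
  spaces\<close>

lemma weak_deriv_classical:
  assumes g: "\<And>x. (g has_real_derivative g' x) (at x)" and c: "continuous_on UNIV g'"
  shows "weak_deriv g g'"
  unfolding weak_deriv_def
proof (intro allI impI)
  fix \<phi> assume \<phi>: "test_fun \<phi>"
  obtain R0 where R0: "0 < R0" "\<And>x. R0 < \<bar>x\<bar> \<Longrightarrow> \<phi> x = 0" using test_fun_support[OF \<phi>, of 0] by auto
  obtain R1 where R1: "0 < R1" "\<And>x. R1 < \<bar>x\<bar> \<Longrightarrow> deriv \<phi> x = 0" using test_fun_support[OF \<phi>, of 1] by auto
  define R where "R = max R0 R1 + 1"
  have R: "0 < R" "\<And>x. R \<le> \<bar>x\<bar> \<Longrightarrow> \<phi> x = 0" "\<And>x. R \<le> \<bar>x\<bar> \<Longrightarrow> deriv \<phi> x = 0" using R0 R1 by (auto simp: R_def)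
  have \<phi>d: "(\<phi> has_real_derivative deriv \<phi> x) (at x)" for x using test_fun_deriv[OF \<phi>, of 0 x] by simp
  have gc: "continuous_on S g" for S using g by (meson DERIV_isCont continuous_at_imp_continuous_on)
  have cc: "continuous_on S (\<lambda>x. g' x * \<phi> x)" "continuous_on S (\<lambda>x. g x * deriv \<phi> x)" for S
    using test_fun_cont[OF \<phi>, of S 0] test_fun_cont[OF \<phi>, of S 1] continuous_on_subset[OF c, of S]
    by (auto intro!: continuous_intros gc)
  have LI: "(LINT x|lborel. m x) = integral {-R..R} m" if "continuous_on UNIV m" "\<And>x. R \<le> \<bar>x\<bar> \<Longrightarrow> m x = 0" for m :: "real \<Rightarrow> real"
  proof -
    have "set_integrable lborel {-R..R} m" by (rule borel_integrable_atLeastAtMost') (rule continuous_on_subset[OF that(1)], simp)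
    then have "(LINT x|lborel. indicator {-R..R} x * m x) = integral {-R..R} m"
      using set_borel_integral_eq_integral(2)[of "{-R..R}" m] by (simp add: set_lebesgue_integral_def)
    moreover have "(LINT x|lborel. m x) = (LINT x|lborel. indicator {-R..R} x * m x)"
    proof (rule Bochner_Integration.integral_cong)
      show "m x = indicator {-R..R} x * m x" for x using that(2)[of x] by (cases "R \<le> \<bar>x\<bar>") (auto simp: indicator_def)
    qed simp
    ultimately show ?thesis by simp
  qed
  have "((\<lambda>x. g' x * \<phi> x + g x * deriv \<phi> x) has_integral (g R * \<phi> R - g (-R) * \<phi> (-R))) {-R..R}"
  proof (rule fundamental_theorem_of_calculus)
    fix x
    have "((\<lambda>x. g x * \<phi> x) has_real_derivative g' x * \<phi> x + g x * deriv \<phi> x) (at x)"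
      by (rule DERIV_cong[OF DERIV_mult[OF g \<phi>d]]) (simp add: algebra_simps)
    then show "((\<lambda>x. g x * \<phi> x) has_vector_derivative g' x * \<phi> x + g x * deriv \<phi> x) (at x within {-R..R})"
      by (simp add: has_real_derivative_iff_has_vector_derivative has_vector_derivative_at_within)
  qed (use R in simp)
  then have "integral {-R..R} (\<lambda>x. g' x * \<phi> x + g x * deriv \<phi> x) = 0" using R by (simp add: integral_unique)
  then have "integral {-R..R} (\<lambda>x. g' x * \<phi> x) + integral {-R..R} (\<lambda>x. g x * deriv \<phi> x) = 0"
    using integral_add[OF integrable_continuous_interval[OF cc(1)] integrable_continuous_interval[OF cc(2)], of "-R" R] by simp
  moreover have "(LINT x|lborel. g' x * \<phi> x) = integral {-R..R} (\<lambda>x. g' x * \<phi> x)" by (rule LI[OF cc(1)]) (simp add: R)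
  moreover have "(LINT x|lborel. g x * deriv \<phi> x) = integral {-R..R} (\<lambda>x. g x * deriv \<phi> x)" by (rule LI[OF cc(2)]) (simp add: R)
  ultimately show "(LINT x|lborel. g x * deriv \<phi> x) = - (LINT x|lborel. g' x * \<phi> x)" by linarith
qed

lemma L2_dominated:
  assumes c: "continuous_on UNIV g" and \<omega>: "integrable lborel (\<lambda>x. (\<omega> x)\<^sup>2)" and b: "\<And>x. \<bar>g x\<bar> \<le> C * \<omega> x"
  shows "L2 g"
proof -
  have [measurable]: "g \<in> borel_measurable borel" by (rule borel_measurable_continuous_onI[OF c])
  have "integrable lborel (\<lambda>x. (g x)\<^sup>2)"
  proof (rule Bochner_Integration.integrable_bound)
    show "integrable lborel (\<lambda>x. C\<^sup>2 * (\<omega> x)\<^sup>2)" using \<omega> by simp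
    have "(g x)\<^sup>2 \<le> C\<^sup>2 * (\<omega> x)\<^sup>2" for x
    proof -
      have "\<bar>g x\<bar> \<le> \<bar>C * \<omega> x\<bar>" using b[of x] by linarith
      then show ?thesis by (simp add: abs_le_square_iff power_mult_distrib)
    qed
    then show "AE x in lborel. norm ((g x)\<^sup>2) \<le> norm (C\<^sup>2 * (\<omega> x)\<^sup>2)" by simp
  qed measurable
  then show ?thesis by (simp add: L2_def)
qed

lemma sobolev_derivs_classical:
  assumes d: "\<And>i x. i < k \<Longrightarrow> (D i has_real_derivative D (Suc i) x) (at x)" and c: "\<And>i. i \<le> k \<Longrightarrow> continuous_on UNIV (D i)"
    and \<omega>: "integrable lborel (\<lambda>x. (\<omega> x)\<^sup>2)" and b: "\<And>i x. i \<le> k \<Longrightarrow> \<bar>D i x\<bar> \<le> C * \<omega> x"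
  shows "sobolev_derivs k (D 0) D"
  unfolding sobolev_derivs_def
  using weak_deriv_classical[OF d c] L2_dominated[OF c \<omega> b] by (auto simp: Suc_leI)

text \<open>Dominated convergence applied to each squared derivative: a common square integrable
  majorant reduces convergence in H^k to pointwise convergence.\<close>

lemma H_norm_tendsto_0:
  assumes j: "friedrichs_mollifier j"
    and d: "\<And>n i x. i < k \<Longrightarrow> (D n i has_real_derivative D n (Suc i) x) (at x)"
    and c: "\<And>n i. i \<le> k \<Longrightarrow> continuous_on UNIV (D n i)"
    and \<omega>: "integrable lborel (\<lambda>x. (\<omega> x)\<^sup>2)" and b: "\<And>n i x. i \<le> k \<Longrightarrow> \<bar>D n i x\<bar> \<le> C * \<omega> x"
    and l: "\<And>i x. i \<le> k \<Longrightarrow> (\<lambda>n. D n i x) \<longlonglongrightarrow> 0"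
  shows "(\<lambda>n :: nat. H_norm k (D n 0)) \<longlonglongrightarrow> 0"
proof -
  have eq: "H_norm k (D n 0) = sqrt (\<Sum>i\<le>k. LINT x|lborel. (D n i x)\<^sup>2)" for n
    by (rule H_norm_eq[OF j sobolev_derivs_classical[where D="D n", OF d c \<omega> b]])
  have "(\<lambda>n. LINT x|lborel. (D n i x)\<^sup>2) \<longlonglongrightarrow> (integral\<^sup>L lborel (\<lambda>x :: real. 0 :: real))" if i: "i \<le> k" for i
  proof (rule integral_dominated_convergence[where w="\<lambda>x. C\<^sup>2 * (\<omega> x)\<^sup>2"])
    show "(\<lambda>x. (D n i x)\<^sup>2) \<in> borel_measurable lborel" for n
      using borel_measurable_continuous_onI[OF c[OF i, of n]] by measurable
    show "integrable lborel (\<lambda>x. C\<^sup>2 * (\<omega> x)\<^sup>2)" using \<omega> by simp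
    show "AE x in lborel. (\<lambda>n. (D n i x)\<^sup>2) \<longlonglongrightarrow> 0"
      using tendsto_power[OF l[OF i], where n=2] by simp
    have "(D n i x)\<^sup>2 \<le> C\<^sup>2 * (\<omega> x)\<^sup>2" for n x
    proof -
      have "\<bar>D n i x\<bar> \<le> \<bar>C * \<omega> x\<bar>" using b[OF i, of n x] by linarith
      then show ?thesis by (simp add: abs_le_square_iff power_mult_distrib)
    qed
    then show "AE x in lborel. norm ((D n i x)\<^sup>2) \<le> C\<^sup>2 * (\<omega> x)\<^sup>2" for n by simp
  qed simp
  then have "(\<lambda>n. sqrt (\<Sum>i\<le>k. LINT x|lborel. (D n i x)\<^sup>2)) \<longlonglongrightarrow> sqrt (\<Sum>i\<le>k. 0)"
    by (intro tendsto_real_sqrt tendsto_sum) auto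
  then show ?thesis by (simp add: eq)
qed

lemma cont_H_classical:
  fixes D :: "nat \<Rightarrow> real \<Rightarrow> real \<Rightarrow> real"
  assumes j: "friedrichs_mollifier j"
    and d: "\<And>i t x. i < k \<Longrightarrow> (D i t has_real_derivative D (Suc i) t x) (at x)"
    and c: "\<And>i. i \<le> k \<Longrightarrow> continuous_on UNIV (\<lambda>p. D i (fst p) (snd p))"
    and dom: "\<And>T. 0 \<le> T \<Longrightarrow> \<exists>\<omega> C. integrable lborel (\<lambda>x. (\<omega> x)\<^sup>2) \<and> (\<forall>i\<le>k. \<forall>t\<in>{0..T}. \<forall>x. \<bar>D i t x\<bar> \<le> C * \<omega> x)"
  shows "cont_H k (D 0)"
proof -
  have cx: "continuous_on UNIV (D i t)" if "i \<le> k" for i t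
  proof -
    have "continuous_on UNIV (\<lambda>x. D i (fst (t, x)) (snd (t, x)))"
      by (rule continuous_on_compose2[OF c[OF that]]) (auto intro!: continuous_intros)
    then show ?thesis by simp
  qed
  have ct: "continuous_on UNIV (\<lambda>t. D i t x)" if "i \<le> k" for i x
  proof -
    have "continuous_on UNIV (\<lambda>t. D i (fst (t, x)) (snd (t, x)))"
      by (rule continuous_on_compose2[OF c[OF that]]) (auto intro!: continuous_intros)
    then show ?thesis by simp
  qed
  show ?thesis
    unfolding cont_H_def
  proof (intro conjI allI impI)
    fix t :: real assume t: "0 \<le> t"
    obtain \<omega> C where w: "integrable lborel (\<lambda>x. (\<omega> x)\<^sup>2)" "\<forall>i\<le>k. \<forall>s\<in>{0..t}. \<forall>x. \<bar>D i s x\<bar> \<le> C * \<omega> x"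
      using dom[OF t] by blast
    have "sobolev_derivs k (D 0 t) (\<lambda>i. D i t)"
      by (rule sobolev_derivs_classical[where D="\<lambda>i. D i t" and C=C, OF d cx w(1)]) (use w(2) t in auto)
    then show "in_H k (D 0 t)" unfolding in_H_def by blast
    show "((\<lambda>s. H_norm k (\<lambda>x. D 0 s x - D 0 t x)) \<longlongrightarrow> 0) (at t within {0..})"
      unfolding tendsto_at_iff_sequentially
    proof (intro allI impI)
      fix X :: "nat \<Rightarrow> real" assume X: "\<forall>i. X i \<in> {0..} - {t}" and lim: "X \<longlonglongrightarrow> t"
      have "bounded (range X)" by (rule convergent_imp_bounded[OF lim])
      then obtain B where B: "\<And>n. norm (X n) \<le> B" unfolding bounded_iff by auto
      \<comment> \<open>A convergent sequence of times is bounded, so a single majorant serves the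
        whole sequence and its limit.\<close>
      define T where "T = max B t"
      have XT: "X n \<in> {0..T}" for n using X[rule_format, of n] B[of n] by (auto simp: T_def)
      have tT: "t \<in> {0..T}" using t by (auto simp: T_def)
      obtain \<omega> C where w: "integrable lborel (\<lambda>x. (\<omega> x)\<^sup>2)" "\<forall>i\<le>k. \<forall>s\<in>{0..T}. \<forall>x. \<bar>D i s x\<bar> \<le> C * \<omega> x"
        using dom[of T] tT by auto
      have "(\<lambda>n. H_norm k ((\<lambda>n i x. D i (X n) x - D i t x) n 0)) \<longlonglongrightarrow> 0"
      proof (rule H_norm_tendsto_0[OF j, where C="2 * C" and \<omega>=\<omega>])
        show "((\<lambda>x. D i (X n) x - D i t x) has_real_derivative D (Suc i) (X n) x - D (Suc i) t x) (at x)" if "i < k" for n i x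
          by (intro DERIV_diff d that)
        show "continuous_on UNIV (\<lambda>x. D i (X n) x - D i t x)" if "i \<le> k" for n i
          by (intro continuous_intros cx that)
        show "\<bar>D i (X n) x - D i t x\<bar> \<le> 2 * C * \<omega> x" if "i \<le> k" for n i x
        proof -
          have "\<bar>D i (X n) x\<bar> \<le> C * \<omega> x" "\<bar>D i t x\<bar> \<le> C * \<omega> x" using w(2) that XT[of n] tT by blast+
          then show ?thesis by linarith
        qed
        show "(\<lambda>n. D i (X n) x - D i t x) \<longlonglongrightarrow> 0" if "i \<le> k" for i x
        proof -
          have "isCont (\<lambda>t. D i t x) t" using ct[OF that] by (simp add: continuous_on_eq_continuous_at)
          then show ?thesis using isCont_tendsto_compose[OF _ lim, of "\<lambda>t. D i t x"] by (simp add: LIM_zero)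
        qed
      qed (rule w(1))
      then show "((\<lambda>s. H_norm k (\<lambda>x. D 0 s x - D 0 t x)) \<circ> X) \<longlonglongrightarrow> 0" by (simp add: o_def)
    qed
  qed
qed

text \<open>By the mean value inequality the majorant of the time derivative also dominates the
  difference quotients, uniformly in the increment.\<close>

lemma C1_H_classical:
  fixes D V :: "nat \<Rightarrow> real \<Rightarrow> real \<Rightarrow> real"
  assumes j: "friedrichs_mollifier j"
    and d: "\<And>i t x. i < k \<Longrightarrow> (D i t has_real_derivative D (Suc i) t x) (at x)"
      "\<And>i t x. i < k \<Longrightarrow> (V i t has_real_derivative V (Suc i) t x) (at x)"
    and c: "\<And>i. i \<le> k \<Longrightarrow> continuous_on UNIV (\<lambda>p. D i (fst p) (snd p))"
      "\<And>i. i \<le> k \<Longrightarrow> continuous_on UNIV (\<lambda>p. V i (fst p) (snd p))"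
    and dom: "\<And>T. 0 \<le> T \<Longrightarrow> \<exists>\<omega> C. integrable lborel (\<lambda>x. (\<omega> x)\<^sup>2) \<and> (\<forall>i\<le>k. \<forall>t\<in>{0..T}. \<forall>x. \<bar>D i t x\<bar> \<le> C * \<omega> x \<and> \<bar>V i t x\<bar> \<le> C * \<omega> x)"
    and dt: "\<And>i t x. i \<le> k \<Longrightarrow> 0 \<le> t \<Longrightarrow> ((\<lambda>s. D i s x) has_real_derivative V i t x) (at t within {0..})"
  shows "C1_H k (D 0)"
  unfolding C1_H_def
proof (intro conjI exI[of _ "V 0"])
  show "cont_H k (D 0)"
  proof (rule cont_H_classical[where D=D, OF j d(1) c(1)])
    fix T :: real assume "0 \<le> T"
    then obtain \<omega> C where "integrable lborel (\<lambda>x. (\<omega> x)\<^sup>2)" "\<forall>i\<le>k. \<forall>t\<in>{0..T}. \<forall>x. \<bar>D i t x\<bar> \<le> C * \<omega> x \<and> \<bar>V i t x\<bar> \<le> C * \<omega> x"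
      using dom by blast
    then show "\<exists>\<omega> C. integrable lborel (\<lambda>x. (\<omega> x)\<^sup>2) \<and> (\<forall>i\<le>k. \<forall>t\<in>{0..T}. \<forall>x. \<bar>D i t x\<bar> \<le> C * \<omega> x)"
      by (intro exI[of _ \<omega>] exI[of _ C]) simp
  qed
  show "cont_H k (V 0)"
  proof (rule cont_H_classical[where D=V, OF j d(2) c(2)])
    fix T :: real assume "0 \<le> T"
    then obtain \<omega> C where "integrable lborel (\<lambda>x. (\<omega> x)\<^sup>2)" "\<forall>i\<le>k. \<forall>t\<in>{0..T}. \<forall>x. \<bar>D i t x\<bar> \<le> C * \<omega> x \<and> \<bar>V i t x\<bar> \<le> C * \<omega> x"
      using dom by blast
    then show "\<exists>\<omega> C. integrable lborel (\<lambda>x. (\<omega> x)\<^sup>2) \<and> (\<forall>i\<le>k. \<forall>t\<in>{0..T}. \<forall>x. \<bar>V i t x\<bar> \<le> C * \<omega> x)"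
      by (intro exI[of _ \<omega>] exI[of _ C]) simp
  qed
  have cx: "continuous_on UNIV (D i t)" "continuous_on UNIV (V i t)" if "i \<le> k" for i t
  proof -
    have "continuous_on UNIV (\<lambda>x. D i (fst (t, x)) (snd (t, x)))" "continuous_on UNIV (\<lambda>x. V i (fst (t, x)) (snd (t, x)))"
      by (rule continuous_on_compose2[OF c(1)[OF that]] continuous_on_compose2[OF c(2)[OF that]]; auto intro!: continuous_intros)+
    then show "continuous_on UNIV (D i t)" "continuous_on UNIV (V i t)" by simp_all
  qed
  show "\<forall>t\<ge>0. ((\<lambda>s. H_norm k (\<lambda>x. (D 0 s x - D 0 t x) / (s - t) - V 0 t x)) \<longlongrightarrow> 0) (at t within {0..})"
  proof (intro allI impI)
    fix t :: real assume t: "0 \<le> t"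
    show "((\<lambda>s. H_norm k (\<lambda>x. (D 0 s x - D 0 t x) / (s - t) - V 0 t x)) \<longlongrightarrow> 0) (at t within {0..})"
      unfolding tendsto_at_iff_sequentially
    proof (intro allI impI)
      fix X :: "nat \<Rightarrow> real" assume X: "\<forall>i. X i \<in> {0..} - {t}" and lim: "X \<longlonglongrightarrow> t"
      have "bounded (range X)" by (rule convergent_imp_bounded[OF lim])
      then obtain B where B: "\<And>n. norm (X n) \<le> B" unfolding bounded_iff by auto
      define T where "T = max B t"
      have XT: "X n \<in> {0..T}" for n using X[rule_format, of n] B[of n] by (auto simp: T_def)
      have Xt: "X n \<noteq> t" for n using X by auto
      have tT: "t \<in> {0..T}" using t by (auto simp: T_def)
      obtain \<omega> C where w: "integrable lborel (\<lambda>x. (\<omega> x)\<^sup>2)" "\<forall>i\<le>k. \<forall>s\<in>{0..T}. \<forall>x. \<bar>D i s x\<bar> \<le> C * \<omega> x \<and> \<bar>V i s x\<bar> \<le> C * \<omega> x"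
        using dom[of T] tT by auto
      have "(\<lambda>n. H_norm k ((\<lambda>n i x. (D i (X n) x - D i t x) / (X n - t) - V i t x) n 0)) \<longlonglongrightarrow> 0"
      proof (rule H_norm_tendsto_0[OF j, where C="2 * C" and \<omega>=\<omega>])
        show "((\<lambda>x. (D i (X n) x - D i t x) / (X n - t) - V i t x) has_real_derivative (D (Suc i) (X n) x - D (Suc i) t x) / (X n - t) - V (Suc i) t x) (at x)" if "i < k" for n i x
          by (intro DERIV_diff DERIV_cdivide d that)
        show "continuous_on UNIV (\<lambda>x. (D i (X n) x - D i t x) / (X n - t) - V i t x)" if "i \<le> k" for n i
          using Xt by (intro continuous_intros cx that) auto
        show "\<bar>(D i (X n) x - D i t x) / (X n - t) - V i t x\<bar> \<le> 2 * C * \<omega> x" if i: "i \<le> k" for n i x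
        proof -
          have "norm (D i (X n) x - D i t x) \<le> (C * \<omega> x) * norm (X n - t)"
          proof (rule field_differentiable_bound[of "{0..T}" "\<lambda>s. D i s x" "\<lambda>s. V i s x"])
            show "((\<lambda>s. D i s x) has_field_derivative V i s x) (at s within {0..T})" if "s \<in> {0..T}" for s
              using dt[OF i, of s x] that by (auto intro: DERIV_subset)
            show "norm (V i s x) \<le> C * \<omega> x" if "s \<in> {0..T}" for s using w(2) i that by simp
          qed (use XT tT in auto)
          then have "\<bar>(D i (X n) x - D i t x) / (X n - t)\<bar> \<le> C * \<omega> x"
            using Xt[of n] by (simp add: divide_le_eq)
          moreover have "\<bar>V i t x\<bar> \<le> C * \<omega> x" using w(2) i tT by simp
          ultimately show ?thesis by linarith
        qed
        show "(\<lambda>n. (D i (X n) x - D i t x) / (X n - t) - V i t x) \<longlonglongrightarrow> 0" if i: "i \<le> k" for i x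
        proof -
          have "((\<lambda>s. (D i s x - D i t x) / (s - t)) \<longlongrightarrow> V i t x) (at t within {0..})"
            using dt[OF i t, of x] by (simp add: has_field_derivative_iff)
          then have "((\<lambda>s. (D i s x - D i t x) / (s - t)) \<circ> X) \<longlonglongrightarrow> V i t x"
            using X lim unfolding tendsto_at_iff_sequentially by blast
          then show ?thesis by (simp add: o_def LIM_zero)
        qed
      qed (rule w(1))
      then show "((\<lambda>s. H_norm k (\<lambda>x. (D 0 s x - D 0 t x) / (s - t) - V 0 t x)) \<circ> X) \<longlonglongrightarrow> 0" by (simp add: o_def)
    qed
  qed
qed

subsection \<open>The mollified initial datum\<close>

lemma has_bochner_integral_exp_abs:
  assumes k: "0 < k"
  shows "has_bochner_integral lborel (\<lambda>x. exp (- (k * \<bar>x - z\<bar>))) (2 / k :: real)"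
proof -
  have a: "has_bochner_integral lborel (\<lambda>x. indicator {..z} x * exp (- (k * (z - x)))) (1 / k)"
    by (rule has_bochner_integral_exp_decay[OF k])
  have "has_bochner_integral lborel (\<lambda>x. indicator {..- z} (0 + (-1) * x) * exp (- (k * (- z - (0 + (-1) * x))))) (1 / k :: real)"
    using lborel_has_bochner_integral_real_affine_iff[of "-1" "\<lambda>x. indicator {..- z} x * exp (- (k * (- z - x))) :: real" "1 / k" 0]
      has_bochner_integral_exp_decay[OF k, of "- z"] by simp
  then have b: "has_bochner_integral lborel (\<lambda>x. indicator {z..} x * exp (- (k * (x - z)))) (1 / k :: real)"
    by (simp add: indicator_def algebra_simps)
  have ae: "AE x in lborel. indicator {..z} x * exp (- (k * (z - x))) + indicator {z..} x * exp (- (k * (x - z))) = exp (- (k * \<bar>x - z\<bar>))"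
    using AE_lborel_singleton[of z] by eventually_elim (auto simp: indicator_def)
  have "has_bochner_integral lborel (\<lambda>x. exp (- (k * \<bar>x - z\<bar>))) (1 / k + 1 / k)"
    by (rule has_bochner_integral_cong_AE[THEN iffD1, OF _ _ ae has_bochner_integral_add[OF a b]]) measurable
  then show ?thesis by simp
qed

text \<open>Convolution of w^2 with a two-sided exponential: a local square norm of w that is
  integrable and inherits slow variation, with rate k, from the kernel.\<close>

definition smear :: "(real \<Rightarrow> real) \<Rightarrow> real \<Rightarrow> real \<Rightarrow> real" where
  "smear w k x = (LINT z|lborel. exp (- (k * \<bar>x - z\<bar>)) * (w z)\<^sup>2)"

context
  fixes w :: "real \<Rightarrow> real" and k :: real
  assumes w: "L2 w" and k: "0 < k"
begin

lemma w_meas [measurable]: "w \<in> borel_measurable borel" and w_int: "integrable lborel (\<lambda>z. (w z)\<^sup>2)"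
  using w by (auto simp: L2_def)

lemma smear_integrand: "integrable lborel (\<lambda>z. exp (- (k * \<bar>x - z\<bar>)) * (w z)\<^sup>2)"
proof (rule Bochner_Integration.integrable_bound[OF w_int])
  have "exp (- (k * \<bar>x - z\<bar>)) * (w z)\<^sup>2 \<le> 1 * (w z)\<^sup>2" for z using k by (intro mult_right_mono) auto
  then show "AE z in lborel. norm (exp (- (k * \<bar>x - z\<bar>)) * (w z)\<^sup>2) \<le> norm ((w z)\<^sup>2)" by simp
qed measurable

lemma smear_nonneg: "0 \<le> smear w k x"
  unfolding smear_def by (intro Bochner_Integration.integral_nonneg) simp

lemma smear_bounded: "smear w k x \<le> (LINT z|lborel. (w z)\<^sup>2)"
  unfolding smear_def
proof (rule integral_mono[OF smear_integrand w_int])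
  show "exp (- (k * \<bar>x - z\<bar>)) * (w z)\<^sup>2 \<le> (w z)\<^sup>2" for z
    using k mult_right_mono[of "exp (- (k * \<bar>x - z\<bar>))" 1 "(w z)\<^sup>2"] by simp
qed

lemma smear_slow: "smear w k y \<le> exp (k * \<bar>x - y\<bar>) * smear w k x"
proof -
  have "smear w k y \<le> (LINT z|lborel. exp (k * \<bar>x - y\<bar>) * (exp (- (k * \<bar>x - z\<bar>)) * (w z)\<^sup>2))"
    unfolding smear_def
  proof (rule integral_mono[OF smear_integrand integrable_mult_right[OF smear_integrand]])
    fix z
    have "\<bar>x - z\<bar> \<le> \<bar>x - y\<bar> + \<bar>y - z\<bar>" by linarith
    then have "k * \<bar>x - z\<bar> \<le> k * (\<bar>x - y\<bar> + \<bar>y - z\<bar>)" using k by (intro mult_left_mono) auto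
    then have "exp (- (k * \<bar>y - z\<bar>)) \<le> exp (k * \<bar>x - y\<bar> + - (k * \<bar>x - z\<bar>))" by (simp add: algebra_simps)
    then have "exp (- (k * \<bar>y - z\<bar>)) * (w z)\<^sup>2 \<le> exp (k * \<bar>x - y\<bar> + - (k * \<bar>x - z\<bar>)) * (w z)\<^sup>2"
      by (rule mult_right_mono) simp
    then show "exp (- (k * \<bar>y - z\<bar>)) * (w z)\<^sup>2 \<le> exp (k * \<bar>x - y\<bar>) * (exp (- (k * \<bar>x - z\<bar>)) * (w z)\<^sup>2)"
      unfolding exp_add by (simp add: mult.assoc)
  qed
  also have "\<dots> = exp (k * \<bar>x - y\<bar>) * smear w k x" by (simp add: smear_def)
  finally show ?thesis .
qed

text \<open>Fubini with the nonnegative integrand: integrating out x first leaves 2/k times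
  w^2.\<close>

lemma smear_integrable: "integrable lborel (smear w k)"
proof -
  define F where "F p = exp (- (k * \<bar>snd p - fst p\<bar>)) * (w (fst p))\<^sup>2" for p :: "real \<times> real"
  have "integrable (lborel \<Otimes>\<^sub>M lborel) F"
  proof (rule lborel_pair.Fubini_integrable)
    show "F \<in> borel_measurable (lborel \<Otimes>\<^sub>M lborel)" unfolding F_def by measurable
    have hb: "has_bochner_integral lborel (\<lambda>x. (w z)\<^sup>2 * exp (- (k * \<bar>x - z\<bar>))) ((w z)\<^sup>2 * (2 / k))" for z
      by (intro has_bochner_integral_mult_right has_bochner_integral_exp_abs k)
    have Feq: "F (z, x) = (w z)\<^sup>2 * exp (- (k * \<bar>x - z\<bar>))" for z x by (simp add: F_def)
    have "(LINT x|lborel. norm (F (z, x))) = (w z)\<^sup>2 * (2 / k)" for z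
      using has_bochner_integral_integral_eq[OF hb[of z]] by (simp add: Feq)
    then show "integrable lborel (\<lambda>z. LINT x|lborel. norm (F (z, x)))" using w_int by simp
    show "AE z in lborel. integrable lborel (\<lambda>x. F (z, x))"
      unfolding Feq using integrable.intros[OF hb] by (intro AE_I2) blast
  qed
  then have "integrable (lborel \<Otimes>\<^sub>M lborel) (\<lambda>(x, z). F (z, x))"
    using lborel_pair.integrable_product_swap by blast
  from lborel_pair.integrable_fst'[OF this] show ?thesis by (simp add: F_def smear_def[abs_def])
qed

end

text \<open>The k-th derivative of the rescaled mollifier; of the powers of \<epsilon>, k come from
  the chain rule and one from the normalisation.\<close>

definition dmoll :: "(real \<Rightarrow> real) \<Rightarrow> real \<Rightarrow> nat \<Rightarrow> real \<Rightarrow> real" where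
  "dmoll j \<epsilon> k x = (deriv ^^ k) j (x / \<epsilon>) / \<epsilon> ^ Suc k"

definition mollified :: "(real \<Rightarrow> real) \<Rightarrow> (real \<Rightarrow> real) \<Rightarrow> real \<Rightarrow> nat \<Rightarrow> real \<Rightarrow> real" where
  "mollified w j \<epsilon> k x = (LINT z|lborel. w z * dmoll j \<epsilon> k (x - z))"

lemma conv_mollifier_eq: "conv w (mollifier_eps j \<epsilon>) = mollified w j \<epsilon> 0"
proof
  fix x
  show "conv w (mollifier_eps j \<epsilon>) x = mollified w j \<epsilon> 0 x"
    using lborel_integral_real_affine[of "-1" "\<lambda>y. w (x - y) * mollifier_eps j \<epsilon> y" x]
    by (simp add: conv_def mollified_def dmoll_def mollifier_eps_def)
qed

context
  fixes j w :: "real \<Rightarrow> real" and \<epsilon> :: real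
  assumes j: "test_fun j" and w: "L2 w" and \<epsilon>: "0 < \<epsilon>"
begin

lemma dmoll_deriv: "(dmoll j \<epsilon> k has_real_derivative dmoll j \<epsilon> (Suc k) x) (at x)"
proof -
  have "((\<lambda>x. x / \<epsilon>) has_real_derivative 1 / \<epsilon>) (at x)" by (rule DERIV_cdivide[OF DERIV_ident])
  then have "((\<lambda>x. (deriv ^^ k) j (x / \<epsilon>) / \<epsilon> ^ Suc k) has_real_derivative (deriv ^^ Suc k) j (x / \<epsilon>) * (1 / \<epsilon>) / \<epsilon> ^ Suc k) (at x)"
    by (rule DERIV_cdivide[OF DERIV_chain2[OF test_fun_deriv[OF j]]])
  moreover have "(deriv ^^ Suc k) j (x / \<epsilon>) * (1 / \<epsilon>) / \<epsilon> ^ Suc k = dmoll j \<epsilon> (Suc k) x"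
    by (simp add: dmoll_def)
  ultimately show ?thesis unfolding dmoll_def[abs_def] by simp
qed

lemma dmoll_bounds: "\<exists>M r. 0 < M \<and> 0 < r \<and> (\<forall>x. \<bar>dmoll j \<epsilon> k x\<bar> \<le> M) \<and> (\<forall>x. r < \<bar>x\<bar> \<longrightarrow> dmoll j \<epsilon> k x = 0)"
proof -
  obtain B where B: "0 < B" "\<And>x. \<bar>(deriv ^^ k) j x\<bar> \<le> B" using test_fun_bounded[OF j] by blast
  obtain R where R: "0 < R" "\<And>x. R < \<bar>x\<bar> \<Longrightarrow> (deriv ^^ k) j x = 0" using test_fun_support[OF j] by blast
  have "\<bar>dmoll j \<epsilon> k x\<bar> \<le> B / \<epsilon> ^ Suc k" for x
    using B(2)[of "x / \<epsilon>"] \<epsilon> by (simp add: dmoll_def divide_right_mono del: power_Suc)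
  moreover have "dmoll j \<epsilon> k x = 0" if "R * \<epsilon> < \<bar>x\<bar>" for x
    using R(2)[of "x / \<epsilon>"] that \<epsilon> by (simp add: dmoll_def field_simps)
  ultimately show ?thesis using B R \<epsilon> by (intro exI[of _ "B / \<epsilon> ^ Suc k"] exI[of _ "R * \<epsilon>"]) auto
qed

lemma dmoll_shift_measurable: "(\<lambda>z. dmoll j \<epsilon> k (x - z)) \<in> borel_measurable borel"
proof (rule borel_measurable_continuous_onI)
  have "continuous_on UNIV (dmoll j \<epsilon> k)"
    using dmoll_deriv by (meson DERIV_isCont continuous_at_imp_continuous_on)
  then show "continuous_on UNIV (\<lambda>z. dmoll j \<epsilon> k (x - z))"
    by (rule continuous_on_compose2) (auto intro!: continuous_intros)
qed

lemma mollified_integrable: "integrable lborel (\<lambda>z. w z * dmoll j \<epsilon> k (x - z))"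
proof -
  obtain M r where M': "0 < M \<and> 0 < r \<and> (\<forall>x. \<bar>dmoll j \<epsilon> k x\<bar> \<le> M) \<and> (\<forall>x. r < \<bar>x\<bar> \<longrightarrow> dmoll j \<epsilon> k x = 0)"
    using dmoll_bounds[of k] by (elim exE)
  then have M: "0 < M" "0 < r" "\<bar>dmoll j \<epsilon> k x\<bar> \<le> M" "r < \<bar>x\<bar> \<Longrightarrow> dmoll j \<epsilon> k x = 0" for x by blast+
  show ?thesis
    by (rule L2_mult_integrable[OF w dmoll_shift_measurable M(3), of "r + \<bar>x\<bar>"]) (auto intro!: M(4))
qed

lemma mollified_deriv: "(mollified w j \<epsilon> k has_real_derivative mollified w j \<epsilon> (Suc k) x) (at x)"
proof -
  obtain M r where "0 < M \<and> 0 < r \<and> (\<forall>x. \<bar>dmoll j \<epsilon> (Suc k) x\<bar> \<le> M) \<and> (\<forall>x. r < \<bar>x\<bar> \<longrightarrow> dmoll j \<epsilon> (Suc k) x = 0)"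
    using dmoll_bounds[of "Suc k"] by (elim exE)
  then have M: "0 < M" "0 < r" "\<bar>dmoll j \<epsilon> (Suc k) x\<bar> \<le> M" for x by blast+
  obtain M' r' where "0 < M' \<and> 0 < r' \<and> (\<forall>x. \<bar>dmoll j \<epsilon> k x\<bar> \<le> M') \<and> (\<forall>x. r' < \<bar>x\<bar> \<longrightarrow> dmoll j \<epsilon> k x = 0)"
    using dmoll_bounds[of k] by (elim exE)
  then have M': "0 < r'" "r' < \<bar>x\<bar> \<Longrightarrow> dmoll j \<epsilon> k x = 0" for x by blast+
  \<comment> \<open>The support radius enlarged by 1, since the increments h are restricted to
    [-1, 1].\<close>
  define R where "R = r' + 1"
  have [measurable]: "w \<in> borel_measurable lborel" using w unfolding L2_def by blast
  have lip: "\<bar>dmoll j \<epsilon> k (y + h) - dmoll j \<epsilon> k y\<bar> \<le> M * \<bar>h\<bar>" for y h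
  proof -
    have "norm (dmoll j \<epsilon> k (y + h) - dmoll j \<epsilon> k y) \<le> M * norm ((y + h) - y)"
    proof (rule field_differentiable_bound[of UNIV _ "dmoll j \<epsilon> (Suc k)"])
      show "norm (dmoll j \<epsilon> (Suc k) z) \<le> M" for z using M(3)[of z] by simp
    qed (rule dmoll_deriv convex_UNIV UNIV_I)+
    then show ?thesis by simp
  qed
  have "((\<lambda>h. (mollified w j \<epsilon> k (x + h) - mollified w j \<epsilon> k x) / h) \<longlongrightarrow> mollified w j \<epsilon> (Suc k) x) (at 0 within {-1..1})"
    unfolding tendsto_at_iff_sequentially
  proof (intro allI impI)
    fix h :: "nat \<Rightarrow> real" assume h: "\<forall>i. h i \<in> {-1..1} - {0}" and h0: "h \<longlonglongrightarrow> 0"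
    define q where "q n z = w z * ((dmoll j \<epsilon> k (x - z + h n) - dmoll j \<epsilon> k (x - z)) / h n)" for n z
    have "(\<lambda>n. LINT z|lborel. q n z) \<longlonglongrightarrow> (LINT z|lborel. w z * dmoll j \<epsilon> (Suc k) (x - z))"
    proof (rule integral_dominated_convergence[where w="\<lambda>z. M * (indicator {x - R..x + R} z * \<bar>w z\<bar>)"])
      show "(\<lambda>z. w z * dmoll j \<epsilon> (Suc k) (x - z)) \<in> borel_measurable lborel"
        using mollified_integrable by blast
      show "q n \<in> borel_measurable lborel" for n
        unfolding q_def using dmoll_shift_measurable[of k x] dmoll_shift_measurable[of k "x + h n"]
        by (simp add: add_diff_eq diff_add_eq)
      show "integrable lborel (\<lambda>z. M * (indicator {x - R..x + R} z * \<bar>w z\<bar>))"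
        by (intro integrable_mult_right L2_integrable_on_bounded w)
      show "AE z in lborel. (\<lambda>n. q n z) \<longlonglongrightarrow> w z * dmoll j \<epsilon> (Suc k) (x - z)"
      proof (rule AE_I2)
        fix z
        have "((\<lambda>h. (dmoll j \<epsilon> k (x - z + h) - dmoll j \<epsilon> k (x - z)) / h) \<longlongrightarrow> dmoll j \<epsilon> (Suc k) (x - z)) (at 0)"
          using dmoll_deriv[of k "x - z"] by (simp add: DERIV_def)
        then have "((\<lambda>h. (dmoll j \<epsilon> k (x - z + h) - dmoll j \<epsilon> k (x - z)) / h) \<circ> h) \<longlonglongrightarrow> dmoll j \<epsilon> (Suc k) (x - z)"
          using h h0 unfolding tendsto_at_iff_sequentially by auto
        then show "(\<lambda>n. q n z) \<longlonglongrightarrow> w z * dmoll j \<epsilon> (Suc k) (x - z)"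
          unfolding q_def o_def by (rule tendsto_mult_left)
      qed
      show "AE z in lborel. norm (q n z) \<le> M * (indicator {x - R..x + R} z * \<bar>w z\<bar>)" for n
      proof (rule AE_I2)
        fix z
        have hn: "h n \<noteq> 0" "\<bar>h n\<bar> \<le> 1" using h[rule_format, of n] by auto
        show "norm (q n z) \<le> M * (indicator {x - R..x + R} z * \<bar>w z\<bar>)"
        proof (cases "\<bar>x - z\<bar> \<le> R")
          case True
          then have "z \<in> {x - R..x + R}" by auto
          moreover have "\<bar>(dmoll j \<epsilon> k (x - z + h n) - dmoll j \<epsilon> k (x - z)) / h n\<bar> \<le> M"
            using lip[of "x - z" "h n"] hn by (simp add: divide_le_eq)
          then have "\<bar>w z\<bar> * \<bar>(dmoll j \<epsilon> k (x - z + h n) - dmoll j \<epsilon> k (x - z)) / h n\<bar> \<le> \<bar>w z\<bar> * M"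
            by (rule mult_left_mono) simp
          ultimately show ?thesis by (simp add: q_def abs_mult mult.commute)
        next
          case False
          then have "r' < \<bar>x - z\<bar>" "r' < \<bar>x - z + h n\<bar>" using hn unfolding R_def by linarith+
          then show ?thesis using M(1) by (simp add: q_def M'(2))
        qed
      qed
    qed
    moreover have "(LINT z|lborel. q n z) = (mollified w j \<epsilon> k (x + h n) - mollified w j \<epsilon> k x) / h n" for n
    proof -
      have "q n = (\<lambda>z. (w z * dmoll j \<epsilon> k (x + h n - z) - w z * dmoll j \<epsilon> k (x - z)) / h n)"
        by (simp add: q_def[abs_def] algebra_simps diff_divide_distrib)
      then show ?thesis
        by (simp add: mollified_def mollified_integrable)
    qed
    ultimately show "((\<lambda>h. (mollified w j \<epsilon> k (x + h) - mollified w j \<epsilon> k x) / h) \<circ> h) \<longlonglongrightarrow> mollified w j \<epsilon> (Suc k) x"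
      by (simp add: o_def mollified_def)
  qed
  then show ?thesis using at_within_Icc_at[of "-1" 0 "1::real"] by (simp add: DERIV_def)
qed

text \<open>Young's inequality with the optimal parameter replaces the Cauchy-Schwarz inequality.\<close>

lemma mollified_le_smear:
  assumes \<beta>: "0 < \<beta>"
  shows "\<exists>K\<ge>0. \<forall>x. \<bar>mollified w j \<epsilon> k x\<bar> \<le> K * sqrt (smear w (2 * \<beta>) x)"
proof -
  obtain M r where M': "0 < M \<and> 0 < r \<and> (\<forall>x. \<bar>dmoll j \<epsilon> k x\<bar> \<le> M) \<and> (\<forall>x. r < \<bar>x\<bar> \<longrightarrow> dmoll j \<epsilon> k x = 0)"
    using dmoll_bounds[of k] by (elim exE)
  then have M: "0 < M" "0 < r" "\<bar>dmoll j \<epsilon> k x\<bar> \<le> M" "r < \<bar>x\<bar> \<Longrightarrow> dmoll j \<epsilon> k x = 0" for x by blast+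
  have \<beta>2: "0 < 2 * \<beta>" using \<beta> by simp
  \<comment> \<open>Half of the mass of the squared bound M over the support of length 2 r, plus
    half of the loss exp(2 \<beta> r) from comparing the exponential kernel with 1 on that
    support.\<close>
  define K where "K = (M\<^sup>2 * (2 * r) + exp (2 * \<beta> * r)) / 2"
  have K0: "0 < K" using M by (simp add: K_def add_nonneg_pos)
  have "\<bar>mollified w j \<epsilon> k x\<bar> \<le> K * sqrt (smear w (2 * \<beta>) x) + e" if e: "0 < e" for x e
  proof -
    \<comment> \<open>Keeps the Young parameter m positive even if the smeared function vanishes at
      x; it costs exactly K sqrt(\<delta>) = e.\<close>
    define \<delta> where "\<delta> = (e / K)\<^sup>2"
    have \<delta>: "0 < \<delta>" using e K0 by (simp add: \<delta>_def)
    define \<Psi> where "\<Psi> = smear w (2 * \<beta>) x"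
    have \<Psi>: "0 \<le> \<Psi>" unfolding \<Psi>_def by (rule smear_nonneg[OF w \<beta>2])
    define m where "m = sqrt (\<Psi> + \<delta>)"
    have m: "0 < m" "m * m = \<Psi> + \<delta>" using \<Psi> \<delta> by (simp_all add: m_def)
    define g where "g z = m * M\<^sup>2 / 2 * indicator {x - r..x + r} z + exp (2 * \<beta> * r) / (2 * m) * (exp (- (2 * \<beta> * \<bar>x - z\<bar>)) * (w z)\<^sup>2)" for z
    have gi: "integrable lborel g"
      unfolding g_def by (intro Bochner_Integration.integrable_add integrable_indicator_Icc integrable_mult_right smear_integrand w \<beta>2)
    have "norm (mollified w j \<epsilon> k x) \<le> (LINT z|lborel. g z)"
      unfolding mollified_def
    proof (rule Bochner_Integration.integral_norm_bound_integral[OF mollified_integrable gi])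
      fix z
      show "norm (w z * dmoll j \<epsilon> k (x - z)) \<le> g z"
      proof (cases "\<bar>x - z\<bar> \<le> r")
        case True
        have "0 \<le> (m * M - \<bar>w z\<bar>)\<^sup>2" by simp
        then have "2 * (m * (M * \<bar>w z\<bar>)) \<le> m * (m * M\<^sup>2) + (w z)\<^sup>2" by (simp add: power2_eq_square algebra_simps)
        then have y: "M * \<bar>w z\<bar> \<le> m * M\<^sup>2 / 2 + 1 / (2 * m) * (w z)\<^sup>2" using m(1) by (simp add: field_simps power2_eq_square)
        have "2 * \<beta> * \<bar>x - z\<bar> \<le> 2 * \<beta> * r" using True \<beta> by simp
        then have "1 \<le> exp (2 * \<beta> * r) * exp (- (2 * \<beta> * \<bar>x - z\<bar>))" by (simp flip: exp_add)
        then have "1 / (2 * m) * (w z)\<^sup>2 * 1 \<le> 1 / (2 * m) * (w z)\<^sup>2 * (exp (2 * \<beta> * r) * exp (- (2 * \<beta> * \<bar>x - z\<bar>)))"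
          using m(1) by (intro mult_left_mono) auto
        with y have "M * \<bar>w z\<bar> \<le> m * M\<^sup>2 / 2 + exp (2 * \<beta> * r) / (2 * m) * (exp (- (2 * \<beta> * \<bar>x - z\<bar>)) * (w z)\<^sup>2)"
          by (simp add: ac_simps)
        moreover have "z \<in> {x - r..x + r}" using True by auto
        moreover have "norm (w z * dmoll j \<epsilon> k (x - z)) \<le> M * \<bar>w z\<bar>"
          using mult_right_mono[OF M(3)[of "x - z"], of "\<bar>w z\<bar>"] by (simp add: abs_mult mult.commute)
        ultimately show ?thesis by (simp add: g_def)
      next
        case False
        then have "dmoll j \<epsilon> k (x - z) = 0" by (intro M(4)) simp
        moreover have "0 \<le> g z" using m(1) by (simp add: g_def)
        ultimately show ?thesis by simp
      qed
    qed
    also have "\<dots> = m * M\<^sup>2 / 2 * (2 * r) + exp (2 * \<beta> * r) / (2 * m) * \<Psi>"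
    proof -
      have "(LINT z|lborel. g z) = (LINT z|lborel. m * M\<^sup>2 / 2 * indicator {x - r..x + r} z) + (LINT z|lborel. exp (2 * \<beta> * r) / (2 * m) * (exp (- (2 * \<beta> * \<bar>x - z\<bar>)) * (w z)\<^sup>2))"
        unfolding g_def by (intro Bochner_Integration.integral_add integrable_indicator_Icc integrable_mult_right smear_integrand w \<beta>2)
      then show ?thesis using M(2) by (simp add: \<Psi>_def smear_def)
    qed
    also have "\<Psi> \<le> m * m" using m \<delta> by simp
    then have "m * M\<^sup>2 / 2 * (2 * r) + exp (2 * \<beta> * r) / (2 * m) * \<Psi> \<le> m * M\<^sup>2 / 2 * (2 * r) + exp (2 * \<beta> * r) / (2 * m) * (m * m)"
      using m(1) by (intro add_left_mono mult_left_mono) auto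
    also have "\<dots> = K * m" using m(1) by (simp add: K_def field_simps)
    also have "m \<le> sqrt \<Psi> + sqrt \<delta>" unfolding m_def using \<Psi> \<delta> by (intro sqrt_add_le_add_sqrt) auto
    then have "K * m \<le> K * (sqrt \<Psi> + sqrt \<delta>)" using K0 by (intro mult_left_mono) auto
    also have "\<dots> = K * sqrt \<Psi> + e" using K0 e by (simp add: \<delta>_def algebra_simps)
    finally show ?thesis by (simp add: \<Psi>_def)
  qed
  then show ?thesis using K0 by (intro exI[of _ K]) (auto intro: field_le_epsilon)
qed

text \<open>The square root halves the rate, so smearing at the rate 2 \<beta> gives a weight of
  rate \<beta>. Summing the constants over orders 0 to 3 makes one weight serve the datum and the
  three derivatives that the solution needs.\<close>

lemma mollified_weight:
  assumes \<beta>: "0 < \<beta>"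
  shows "\<exists>\<omega>. weight \<beta> \<omega> \<and> (\<forall>k\<le>3. \<forall>x. \<bar>mollified w j \<epsilon> k x\<bar> \<le> \<omega> x)"
proof -
  have "\<forall>k. \<exists>K\<ge>0. \<forall>x. \<bar>mollified w j \<epsilon> k x\<bar> \<le> K * sqrt (smear w (2 * \<beta>) x)"
    using mollified_le_smear[OF \<beta>] by blast
  then obtain K where K: "\<And>k. 0 \<le> K k" "\<And>k x. \<bar>mollified w j \<epsilon> k x\<bar> \<le> K k * sqrt (smear w (2 * \<beta>) x)" by metis
  have \<beta>2: "0 < 2 * \<beta>" using \<beta> by simp
  define KK where "KK = (\<Sum>k\<le>3. K k)"
  have KK0: "0 \<le> KK" unfolding KK_def by (intro sum_nonneg K)
  define \<omega> where "\<omega> x = KK * sqrt (smear w (2 * \<beta>) x)" for x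
  note sm = smear_nonneg[OF w \<beta>2] smear_bounded[OF w \<beta>2] smear_slow[OF w \<beta>2] smear_integrable[OF w \<beta>2]
  have "\<omega> y \<le> exp (\<beta> * \<bar>x - y\<bar>) * \<omega> x" for x y
  proof -
    have "sqrt (smear w (2 * \<beta>) y) \<le> sqrt (exp (2 * (\<beta> * \<bar>x - y\<bar>)) * smear w (2 * \<beta>) x)"
      using sm(3)[of y x] by (intro real_sqrt_le_mono) (simp add: mult.assoc)
    also have "\<dots> = exp (\<beta> * \<bar>x - y\<bar>) * sqrt (smear w (2 * \<beta>) x)"
      by (simp add: real_sqrt_mult exp_double)
    finally show ?thesis using mult_left_mono[OF _ KK0] unfolding \<omega>_def by (metis mult.left_commute)
  qed
  moreover have "0 \<le> \<omega> x" for x using KK0 sm(1) by (simp add: \<omega>_def)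
  moreover have "integrable lborel (\<lambda>x. (\<omega> x)\<^sup>2)"
    using sm(4) by (simp add: \<omega>_def power_mult_distrib sm(1))
  moreover have "\<exists>B. \<forall>x. \<omega> x \<le> B"
    unfolding \<omega>_def using KK0 sm(2) by (intro exI[of _ "KK * sqrt (LINT z|lborel. (w z)\<^sup>2)"] allI mult_left_mono real_sqrt_le_mono)
  ultimately have "weight \<beta> \<omega>" using \<beta> by (simp add: weight_def slow_def)
  moreover have "\<bar>mollified w j \<epsilon> k x\<bar> \<le> \<omega> x" if "k \<le> 3" for k x
  proof -
    have "K k \<le> KK" unfolding KK_def by (rule member_le_sum) (use that K in auto)
    then have "K k * sqrt (smear w (2 * \<beta>) x) \<le> \<omega> x" unfolding \<omega>_def using sm(1)[of x] by (intro mult_right_mono) auto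
    then show ?thesis using K(2)[of k x] by linarith
  qed
  ultimately show ?thesis by blast
qed

end

theorem theorem4p1:
  fixes f K j u0 :: "real \<Rightarrow> real" and c l \<epsilon> :: real
  assumes hf: "C_k 4 f"
    and hconv: "\<And>x. deriv (deriv f) x \<ge> c" and hc: "c > 0"
    and hl: "l > 0" and heps: "\<epsilon> > 0"
    and hu0: "in_H 1 u0"
    and hj: "friedrichs_mollifier j"
    and hK: "\<And>v. (K has_real_derivative v * deriv f v) (at v)"
  shows "\<exists>u :: real \<Rightarrow> real \<Rightarrow> real.
     cont_H 3 u \<and> C1_H 2 u
   \<and> u 0 = conv u0 (mollifier_eps j \<epsilon>)
   \<and> (\<forall>t>0. \<forall>x.
        (\<lambda>s. u s x) differentiable (at t)
      \<and> (\<lambda>y. f (u t y) + l\<^sup>2 * Peps f l \<epsilon> (u t) y) differentiable (at x)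
      \<and> deriv (\<lambda>s. u s x) t
        + deriv (\<lambda>y. f (u t y) + l\<^sup>2 * Peps f l \<epsilon> (u t) y) x = 0)
   \<and> (\<forall>t>0. \<forall>x.
        (\<lambda>s. 1/2 * (u s x)\<^sup>2 + 1/2 * l\<^sup>2 * (deriv (u s) x)\<^sup>2) differentiable (at t)
      \<and> (\<lambda>y. K (u t y) + 1/2 * l\<^sup>2 * deriv f (u t y) * (deriv (u t) y)\<^sup>2
             + l\<^sup>2 * u t y * Peps f l \<epsilon> (u t) y) differentiable (at x)
      \<and> deriv (\<lambda>s. 1/2 * (u s x)\<^sup>2 + 1/2 * l\<^sup>2 * (deriv (u s) x)\<^sup>2) t
        + deriv (\<lambda>y. K (u t y) + 1/2 * l\<^sup>2 * deriv f (u t y) * (deriv (u t) y)\<^sup>2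
             + l\<^sup>2 * u t y * Peps f l \<epsilon> (u t) y) x
        = 1/2 * l\<^sup>2 * deriv (deriv f) (u t x) * deriv (u t) x * chi \<epsilon> (deriv (u t) x)
      \<and> 1/2 * l\<^sup>2 * deriv (deriv f) (u t x) * deriv (u t) x * chi \<epsilon> (deriv (u t) x) \<le> 0)"
proof -
  define f1 where "f1 = deriv f"
  define f2 where "f2 = deriv f1"
  define f3 where "f3 = deriv f2"
  define f4 where "f4 = deriv f3"
  have pow: "(deriv ^^ 0) f = f" "(deriv ^^ 1) f = f1" "(deriv ^^ 2) f = f2" "(deriv ^^ 3) f = f3" "(deriv ^^ 4) f = f4"
    by (simp_all add: f1_def f2_def f3_def f4_def numeral_eq_Suc)
  have dd: "\<forall>i<4. \<forall>x. ((deriv ^^ i) f) differentiable (at x)" and f4c: "continuous_on UNIV f4"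
    using hf unfolding C_k_def pow by auto
  interpret reg_law f f1 f2 f3 f4 c l \<epsilon>
  proof
    show "(f has_real_derivative f1 x) (at x)" "(f1 has_real_derivative f2 x) (at x)"
      "(f2 has_real_derivative f3 x) (at x)" "(f3 has_real_derivative f4 x) (at x)" for x
      using dd[rule_format, of 0 x] dd[rule_format, of 1 x] dd[rule_format, of 2 x] dd[rule_format, of 3 x]
      unfolding pow f1_def[symmetric] f2_def f3_def f4_def
      by (simp_all add: DERIV_deriv_iff_real_differentiable[symmetric] f1_def)
    show "c \<le> f2 x" for x using hconv[of x] by (simp add: f2_def f1_def)
  qed (use f4c hc hl heps in auto)
  have w: "L2 u0" using hu0 by (auto simp: in_H_def sobolev_derivs_def)
  have jt: "test_fun j" using hj by (simp add: friedrichs_mollifier_def)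
  note md = mollified_deriv[OF jt w heps]
  define M where "M = mollified u0 j \<epsilon>"
  have Md: "(M k has_real_derivative M (Suc k) x) (at x)" for k x unfolding M_def by (rule md)
  have Mc: "continuous_on UNIV (M k)" for k using Md by (meson DERIV_isCont continuous_at_imp_continuous_on)
  have Mw: "\<exists>\<omega>. weight \<beta> \<omega> \<and> (\<forall>k\<le>3. \<forall>x. \<bar>M k x\<bar> \<le> \<omega> x)" if "0 < \<beta>" for \<beta>
    unfolding M_def by (rule mollified_weight[OF jt w heps that])
  \<comment> \<open>One weight, of rate 1, suffices to see that the datum and its derivatives are
    bounded.\<close>
  obtain \<omega>1 B1 where \<omega>1: "\<forall>k\<le>3. \<forall>x. \<bar>M k x\<bar> \<le> \<omega>1 x" "\<forall>x. \<omega>1 x \<le> B1" using Mw[of 1] unfolding weight_def by auto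
  have Mb: "M k \<in> bcontfun" if "k \<le> 3" for k
    by (rule bcontfun_normI[OF Mc, of _ B1]) (use \<omega>1 that in \<open>auto intro: order_trans\<close>)
  define U0 where "U0 = Bcontfun (M 0)"
  define Q0 where "Q0 = Bcontfun (M 1)"
  have UQ: "apply_bcontfun U0 = M 0" "apply_bcontfun Q0 = M 1"
    using Mb[of 0] Mb[of 1] by (simp_all add: U0_def Q0_def Bcontfun_inverse)
  have "\<exists>X. X 0 = (U0, Q0, 0) \<and> ode_sol vf {0..} X"
  proof (rule lagrangian_global)
    show "(apply_bcontfun U0 has_real_derivative apply_bcontfun Q0 x) (at x)" for x using Md[of 0 x] by (simp add: UQ)
    show "\<exists>\<omega>. weight \<beta> \<omega> \<and> (\<forall>x. \<bar>apply_bcontfun U0 x\<bar> \<le> \<omega> x \<and> \<bar>apply_bcontfun Q0 x\<bar> \<le> \<omega> x)" if "0 < \<beta>" for \<beta>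
      using Mw[OF that] unfolding UQ by (meson le_numeral_extra(3) one_le_numeral zero_le)
  qed
  then obtain X' where X': "X' 0 = (U0, Q0, 0)" "ode_sol vf {0..} X'" by blast
  \<comment> \<open>Freezing at negative times does not affect derivatives taken within the
    half-line.\<close>
  define X where "X t = X' (max 0 t)" for t
  have Xs: "ode_sol vf {0..} X"
    unfolding ode_sol_def
  proof
    fix t :: real assume t: "t \<in> {0..}"
    then have "(X' has_vector_derivative vf (X' t)) (at t within {0..})" using X'(2) by (simp add: ode_sol_def)
    then have "(X has_vector_derivative vf (X' t)) (at t within {0..})"
      by (rule has_vector_derivative_transform[rotated 2]) (use t in \<open>auto simp: X_def max_def\<close>)
    then show "(X has_vector_derivative vf (X t)) (at t within {0..})" using t by (simp add: X_def max_def)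
  qed
  interpret global_lagrangian f f1 f2 f3 f4 c l \<epsilon> X U0 Q0 "M 2" "M 3"
  proof
    show "X 0 = (U0, Q0, 0)" using X'(1) by (simp add: X_def)
    show "X t = X 0" if "t \<le> 0" for t using that by (simp add: X_def max_def)
    show "(apply_bcontfun U0 has_real_derivative apply_bcontfun Q0 x) (at x)" for x using Md[of 0 x] by (simp add: UQ)
    show "(apply_bcontfun Q0 has_real_derivative M 2 x) (at x)" for x using Md[of 1 x] by (simp add: UQ numeral_2_eq_2)
    show "(M 2 has_real_derivative M 3 x) (at x)" for x using Md[of 2 x] by (simp add: numeral_3_eq_3)
    show "\<exists>\<omega>. weight \<beta> \<omega> \<and> (\<forall>x. \<bar>apply_bcontfun U0 x\<bar> \<le> \<omega> x \<and> \<bar>apply_bcontfun Q0 x\<bar> \<le> \<omega> x \<and> \<bar>M 2 x\<bar> \<le> \<omega> x \<and> \<bar>M 3 x\<bar> \<le> \<omega> x)"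
      if b: "0 < \<beta>" for \<beta>
    proof -
      obtain \<omega> where "weight \<beta> \<omega>" "\<forall>k\<le>3. \<forall>x. \<bar>M k x\<bar> \<le> \<omega> x" using Mw[OF b] by blast
      then show ?thesis unfolding UQ by (intro exI[of _ \<omega>]) auto
    qed
  qed (rule Xs Mc)+
  \<comment> \<open>Fields indexed by the order of the space derivative, the form that the Sobolev
    lemmas expect: four for H^3, and in \<open>V\<close> three for the time derivative in
    H^2.\<close>
  define D where "D i = [u, q, s, \<theta>] ! i" for i :: nat
  define V where "V i = [v, v1, v2] ! i" for i :: nat
  have i3: "i < 3 \<Longrightarrow> i = 0 \<or> i = 1 \<or> i = 2" "i \<le> 3 \<Longrightarrow> i = 0 \<or> i = 1 \<or> i = 2 \<or> i = 3"
    "i < 2 \<Longrightarrow> i = 0 \<or> i = 1" "i \<le> 2 \<Longrightarrow> i = 0 \<or> i = 1 \<or> i = 2" for i :: nat by linarith+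
  have DV: "D 0 = u" "D 1 = q" "D (Suc 0) = q" "D 2 = s" "D 3 = \<theta>" "V 0 = v" "V 1 = v1" "V (Suc 0) = v1" "V 2 = v2"
    by (simp_all add: D_def V_def numeral_eq_Suc)
  have DS: "D (Suc 1) = s" "D (Suc 2) = \<theta>" "V (Suc 1) = v2" by (simp_all add: D_def V_def numeral_eq_Suc)
  have Dx: "(D i t has_real_derivative D (Suc i) t x) (at x)" if "i < 3" for i t x
    using i3(1)[OF that] by (elim disjE) (simp_all only: DV DS u_x q_x s_x)
  have Vx: "(V i t has_real_derivative V (Suc i) t x) (at x)" if "i < 2" for i t x
    using i3(3)[OF that] by (elim disjE) (simp_all only: DV DS v_x v1_x)
  have Dc: "jcont (D i)" if "i \<le> 3" for i
    using i3(2)[OF that] by (elim disjE) (simp_all only: DV jc_fields)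
  have Vc: "jcont (V i)" if "i \<le> 2" for i
    using i3(4)[OF that] by (elim disjE) (simp_all only: DV jc_v)
  have Dt: "((\<lambda>r. D i r x) has_real_derivative V i t x) (at t within {0..})" if "i \<le> 2" "0 \<le> t" for i t x
    using i3(4)[OF that(1)] by (elim disjE) (simp_all only: DV u_t[OF that(2)] q_t[OF that(2)] s_t[OF that(2)])
  have dom: "\<exists>\<omega> C. integrable lborel (\<lambda>x. (\<omega> x)\<^sup>2) \<and> (\<forall>i\<le>3. \<forall>t\<in>{0..T}. \<forall>x. \<bar>D i t x\<bar> \<le> C * \<omega> x) \<and> (\<forall>i\<le>2. \<forall>t\<in>{0..T}. \<forall>x. \<bar>V i t x\<bar> \<le> C * \<omega> x)"
    if T: "0 \<le> T" for T
  proof -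
    obtain \<beta> \<omega> where w: "weight \<beta> \<omega>" and d: "dominated T \<omega> u" "dominated T \<omega> q" "dominated T \<omega> s" "dominated T \<omega> \<theta>"
      "dominated T \<omega> v" "dominated T \<omega> v1" "dominated T \<omega> v2" using dominated_euler_fields[OF T] by blast
    have \<omega>0: "0 \<le> \<omega> x" for x using w by (simp add: weight_def slow_def)
    have "dominated T \<omega> (\<lambda>t x. \<bar>u t x\<bar> + \<bar>q t x\<bar> + \<bar>s t x\<bar> + \<bar>\<theta> t x\<bar> + \<bar>v t x\<bar> + \<bar>v1 t x\<bar> + \<bar>v2 t x\<bar>)"
      by (intro dominated_add dominated_abs d)
    then obtain C where C: "0 \<le> C" "\<forall>t\<in>{0..T}. \<forall>x. \<bar>\<bar>u t x\<bar> + \<bar>q t x\<bar> + \<bar>s t x\<bar> + \<bar>\<theta> t x\<bar> + \<bar>v t x\<bar> + \<bar>v1 t x\<bar> + \<bar>v2 t x\<bar>\<bar> \<le> C * \<omega> x"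
      by (rule dominatedE)
    have all: "\<bar>u t x\<bar> \<le> C * \<omega> x \<and> \<bar>q t x\<bar> \<le> C * \<omega> x \<and> \<bar>s t x\<bar> \<le> C * \<omega> x \<and> \<bar>\<theta> t x\<bar> \<le> C * \<omega> x
        \<and> \<bar>v t x\<bar> \<le> C * \<omega> x \<and> \<bar>v1 t x\<bar> \<le> C * \<omega> x \<and> \<bar>v2 t x\<bar> \<le> C * \<omega> x" if "t \<in> {0..T}" for t x
    proof -
      have sum_le: "\<bar>u t x\<bar> + \<bar>q t x\<bar> + \<bar>s t x\<bar> + \<bar>\<theta> t x\<bar> + \<bar>v t x\<bar> + \<bar>v1 t x\<bar> + \<bar>v2 t x\<bar> \<le> C * \<omega> x"
        by (rule order_trans[OF abs_ge_self C(2)[rule_format, OF that]])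
      have each: "a1 \<le> b \<and> a2 \<le> b \<and> a3 \<le> b \<and> a4 \<le> b \<and> a5 \<le> b \<and> a6 \<le> b \<and> a7 \<le> b"
        if "0 \<le> a1" "0 \<le> a2" "0 \<le> a3" "0 \<le> a4" "0 \<le> a5" "0 \<le> a6" "0 \<le> a7" "a1 + a2 + a3 + a4 + a5 + a6 + a7 \<le> b"
        for a1 a2 a3 a4 a5 a6 a7 b :: real using that by linarith
      show ?thesis
        by (rule each[OF abs_ge_zero abs_ge_zero abs_ge_zero abs_ge_zero abs_ge_zero abs_ge_zero abs_ge_zero sum_le])
    qed
    have "\<forall>i\<le>3. \<forall>t\<in>{0..T}. \<forall>x. \<bar>D i t x\<bar> \<le> C * \<omega> x"
    proof (intro allI impI ballI)
      fix i :: nat and t x assume "i \<le> 3" "t \<in> {0..T}"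
      from i3(2)[OF \<open>i \<le> 3\<close>] show "\<bar>D i t x\<bar> \<le> C * \<omega> x"
        by (elim disjE) (use all[OF \<open>t \<in> {0..T}\<close>, of x] in \<open>simp_all only: DV\<close>)
    qed
    moreover have "\<forall>i\<le>2. \<forall>t\<in>{0..T}. \<forall>x. \<bar>V i t x\<bar> \<le> C * \<omega> x"
    proof (intro allI impI ballI)
      fix i :: nat and t x assume "i \<le> 2" "t \<in> {0..T}"
      from i3(4)[OF \<open>i \<le> 2\<close>] show "\<bar>V i t x\<bar> \<le> C * \<omega> x"
        by (elim disjE) (use all[OF \<open>t \<in> {0..T}\<close>, of x] in \<open>simp_all only: DV\<close>)
    qed
    moreover have "integrable lborel (\<lambda>x. (\<omega> x)\<^sup>2)" using w by (simp add: weight_def)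
    ultimately show ?thesis by blast
  qed
  have "cont_H 3 (D 0)"
  proof (rule cont_H_classical[where D=D, OF hj Dx Dc])
    fix T :: real assume "0 \<le> T"
    then obtain \<omega> C where "integrable lborel (\<lambda>x. (\<omega> x)\<^sup>2)" "\<forall>i\<le>3. \<forall>t\<in>{0..T}. \<forall>x. \<bar>D i t x\<bar> \<le> C * \<omega> x" using dom by blast
    then show "\<exists>\<omega> C. integrable lborel (\<lambda>x. (\<omega> x)\<^sup>2) \<and> (\<forall>i\<le>3. \<forall>t\<in>{0..T}. \<forall>x. \<bar>D i t x\<bar> \<le> C * \<omega> x)" by blast
  qed
  then have 1: "cont_H 3 u" by (simp only: DV)
  have "C1_H 2 (D 0)"
  proof (rule C1_H_classical[where D=D and V=V, OF hj])
    show "(D i t has_real_derivative D (Suc i) t x) (at x)" if "i < 2" for i t x using Dx[of i] that by simp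
    show "jcont (D i)" if "i \<le> 2" for i using Dc[of i] that by simp
    fix T :: real assume "0 \<le> T"
    then obtain \<omega> C where "integrable lborel (\<lambda>x. (\<omega> x)\<^sup>2)" "\<forall>i\<le>3. \<forall>t\<in>{0..T}. \<forall>x. \<bar>D i t x\<bar> \<le> C * \<omega> x"
      "\<forall>i\<le>2. \<forall>t\<in>{0..T}. \<forall>x. \<bar>V i t x\<bar> \<le> C * \<omega> x" using dom by blast
    then show "\<exists>\<omega> C. integrable lborel (\<lambda>x. (\<omega> x)\<^sup>2) \<and> (\<forall>i\<le>2. \<forall>t\<in>{0..T}. \<forall>x. \<bar>D i t x\<bar> \<le> C * \<omega> x \<and> \<bar>V i t x\<bar> \<le> C * \<omega> x)"
      by (intro exI[of _ \<omega>] exI[of _ C]) auto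
  qed (use Vx Vc Dt in auto)
  then have 2: "C1_H 2 u" by (simp only: DV)
  have 3: "u 0 = conv u0 (mollifier_eps j \<epsilon>)"
    using u_0 by (auto simp: UQ M_def conv_mollifier_eq)
  \<comment> \<open>At positive times the one-sided time derivatives become the two-sided ones of
    the statement.\<close>
  have at: "at t within {0..} = at t" if "0 < t" for t :: real
    using that by (intro at_within_interior) auto
  have ut: "((\<lambda>r. u r x) has_real_derivative v t x) (at t)" and qt: "((\<lambda>r. q r x) has_real_derivative v1 t x) (at t)" if "0 < t" for t x
    using u_t[of t x] q_t[of t x] that at by simp_all
  have rd: "g differentiable (at x)" if "(g has_real_derivative d) (at x)" for g :: "real \<Rightarrow> real" and d x
    using that real_differentiable_def by blast
  have 4: "(\<lambda>r. u r x) differentiable (at t)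
      \<and> (\<lambda>y. f (u t y) + l\<^sup>2 * Peps f l \<epsilon> (u t) y) differentiable (at x)
      \<and> deriv (\<lambda>r. u r x) t + deriv (\<lambda>y. f (u t y) + l\<^sup>2 * Peps f l \<epsilon> (u t) y) x = 0" if t: "0 < t" for t x
  proof -
    have flux: "((\<lambda>y. f (u t y) + l\<^sup>2 * Peps f l \<epsilon> (u t) y) has_real_derivative f1 (u t x) * q t x + l\<^sup>2 * px t x) (at x)"
      unfolding Peps_u by (intro DERIV_add DERIV_cmult DERIV_chain2[OF f_d u_x] p_x)
    show ?thesis
      using DERIV_imp_deriv[OF ut[OF t, of x]] DERIV_imp_deriv[OF flux] rd[OF ut[OF t, of x]] rd[OF flux]
      by (simp add: v_def)
  qed
  have 5: "(\<lambda>r. 1/2 * (u r x)\<^sup>2 + 1/2 * l\<^sup>2 * (deriv (u r) x)\<^sup>2) differentiable (at t)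
      \<and> (\<lambda>y. K (u t y) + 1/2 * l\<^sup>2 * deriv f (u t y) * (deriv (u t) y)\<^sup>2
             + l\<^sup>2 * u t y * Peps f l \<epsilon> (u t) y) differentiable (at x)
      \<and> deriv (\<lambda>r. 1/2 * (u r x)\<^sup>2 + 1/2 * l\<^sup>2 * (deriv (u r) x)\<^sup>2) t
        + deriv (\<lambda>y. K (u t y) + 1/2 * l\<^sup>2 * deriv f (u t y) * (deriv (u t) y)\<^sup>2
             + l\<^sup>2 * u t y * Peps f l \<epsilon> (u t) y) x
        = 1/2 * l\<^sup>2 * deriv (deriv f) (u t x) * deriv (u t) x * chi \<epsilon> (deriv (u t) x)
      \<and> 1/2 * l\<^sup>2 * deriv (deriv f) (u t x) * deriv (u t) x * chi \<epsilon> (deriv (u t) x) \<le> 0" if t: "0 < t" for t x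
  proof -
    have d: "deriv f = f1" "deriv f1 = f2" by (rule deriv_f)+
    have e: "((\<lambda>r. 1/2 * (u r x)\<^sup>2 + 1/2 * l\<^sup>2 * (q r x)\<^sup>2) has_real_derivative u t x * v t x + l\<^sup>2 * (q t x * v1 t x)) (at t)"
      by (rule derivative_eq_intros ut[OF t] qt[OF t] refl)+ (simp add: algebra_simps)
    have fl: "((\<lambda>y. K (u t y) + 1/2 * l\<^sup>2 * f1 (u t y) * (q t y)\<^sup>2 + l\<^sup>2 * u t y * p t y) has_real_derivative
        u t x * f1 (u t x) * q t x + (1/2 * l\<^sup>2 * (f2 (u t x) * q t x) * (q t x)\<^sup>2 + l\<^sup>2 * f1 (u t x) * (q t x * s t x))
         + (l\<^sup>2 * q t x * p t x + l\<^sup>2 * u t x * px t x)) (at x)"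
      by (rule derivative_eq_intros DERIV_chain2[OF hK[unfolded d] u_x] DERIV_chain2[OF f1_d u_x] u_x q_x p_x refl)+ (simp add: algebra_simps)
    have sgn: "1/2 * l\<^sup>2 * f2 (u t x) * q t x * chi \<epsilon> (q t x) \<le> 0"
    proof (cases "q t x \<le> - 1 / \<epsilon>")
      case True
      then have "q t x \<le> 0" using divide_pos_pos[OF zero_less_one heps] by linarith
      then have "q t x * chi \<epsilon> (q t x) \<le> 0" using chi_nonneg by (rule mult_nonpos_nonneg)
      moreover have "0 \<le> 1/2 * l\<^sup>2 * f2 (u t x)" using f2_pos[of "u t x"] by simp
      ultimately have "1/2 * l\<^sup>2 * f2 (u t x) * (q t x * chi \<epsilon> (q t x)) \<le> 0" by (rule mult_nonneg_nonpos[rotated])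
      then show ?thesis by (simp only: mult.assoc)
    qed (simp add: chi_def)
    \<comment> \<open>All transport and pressure terms cancel, K contributing u f'(u) q. What is
      left is l^2 f''(u) q (q^2 - \<psi>(q)) / 2, and q^2 - \<psi>(q) is the cut-off.\<close>
    have "(u t x * v t x + l\<^sup>2 * (q t x * v1 t x)) + (u t x * f1 (u t x) * q t x + (1/2 * l\<^sup>2 * (f2 (u t x) * q t x) * (q t x)\<^sup>2 + l\<^sup>2 * f1 (u t x) * (q t x * s t x))
         + (l\<^sup>2 * q t x * p t x + l\<^sup>2 * u t x * px t x)) = 1/2 * l\<^sup>2 * f2 (u t x) * q t x * chi \<epsilon> (q t x)"
      unfolding v_def v1_def \<psi>_def by (simp add: algebra_simps power2_eq_square)
    then show ?thesis
      unfolding deriv_u d Peps_u using DERIV_imp_deriv[OF e] DERIV_imp_deriv[OF fl] rd[OF e] rd[OF fl] sgn by simp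
  qed
  show ?thesis using 1 2 3 4 5 by blast
qed

end
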